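(* Let $R$ be a Huber ring, $(A,\underline{\sigma})$ a twisted $R$-adic algebra of order $d$, and $\underline{x}=(x_1,\ldots,x_d)$ elements of $A$. Suppose there exist elements $\underline{q}=(q_1,\ldots,q_d)$ of $R$ such that $\underline{x}$ are classical and symmetric (good) $\underline{q}$-coordinates and such that $$\forall i=1,\ldots,d,\ \forall n\geq 1,\quad (n)_{q_i}:=1+q_i+\cdots+q_i^{n-1}\in R^\times .$$ Then there exists an equivalence of categories $$\nabla_{\underline{q}}^{\mathrm{Int}}\text{-}\mathrm{Mod}(A)\simeq \mathrm{D}^{(\infty)}_{A,\underline{q}}\text{-}\mathrm{Mod}$$ between the category of $A$-modules endowed with an integrable twisted connection and the category of $\mathrm{D}^{(\infty)}_{A,\underline{q}}$-modules.
   Context: Huber rings. All rings are unitary. A Huber ring is a commutative topological ring $A$ having an open subring $A_0$ (a ring of definition) and a finitely generated ideal $I_0\subset A_0$ (an ideal of definition) such that $\{I_0^n\}_n$ is a fundamental system of neighbourhoods of $0$ in $A_0$; it is an adic ring if one can take $A_0=A$. A morphism of Huber rings is a continuous ring homomorphism; $u:A\to B$ is adic if there are rings of definition $A_0,B_0$ and an ideal of definition $I_0$ of $A_0$ with $u(A_0)\subset B_0$ and $u(I_0)B_0$ an ideal of definition of $B$. An $R$-adic algebra is a Huber ring $A$ with an adic morphism $R\to A$. Polynomial rings $A[\underline X]$ are Huber rings with ring of definition $A_0[\underline X]$ and ideal of definition $I_0A_0[\underline X]$. Good étale coordinates. A morphism $\varphi:A\to B$ is topologically of finite presentation if it is adic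 and there are rings of definition $A_0,B_0$ with $\varphi(A_0)\subset B_0$ such that $A_0/I\to B_0/\varphi(I)B_0$ is of finite presentation for every ideal of definition $I\subset A_0$ and $A\otimes_{A_0}\widehat{B_0}\to\widehat B$ is of finite presentation. A morphism of adic rings $A\to B$ is formally étale if for every complete adic ring $C$, nilpotent ideal $\mathfrak c\subset C$, and commutative square of adic rings formed by $A\to C$, $B\to C/\mathfrak c$, $A\to B$, $C\to C/\mathfrak c$, there is a unique morphism $B\to C$ making the diagram commute; it is topologically étale if it is formally étale and topologically of finite presentation. A morphism $\varphi:A\to B$ of Huber rings is good étale, with good model $(\varphi_0,A_0,B_0)$, if $A_0,B_0$ are rings of definition with $\varphi(A_0)\subset B_0$, the induced $\varphi_0:A_0\to B_0$ is topologically étale and $B=A\otimes_{A_0}B_0$. Elements $x_1,\dots,x_d$ of a Huber $R$-algebra $A$ are good étale coordinates, with good model $(\varphi_0,R_0,A_0)$, if $\varphi:R[X_1,\dots,X_d]\to A$, $X_i\mapsto x_i$, is good étale with a good model of the form $\varphi_0:R_0[X_1,\dots,X_d]\to A_0$. Twisted algebras and coordinates. A twisted $R$-adic algebra of order $d$ is an $R$-adic algebra $A$ with pairwise commuting continuous $R$-linear ring endomorphisms $\underline{\sigma}=(\sigma_1,\dots,\sigma_d)$. Given $\underline x=(x_1,\dots,x_d)\in A^d$, put in $A[\underline\xi]=A[\xi_1,\dots,\xi_d]$, for $\underline k\in\mathbb N^d$, $\underline\xi^{(\underline k)_{\underline\sigma}}=\prod_{i=1}^d\prod_{j=0}^{k_i-1}(\xi_i+x_i-\sigma_i^j(x_i))$,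 and $P_{A,(n)_{\underline\sigma}}=A[\underline\xi]/(\underline\xi^{(\underline k)_{\underline\sigma}}: |\underline k|=n+1)$ with the quotient topology. It is a free $A$-module with basis $\{\underline\xi^{(\underline k)_{\underline\sigma}}\}_{|\underline k|\le n}$. The $x_i$ are $\underline\sigma$-coordinates if for every $n\in\mathbb N$ there is a unique adic morphism of $R$-algebras $\Theta_{A,(n)_{\underline\sigma}}:A\to P_{A,(n)_{\underline\sigma}}$ with $x_i\mapsto x_i+\xi_i$ whose composition with the projection $P_{A,(n)_{\underline\sigma}}\to A$, $\xi_i\mapsto0$, is the identity. They are good $\underline\sigma$-coordinates if they are good étale coordinates with a good model $(\varphi_0,R_0,A_0)$ such that $\sigma_i(A_0)\subset A_0$ for all $i$ and they are $\underline\sigma$-coordinates of the twisted $R_0$-adic algebra $(A_0,\underline\sigma)$; then $\Theta_{A,(n)_{\underline\sigma}}:=\mathrm{Id}_R\otimes\Theta_{A_0,(n)_{\underline\sigma}}:A=R\otimes_{R_0}A_0\to R\otimes_{R_0}P_{A_0,(n)_{\underline\sigma}}=P_{A,(n)_{\underline\sigma}}$. "(Good) $\underline\sigma$-coordinates" means: $\underline\sigma$-coordinates or good $\underline\sigma$-coordinates. They are (good) $\underline q$-coordinates, for $q_1,\dots,q_d\in R$, if they are (good) $\underline\sigma$-coordinates and $\sigma_i(x_j)=q_i^{\delta_{i,j}}x_j$ for all $i,j$ ($\delta_{i,j}$ the Kronecker symbol); the subscript $\underline\sigma$ is then written $\underline q$. Classical and symmetric. The $R$-linear maps $\partial_{\underline\sigma,i}:A\to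 A$ are defined by $\Theta_{A,(1)_{\underline\sigma}}(f)=f+\sum_{i=1}^d\partial_{\underline\sigma,i}(f)\xi_i$. The coordinates are classical if $\sigma_i(f)=f+(\sigma_i(x_i)-x_i)\partial_{\underline\sigma,i}(f)$ for all $f\in A$, $i=1,\dots,d$. They are symmetric if $\sigma_i(x_i)\in R[x_i]$ for all $i$ and $\delta_{n,m}(\Theta_{A,(n+m)_{\underline\sigma}}(f))=1\otimes'\Theta_{A,(m)_{\underline\sigma}}(f)$ for all $n,m\in\mathbb N$, $f\in A$, where $\otimes'_A$ means that the left factor is viewed as an $A$-module through $\Theta_{A,(n)_{\underline\sigma}}$ and $\delta_{n,m}:P_{A,(n+m)_{\underline\sigma}}\to P_{A,(n)_{\underline\sigma}}\otimes'_AP_{A,(m)_{\underline\sigma}}$ is the unique morphism of $A$-algebras ($A$ acting on the target through the usual structure of the left factor) with $\xi_i\mapsto\xi_i\otimes1+1\otimes\xi_i$ (it exists when $\sigma_i(x_i)\in R[x_i]$ for all $i$). Connections. $\Omega^1_{\underline\sigma}$ is the kernel of $P_{A,(1)_{\underline\sigma}}\to A$, the free $A$-module on $\xi_1,\dots,\xi_d$. A twisted connection on an $A$-module $M$ is a map $\nabla_{\underline\sigma}:M\to M\otimes_A\Omega^1_{\underline\sigma}$ such that $\Theta_M(s)=s\otimes1+\nabla_{\underline\sigma}(s)\in M\otimes_AP_{A,(1)_{\underline\sigma}}$ is additive in $s$ with $\Theta_M(fs)=\Theta_{A,(1)_{\underline\sigma}}(f)\Theta_M(s)$ for $f\in A$,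 $s\in M$. Writing $\nabla_{\underline\sigma}(s)=\sum_i\partial_{M,i}(s)\otimes\xi_i$ and $dx_i=\xi_i$, it is integrable if $\nabla_{1,\underline\sigma}\circ\nabla_{\underline\sigma}=0$, where $\nabla_{1,\underline\sigma}:M\otimes\Omega^1_{\underline\sigma}\to M\otimes\bigwedge^2\Omega^1_{\underline\sigma}$ is the additive map $m\otimes dx_i\mapsto\nabla_{\underline\sigma}(m)\wedge dx_i=\sum_j\partial_{M,j}(m)\otimes dx_j\wedge dx_i$. $\nabla^{\mathrm{Int}}_{\underline\sigma}\text{-}\mathrm{Mod}(A)$ is the category of $A$-modules with an integrable twisted connection (morphisms: $A$-linear maps compatible with the connections). Differential operators. For symmetric coordinates, $\mathrm D^{(\infty)}_{A,\underline\sigma}$ is the subring of $\mathrm{End}_R(A)$ consisting of the maps of the form $\phi=\tilde\phi\circ\Theta_{A,(n)_{\underline\sigma}}$ for some $n\in\mathbb N$ and some $A$-linear $\tilde\phi:P_{A,(n)_{\underline\sigma}}\to A$; equivalently it is the free left $A$-module on the operators $\partial^{[\underline k]}_{\underline\sigma}$, $\underline k\in\mathbb N^d$, determined by $\Theta_{A,(n)_{\underline\sigma}}(f)=\sum_{|\underline k|\le n}\partial^{[\underline k]}_{\underline\sigma}(f)\,\underline\xi^{(\underline k)_{\underline\sigma}}$. *)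

theory Defs
  imports
    "HOL-Library.Multiset"
    "HOL-Analysis.Abstract_Limits"
    "HOL-Analysis.Product_Topology"
    "HOL-Analysis.T1_Spaces"
    "HOL-Algebra.Module"
    "HOL-Algebra.QuotRing"
    "HOL-Algebra.Subrings"
    "HOL-Algebra.Ideal_Product"
    "HOL-Algebra.Free_Abelian_Groups"
begin

section \<open>Huber rings\<close>

record 'a tring = "'a ring" +
  topo :: "'a topology"

locale topological_cring = cring A for A :: "('a, 'z) tring_scheme" (structure) +
  assumes topspace_eq: "topspace (topo A) = carrier A"
    and continuous_add:
      "continuous_map (prod_topology (topo A) (topo A)) (topo A) (\<lambda>(a, b). a \<oplus> b)"
    and continuous_minus: "continuous_map (topo A) (topo A) (\<lambda>a. \<ominus> a)"
    and continuous_mult: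
      "continuous_map (prod_topology (topo A) (topo A)) (topo A) (\<lambda>(a, b). a \<otimes> b)"

definition subtring :: "'a tring \<Rightarrow> 'a set \<Rightarrow> 'a tring" where
  "subtring A S = A\<lparr>carrier := S, topo := subtopology (topo A) S\<rparr>"

definition quotient_tring :: "'a tring \<Rightarrow> 'a set \<Rightarrow> 'a set tring" where
  "quotient_tring A I = ring.extend (A Quot I)
     (tring.fields (topology (\<lambda>U. U \<subseteq> carrier (A Quot I) \<and> openin (topo A) (\<Union> U))))"

abbreviation ideal_power :: "('a, 'z) ring_scheme \<Rightarrow> 'a set \<Rightarrow> nat \<Rightarrow> 'a set" where
  "ideal_power A I n \<equiv> I [^]\<^bsub>ideals_set A\<^esub> n"

definition ideal_of_definition :: "'a tring \<Rightarrow> 'a set \<Rightarrow> 'a set \<Rightarrow> bool" where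
  "ideal_of_definition A A0 I0 \<longleftrightarrow>
     subring A0 A \<and> openin (topo A) A0 \<and>
     (\<exists>F. finite F \<and> F \<subseteq> A0 \<and> I0 = genideal (subtring A A0) F) \<and>
     (\<forall>n. \<exists>U. openin (subtopology (topo A) A0) U \<and> \<zero>\<^bsub>A\<^esub> \<in> U
        \<and> U \<subseteq> ideal_power (subtring A A0) I0 n) \<and>
     (\<forall>U. openin (subtopology (topo A) A0) U \<and> \<zero>\<^bsub>A\<^esub> \<in> U \<longrightarrow>
        (\<exists>n. ideal_power (subtring A A0) I0 n \<subseteq> U))"

definition ring_of_definition :: "'a tring \<Rightarrow> 'a set \<Rightarrow> bool" where
  "ring_of_definition A A0 \<longleftrightarrow> (\<exists>I0. ideal_of_definition A A0 I0)"

definition huber_ring :: "'a tring \<Rightarrow> bool" where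
  "huber_ring A \<longleftrightarrow> topological_cring A \<and> (\<exists>A0. ring_of_definition A A0)"

definition adic_ring :: "'a tring \<Rightarrow> bool" where
  "adic_ring A \<longleftrightarrow> topological_cring A \<and> ring_of_definition A (carrier A)"

definition huber_hom :: "'a tring \<Rightarrow> 'b tring \<Rightarrow> ('a \<Rightarrow> 'b) \<Rightarrow> bool" where
  "huber_hom A B u \<longleftrightarrow> u \<in> ring_hom A B \<and> continuous_map (topo A) (topo B) u"

definition adic_hom :: "'a tring \<Rightarrow> 'b tring \<Rightarrow> ('a \<Rightarrow> 'b) \<Rightarrow> bool" where
  "adic_hom A B u \<longleftrightarrow> huber_hom A B u \<and>
     (\<exists>A0 I0 B0. ideal_of_definition A A0 I0 \<and> ring_of_definition B B0 \<and> u ` A0 \<subseteq> B0 \<and>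
        ideal_of_definition B B0 (genideal (subtring B B0) (u ` I0)))"


section \<open>Polynomial rings\<close>

text \<open>
  Monomials in variables from a set \<open>V\<close> are multisets over \<open>V\<close>, and a polynomial is the function
  sending a monomial to its coefficient.
\<close>

type_synonym ('v, 'a) mpoly = "'v multiset \<Rightarrow> 'a"

definition mpoly_ring :: "('a, 'z) ring_scheme \<Rightarrow> 'v set \<Rightarrow> ('v, 'a) mpoly ring" where
  "mpoly_ring A V =
     \<lparr>carrier = {p. (\<forall>m. p m \<in> carrier A) \<and> finite {m. p m \<noteq> \<zero>\<^bsub>A\<^esub>} \<and>
                    (\<forall>m. p m \<noteq> \<zero>\<^bsub>A\<^esub> \<longrightarrow> set_mset m \<subseteq> V)},
      monoid.mult = (\<lambda>p r m. \<Oplus>\<^bsub>A\<^esub>k\<in>{k. k \<subseteq># m}. p k \<otimes>\<^bsub>A\<^esub> r (m - k)),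
      monoid.one = (\<lambda>m. if m = {#} then \<one>\<^bsub>A\<^esub> else \<zero>\<^bsub>A\<^esub>),
      ring.zero = (\<lambda>m. \<zero>\<^bsub>A\<^esub>),
      ring.add = (\<lambda>p r m. p m \<oplus>\<^bsub>A\<^esub> r m)\<rparr>"

definition mpoly_const :: "('a, 'z) ring_scheme \<Rightarrow> 'a \<Rightarrow> ('v, 'a) mpoly" where
  "mpoly_const A a = (\<lambda>m. if m = {#} then a else \<zero>\<^bsub>A\<^esub>)"

definition mpoly_var :: "('a, 'z) ring_scheme \<Rightarrow> 'v \<Rightarrow> ('v, 'a) mpoly" where
  "mpoly_var A v = (\<lambda>m. if m = {#v#} then \<one>\<^bsub>A\<^esub> else \<zero>\<^bsub>A\<^esub>)"

definition mpoly_eval :: "('a, 'z) ring_scheme \<Rightarrow> ('b, 'w) ring_scheme \<Rightarrow>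
    ('a \<Rightarrow> 'b) \<Rightarrow> ('v \<Rightarrow> 'b) \<Rightarrow> ('v, 'a) mpoly \<Rightarrow> 'b" where
  "mpoly_eval A B \<phi> t p =
     (\<Oplus>\<^bsub>B\<^esub>m\<in>{m. p m \<noteq> \<zero>\<^bsub>A\<^esub>}.
        \<phi> (p m) \<otimes>\<^bsub>B\<^esub> (\<Otimes>\<^bsub>B\<^esub>v\<in>set_mset m. t v [^]\<^bsub>B\<^esub> count m v))"

text \<open>
  The topology on \<open>A[V]\<close> for which, for every ring of definition \<open>A0\<close> of \<open>A\<close> with ideal of
  definition \<open>I0\<close>, the powers of the ideal \<open>I0 A0[V]\<close> of \<open>A0[V]\<close> form a fundamental system of
  neighbourhoods of zero. (All choices of \<open>(A0, I0)\<close> define the same topology.)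
\<close>

definition mpoly_tring :: "'a tring \<Rightarrow> 'v set \<Rightarrow> ('v, 'a) mpoly tring" where
  "mpoly_tring A V = ring.extend (mpoly_ring A V) (tring.fields (topology (\<lambda>U.
     U \<subseteq> carrier (mpoly_ring A V) \<and>
     (\<forall>p\<in>U. \<exists>A0 I0 n. ideal_of_definition A A0 I0 \<and>
        (let S = mpoly_ring (subtring A A0) V
         in p <+\<^bsub>mpoly_ring A V\<^esub> ideal_power S (genideal S (mpoly_const A ` I0)) n \<subseteq> U)))))"

definition finite_presentation ::
    "('a, 'z) ring_scheme \<Rightarrow> ('b, 'w) ring_scheme \<Rightarrow> ('a \<Rightarrow> 'b) \<Rightarrow> bool" where
  "finite_presentation A B \<phi> \<longleftrightarrow> \<phi> \<in> ring_hom A B \<and>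
     (\<exists>(n::nat) t. t \<in> {..<n} \<rightarrow> carrier B \<and>
        (let S = mpoly_ring A {..<n}; e = mpoly_eval A B \<phi> t
         in e ` carrier S = carrier B \<and>
            (\<exists>F. finite F \<and> F \<subseteq> carrier S \<and> a_kernel S B e = genideal S F)))"


section \<open>Completions\<close>

definition cauchy_seq :: "'a tring \<Rightarrow> (nat \<Rightarrow> 'a) \<Rightarrow> bool" where
  "cauchy_seq A s \<longleftrightarrow> (\<forall>n. s n \<in> carrier A) \<and>
     (\<forall>U. openin (topo A) U \<and> \<zero>\<^bsub>A\<^esub> \<in> U \<longrightarrow> (\<exists>N. \<forall>m\<ge>N. \<forall>n\<ge>N. s m \<ominus>\<^bsub>A\<^esub> s n \<in> U))"

text \<open>The topology of a Huber ring is first countable, so that sequences suffice here.\<close>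

definition complete_tring :: "'a tring \<Rightarrow> bool" where
  "complete_tring A \<longleftrightarrow> Hausdorff_space (topo A) \<and>
     (\<forall>s. cauchy_seq A s \<longrightarrow> (\<exists>l. limitin (topo A) s l sequentially))"

definition cauchy_ring :: "'a tring \<Rightarrow> (nat \<Rightarrow> 'a) ring" where
  "cauchy_ring A =
     \<lparr>carrier = {s. cauchy_seq A s},
      monoid.mult = (\<lambda>s t n. s n \<otimes>\<^bsub>A\<^esub> t n),
      monoid.one = (\<lambda>n. \<one>\<^bsub>A\<^esub>),
      ring.zero = (\<lambda>n. \<zero>\<^bsub>A\<^esub>),
      ring.add = (\<lambda>s t n. s n \<oplus>\<^bsub>A\<^esub> t n)\<rparr>"

definition null_seqs :: "'a tring \<Rightarrow> (nat \<Rightarrow> 'a) set" where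
  "null_seqs A = {s. (\<forall>n. s n \<in> carrier A) \<and> limitin (topo A) s \<zero>\<^bsub>A\<^esub> sequentially}"

definition completion :: "'a tring \<Rightarrow> (nat \<Rightarrow> 'a) set ring" where
  "completion A = cauchy_ring A Quot null_seqs A"

definition to_completion :: "'a tring \<Rightarrow> 'a \<Rightarrow> (nat \<Rightarrow> 'a) set" where
  "to_completion A a = null_seqs A +>\<^bsub>cauchy_ring A\<^esub> (\<lambda>n. a)"

definition completion_map :: "'b tring \<Rightarrow> ('a \<Rightarrow> 'b) \<Rightarrow> (nat \<Rightarrow> 'a) set \<Rightarrow> (nat \<Rightarrow> 'b) set" where
  "completion_map B f X = (\<Union>s\<in>X. (null_seqs B +>\<^bsub>cauchy_ring B\<^esub> (\<lambda>n. f (s n))))"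


section \<open>Modules and tensor products\<close>

definition as_algebra :: "('a \<Rightarrow> 'b) \<Rightarrow> ('b, 'z) ring_scheme \<Rightarrow> ('a, 'b) module" where
  "as_algebra \<phi> B =
     \<lparr>carrier = carrier B,
      monoid.mult = monoid.mult B,
      monoid.one = monoid.one B,
      ring.zero = ring.zero B,
      ring.add = ring.add B,
      smult = (\<lambda>a b. \<phi> a \<otimes>\<^bsub>B\<^esub> b)\<rparr>"

text \<open>Morphisms are taken to be extensional, so that equal morphisms are equal as functions.\<close>

definition module_hom ::
    "('a, 'z) ring_scheme \<Rightarrow> ('a, 'm, 'y) module_scheme \<Rightarrow> ('a, 'n, 'w) module_scheme \<Rightarrow> ('m \<Rightarrow> 'n) set" where
  "module_hom A M N = {h \<in> carrier M \<rightarrow>\<^sub>E carrier N.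
     (\<forall>m\<in>carrier M. \<forall>m'\<in>carrier M. h (m \<oplus>\<^bsub>M\<^esub> m') = h m \<oplus>\<^bsub>N\<^esub> h m') \<and>
     (\<forall>a\<in>carrier A. \<forall>m\<in>carrier M. h (a \<odot>\<^bsub>M\<^esub> m) = a \<odot>\<^bsub>N\<^esub> h m)}"

locale left_module = R?: ring D + M?: abelian_group M
  for D :: "('a, 'z) ring_scheme" and M :: "('a, 'm, 'y) module_scheme" (structure) +
  assumes smult_closed: "\<lbrakk>a \<in> carrier D; m \<in> carrier M\<rbrakk> \<Longrightarrow> a \<odot> m \<in> carrier M"
    and smult_l_distr: "\<lbrakk>a \<in> carrier D; b \<in> carrier D; m \<in> carrier M\<rbrakk> \<Longrightarrow>
      (a \<oplus>\<^bsub>D\<^esub> b) \<odot> m = a \<odot> m \<oplus> b \<odot> m"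
    and smult_r_distr: "\<lbrakk>a \<in> carrier D; m \<in> carrier M; m' \<in> carrier M\<rbrakk> \<Longrightarrow>
      a \<odot> (m \<oplus> m') = a \<odot> m \<oplus> a \<odot> m'"
    and smult_assoc: "\<lbrakk>a \<in> carrier D; b \<in> carrier D; m \<in> carrier M\<rbrakk> \<Longrightarrow>
      (a \<otimes>\<^bsub>D\<^esub> b) \<odot> m = a \<odot> (b \<odot> m)"
    and smult_one: "m \<in> carrier M \<Longrightarrow> \<one>\<^bsub>D\<^esub> \<odot> m = m"

text \<open>
  \<open>M \<otimes>\<^sub>A N\<close> is the free abelian group on \<open>M \<times> N\<close> modulo the subgroup generated by the
  bilinearity relators. Of the coefficient ring only its carrier matters. The ring structure
  \<open>(m \<otimes> n) (m' \<otimes> n') = m m' \<otimes> n n'\<close> is meaningful only if \<open>M\<close> and \<open>N\<close> are algebras.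
\<close>

definition tensor_null ::
    "('a, 'z) ring_scheme \<Rightarrow> ('a, 'm, 'y) module_scheme \<Rightarrow> ('a, 'n, 'w) module_scheme
      \<Rightarrow> ('m \<times> 'n \<Rightarrow>\<^sub>0 int) set" where
  "tensor_null A M N = generate (free_Abelian_group (carrier M \<times> carrier N))
     ({frag_of (m \<oplus>\<^bsub>M\<^esub> m', n) - frag_of (m, n) - frag_of (m', n) | m m' n.
         m \<in> carrier M \<and> m' \<in> carrier M \<and> n \<in> carrier N} \<union>
      {frag_of (m, n \<oplus>\<^bsub>N\<^esub> n') - frag_of (m, n) - frag_of (m, n') | m n n'.
         m \<in> carrier M \<and> n \<in> carrier N \<and> n' \<in> carrier N} \<union>
      {frag_of (a \<odot>\<^bsub>M\<^esub> m, n) - frag_of (m, a \<odot>\<^bsub>N\<^esub> n) | a m n.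
         a \<in> carrier A \<and> m \<in> carrier M \<and> n \<in> carrier N})"

definition tensor_class ::
    "('a, 'z) ring_scheme \<Rightarrow> ('a, 'm, 'y) module_scheme \<Rightarrow> ('a, 'n, 'w) module_scheme
      \<Rightarrow> ('m \<times> 'n \<Rightarrow>\<^sub>0 int) \<Rightarrow> ('m \<times> 'n \<Rightarrow>\<^sub>0 int) set" where
  "tensor_class A M N z = tensor_null A M N #>\<^bsub>free_Abelian_group (carrier M \<times> carrier N)\<^esub> z"

definition tensor_elt ::
    "('a, 'z) ring_scheme \<Rightarrow> ('a, 'm, 'y) module_scheme \<Rightarrow> ('a, 'n, 'w) module_scheme
      \<Rightarrow> 'm \<Rightarrow> 'n \<Rightarrow> ('m \<times> 'n \<Rightarrow>\<^sub>0 int) set" where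
  "tensor_elt A M N m n = tensor_class A M N (frag_of (m, n))"

definition tensor_map ::
    "('a, 'z) ring_scheme \<Rightarrow> ('a, 'm2, 'y) module_scheme \<Rightarrow> ('a, 'n2, 'w) module_scheme
      \<Rightarrow> ('m \<Rightarrow> 'm2) \<Rightarrow> ('n \<Rightarrow> 'n2) \<Rightarrow> ('m \<times> 'n \<Rightarrow>\<^sub>0 int) set \<Rightarrow> ('m2 \<times> 'n2 \<Rightarrow>\<^sub>0 int) set" where
  "tensor_map A M' N' f g X =
     (\<Union>z\<in>X. tensor_class A M' N' (frag_extend (\<lambda>(m, n). frag_of (f m, g n)) z))"

definition tensor ::
    "('a, 'z) ring_scheme \<Rightarrow> ('a, 'm, 'y) module_scheme \<Rightarrow> ('a, 'n, 'w) module_scheme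
      \<Rightarrow> ('a, ('m \<times> 'n \<Rightarrow>\<^sub>0 int) set) module" where
  "tensor A M N = (let G = free_Abelian_group (carrier M \<times> carrier N) Mod tensor_null A M N in
     \<lparr>carrier = carrier G,
      monoid.mult = (\<lambda>X Y. \<Union>z\<in>X. \<Union>w\<in>Y. tensor_class A M N
        (frag_extend (\<lambda>(m, n). frag_extend (\<lambda>(m', n'). frag_of (m \<otimes>\<^bsub>M\<^esub> m', n \<otimes>\<^bsub>N\<^esub> n')) w) z)),
      monoid.one = tensor_elt A M N \<one>\<^bsub>M\<^esub> \<one>\<^bsub>N\<^esub>,
      ring.zero = \<one>\<^bsub>G\<^esub>,
      ring.add = monoid.mult G,
      smult = (\<lambda>a. tensor_map A M N (\<lambda>m. a \<odot>\<^bsub>M\<^esub> m) (\<lambda>n. n))\<rparr>)"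

definition exterior_null ::
    "('a, 'z) ring_scheme \<Rightarrow> ('a, 'm, 'y) module_scheme \<Rightarrow> ('m \<times> 'm \<Rightarrow>\<^sub>0 int) set set" where
  "exterior_null A N = generate (add_monoid (tensor A N N))
     {a \<odot>\<^bsub>tensor A N N\<^esub> tensor_elt A N N n n | a n. a \<in> carrier A \<and> n \<in> carrier N}"

definition wedge ::
    "('a, 'z) ring_scheme \<Rightarrow> ('a, 'm, 'y) module_scheme \<Rightarrow> 'm \<Rightarrow> 'm \<Rightarrow> ('m \<times> 'm \<Rightarrow>\<^sub>0 int) set set" where
  "wedge A N n n' = exterior_null A N +>\<^bsub>tensor A N N\<^esub> tensor_elt A N N n n'"

text \<open>Only the module structure of the exterior square is meaningful.\<close>

definition exterior_square ::
    "('a, 'z) ring_scheme \<Rightarrow> ('a, 'm, 'y) module_scheme \<Rightarrow> ('a, ('m \<times> 'm \<Rightarrow>\<^sub>0 int) set set) module" where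
  "exterior_square A N =
     \<lparr>carrier = a_rcosets\<^bsub>tensor A N N\<^esub> (exterior_null A N),
      monoid.mult = undefined,
      monoid.one = undefined,
      ring.zero = exterior_null A N,
      ring.add = set_add (tensor A N N),
      smult = (\<lambda>a X. \<Union>z\<in>X. exterior_null A N +>\<^bsub>tensor A N N\<^esub> (a \<odot>\<^bsub>tensor A N N\<^esub> z))\<rparr>"


section \<open>Good etale coordinates\<close>

definition top_finite_presentation :: "'a tring \<Rightarrow> 'b tring \<Rightarrow> ('a \<Rightarrow> 'b) \<Rightarrow> bool" where
  "top_finite_presentation A B \<phi> \<longleftrightarrow> adic_hom A B \<phi> \<and>
     (\<exists>A0 B0. ring_of_definition A A0 \<and> ring_of_definition B B0 \<and> \<phi> ` A0 \<subseteq> B0 \<and>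
        (\<forall>I. ideal_of_definition A A0 I \<longrightarrow>
           (let J = genideal (subtring B B0) (\<phi> ` I)
            in finite_presentation (subtring A A0 Quot I) (subtring B B0 Quot J)
                 (\<lambda>X. \<Union>a\<in>X. J +>\<^bsub>subtring B B0\<^esub> \<phi> a))) \<and>
        (let cA = as_algebra (\<lambda>a. a) A;
             cB0 = as_algebra (\<lambda>a. to_completion (subtring B B0) (\<phi> a)) (completion (subtring B B0));
             T = tensor (subtring A A0) cA cB0
         in \<exists>h. (\<forall>a\<in>carrier A. \<forall>y\<in>carrier cB0.
                   h (tensor_elt (subtring A A0) cA cB0 a y) =
                     to_completion B (\<phi> a) \<otimes>\<^bsub>completion B\<^esub> completion_map B (\<lambda>b. b) y) \<and>
                finite_presentation T (completion B) h))"

text \<open>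
  The test rings \<open>C\<close> range over the complete adic rings carried by subsets of the type
  \<open>nat \<Rightarrow> 'a \<times> 'b \<times> nat\<close>, of cardinality \<open>\<kappa>\<^sup>\<omega>\<close> with \<open>\<kappa> = max |'a| |'b| \<omega>\<close>.
  This loses nothing: for an arbitrary lifting problem \<open>A \<rightarrow> C\<close>, \<open>B \<rightarrow> C/c\<close>, choose a
  subring of \<open>C\<close> of at most that cardinality that contains the image of \<open>A\<close>, representatives of
  the image of \<open>B\<close> and any given liftings, is closed under limits of sequences, and is an
  elementary substructure of \<open>C\<close> with \<open>c\<close> and the powers of an ideal of definition as
  additional predicates. It is a complete adic ring, and the problem lives on it.
\<close>

definition formally_etale :: "'a tring \<Rightarrow> 'b tring \<Rightarrow> ('a \<Rightarrow> 'b) \<Rightarrow> bool" where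
  "formally_etale A B \<phi> \<longleftrightarrow>
     (\<forall>(C :: (nat \<Rightarrow> 'a \<times> 'b \<times> nat) tring) c u v.
        adic_ring C \<and> complete_tring C \<and> ideal c C \<and> (\<exists>n. ideal_power C c n = {\<zero>\<^bsub>C\<^esub>}) \<and>
        huber_hom A C u \<and> huber_hom B (quotient_tring C c) v \<and>
        (\<forall>a\<in>carrier A. v (\<phi> a) = c +>\<^bsub>C\<^esub> u a) \<longrightarrow>
        (\<exists>!w. w \<in> extensional (carrier B) \<and> huber_hom B C w \<and>
           (\<forall>a\<in>carrier A. w (\<phi> a) = u a) \<and> (\<forall>b\<in>carrier B. c +>\<^bsub>C\<^esub> w b = v b)))"

definition topologically_etale :: "'a tring \<Rightarrow> 'b tring \<Rightarrow> ('a \<Rightarrow> 'b) \<Rightarrow> bool" where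
  "topologically_etale A B \<phi> \<longleftrightarrow> adic_ring A \<and> adic_ring B \<and> huber_hom A B \<phi> \<and>
     formally_etale A B \<phi> \<and> top_finite_presentation A B \<phi>"

text \<open>
  \<open>B = A \<otimes>\<^bsub>A0\<^esub> B0\<close> says that the canonical map \<open>a \<otimes> b \<mapsto> \<phi> a * b\<close> is an isomorphism.
\<close>

definition good_etale_model ::
    "'a tring \<Rightarrow> 'b tring \<Rightarrow> ('a \<Rightarrow> 'b) \<Rightarrow> 'a set \<Rightarrow> 'b set \<Rightarrow> bool" where
  "good_etale_model A B \<phi> A0 B0 \<longleftrightarrow> huber_hom A B \<phi> \<and>
     ring_of_definition A A0 \<and> ring_of_definition B B0 \<and> \<phi> ` A0 \<subseteq> B0 \<and>
     topologically_etale (subtring A A0) (subtring B B0) \<phi> \<and>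
     (let cA = as_algebra (\<lambda>a. a) A; cB0 = as_algebra \<phi> (subtring B B0)
      in \<exists>h \<in> ring_iso (tensor (subtring A A0) cA cB0) B.
           \<forall>a\<in>carrier A. \<forall>b\<in>B0. h (tensor_elt (subtring A A0) cA cB0 a b) = \<phi> a \<otimes>\<^bsub>B\<^esub> b)"

text \<open>From here on, \<open>\<eta>\<close> is the structure map \<open>R \<rightarrow> A\<close> and indices run through \<open>{..<d}\<close>.\<close>

definition good_etale_coordinates_model ::
    "'r tring \<Rightarrow> ('r \<Rightarrow> 'a) \<Rightarrow> 'a tring \<Rightarrow> nat \<Rightarrow> (nat \<Rightarrow> 'a) \<Rightarrow> 'r set \<Rightarrow> 'a set \<Rightarrow> bool" where
  "good_etale_coordinates_model R \<eta> A d x R0 A0 \<longleftrightarrow>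
     x \<in> {..<d} \<rightarrow> carrier A \<and> ring_of_definition R R0 \<and>
     good_etale_model (mpoly_tring R {..<d}) A (mpoly_eval R A \<eta> x)
       (carrier (mpoly_ring (subtring R R0) {..<d})) A0"


section \<open>Twisted algebras and twisted principal parts\<close>

definition twisted_adic_algebra ::
    "'r tring \<Rightarrow> ('r \<Rightarrow> 'a) \<Rightarrow> 'a tring \<Rightarrow> nat \<Rightarrow> (nat \<Rightarrow> 'a \<Rightarrow> 'a) \<Rightarrow> bool" where
  "twisted_adic_algebra R \<eta> A d \<sigma> \<longleftrightarrow>
     huber_ring R \<and> huber_ring A \<and> adic_hom R A \<eta> \<and>
     (\<forall>i<d. huber_hom A A (\<sigma> i) \<and>
        (\<forall>r\<in>carrier R. \<forall>a\<in>carrier A. \<sigma> i (\<eta> r \<otimes>\<^bsub>A\<^esub> a) = \<eta> r \<otimes>\<^bsub>A\<^esub> \<sigma> i a)) \<and>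
     (\<forall>i<d. \<forall>j<d. \<forall>a\<in>carrier A. \<sigma> i (\<sigma> j a) = \<sigma> j (\<sigma> i a))"

text \<open>The twisted power with multi-exponent \<open>k\<close>, encoded as the multiset with multiplicities \<open>k\<^sub>i\<close>.\<close>

definition xi_power ::
    "'a tring \<Rightarrow> nat \<Rightarrow> (nat \<Rightarrow> 'a \<Rightarrow> 'a) \<Rightarrow> (nat \<Rightarrow> 'a) \<Rightarrow> nat multiset \<Rightarrow> (nat, 'a) mpoly" where
  "xi_power A d \<sigma> x k = (let S = mpoly_tring A {..<d} in
     \<Otimes>\<^bsub>S\<^esub>i\<in>{..<d}. \<Otimes>\<^bsub>S\<^esub>j\<in>{..<count k i}.
       (mpoly_var A i \<oplus>\<^bsub>S\<^esub> mpoly_const A (x i \<ominus>\<^bsub>A\<^esub> (\<sigma> i ^^ j) (x i))))"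

definition xi_ideal ::
    "'a tring \<Rightarrow> nat \<Rightarrow> (nat \<Rightarrow> 'a \<Rightarrow> 'a) \<Rightarrow> (nat \<Rightarrow> 'a) \<Rightarrow> nat \<Rightarrow> (nat, 'a) mpoly set" where
  "xi_ideal A d \<sigma> x n = genideal (mpoly_tring A {..<d})
     {xi_power A d \<sigma> x k | k. set_mset k \<subseteq> {..<d} \<and> size k = n + 1}"

definition principal_parts ::
    "'a tring \<Rightarrow> nat \<Rightarrow> (nat \<Rightarrow> 'a \<Rightarrow> 'a) \<Rightarrow> (nat \<Rightarrow> 'a) \<Rightarrow> nat \<Rightarrow> (nat, 'a) mpoly set tring" where
  "principal_parts A d \<sigma> x n = quotient_tring (mpoly_tring A {..<d}) (xi_ideal A d \<sigma> x n)"

definition pp_class ::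
    "'a tring \<Rightarrow> nat \<Rightarrow> (nat \<Rightarrow> 'a \<Rightarrow> 'a) \<Rightarrow> (nat \<Rightarrow> 'a) \<Rightarrow> nat \<Rightarrow> (nat, 'a) mpoly \<Rightarrow> (nat, 'a) mpoly set" where
  "pp_class A d \<sigma> x n p = xi_ideal A d \<sigma> x n +>\<^bsub>mpoly_tring A {..<d}\<^esub> p"

definition pp_const ::
    "'a tring \<Rightarrow> nat \<Rightarrow> (nat \<Rightarrow> 'a \<Rightarrow> 'a) \<Rightarrow> (nat \<Rightarrow> 'a) \<Rightarrow> nat \<Rightarrow> 'a \<Rightarrow> (nat, 'a) mpoly set" where
  "pp_const A d \<sigma> x n a = pp_class A d \<sigma> x n (mpoly_const A a)"

definition pp_xi ::
    "'a tring \<Rightarrow> nat \<Rightarrow> (nat \<Rightarrow> 'a \<Rightarrow> 'a) \<Rightarrow> (nat \<Rightarrow> 'a) \<Rightarrow> nat \<Rightarrow> nat \<Rightarrow> (nat, 'a) mpoly set" where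
  "pp_xi A d \<sigma> x n i = pp_class A d \<sigma> x n (mpoly_var A i)"

text \<open>The projection \<open>\<xi>\<^sub>i \<mapsto> 0\<close>: all representatives have the same constant coefficient.\<close>

definition pp_proj :: "(nat, 'a) mpoly set \<Rightarrow> 'a" where
  "pp_proj X = the_elem ((\<lambda>p. p {#}) ` X)"

abbreviation pp_algebra ::
    "'a tring \<Rightarrow> nat \<Rightarrow> (nat \<Rightarrow> 'a \<Rightarrow> 'a) \<Rightarrow> (nat \<Rightarrow> 'a) \<Rightarrow> nat \<Rightarrow> ('a, (nat, 'a) mpoly set) module" where
  "pp_algebra A d \<sigma> x n \<equiv> as_algebra (pp_const A d \<sigma> x n) (principal_parts A d \<sigma> x n)"


section \<open>Twisted coordinates\<close>

definition taylor_map ::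
    "'r tring \<Rightarrow> ('r \<Rightarrow> 'a) \<Rightarrow> 'a tring \<Rightarrow> nat \<Rightarrow> (nat \<Rightarrow> 'a \<Rightarrow> 'a) \<Rightarrow> (nat \<Rightarrow> 'a) \<Rightarrow> nat
      \<Rightarrow> ('a \<Rightarrow> (nat, 'a) mpoly set) \<Rightarrow> bool" where
  "taylor_map R \<eta> A d \<sigma> x n \<theta> \<longleftrightarrow>
     \<theta> \<in> extensional (carrier A) \<and> adic_hom A (principal_parts A d \<sigma> x n) \<theta> \<and>
     (\<forall>r\<in>carrier R. \<theta> (\<eta> r) = pp_const A d \<sigma> x n (\<eta> r)) \<and>
     (\<forall>i<d. \<theta> (x i) =
        pp_const A d \<sigma> x n (x i) \<oplus>\<^bsub>principal_parts A d \<sigma> x n\<^esub> pp_xi A d \<sigma> x n i) \<and>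
     (\<forall>f\<in>carrier A. pp_proj (\<theta> f) = f)"

definition sigma_coordinates ::
    "'r tring \<Rightarrow> ('r \<Rightarrow> 'a) \<Rightarrow> 'a tring \<Rightarrow> nat \<Rightarrow> (nat \<Rightarrow> 'a \<Rightarrow> 'a) \<Rightarrow> (nat \<Rightarrow> 'a) \<Rightarrow> bool" where
  "sigma_coordinates R \<eta> A d \<sigma> x \<longleftrightarrow>
     x \<in> {..<d} \<rightarrow> carrier A \<and> (\<forall>n. \<exists>!\<theta>. taylor_map R \<eta> A d \<sigma> x n \<theta>)"

definition good_sigma_coordinates_model ::
    "'r tring \<Rightarrow> ('r \<Rightarrow> 'a) \<Rightarrow> 'a tring \<Rightarrow> nat \<Rightarrow> (nat \<Rightarrow> 'a \<Rightarrow> 'a) \<Rightarrow> (nat \<Rightarrow> 'a)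
      \<Rightarrow> 'r set \<Rightarrow> 'a set \<Rightarrow> bool" where
  "good_sigma_coordinates_model R \<eta> A d \<sigma> x R0 A0 \<longleftrightarrow>
     good_etale_coordinates_model R \<eta> A d x R0 A0 \<and>
     (\<forall>i<d. \<sigma> i ` A0 \<subseteq> A0) \<and>
     twisted_adic_algebra (subtring R R0) \<eta> (subtring A A0) d \<sigma> \<and>
     sigma_coordinates (subtring R R0) \<eta> (subtring A A0) d \<sigma> x"

text \<open>
  The map \<open>Id\<^sub>R \<otimes> \<Theta>\<close> for the Taylor map \<open>\<Theta>\<close> of \<open>A0\<close>: under the canonical identifications
  of \<open>R \<otimes> A0\<close> with \<open>A\<close> and of \<open>R \<otimes> P\<^bsub>A0\<^esub>\<close> with \<open>P\<^sub>A\<close>, an elementary tensor \<open>r \<otimes> a\<close> is the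
  product \<open>r a\<close>. The union below is the coset of \<open>A[\<xi>]\<close> containing the given coset of \<open>A0[\<xi>]\<close>.
\<close>

definition good_taylor_map ::
    "'r tring \<Rightarrow> ('r \<Rightarrow> 'a) \<Rightarrow> 'a tring \<Rightarrow> nat \<Rightarrow> (nat \<Rightarrow> 'a \<Rightarrow> 'a) \<Rightarrow> (nat \<Rightarrow> 'a)
      \<Rightarrow> 'r set \<Rightarrow> 'a set \<Rightarrow> nat \<Rightarrow> ('a \<Rightarrow> (nat, 'a) mpoly set) \<Rightarrow> bool" where
  "good_taylor_map R \<eta> A d \<sigma> x R0 A0 n \<theta> \<longleftrightarrow>
     \<theta> \<in> extensional (carrier A) \<and>
     \<theta> \<in> hom (add_monoid A) (add_monoid (principal_parts A d \<sigma> x n)) \<and>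
     (\<exists>\<theta>0. taylor_map (subtring R R0) \<eta> (subtring A A0) d \<sigma> x n \<theta>0 \<and>
        (\<forall>r\<in>carrier R. \<forall>a\<in>A0. \<theta> (\<eta> r \<otimes>\<^bsub>A\<^esub> a) =
           pp_const A d \<sigma> x n (\<eta> r) \<otimes>\<^bsub>principal_parts A d \<sigma> x n\<^esub>
             (\<Union>p\<in>\<theta>0 a. pp_class A d \<sigma> x n p)))"

text \<open>
  The elements \<open>x\<close> are (good) \<open>\<sigma>\<close>-coordinates, and \<open>\<Theta>\<close> is the family of Taylor maps that the
  definition attaches to them: in the good case, to a good model.
\<close>

definition coordinates_with_taylor ::
    "'r tring \<Rightarrow> ('r \<Rightarrow> 'a) \<Rightarrow> 'a tring \<Rightarrow> nat \<Rightarrow> (nat \<Rightarrow> 'a \<Rightarrow> 'a) \<Rightarrow> (nat \<Rightarrow> 'a)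
      \<Rightarrow> (nat \<Rightarrow> 'a \<Rightarrow> (nat, 'a) mpoly set) \<Rightarrow> bool" where
  "coordinates_with_taylor R \<eta> A d \<sigma> x \<Theta> \<longleftrightarrow>
     (sigma_coordinates R \<eta> A d \<sigma> x \<and> (\<forall>n. taylor_map R \<eta> A d \<sigma> x n (\<Theta> n))) \<or>
     (\<exists>R0 A0. good_sigma_coordinates_model R \<eta> A d \<sigma> x R0 A0 \<and>
        (\<forall>n. good_taylor_map R \<eta> A d \<sigma> x R0 A0 n (\<Theta> n)))"

definition q_coordinates_with_taylor ::
    "'r tring \<Rightarrow> ('r \<Rightarrow> 'a) \<Rightarrow> 'a tring \<Rightarrow> nat \<Rightarrow> (nat \<Rightarrow> 'a \<Rightarrow> 'a) \<Rightarrow> (nat \<Rightarrow> 'a) \<Rightarrow> (nat \<Rightarrow> 'r)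
      \<Rightarrow> (nat \<Rightarrow> 'a \<Rightarrow> (nat, 'a) mpoly set) \<Rightarrow> bool" where
  "q_coordinates_with_taylor R \<eta> A d \<sigma> x q \<Theta> \<longleftrightarrow>
     coordinates_with_taylor R \<eta> A d \<sigma> x \<Theta> \<and> q \<in> {..<d} \<rightarrow> carrier R \<and>
     (\<forall>i<d. \<forall>j<d. \<sigma> i (x j) = \<eta> (q i [^]\<^bsub>R\<^esub> (if i = j then 1 else 0 :: nat)) \<otimes>\<^bsub>A\<^esub> x j)"

definition tw_partial ::
    "'a tring \<Rightarrow> nat \<Rightarrow> (nat \<Rightarrow> 'a \<Rightarrow> 'a) \<Rightarrow> (nat \<Rightarrow> 'a) \<Rightarrow> (nat \<Rightarrow> 'a \<Rightarrow> (nat, 'a) mpoly set)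
      \<Rightarrow> nat \<Rightarrow> 'a \<Rightarrow> 'a" where
  "tw_partial A d \<sigma> x \<Theta> i f = (let P = principal_parts A d \<sigma> x 1 in
     (THE c. c \<in> {..<d} \<rightarrow>\<^sub>E carrier A \<and>
        \<Theta> 1 f = pp_const A d \<sigma> x 1 f \<oplus>\<^bsub>P\<^esub>
          (\<Oplus>\<^bsub>P\<^esub>j\<in>{..<d}. pp_const A d \<sigma> x 1 (c j) \<otimes>\<^bsub>P\<^esub> pp_xi A d \<sigma> x 1 j)) i)"

definition classical_coordinates ::
    "'a tring \<Rightarrow> nat \<Rightarrow> (nat \<Rightarrow> 'a \<Rightarrow> 'a) \<Rightarrow> (nat \<Rightarrow> 'a)
      \<Rightarrow> (nat \<Rightarrow> 'a \<Rightarrow> (nat, 'a) mpoly set) \<Rightarrow> bool" where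
  "classical_coordinates A d \<sigma> x \<Theta> \<longleftrightarrow>
     (\<forall>f\<in>carrier A. \<forall>i<d.
        \<sigma> i f = f \<oplus>\<^bsub>A\<^esub> (\<sigma> i (x i) \<ominus>\<^bsub>A\<^esub> x i) \<otimes>\<^bsub>A\<^esub> tw_partial A d \<sigma> x \<Theta> i f)"

text \<open>The left factor of \<open>P\<^bsub>(n)\<^esub> \<otimes>' P\<^bsub>(m)\<^esub>\<close>, viewed as an \<open>A\<close>-module through the Taylor map.\<close>

abbreviation pp_algebra_taylor ::
    "'a tring \<Rightarrow> nat \<Rightarrow> (nat \<Rightarrow> 'a \<Rightarrow> 'a) \<Rightarrow> (nat \<Rightarrow> 'a) \<Rightarrow> (nat \<Rightarrow> 'a \<Rightarrow> (nat, 'a) mpoly set)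
      \<Rightarrow> nat \<Rightarrow> ('a, (nat, 'a) mpoly set) module" where
  "pp_algebra_taylor A d \<sigma> x \<Theta> n \<equiv> as_algebra (\<Theta> n) (principal_parts A d \<sigma> x n)"

definition pp_delta ::
    "'a tring \<Rightarrow> nat \<Rightarrow> (nat \<Rightarrow> 'a \<Rightarrow> 'a) \<Rightarrow> (nat \<Rightarrow> 'a) \<Rightarrow> (nat \<Rightarrow> 'a \<Rightarrow> (nat, 'a) mpoly set)
      \<Rightarrow> nat \<Rightarrow> nat
      \<Rightarrow> (nat, 'a) mpoly set \<Rightarrow> ((nat, 'a) mpoly set \<times> (nat, 'a) mpoly set \<Rightarrow>\<^sub>0 int) set" where
  "pp_delta A d \<sigma> x \<Theta> n m = (let
       P = principal_parts A d \<sigma> x (n + m);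
       Pn = pp_algebra_taylor A d \<sigma> x \<Theta> n; Pm = pp_algebra A d \<sigma> x m;
       T = tensor A Pn Pm; t = tensor_elt A Pn Pm
     in THE D. D \<in> extensional (carrier P) \<and> D \<in> ring_hom P T \<and>
          (\<forall>a\<in>carrier A. D (pp_const A d \<sigma> x (n + m) a) = t (pp_const A d \<sigma> x n a) \<one>\<^bsub>Pm\<^esub>) \<and>
          (\<forall>i<d. D (pp_xi A d \<sigma> x (n + m) i) =
             t (pp_xi A d \<sigma> x n i) \<one>\<^bsub>Pm\<^esub> \<oplus>\<^bsub>T\<^esub> t \<one>\<^bsub>Pn\<^esub> (pp_xi A d \<sigma> x m i)))"

definition symmetric_coordinates ::
    "'r tring \<Rightarrow> ('r \<Rightarrow> 'a) \<Rightarrow> 'a tring \<Rightarrow> nat \<Rightarrow> (nat \<Rightarrow> 'a \<Rightarrow> 'a) \<Rightarrow> (nat \<Rightarrow> 'a)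
      \<Rightarrow> (nat \<Rightarrow> 'a \<Rightarrow> (nat, 'a) mpoly set) \<Rightarrow> bool" where
  "symmetric_coordinates R \<eta> A d \<sigma> x \<Theta> \<longleftrightarrow>
     (\<forall>i<d. \<sigma> i (x i) \<in> mpoly_eval R A \<eta> x ` carrier (mpoly_ring R {i})) \<and>
     (\<forall>n m. \<forall>f\<in>carrier A. pp_delta A d \<sigma> x \<Theta> n m (\<Theta> (n + m) f) =
        tensor_elt A (pp_algebra_taylor A d \<sigma> x \<Theta> n) (pp_algebra A d \<sigma> x m)
          \<one>\<^bsub>principal_parts A d \<sigma> x n\<^esub> (\<Theta> m f))"


section \<open>Categories\<close>

text \<open>Arrows are functions without recorded source and target, so \<open>Comp\<close> takes the objects as well.\<close>

record ('o, 'h) category =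
  Obj :: "'o set"
  Hom :: "'o \<Rightarrow> 'o \<Rightarrow> 'h set"
  Ident :: "'o \<Rightarrow> 'h"
  Comp :: "'o \<Rightarrow> 'o \<Rightarrow> 'o \<Rightarrow> 'h \<Rightarrow> 'h \<Rightarrow> 'h"  \<comment> \<open>\<open>Comp C X Y Z g f\<close> is \<open>g \<circ> f\<close> for \<open>f : X \<rightarrow> Y\<close>, \<open>g : Y \<rightarrow> Z\<close>\<close>

definition is_category :: "('o, 'h) category \<Rightarrow> bool" where
  "is_category C \<longleftrightarrow>
     (\<forall>X\<in>Obj C. Ident C X \<in> Hom C X X) \<and>
     (\<forall>X\<in>Obj C. \<forall>Y\<in>Obj C. \<forall>Z\<in>Obj C. \<forall>f\<in>Hom C X Y. \<forall>g\<in>Hom C Y Z. Comp C X Y Z g f \<in> Hom C X Z) \<and>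
     (\<forall>X\<in>Obj C. \<forall>Y\<in>Obj C. \<forall>f\<in>Hom C X Y.
        Comp C X X Y f (Ident C X) = f \<and> Comp C X Y Y (Ident C Y) f = f) \<and>
     (\<forall>X\<in>Obj C. \<forall>Y\<in>Obj C. \<forall>Z\<in>Obj C. \<forall>W\<in>Obj C. \<forall>f\<in>Hom C X Y. \<forall>g\<in>Hom C Y Z. \<forall>h\<in>Hom C Z W.
        Comp C X Z W h (Comp C X Y Z g f) = Comp C X Y W (Comp C Y Z W h g) f)"

definition is_functor :: "('o, 'h) category \<Rightarrow> ('p, 'k) category \<Rightarrow>
    ('o \<Rightarrow> 'p) \<Rightarrow> ('o \<Rightarrow> 'o \<Rightarrow> 'h \<Rightarrow> 'k) \<Rightarrow> bool" where
  "is_functor C D Fo Fm \<longleftrightarrow>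
     (\<forall>X\<in>Obj C. Fo X \<in> Obj D) \<and>
     (\<forall>X\<in>Obj C. \<forall>Y\<in>Obj C. \<forall>f\<in>Hom C X Y. Fm X Y f \<in> Hom D (Fo X) (Fo Y)) \<and>
     (\<forall>X\<in>Obj C. Fm X X (Ident C X) = Ident D (Fo X)) \<and>
     (\<forall>X\<in>Obj C. \<forall>Y\<in>Obj C. \<forall>Z\<in>Obj C. \<forall>f\<in>Hom C X Y. \<forall>g\<in>Hom C Y Z.
        Fm X Z (Comp C X Y Z g f) = Comp D (Fo X) (Fo Y) (Fo Z) (Fm Y Z g) (Fm X Y f))"

definition iso_arrow :: "('o, 'h) category \<Rightarrow> 'o \<Rightarrow> 'o \<Rightarrow> 'h \<Rightarrow> bool" where
  "iso_arrow C X Y f \<longleftrightarrow> f \<in> Hom C X Y \<and>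
     (\<exists>g\<in>Hom C Y X. Comp C X Y X g f = Ident C X \<and> Comp C Y X Y f g = Ident C Y)"

definition naturally_isomorphic :: "('o, 'h) category \<Rightarrow> ('p, 'k) category \<Rightarrow>
    ('o \<Rightarrow> 'p) \<Rightarrow> ('o \<Rightarrow> 'o \<Rightarrow> 'h \<Rightarrow> 'k) \<Rightarrow> ('o \<Rightarrow> 'p) \<Rightarrow> ('o \<Rightarrow> 'o \<Rightarrow> 'h \<Rightarrow> 'k) \<Rightarrow> bool" where
  "naturally_isomorphic C D Fo Fm Go Gm \<longleftrightarrow>
     (\<exists>\<tau>. (\<forall>X\<in>Obj C. iso_arrow D (Fo X) (Go X) (\<tau> X)) \<and>
        (\<forall>X\<in>Obj C. \<forall>Y\<in>Obj C. \<forall>f\<in>Hom C X Y.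
           Comp D (Fo X) (Fo Y) (Go Y) (\<tau> Y) (Fm X Y f) =
           Comp D (Fo X) (Go X) (Go Y) (Gm X Y f) (\<tau> X)))"

definition equivalent_categories :: "('o, 'h) category \<Rightarrow> ('p, 'k) category \<Rightarrow> bool" where
  "equivalent_categories C D \<longleftrightarrow> is_category C \<and> is_category D \<and>
     (\<exists>Fo Fm Go Gm. is_functor C D Fo Fm \<and> is_functor D C Go Gm \<and>
        naturally_isomorphic C C
          (\<lambda>X. Go (Fo X)) (\<lambda>X Y f. Gm (Fo X) (Fo Y) (Fm X Y f)) (\<lambda>X. X) (\<lambda>X Y f. f) \<and>
        naturally_isomorphic D D
          (\<lambda>X. Fo (Go X)) (\<lambda>X Y f. Fm (Go X) (Go Y) (Gm X Y f)) (\<lambda>X. X) (\<lambda>X Y f. f))"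


section \<open>Twisted connections\<close>

definition tw_omega ::
    "'a tring \<Rightarrow> nat \<Rightarrow> (nat \<Rightarrow> 'a \<Rightarrow> 'a) \<Rightarrow> (nat \<Rightarrow> 'a) \<Rightarrow> ('a, (nat, 'a) mpoly set) module" where
  "tw_omega A d \<sigma> x = (pp_algebra A d \<sigma> x 1)
     \<lparr>carrier := {X \<in> carrier (principal_parts A d \<sigma> x 1). pp_proj X = \<zero>\<^bsub>A\<^esub>}\<rparr>"

type_synonym ('a, 'm) conn = "'m \<Rightarrow> ('m \<times> (nat, 'a) mpoly set \<Rightarrow>\<^sub>0 int) set"

definition twisted_connection ::
    "'a tring \<Rightarrow> nat \<Rightarrow> (nat \<Rightarrow> 'a \<Rightarrow> 'a) \<Rightarrow> (nat \<Rightarrow> 'a) \<Rightarrow> (nat \<Rightarrow> 'a \<Rightarrow> (nat, 'a) mpoly set)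
      \<Rightarrow> ('a, 'm) module \<Rightarrow> ('a, 'm) conn \<Rightarrow> bool" where
  "twisted_connection A d \<sigma> x \<Theta> M D \<longleftrightarrow>
     D \<in> carrier M \<rightarrow>\<^sub>E carrier (tensor A M (tw_omega A d \<sigma> x)) \<and>
     (let P = pp_algebra A d \<sigma> x 1; T = tensor A M P;
          \<Theta>M = (\<lambda>s. tensor_elt A M P s \<one>\<^bsub>P\<^esub> \<oplus>\<^bsub>T\<^esub> tensor_map A M P (\<lambda>m. m) (\<lambda>\<omega>. \<omega>) (D s))
      in (\<forall>s\<in>carrier M. \<forall>t\<in>carrier M. \<Theta>M (s \<oplus>\<^bsub>M\<^esub> t) = \<Theta>M s \<oplus>\<^bsub>T\<^esub> \<Theta>M t) \<and>
         (\<forall>f\<in>carrier A. \<forall>s\<in>carrier M.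
            \<Theta>M (f \<odot>\<^bsub>M\<^esub> s) = tensor_map A M P (\<lambda>m. m) (\<lambda>p. \<Theta> 1 f \<otimes>\<^bsub>P\<^esub> p) (\<Theta>M s)))"

text \<open>
  The conditions determine \<open>D1\<close>, the extension of the connection \<open>D\<close> to one-forms, because
  \<open>M \<otimes> \<Omega>\<close> is the sum of the subgroups \<open>M \<otimes> dx\<^sub>i\<close>, with \<open>dx\<^sub>i\<close> the class of \<open>\<xi>\<^sub>i\<close>.
\<close>

definition integrable_connection ::
    "'a tring \<Rightarrow> nat \<Rightarrow> (nat \<Rightarrow> 'a \<Rightarrow> 'a) \<Rightarrow> (nat \<Rightarrow> 'a)
      \<Rightarrow> ('a, 'm) module \<Rightarrow> ('a, 'm) conn \<Rightarrow> bool" where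
  "integrable_connection A d \<sigma> x M D \<longleftrightarrow>
     (let \<Omega> = tw_omega A d \<sigma> x; \<Omega>2 = exterior_square A \<Omega>
      in \<exists>D1 \<in> hom (add_monoid (tensor A M \<Omega>)) (add_monoid (tensor A M \<Omega>2)).
           (\<forall>m\<in>carrier M. \<forall>i<d. D1 (tensor_elt A M \<Omega> m (pp_xi A d \<sigma> x 1 i)) =
              tensor_map A M \<Omega>2 (\<lambda>m. m) (\<lambda>\<omega>. wedge A \<Omega> \<omega> (pp_xi A d \<sigma> x 1 i)) (D m)) \<and>
           (\<forall>s\<in>carrier M. D1 (D s) = \<zero>\<^bsub>tensor A M \<Omega>2\<^esub>))"

definition integrable_connection_category ::
    "'a tring \<Rightarrow> nat \<Rightarrow> (nat \<Rightarrow> 'a \<Rightarrow> 'a) \<Rightarrow> (nat \<Rightarrow> 'a) \<Rightarrow> (nat \<Rightarrow> 'a \<Rightarrow> (nat, 'a) mpoly set)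
      \<Rightarrow> (('a, 'm) module \<times> ('a, 'm) conn, 'm \<Rightarrow> 'm) category" where
  "integrable_connection_category A d \<sigma> x \<Theta> =
     \<lparr>Obj = {(M, D). Module.module A M \<and> twisted_connection A d \<sigma> x \<Theta> M D \<and>
                     integrable_connection A d \<sigma> x M D},
      Hom = (\<lambda>(M, DM) (N, DN). {h \<in> module_hom A M N. \<forall>s\<in>carrier M.
               tensor_map A N (tw_omega A d \<sigma> x) h (\<lambda>\<omega>. \<omega>) (DM s) = DN (h s)}),
      Ident = (\<lambda>(M, DM). restrict (\<lambda>m. m) (carrier M)),
      Comp = (\<lambda>(M, DM) _ _ g f. compose (carrier M) g f)\<rparr>"


section \<open>Twisted differential operators\<close>

definition linear_endo_ring :: "'r tring \<Rightarrow> ('r \<Rightarrow> 'a) \<Rightarrow> 'a tring \<Rightarrow> ('a \<Rightarrow> 'a) ring" where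
  "linear_endo_ring R \<eta> A =
     \<lparr>carrier = module_hom R (as_algebra \<eta> A) (as_algebra \<eta> A),
      monoid.mult = compose (carrier A),
      monoid.one = restrict (\<lambda>a. a) (carrier A),
      ring.zero = restrict (\<lambda>a. \<zero>\<^bsub>A\<^esub>) (carrier A),
      ring.add = (\<lambda>f g. restrict (\<lambda>a. f a \<oplus>\<^bsub>A\<^esub> g a) (carrier A))\<rparr>"

definition diff_op_ring ::
    "'r tring \<Rightarrow> ('r \<Rightarrow> 'a) \<Rightarrow> 'a tring \<Rightarrow> nat \<Rightarrow> (nat \<Rightarrow> 'a \<Rightarrow> 'a) \<Rightarrow> (nat \<Rightarrow> 'a)
      \<Rightarrow> (nat \<Rightarrow> 'a \<Rightarrow> (nat, 'a) mpoly set) \<Rightarrow> ('a \<Rightarrow> 'a) ring" where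
  "diff_op_ring R \<eta> A d \<sigma> x \<Theta> = (linear_endo_ring R \<eta> A)
     \<lparr>carrier := {f \<in> carrier (linear_endo_ring R \<eta> A).
        \<exists>n. \<exists>\<psi> \<in> module_hom A (pp_algebra A d \<sigma> x n) (as_algebra (\<lambda>a. a) A).
          f = compose (carrier A) \<psi> (\<Theta> n)}\<rparr>"

definition left_module_category ::
    "('a, 'z) ring_scheme \<Rightarrow> (('a, 'm) module, 'm \<Rightarrow> 'm) category" where
  "left_module_category D =
     \<lparr>Obj = {M. left_module D M},
      Hom = module_hom D,
      Ident = (\<lambda>M. restrict (\<lambda>m. m) (carrier M)),
      Comp = (\<lambda>M _ _ g f. compose (carrier M) g f)\<rparr>"

definition q_number :: "('a, 'z) ring_scheme \<Rightarrow> 'a \<Rightarrow> nat \<Rightarrow> 'a" where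
  "q_number R q n = (\<Oplus>\<^bsub>R\<^esub>k\<in>{..<n}. q [^]\<^bsub>R\<^esub> k)"

end

theory Submission
  imports Defs
begin

text \<open>
  Symmetry of the coordinates gives \<open>\<partial>\<^sub>i \<circ> \<partial>\<^sup>[\<^sup>k\<^sup>] = (k\<^sub>i + 1) \<partial>\<^sup>[\<^sup>k \<^sup>+ \<^sup>e\<^sub>i\<^sup>]\<close>, where the number is the
  \<open>q\<^sub>i\<close>-number. As these numbers are invertible constants, the ring of differential operators is
  generated over \<open>A\<close> by the \<open>\<partial>\<^sub>i\<close>, which commute and satisfy
  \<open>\<partial>\<^sub>i (f g) = \<partial>\<^sub>i f \<cdot> g + \<sigma>\<^sub>i f \<cdot> \<partial>\<^sub>i g\<close> because the coordinates are classical; freeness over \<open>A\<close> shows that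
  there are no further relations. A module over this ring is thus an \<open>A\<close>-module with commuting
  additive operators that satisfy the twisted Leibniz rule. Such operators are the components of a
  twisted connection, and they commute if and only if it is integrable. For good coordinates,
  \<open>A\<close> is spanned additively by the products of elements of \<open>R\<close> and \<open>A\<^sub>0\<close>, so the extended Taylor
  maps are still ring homomorphisms that fix \<open>R\<close>.
\<close>

section \<open>Polynomial rings\<close>

text \<open>\<open>pp_delta\<close> and \<open>tw_partial\<close> are definite descriptions, so
  symmetry and classicality yield nothing before the described objects are shown to exist. For
  \<delta>_{1,m} this rests on the twisted binomial formula up to left degree one,
  \<delta>(\<xi>^(k)) = 1 \<otimes> \<xi>^(k) + \<Sum>_j (k_j) \<xi>_j \<otimes> \<xi>^(k-e_j),
  whose right-hand side vanishes for |k| > m + 1. It becomes an identity between operators through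
  explicit coefficient functionals, first on the principal parts, where they come from a
  Stirling-type change of basis, then on the tensor product. Linear independence of the
  \<partial>^[k] needs more than freeness of the principal parts P_n: the relation \<xi>_i
  \<Theta>(g) = \<Theta>(x_i g) - x_i \<Theta>(g) makes the A-span of \<Theta>(A) all of P_n.
  Independence lets an operator act on a module through its coefficients. The inverses of the
  q-numbers come from R, so they are killed by every \<partial>_i and fixed by every \<sigma>_i;
  hence the operators \<partial>^k divided by q-factorials compose on a module by the same rule as
  on A.\<close>

lemma finite_submultisets: "finite {k. k \<subseteq># m}"
proof (rule finite_subset)
  show "{k. k \<subseteq># m} \<subseteq> (\<Union>n\<le>size m. multisets_of_size (set_mset m) n)"
    by (auto simp: multisets_of_size_def size_mset_mono dest: set_mset_mono subsetD mset_subset_eqD)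
qed auto

text \<open>Divisibility by a product of monomials can be tested one monomial at a time. This is
  associativity of the polynomial product when the two left factors are monomials.\<close>

lemma add_submset_iff: "m + m' \<subseteq># k \<longleftrightarrow> m \<subseteq># k \<and> m' \<subseteq># k - m"
proof -
  have "count m a + count m' a \<le> count k a \<longleftrightarrow>
      count m a \<le> count k a \<and> count m' a \<le> count k a - count m a" for a
    by arith
  then show ?thesis by (simp add: subseteq_mset_def all_conj_distrib)
qed

definition mp_monom :: "('a, 'z) ring_scheme \<Rightarrow> 'a \<Rightarrow> 'v multiset \<Rightarrow> ('v, 'a) mpoly" where
  "mp_monom A c m = (\<lambda>k. if k = m then c else \<zero>\<^bsub>A\<^esub>)"

locale poly_over = cring A for A :: "('a, 'z) ring_scheme" (structure) +
  fixes V :: "'v set"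
begin

abbreviation S :: "('v, 'a) mpoly ring" where "S \<equiv> mpoly_ring A V"

lemma carrier_S: "p \<in> carrier S \<longleftrightarrow>
    (\<forall>m. p m \<in> carrier A) \<and> finite {m. p m \<noteq> \<zero>} \<and> (\<forall>m. p m \<noteq> \<zero> \<longrightarrow> set_mset m \<subseteq> V)"
  by (simp add: mpoly_ring_def)

lemma carrier_SI:
  "(\<And>m. p m \<in> carrier A) \<Longrightarrow> finite {m. p m \<noteq> \<zero>} \<Longrightarrow> (\<And>m. p m \<noteq> \<zero> \<Longrightarrow> set_mset m \<subseteq> V)
    \<Longrightarrow> p \<in> carrier S"
  by (simp add: carrier_S)

lemma coeff_closed [simp]: "p \<in> carrier S \<Longrightarrow> p m \<in> carrier A"
  by (simp add: carrier_S)

lemma add_S: "p \<oplus>\<^bsub>S\<^esub> r = (\<lambda>m. p m \<oplus> r m)"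
  and zero_S: "\<zero>\<^bsub>S\<^esub> = (\<lambda>m. \<zero>)"
  and one_S: "\<one>\<^bsub>S\<^esub> = mp_monom A \<one> {#}"
  and mult_S: "p \<otimes>\<^bsub>S\<^esub> r = (\<lambda>m. \<Oplus>k\<in>{k. k \<subseteq># m}. p k \<otimes> r (m - k))"
  by (simp_all only: mpoly_ring_def mp_monom_def ring.select_convs monoid.select_convs)

lemma const_mono: "mpoly_const A c = mp_monom A c {#}"
  and var_mono: "mpoly_var A v = mp_monom A \<one> {#v#}"
  by (simp_all add: mpoly_const_def mpoly_var_def mp_monom_def)

lemma mono_closed [simp]:
  assumes "c \<in> carrier A" "set_mset m \<subseteq> V"
  shows "mp_monom A c m \<in> carrier S"
proof -
  have "{k. mp_monom A c m k \<noteq> \<zero>} \<subseteq> {m}" by (auto simp: mp_monom_def split: if_splits)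
  then have "finite {k. mp_monom A c m k \<noteq> \<zero>}" by (rule finite_subset) simp
  then show ?thesis using assms by (simp add: carrier_S) (simp add: mp_monom_def)
qed

lemma add_S_closed: "p \<in> carrier S \<Longrightarrow> r \<in> carrier S \<Longrightarrow> p \<oplus>\<^bsub>S\<^esub> r \<in> carrier S"
proof -
  assume p: "p \<in> carrier S" and r: "r \<in> carrier S"
  have "{m. p m \<oplus> r m \<noteq> \<zero>} \<subseteq> {m. p m \<noteq> \<zero>} \<union> {m. r m \<noteq> \<zero>}" by auto
  moreover have "finite ({m. p m \<noteq> \<zero>} \<union> {m. r m \<noteq> \<zero>})" using p r by (simp add: carrier_S)
  ultimately have "finite {m. p m \<oplus> r m \<noteq> \<zero>}" by (rule finite_subset)
  moreover have "set_mset m \<subseteq> V" if "p m \<oplus> r m \<noteq> \<zero>" for m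
  proof (cases "p m = \<zero>")
    case True
    then have "r m \<noteq> \<zero>" using that by auto
    then show ?thesis using r by (simp add: carrier_S)
  next
    case False
    then show ?thesis using p by (simp add: carrier_S)
  qed
  ultimately show ?thesis using p r by (simp add: carrier_S add_S)
qed

lemma zero_S_closed: "\<zero>\<^bsub>S\<^esub> \<in> carrier S"
  by (simp add: carrier_S zero_S)

text \<open>Induction on the finite support, one nonzero coefficient being split off as a monomial.
  Laws that are additive in each argument thereby reduce to monomials.\<close>

lemma S_induct [consumes 1, case_names zero add]:
  assumes p: "p \<in> carrier S" and z: "P \<zero>\<^bsub>S\<^esub>"
    and a: "\<And>c m p. c \<in> carrier A \<Longrightarrow> set_mset m \<subseteq> V \<Longrightarrow> p \<in> carrier S \<Longrightarrow> P p \<Longrightarrow> P (mp_monom A c m \<oplus>\<^bsub>S\<^esub> p)"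
  shows "P p"
proof -
  have "finite F \<Longrightarrow> \<forall>p. p \<in> carrier S \<longrightarrow> {m. p m \<noteq> \<zero>} = F \<longrightarrow> P p" for F
  proof (induction F rule: finite_induct)
    case empty
    have "p = \<zero>\<^bsub>S\<^esub>" if "{m. p m \<noteq> \<zero>} = {}" for p
      using that by (auto simp: zero_S)
    then show ?case using z by blast
  next
    case (insert m F)
    show ?case
    proof (intro allI impI)
      fix p assume p: "p \<in> carrier S" and s: "{m. p m \<noteq> \<zero>} = insert m F"
      let ?p = "p(m := \<zero>)"
      have F: "{k. ?p k \<noteq> \<zero>} = F" using s insert.hyps by auto
      moreover have "?p \<in> carrier S"
      proof (rule carrier_SI)
        show "finite {k. ?p k \<noteq> \<zero>}" using insert.hyps by (simp only: F)
      qed (use p in \<open>auto simp: carrier_S split: if_splits\<close>)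
      ultimately have "P ?p" using insert.IH by blast
      moreover have "set_mset m \<subseteq> V" using p s by (auto simp: carrier_S)
      moreover have "p = mp_monom A (p m) m \<oplus>\<^bsub>S\<^esub> ?p" using p by (auto simp: add_S mp_monom_def carrier_S)
      ultimately show "P p" using a[of "p m" m ?p] p \<open>?p \<in> carrier S\<close> by simp
    qed
  qed
  then show ?thesis using p by (auto simp: carrier_S)
qed

text \<open>Of the convolution sum only the summand at \<open>m\<close> survives, so a monomial acts
  by shifting exponents. Commutativity and associativity are proved in this form.\<close>

lemma mult_mono: 
  assumes "c \<in> carrier A" "r \<in> carrier S"
  shows "mp_monom A c m \<otimes>\<^bsub>S\<^esub> r = (\<lambda>k. if m \<subseteq># k then c \<otimes> r (k - m) else \<zero>)"
proof
  fix k
  have "(\<Oplus>j\<in>{j. j \<subseteq># k}. mp_monom A c m j \<otimes> r (k - j)) = (\<Oplus>j\<in>{j. j \<subseteq># k}. if m = j then c \<otimes> r (k - j) else \<zero>)"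
    using assms by (intro finsum_cong) (auto simp: mp_monom_def carrier_S simp_implies_def)
  also have "\<dots> = (if m \<subseteq># k then c \<otimes> r (k - m) else \<zero>)"
  proof (cases "m \<subseteq># k")
    case True
    then show ?thesis
      using finsum_singleton[of m "{j. j \<subseteq># k}" "\<lambda>j. c \<otimes> r (k - j)"] assms finite_submultisets[of k] by auto
  next
    case False
    then have "(\<Oplus>j\<in>{j. j \<subseteq># k}. if m = j then c \<otimes> r (k - j) else \<zero>) = (\<Oplus>j\<in>{j. j \<subseteq># k}. \<zero>)"
      using assms by (intro finsum_cong) (auto simp: carrier_S simp_implies_def)
    then show ?thesis using False by simp
  qed
  finally show "(mp_monom A c m \<otimes>\<^bsub>S\<^esub> r) k = (if m \<subseteq># k then c \<otimes> r (k - m) else \<zero>)"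
    by (simp add: mult_S)
qed

lemma mono_mult_mono:
  assumes "c \<in> carrier A" "c' \<in> carrier A" "set_mset m' \<subseteq> V"
  shows "mp_monom A c m \<otimes>\<^bsub>S\<^esub> mp_monom A c' m' = mp_monom A (c \<otimes> c') (m + m')"
  unfolding mult_mono[OF assms(1) mono_closed[OF assms(2,3)]]
  using assms(1) by (auto simp: mp_monom_def fun_eq_iff)

lemma mono_mult_closed:
  assumes c: "c \<in> carrier A" "set_mset m \<subseteq> V" and r: "r \<in> carrier S"
  shows "mp_monom A c m \<otimes>\<^bsub>S\<^esub> r \<in> carrier S"
proof -
  have "{k. (if m \<subseteq># k then c \<otimes> r (k - m) else \<zero>) \<noteq> \<zero>} \<subseteq> (\<lambda>k. m + k) ` {k. r k \<noteq> \<zero>}"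
  proof
    fix k assume "k \<in> {k. (if m \<subseteq># k then c \<otimes> r (k - m) else \<zero>) \<noteq> \<zero>}"
    then have "m \<subseteq># k" "r (k - m) \<noteq> \<zero>" using c by (auto split: if_splits)
    then show "k \<in> (\<lambda>k. m + k) ` {k. r k \<noteq> \<zero>}"
      by (intro image_eqI[of _ _ "k - m"]) auto
  qed
  moreover have "set_mset k \<subseteq> V" if "m \<subseteq># k" "c \<otimes> r (k - m) \<noteq> \<zero>" for k
  proof -
    have "r (k - m) \<noteq> \<zero>" using that c by auto
    then have "set_mset (k - m) \<subseteq> V" using r by (auto simp: carrier_S)
    then have "set_mset (m + (k - m)) \<subseteq> V" using c(2) by (simp add: set_mset_union)
    then show ?thesis using that by simp
  qed
  moreover have "finite ((\<lambda>k. m + k) ` {k. r k \<noteq> \<zero>})" using r by (simp add: carrier_S)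
  ultimately show ?thesis
    unfolding mult_mono[OF c(1) r]
    using c r by (intro carrier_SI) (auto dest: finite_subset split: if_splits)
qed

lemma mult_S_distr:
  assumes "p \<in> carrier S" "p' \<in> carrier S" "r \<in> carrier S"
  shows "(p \<oplus>\<^bsub>S\<^esub> p') \<otimes>\<^bsub>S\<^esub> r = p \<otimes>\<^bsub>S\<^esub> r \<oplus>\<^bsub>S\<^esub> p' \<otimes>\<^bsub>S\<^esub> r"
    and "r \<otimes>\<^bsub>S\<^esub> (p \<oplus>\<^bsub>S\<^esub> p') = r \<otimes>\<^bsub>S\<^esub> p \<oplus>\<^bsub>S\<^esub> r \<otimes>\<^bsub>S\<^esub> p'"
  using assms by (simp_all add: mult_S add_S l_distr r_distr finsum_addf Pi_def)

lemma zero_mult_S: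
  assumes "r \<in> carrier S"
  shows "\<zero>\<^bsub>S\<^esub> \<otimes>\<^bsub>S\<^esub> r = \<zero>\<^bsub>S\<^esub>" and "r \<otimes>\<^bsub>S\<^esub> \<zero>\<^bsub>S\<^esub> = \<zero>\<^bsub>S\<^esub>"
  using assms by (simp_all add: mult_S zero_S)

lemma mult_S_closed:
  assumes p: "p \<in> carrier S" and r: "r \<in> carrier S"
  shows "p \<otimes>\<^bsub>S\<^esub> r \<in> carrier S"
  using p
proof (induction rule: S_induct)
  case zero then show ?case using r by (simp add: zero_mult_S zero_S_closed)
next
  case (add c m p)
  then show ?case using r by (simp add: mult_S_distr add_S_closed mono_mult_closed)
qed

lemma mult_S_comm:
  assumes p: "p \<in> carrier S" and r: "r \<in> carrier S"
  shows "p \<otimes>\<^bsub>S\<^esub> r = r \<otimes>\<^bsub>S\<^esub> p"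
  using p
proof (induction rule: S_induct)
  case zero then show ?case using r by (simp add: zero_mult_S)
next
  case (add c m p)
  have "mp_monom A c m \<otimes>\<^bsub>S\<^esub> r = r \<otimes>\<^bsub>S\<^esub> mp_monom A c m"
    using r
  proof (induction rule: S_induct)
    case zero then show ?case using add by (simp add: zero_mult_S)
  next
    note cm = add.hyps
    case (add c' m' p')
    then show ?case using cm
      by (simp add: mult_S_distr mono_mult_mono m_comm union_commute)
  qed
  then show ?case using r add by (simp add: mult_S_distr)
qed

lemma mult_S_assoc:
  assumes p: "p \<in> carrier S" and q: "q \<in> carrier S" and r: "r \<in> carrier S"
  shows "(p \<otimes>\<^bsub>S\<^esub> q) \<otimes>\<^bsub>S\<^esub> r = p \<otimes>\<^bsub>S\<^esub> (q \<otimes>\<^bsub>S\<^esub> r)"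
  using p
proof (induction rule: S_induct)
  case zero then show ?case using q r by (simp add: zero_mult_S mult_S_closed)
next
  case (add c m p)
  have "(mp_monom A c m \<otimes>\<^bsub>S\<^esub> q) \<otimes>\<^bsub>S\<^esub> r = mp_monom A c m \<otimes>\<^bsub>S\<^esub> (q \<otimes>\<^bsub>S\<^esub> r)"
    using q
  proof (induction rule: S_induct)
    case zero then show ?case using add r by (simp add: zero_mult_S)
  next
    note cm = add.hyps
    case (add c' m' p')
    \<comment> \<open>Both sides are explicit shifts of the arbitrary third factor, compared by
      \<open>add_submset_iff\<close>.\<close>
    have "mp_monom A (c \<otimes> c') (m + m') \<otimes>\<^bsub>S\<^esub> r = mp_monom A c m \<otimes>\<^bsub>S\<^esub> (mp_monom A c' m' \<otimes>\<^bsub>S\<^esub> r)"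
      unfolding mult_mono[OF m_closed[OF cm(1) add(1)] r]
        mult_mono[OF cm(1) mono_mult_closed[OF add(1,2) r]]
      unfolding mult_mono[OF add(1) r]
      using cm(1) add(1) r by (simp add: fun_eq_iff m_assoc add_submset_iff)
    then show ?case using add r cm
      by (simp add: mult_S_distr mono_mult_mono mult_S_closed)
  qed
  then show ?case using q r add by (simp add: mult_S_distr mult_S_closed)
qed

lemma cring_S: "cring S"
proof (rule cringI)
  show "abelian_group S"
  proof (rule abelian_groupI)
    fix p assume p: "p \<in> carrier S"
    show "\<exists>r\<in>carrier S. r \<oplus>\<^bsub>S\<^esub> p = \<zero>\<^bsub>S\<^esub>"
    proof
      show "(\<lambda>m. \<ominus> p m) \<in> carrier S"
      proof (rule carrier_SI)
        have "{m. \<ominus> p m \<noteq> \<zero>} \<subseteq> {m. p m \<noteq> \<zero>}" by auto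
        then show "finite {m. \<ominus> p m \<noteq> \<zero>}" by (rule finite_subset) (use p in \<open>simp add: carrier_S\<close>)
        show "set_mset m \<subseteq> V" if "\<ominus> p m \<noteq> \<zero>" for m
        proof -
          have "p m \<noteq> \<zero>" using that by auto
          then show ?thesis using p by (simp add: carrier_S)
        qed
      qed (use p in auto)
      show "(\<lambda>m. \<ominus> p m) \<oplus>\<^bsub>S\<^esub> p = \<zero>\<^bsub>S\<^esub>" using p by (simp add: add_S zero_S l_neg)
    qed
  qed (simp_all add: add_S_closed zero_S_closed, simp_all add: add_S zero_S a_ac)
  show "comm_monoid S"
  proof (rule comm_monoidI)
    show "\<one>\<^bsub>S\<^esub> \<in> carrier S" by (simp add: one_S)
    show "\<one>\<^bsub>S\<^esub> \<otimes>\<^bsub>S\<^esub> p = p" if "p \<in> carrier S" for p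
      using that by (simp only: one_S mult_mono[OF one_closed that]) simp
  qed (auto intro: mult_S_closed mult_S_comm mult_S_assoc)
qed (simp add: mult_S_distr)

lemma const_in_S [simp]: "c \<in> carrier A \<Longrightarrow> mpoly_const A c \<in> carrier S"
  by (simp add: const_mono)

lemma var_in_S [simp]: "v \<in> V \<Longrightarrow> mpoly_var A v \<in> carrier S"
  by (simp add: var_mono)

lemma const_hom: "mpoly_const A \<in> ring_hom A S"
  by (rule ring_hom_memI) (auto simp: const_mono one_S mono_mult_mono add_S, auto simp: mp_monom_def)

text \<open>Monomials are built up one variable at a time. This is the rule for statements about
  ideals, spans and algebra maps, where constants and variables are what one knows.\<close>

lemma poly_induct [consumes 1, case_names const add mult]:
  assumes p: "p \<in> carrier S"
    and c: "\<And>c. c \<in> carrier A \<Longrightarrow> P (mpoly_const A c)"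
    and a: "\<And>p r. p \<in> carrier S \<Longrightarrow> r \<in> carrier S \<Longrightarrow> P p \<Longrightarrow> P r \<Longrightarrow> P (p \<oplus>\<^bsub>S\<^esub> r)"
    and m: "\<And>v p. v \<in> V \<Longrightarrow> p \<in> carrier S \<Longrightarrow> P p \<Longrightarrow> P (mpoly_var A v \<otimes>\<^bsub>S\<^esub> p)"
  shows "P p"
proof -
  have mono: "set_mset m \<subseteq> V \<Longrightarrow> P (mp_monom A c m)" if "c \<in> carrier A" for c m
  proof (induction m)
    case empty then show ?case using c that by (simp add: const_mono)
  next
    case (add v m)
    have "mp_monom A c (add_mset v m) = mpoly_var A v \<otimes>\<^bsub>S\<^esub> mp_monom A c m"
      using that add by (simp add: var_mono mono_mult_mono)
    then show ?case using add m that by simp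
  qed
  show ?thesis using p
  proof (induction rule: S_induct)
    case zero
    have "mpoly_const A \<zero> = \<zero>\<^bsub>S\<^esub>" by (auto simp: mpoly_const_def zero_S)
    then show ?case using c[of \<zero>] by simp
  next
    case (add c m p) then show ?case using a mono by simp
  qed
qed

end

section \<open>Evaluation homomorphisms of polynomial rings\<close>

locale poly_eval = poly_over A V + B: cring B
  for A :: "('a, 'z) ring_scheme" and V :: "'v set" and B :: "('b, 'w) ring_scheme" (structure) +
  fixes \<phi> :: "'a \<Rightarrow> 'b" and t :: "'v \<Rightarrow> 'b"
  assumes hom: "\<phi> \<in> ring_hom A B" and t: "\<And>v. v \<in> V \<Longrightarrow> t v \<in> carrier B"
begin

abbreviation ev where "ev \<equiv> mpoly_eval A B \<phi> t"

definition tm :: "'v multiset \<Rightarrow> 'b" where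
  "tm m = (\<Otimes>\<^bsub>B\<^esub>v\<in>set_mset m. t v [^]\<^bsub>B\<^esub> count m v)"

lemma tm_closed [simp]: "set_mset m \<subseteq> V \<Longrightarrow> tm m \<in> carrier B"
  unfolding tm_def using t by (intro B.finprod_closed) auto

lemma tm_ext:
  assumes "finite F" "set_mset m \<subseteq> F" "F \<subseteq> V"
  shows "tm m = (\<Otimes>\<^bsub>B\<^esub>v\<in>F. t v [^]\<^bsub>B\<^esub> count m v)"
  unfolding tm_def using assms t
  by (intro B.finprod_mono_neutral_cong_left) (auto simp: not_in_iff)

lemma tm_union:
  assumes "set_mset m \<subseteq> V" "set_mset m' \<subseteq> V"
  shows "tm (m + m') = tm m \<otimes>\<^bsub>B\<^esub> tm m'"
proof -
  let ?F = "set_mset m \<union> set_mset m'"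
  have "tm (m + m') = (\<Otimes>\<^bsub>B\<^esub>v\<in>?F. t v [^]\<^bsub>B\<^esub> count m v \<otimes>\<^bsub>B\<^esub> t v [^]\<^bsub>B\<^esub> count m' v)"
    using assms t by (subst tm_ext[of ?F]) (auto intro!: B.finprod_cong' simp: B.nat_pow_mult Pi_def)
  also have "\<dots> = tm m \<otimes>\<^bsub>B\<^esub> tm m'"
    using assms t by (subst B.finprod_multf) (auto simp: tm_ext[of ?F m] tm_ext[of ?F m'] Pi_def)
  finally show ?thesis .
qed

lemma tm_empty [simp]: "tm {#} = \<one>\<^bsub>B\<^esub>"
  and tm_single [simp]: "v \<in> V \<Longrightarrow> tm {#v#} = t v"
  using t by (auto simp: tm_def Pi_def)

interpretation H: ring_hom_cring A B \<phi>
  by (rule ring_hom_cringI[OF is_cring B.is_cring hom])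

lemma term_closed: "p \<in> carrier S \<Longrightarrow> p m \<noteq> \<zero>\<^bsub>A\<^esub> \<Longrightarrow> \<phi> (p m) \<otimes>\<^bsub>B\<^esub> tm m \<in> carrier B"
  by (intro B.m_closed tm_closed H.hom_closed) (auto simp: carrier_S)

lemma term_closed': "p \<in> carrier S \<Longrightarrow> set_mset m \<subseteq> V \<Longrightarrow> \<phi> (p m) \<otimes>\<^bsub>B\<^esub> tm m \<in> carrier B"
  by (intro B.m_closed tm_closed H.hom_closed) (auto simp: carrier_S)

lemma ev_ext:
  assumes "p \<in> carrier S" "finite F" "{m. p m \<noteq> \<zero>\<^bsub>A\<^esub>} \<subseteq> F" "\<And>m. m \<in> F \<Longrightarrow> set_mset m \<subseteq> V"
  shows "ev p = (\<Oplus>\<^bsub>B\<^esub>m\<in>F. \<phi> (p m) \<otimes>\<^bsub>B\<^esub> tm m)"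
  unfolding mpoly_eval_def tm_def[symmetric] using assms
  by (intro B.add.finprod_mono_neutral_cong_left) (auto intro!: term_closed')

lemma ev_closed [simp]: "p \<in> carrier S \<Longrightarrow> ev p \<in> carrier B"
  unfolding mpoly_eval_def tm_def[symmetric] by (intro B.finsum_closed) (auto intro: term_closed)

lemma ev_add:
  assumes p: "p \<in> carrier S" and r: "r \<in> carrier S"
  shows "ev (p \<oplus>\<^bsub>S\<^esub> r) = ev p \<oplus>\<^bsub>B\<^esub> ev r"
proof -
  let ?F = "{m. p m \<noteq> \<zero>\<^bsub>A\<^esub>} \<union> {m. r m \<noteq> \<zero>\<^bsub>A\<^esub>}"
  have F: "finite ?F" "\<And>m. m \<in> ?F \<Longrightarrow> set_mset m \<subseteq> V" using p r by (auto simp: carrier_S)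
  have "{m. (p \<oplus>\<^bsub>S\<^esub> r) m \<noteq> \<zero>\<^bsub>A\<^esub>} \<subseteq> ?F" by (auto simp: add_S)
  then have "ev (p \<oplus>\<^bsub>S\<^esub> r) = (\<Oplus>\<^bsub>B\<^esub>m\<in>?F. \<phi> (p m \<oplus>\<^bsub>A\<^esub> r m) \<otimes>\<^bsub>B\<^esub> tm m)"
    using F p r by (subst ev_ext[of _ ?F]) (auto simp: add_S_closed, simp add: add_S)
  also have "\<dots> = (\<Oplus>\<^bsub>B\<^esub>m\<in>?F. \<phi> (p m) \<otimes>\<^bsub>B\<^esub> tm m \<oplus>\<^bsub>B\<^esub> \<phi> (r m) \<otimes>\<^bsub>B\<^esub> tm m)"
    using F p r by (intro B.finsum_cong') (auto simp: B.l_distr term_closed')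
  also have "\<dots> = (\<Oplus>\<^bsub>B\<^esub>m\<in>?F. \<phi> (p m) \<otimes>\<^bsub>B\<^esub> tm m) \<oplus>\<^bsub>B\<^esub> (\<Oplus>\<^bsub>B\<^esub>m\<in>?F. \<phi> (r m) \<otimes>\<^bsub>B\<^esub> tm m)"
    using F p r by (intro B.finsum_addf) (auto simp: term_closed')
  also have "\<dots> = ev p \<oplus>\<^bsub>B\<^esub> ev r"
    by (subst (1 2) ev_ext[of _ ?F]) (use F p r in auto)
  finally show ?thesis .
qed

lemma ev_mono:
  assumes "c \<in> carrier A" "set_mset m \<subseteq> V"
  shows "ev (mp_monom A c m) = \<phi> c \<otimes>\<^bsub>B\<^esub> tm m"
proof -
  have "ev (mp_monom A c m) = (\<Oplus>\<^bsub>B\<^esub>k\<in>{m}. \<phi> (mp_monom A c m k) \<otimes>\<^bsub>B\<^esub> tm k)"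
    using assms by (intro ev_ext mono_closed) (auto simp: mp_monom_def split: if_splits)
  then show ?thesis using assms by (simp add: mp_monom_def)
qed

lemma ev_zero: "ev \<zero>\<^bsub>S\<^esub> = \<zero>\<^bsub>B\<^esub>"
  by (simp add: mpoly_eval_def zero_S)

text \<open>Additivity in both arguments leaves a product of two monomials, where the claim is
  \<open>tm_union\<close>.\<close>

lemma ev_mult:
  assumes p: "p \<in> carrier S" and r: "r \<in> carrier S"
  shows "ev (p \<otimes>\<^bsub>S\<^esub> r) = ev p \<otimes>\<^bsub>B\<^esub> ev r"
  using p
proof (induction rule: S_induct)
  case zero then show ?case using r by (simp add: zero_mult_S ev_zero)
next
  case (add c m p)
  note cm = add.hyps
  have "ev (mp_monom A c m \<otimes>\<^bsub>S\<^esub> r) = ev (mp_monom A c m) \<otimes>\<^bsub>B\<^esub> ev r"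
    using r
  proof (induction rule: S_induct)
    case zero then show ?case using cm by (simp add: zero_mult_S ev_zero)
  next
    case (add c' m' p')
    have "\<phi> (c \<otimes>\<^bsub>A\<^esub> c') \<otimes>\<^bsub>B\<^esub> (tm m \<otimes>\<^bsub>B\<^esub> tm m') = \<phi> c \<otimes>\<^bsub>B\<^esub> tm m \<otimes>\<^bsub>B\<^esub> (\<phi> c' \<otimes>\<^bsub>B\<^esub> tm m')"
      using cm add by (simp add: B.m_ac)
    then show ?case using cm add
      by (simp add: mult_S_distr ev_add mono_mult_mono mono_mult_closed ev_mono tm_union B.r_distr)
  qed
  then show ?case using cm add r
    by (simp add: mult_S_distr ev_add mono_mult_closed mult_S_closed B.l_distr)
qed

lemma ev_const [simp]: "c \<in> carrier A \<Longrightarrow> ev (mpoly_const A c) = \<phi> c"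
  by (simp add: const_mono ev_mono)

lemma ev_var [simp]: "v \<in> V \<Longrightarrow> ev (mpoly_var A v) = t v"
  using t by (simp add: var_mono ev_mono)

lemma ev_hom: "ev \<in> ring_hom S B"
  by (rule ring_hom_memI) (auto simp: ev_mult ev_add one_S ev_mono)

end

section \<open>Twisted principal parts\<close>

text \<open>Topological rings, quotients and algebras are different records around the same
  operations; the ring axioms are carried over along equal fields.\<close>

lemma cring_cong:
  assumes "cring R" "carrier Q = carrier R" "monoid.mult Q = monoid.mult R" "monoid.one Q = monoid.one R"
    "ring.add Q = ring.add R" "ring.zero Q = ring.zero R"
  shows "cring Q"
proof -
  interpret R: cring R by fact
  show ?thesis
  proof (rule cringI)
    show "abelian_group Q"
    proof (rule abelian_groupI)
      show "\<exists>y\<in>carrier Q. y \<oplus>\<^bsub>Q\<^esub> x = \<zero>\<^bsub>Q\<^esub>" if "x \<in> carrier Q" for x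
        using that R.a_inv_closed R.l_neg by (auto simp: assms)
    qed (simp_all add: assms R.a_ac)
    show "comm_monoid Q"
      by (rule comm_monoidI) (simp_all add: assms R.m_ac)
  qed (simp add: assms R.l_distr)
qed

lemma mpoly_tring_sel:
  "carrier (mpoly_tring A V) = carrier (mpoly_ring A V)"
  "monoid.mult (mpoly_tring A V) = monoid.mult (mpoly_ring A V)"
  "monoid.one (mpoly_tring A V) = monoid.one (mpoly_ring A V)"
  "ring.add (mpoly_tring A V) = ring.add (mpoly_ring A V)"
  "ring.zero (mpoly_tring A V) = ring.zero (mpoly_ring A V)"
  by (simp_all add: mpoly_tring_def ring.defs)

lemma quotient_tring_sel:
  "carrier (quotient_tring A I) = carrier (A Quot I)"
  "monoid.mult (quotient_tring A I) = monoid.mult (A Quot I)"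
  "monoid.one (quotient_tring A I) = monoid.one (A Quot I)"
  "ring.add (quotient_tring A I) = ring.add (A Quot I)"
  "ring.zero (quotient_tring A I) = ring.zero (A Quot I)"
  by (simp_all add: quotient_tring_def ring.defs)

text \<open>
  The monomial \<open>X\<^sup>a\<close> is the combination of the twisted powers \<open>\<Prod>\<^sub>j\<^sub><\<^sub>b (X + y\<^sub>j)\<close> with these
  coefficients, a deformation of the Stirling numbers of the second kind.
\<close>

primrec (in cring) stirling :: "(nat \<Rightarrow> 'a) \<Rightarrow> nat \<Rightarrow> nat \<Rightarrow> 'a" where
  "stirling y 0 b = (if b = 0 then \<one> else \<zero>)"
| "stirling y (Suc a) b = (if b = 0 then \<zero> else stirling y a (b - 1)) \<ominus> y b \<otimes> stirling y a b"

text \<open>Only closedness of \<open>x\<close> and \<open>\<sigma>\<close> is recorded, so that the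
  locale applies both to A and to a ring of definition inside A.\<close>

locale twisted_poly = cring A for A :: "'a tring" (structure) +
  fixes d :: nat and \<sigma> :: "nat \<Rightarrow> 'a \<Rightarrow> 'a" and x :: "nat \<Rightarrow> 'a"
  assumes x_closed: "i < d \<Longrightarrow> x i \<in> carrier A"
    and sigma_closed: "i < d \<Longrightarrow> a \<in> carrier A \<Longrightarrow> \<sigma> i a \<in> carrier A"
begin

sublocale poly_over A "{..<d}" ..

abbreviation T where "T \<equiv> mpoly_tring A {..<d}"

lemmas T_sel = mpoly_tring_sel[of A "{..<d}"]

sublocale T: cring T
  by (rule cring_cong[OF cring_S]) (simp_all add: mpoly_tring_sel)

definition shift :: "nat \<Rightarrow> nat \<Rightarrow> 'a" where "shift i j = x i \<ominus> (\<sigma> i ^^ j) (x i)"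

lemma sigma_pow_closed: "i < d \<Longrightarrow> (\<sigma> i ^^ j) (x i) \<in> carrier A"
  by (induction j) (auto simp: x_closed sigma_closed)

lemma shift_closed [simp]: "i < d \<Longrightarrow> shift i j \<in> carrier A"
  by (simp add: shift_def x_closed sigma_pow_closed)

lemma shift_0 [simp]: "i < d \<Longrightarrow> shift i 0 = \<zero>"
  by (simp add: shift_def x_closed a_minus_def r_neg)

abbreviation fac :: "nat \<Rightarrow> nat \<Rightarrow> (nat, 'a) mpoly" where
  "fac i j \<equiv> mpoly_var A i \<oplus>\<^bsub>T\<^esub> mpoly_const A (shift i j)"

lemma const_in_T [simp]: "c \<in> carrier A \<Longrightarrow> mpoly_const A c \<in> carrier T"
  and var_in_T [simp]: "i < d \<Longrightarrow> mpoly_var A i \<in> carrier T"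
  by (simp_all add: T_sel)

lemma const_hom_T: "mpoly_const A \<in> ring_hom A T"
  using const_hom by (auto simp: ring_hom_def T_sel)

abbreviation xip where "xip \<equiv> xi_power A d \<sigma> x"

lemma xip_eq: "xip k = (\<Otimes>\<^bsub>T\<^esub>i\<in>{..<d}. \<Otimes>\<^bsub>T\<^esub>j\<in>{..<count k i}. fac i j)"
  by (simp add: xi_power_def shift_def Let_def)

lemma xip_closed [simp]: "xip k \<in> carrier T"
  unfolding xip_eq by (intro T.finprod_closed) auto

lemma xip_empty: "xip {#} = \<one>\<^bsub>T\<^esub>"
  unfolding xip_eq by (intro T.finprod_one_eqI) simp

text \<open>The new factor has index \<open>count k i\<close>, the first index not yet used for the
  variable \<open>i\<close>, because the factors are numbered from zero.\<close>

lemma xip_add: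
  assumes i: "i < d"
  shows "xip (add_mset i k) = fac i (count k i) \<otimes>\<^bsub>T\<^esub> xip k"
proof -
  let ?g = "\<lambda>k i. \<Otimes>\<^bsub>T\<^esub>j\<in>{..<count k i}. fac i j"
  have d: "{..<d} = insert i ({..<d} - {i})" using i by auto
  have g: "?g k j \<in> carrier T" if "j < d" for j k using that by (intro T.finprod_closed) auto
  have "xip (add_mset i k) = ?g (add_mset i k) i \<otimes>\<^bsub>T\<^esub> (\<Otimes>\<^bsub>T\<^esub>j\<in>{..<d} - {i}. ?g (add_mset i k) j)"
    unfolding xip_eq using i g by (subst d, subst T.finprod_insert) auto
  also have "(\<Otimes>\<^bsub>T\<^esub>j\<in>{..<d} - {i}. ?g (add_mset i k) j) = (\<Otimes>\<^bsub>T\<^esub>j\<in>{..<d} - {i}. ?g k j)"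
    using i g by (intro T.finprod_cong') auto
  also have "?g (add_mset i k) i = fac i (count k i) \<otimes>\<^bsub>T\<^esub> ?g k i"
    using i by (simp add: lessThan_Suc Pi_def)
  finally have "xip (add_mset i k) = fac i (count k i) \<otimes>\<^bsub>T\<^esub> (?g k i \<otimes>\<^bsub>T\<^esub> (\<Otimes>\<^bsub>T\<^esub>j\<in>{..<d} - {i}. ?g k j))"
    using i g by (simp add: T.m_assoc Pi_def)
  also have "?g k i \<otimes>\<^bsub>T\<^esub> (\<Otimes>\<^bsub>T\<^esub>j\<in>{..<d} - {i}. ?g k j) = xip k"
    unfolding xip_eq using i g by (subst (4) d, subst T.finprod_insert) auto
  finally show ?thesis .
qed

lemma stirling_closed [simp]: "i < d \<Longrightarrow> stirling (shift i) a b \<in> carrier A"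
  by (induction a arbitrary: b) auto

text \<open>The coefficient of \<xi>^(k) in the monomial \<xi>^m. Different variables do not
  interact, hence a product of one-variable coefficients.\<close>

definition wt :: "nat multiset \<Rightarrow> nat multiset \<Rightarrow> 'a" where
  "wt k m = (\<Otimes>i\<in>{..<d}. stirling (shift i) (count m i) (count k i))"

lemma wt_closed [simp]: "wt k m \<in> carrier A"
  unfolding wt_def by (intro finprod_closed) auto

text \<open>The recursion of \<open>stirling\<close> in the factor of the variable \<open>i\<close>.
  It mirrors \<xi>_i \<xi>^(k) = \<xi>^(k+e_i) - y \<xi>^(k), where y is the shift of index
  k_i.\<close>

lemma wt_add:
  assumes i: "i < d"
  shows "wt k (add_mset i m) = (if i \<in># k then wt (k - {#i#}) m else \<zero>) \<ominus> shift i (count k i) \<otimes> wt k m"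
proof -
  let ?g = "\<lambda>k m j. stirling (shift j) (count m j) (count k j)"
  have d: "{..<d} = insert i ({..<d} - {i})" using i by auto
  \<comment> \<open>The contribution of the variables other than \<open>i\<close>, common to all
    terms of the identity.\<close>
  define r where "r = (\<Otimes>j\<in>{..<d} - {i}. ?g k m j)"
  have r: "r \<in> carrier A" unfolding r_def by (intro finprod_closed) auto
  have split: "wt k' m' = ?g k' m' i \<otimes> r" if "\<And>j. j \<noteq> i \<Longrightarrow> count k' j = count k j"
    "\<And>j. j \<noteq> i \<Longrightarrow> count m' j = count m j" for k' m'
  proof -
    have "wt k' m' = ?g k' m' i \<otimes> (\<Otimes>j\<in>{..<d} - {i}. ?g k' m' j)"
      unfolding wt_def using i by (subst d, subst finprod_insert) auto
    also have "(\<Otimes>j\<in>{..<d} - {i}. ?g k' m' j) = r"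
      unfolding r_def using that by (intro finprod_cong') auto
    finally show ?thesis .
  qed
  show ?thesis
  proof (cases "i \<in># k")
    case True
    then have k: "count k i \<noteq> 0" by simp
    have "wt k (add_mset i m) = ?g k (add_mset i m) i \<otimes> r" "wt (k - {#i#}) m = ?g (k - {#i#}) m i \<otimes> r"
      "wt k m = ?g k m i \<otimes> r" by (rule split; simp)+
    then show ?thesis using True k i r
      by (simp add: a_minus_def l_distr l_minus m_assoc)
  next
    case False
    then have k: "count k i = 0" by (simp add: not_in_iff)
    have "wt k (add_mset i m) = ?g k (add_mset i m) i \<otimes> r" 
      "wt k m = ?g k m i \<otimes> r" by (rule split; simp)+
    then show ?thesis using False k i r by (simp add: a_minus_def)
  qed
qed

lemma wt_empty: "set_mset k \<subseteq> {..<d} \<Longrightarrow> wt k {#} = (if k = {#} then \<one> else \<zero>)"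
proof (cases "k = {#}")
  case True
  then show ?thesis unfolding wt_def by (simp add: finprod_one_eqI)
next
  case False
  assume k: "set_mset k \<subseteq> {..<d}"
  then obtain i where i: "i \<in># k" "i < d" using False multiset_nonemptyE[of k] by blast
  have d: "{..<d} = insert i ({..<d} - {i})" using i by auto
  have "wt k {#} = \<zero>"
    unfolding wt_def using i by (subst d, subst finprod_insert) (auto simp: count_eq_zero_iff)
  then show ?thesis using False by simp
qed

text \<open>The coordinate at \<xi>^(k) of a polynomial, each monomial being rewritten in twisted
  powers; duality with the twisted powers is \<open>tco_xip\<close>.\<close>

definition tco :: "nat multiset \<Rightarrow> (nat, 'a) mpoly \<Rightarrow> 'a" where
  "tco k p = (\<Oplus>m\<in>{m. p m \<noteq> \<zero>}. p m \<otimes> wt k m)"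

lemma tco_ext:
  assumes "p \<in> carrier S" "finite F" "{m. p m \<noteq> \<zero>} \<subseteq> F"
  shows "tco k p = (\<Oplus>m\<in>F. p m \<otimes> wt k m)"
  unfolding tco_def using assms by (intro add.finprod_mono_neutral_cong_left) auto

lemma tco_closed [simp]: "p \<in> carrier S \<Longrightarrow> tco k p \<in> carrier A"
  unfolding tco_def by (intro finsum_closed) auto

lemma tco_add:
  assumes p: "p \<in> carrier S" and r: "r \<in> carrier S"
  shows "tco k (p \<oplus>\<^bsub>S\<^esub> r) = tco k p \<oplus> tco k r"
proof -
  let ?F = "{m. p m \<noteq> \<zero>} \<union> {m. r m \<noteq> \<zero>}"
  have F: "finite ?F" using p r by (auto simp: carrier_S)
  have "{m. (p \<oplus>\<^bsub>S\<^esub> r) m \<noteq> \<zero>} \<subseteq> ?F" by (auto simp: add_S)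
  then have "tco k (p \<oplus>\<^bsub>S\<^esub> r) = (\<Oplus>m\<in>?F. (p m \<oplus> r m) \<otimes> wt k m)"
    using F p r by (subst tco_ext[of _ ?F]) (auto simp: add_S_closed, simp add: add_S)
  also have "\<dots> = (\<Oplus>m\<in>?F. p m \<otimes> wt k m \<oplus> r m \<otimes> wt k m)"
    using F p r by (intro finsum_cong') (auto simp: l_distr)
  also have "\<dots> = (\<Oplus>m\<in>?F. p m \<otimes> wt k m) \<oplus> (\<Oplus>m\<in>?F. r m \<otimes> wt k m)"
    using F p r by (intro finsum_addf) auto
  also have "\<dots> = tco k p \<oplus> tco k r"
    by (subst (1 2) tco_ext[of _ ?F]) (use F p r in auto)
  finally show ?thesis .
qed

lemma tco_zero [simp]: "tco k \<zero>\<^bsub>S\<^esub> = \<zero>"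
  by (simp add: tco_def zero_S)

lemma tco_mono:
  assumes "c \<in> carrier A" "set_mset m \<subseteq> {..<d}"
  shows "tco k (mp_monom A c m) = c \<otimes> wt k m"
proof -
  have "tco k (mp_monom A c m) = (\<Oplus>j\<in>{m}. mp_monom A c m j \<otimes> wt k j)"
    using assms by (intro tco_ext mono_closed) (auto simp: mp_monom_def split: if_splits)
  then show ?thesis using assms by (simp add: mp_monom_def)
qed

lemma tco_const_mult:
  assumes c: "c \<in> carrier A" and p: "p \<in> carrier S"
  shows "tco k (mpoly_const A c \<otimes>\<^bsub>S\<^esub> p) = c \<otimes> tco k p"
  using p
proof (induction rule: S_induct)
  case zero then show ?case using c by (simp add: zero_mult_S)
next
  case (add b m p)
  then show ?case using c
    by (simp add: mult_S_distr tco_add const_mono mono_mult_mono mono_mult_closed tco_mono m_assoc r_distr)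
qed

lemma tco_var_mult:
  assumes i: "i < d" and p: "p \<in> carrier S"
  shows "tco k (mpoly_var A i \<otimes>\<^bsub>S\<^esub> p) =
    (if i \<in># k then tco (k - {#i#}) p else \<zero>) \<ominus> shift i (count k i) \<otimes> tco k p"
  using p
proof (induction rule: S_induct)
  case zero then show ?case using i by (simp add: zero_mult_S a_minus_def)
next
  case (add b m p)
  let ?y = "shift i (count k i)"
  have "tco k (mpoly_var A i \<otimes>\<^bsub>S\<^esub> mp_monom A b m) = b \<otimes> wt k (add_mset i m)"
    using add i by (simp add: var_mono mono_mult_mono tco_mono)
  also have "\<dots> = (if i \<in># k then b \<otimes> wt (k - {#i#}) m else \<zero>) \<ominus> ?y \<otimes> (b \<otimes> wt k m)"
    using add i by (simp add: wt_add a_minus_def r_distr r_minus m_lcomm)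
  finally show ?case using add i
    by (simp add: mult_S_distr tco_add mult_S_closed tco_mono a_minus_def r_distr minus_add a_ac)
qed

lemma tco_one: "set_mset k \<subseteq> {..<d} \<Longrightarrow> tco k \<one>\<^bsub>S\<^esub> = (if k = {#} then \<one> else \<zero>)"
  by (simp add: one_S tco_mono wt_empty)

text \<open>Expanding the last factor of \<xi>^(l+e_i) gives, besides the wanted term, the
  difference of the shifts of index l_i and k_i times the coordinate at k of \<xi>^(l). It vanishes:
  for k = l the shifts agree, otherwise the coordinate is zero by induction.\<close>

lemma tco_xip:
  assumes "set_mset l \<subseteq> {..<d}" "set_mset k \<subseteq> {..<d}"
  shows "tco k (xip l) = (if k = l then \<one> else \<zero>)"
  using assms
proof (induction l arbitrary: k)
  case empty
  then show ?case using tco_one by (simp add: xip_empty T_sel)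
next
  case (add i l)
  then have i: "i < d" by simp
  have xS: "xip l \<in> carrier S" using xip_closed[of l] by (simp only: T_sel)
  have "tco k (xip (add_mset i l)) =
    tco k (mpoly_var A i \<otimes>\<^bsub>S\<^esub> xip l) \<oplus> tco k (mpoly_const A (shift i (count l i)) \<otimes>\<^bsub>S\<^esub> xip l)"
    using i xS by (simp add: xip_add T_sel mult_S_distr tco_add mult_S_closed)
  also have "\<dots> = (if i \<in># k then tco (k - {#i#}) (xip l) else \<zero>) \<ominus> shift i (count k i) \<otimes> tco k (xip l)
      \<oplus> shift i (count l i) \<otimes> tco k (xip l)"
    using i xS by (simp add: tco_var_mult tco_const_mult)
  also have "\<dots> = (if i \<in># k then tco (k - {#i#}) (xip l) else \<zero>)"
  proof (cases "k = l")
    case True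
    then show ?thesis using i xS by (simp add: a_minus_def a_assoc l_neg)
  next
    case False
    then show ?thesis using add i xS by (simp add: a_minus_def)
  qed
  also have "\<dots> = (if k = add_mset i l then \<one> else \<zero>)"
  proof (cases "i \<in># k")
    case True
    then have "set_mset (k - {#i#}) \<subseteq> {..<d}" using add.prems by (auto dest: in_diffD)
    moreover have "k - {#i#} = l \<longleftrightarrow> k = add_mset i l" using True by auto
    ultimately show ?thesis using True add by simp
  qed auto
  finally show ?case .
qed

text \<open>The shift of index 0 is zero, so a twisted power of positive degree has no constant
  term. Hence the projection \<xi> \<mapsto> 0 is the coordinate at the empty index.\<close>

lemma tco_empty:
  assumes "p \<in> carrier S"
  shows "tco {#} p = p {#}"
  using assms
proof (induction rule: S_induct)
  case zero then show ?case by (simp add: zero_S tco_def)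
next
  case (add c m p)
  have "wt {#} m = (if m = {#} then \<one> else \<zero>)"
    using add(2) by (induction m) (auto simp: wt_empty wt_add a_minus_def)
  then show ?case using add by (simp add: tco_add tco_mono) (simp add: add_S mp_monom_def)
qed

end

section \<open>Freeness of the principal parts over A\<close>

locale principal_parts_ring = twisted_poly A d \<sigma> x
  for A :: "'a tring" (structure) and d :: nat and \<sigma> :: "nat \<Rightarrow> 'a \<Rightarrow> 'a" and x :: "nat \<Rightarrow> 'a" +
  fixes n :: nat
begin

abbreviation I where "I \<equiv> xi_ideal A d \<sigma> x n"
abbreviation P where "P \<equiv> principal_parts A d \<sigma> x n"
abbreviation cl where "cl \<equiv> pp_class A d \<sigma> x n"
abbreviation pc where "pc \<equiv> pp_const A d \<sigma> x n"
abbreviation px where "px \<equiv> pp_xi A d \<sigma> x n"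
abbreviation Xi where "Xi k \<equiv> cl (xip k)"

definition K :: "nat multiset set" where "K = {k. set_mset k \<subseteq> {..<d} \<and> size k \<le> n}"

lemma finite_K [simp]: "finite K"
proof (rule finite_subset)
  show "K \<subseteq> (\<Union>n\<le>n. multisets_of_size {..<d} n)" by (auto simp: multisets_of_size_def K_def)
qed auto

lemma ideal_I: "ideal I T"
  unfolding xi_ideal_def by (intro T.genideal_ideal) auto

sublocale I: ideal I T by (rule ideal_I)

sublocale P: cring P
  unfolding principal_parts_def
  by (rule cring_cong[OF I.quotient_is_cring[OF T.is_cring]]) (simp_all add: quotient_tring_sel)

lemma cl_hom: "cl \<in> ring_hom T P"
  using I.rcos_ring_hom
  by (simp add: ring_hom_def principal_parts_def quotient_tring_sel pp_class_def[abs_def])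

sublocale cl: ring_hom_cring T P cl
  by (rule ring_hom_cringI[OF T.is_cring P.is_cring cl_hom])

lemma carrier_P: "carrier P = cl ` carrier T"
  by (auto simp: principal_parts_def quotient_tring_sel FactRing_def A_RCOSETS_def' pp_class_def)

lemma pc_hom: "pc \<in> ring_hom A P"
  using ring_hom_trans[OF const_hom_T cl_hom] by (simp add: comp_def pp_const_def[abs_def])

sublocale pc: ring_hom_cring A P pc
  by (rule ring_hom_cringI[OF is_cring P.is_cring pc_hom])

lemma px_closed [simp]: "i < d \<Longrightarrow> px i \<in> carrier P"
  by (simp add: pp_xi_def)

lemma Xi_empty: "Xi {#} = \<one>\<^bsub>P\<^esub>"
  by (simp add: xip_empty)

lemma Xi_add: "i < d \<Longrightarrow> Xi (add_mset i k) = (px i \<oplus>\<^bsub>P\<^esub> pc (shift i (count k i))) \<otimes>\<^bsub>P\<^esub> Xi k"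
  by (simp add: xip_add pp_xi_def pp_const_def)

lemma Xi_single: "i < d \<Longrightarrow> Xi {#i#} = px i"
  using Xi_add[of i "{#}"] by (simp add: Xi_empty)

lemma px_Xi: "i < d \<Longrightarrow> px i \<otimes>\<^bsub>P\<^esub> Xi k = Xi (add_mset i k) \<ominus>\<^bsub>P\<^esub> pc (shift i (count k i)) \<otimes>\<^bsub>P\<^esub> Xi k"
  by (simp add: Xi_add P.l_distr a_minus_def P.a_assoc P.r_neg)

text \<open>The generators have degree exactly n + 1; a twisted power of higher degree is a multiple
  of one of them, since dropping an index drops a factor.\<close>

lemma xip_in_I:
  assumes "set_mset k \<subseteq> {..<d}" "size k > n"
  shows "xip k \<in> I"
  using assms
proof (induction k)
  case (add i k)
  show ?case
  proof (cases "size k = n")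
    case True
    have "xip (add_mset i k) \<in> {xip k |k. set_mset k \<subseteq> {..<d} \<and> size k = n + 1}"
      using True add.prems by (intro CollectI exI[of _ "add_mset i k"]) auto
    then show ?thesis unfolding xi_ideal_def
      using T.genideal_self[of "{xip k |k. set_mset k \<subseteq> {..<d} \<and> size k = n + 1}"] xip_closed by blast
  next
    case False
    then have "xip k \<in> I" using add by auto
    then show ?thesis using add.prems by (simp add: xip_add I.I_l_closed)
  qed
qed simp

lemma Xi_zero:
  assumes "set_mset k \<subseteq> {..<d}" "size k > n"
  shows "Xi k = \<zero>\<^bsub>P\<^esub>"
proof -
  have "Xi k = cl \<zero>\<^bsub>T\<^esub>"
    unfolding pp_class_def using xip_in_I[OF assms]
    by (metis I.a_rcos_const I.zero_closed)
  then show ?thesis by simp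
qed

lemma in_S: "p \<in> carrier T \<Longrightarrow> p \<in> carrier S"
  by (simp add: T_sel)

lemma tco_add': "p \<in> carrier T \<Longrightarrow> r \<in> carrier T \<Longrightarrow> tco k (p \<oplus>\<^bsub>T\<^esub> r) = tco k p \<oplus> tco k r"
  using tco_add by (simp add: T_sel)

lemma K_diff: "k \<in> K \<Longrightarrow> i \<in># k \<Longrightarrow> k - {#i#} \<in> K"
  by (auto simp: K_def size_Diff_singleton dest: in_diffD)

text \<open>A variable computes the new coordinate at k from the old ones at k and at k with one
  index removed, and \<open>K\<close> is closed under removing indices. So vanishing of all
  coordinates of degree at most n survives multiplication by constants and variables, hence by all
  polynomials.\<close>

lemma tco_ideal: "ideal {p \<in> carrier T. \<forall>k\<in>K. tco k p = \<zero>} T"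
proof -
  let ?J = "{p \<in> carrier T. \<forall>k\<in>K. tco k p = \<zero>}"
  have z: "tco k \<zero>\<^bsub>T\<^esub> = \<zero>" for k using tco_zero by (simp add: T_sel)
  have l: "r \<otimes>\<^bsub>T\<^esub> p \<in> ?J" if p: "p \<in> ?J" and r: "r \<in> carrier T" for p r
    using in_S[OF r]
  proof (induction rule: poly_induct)
    case (const c)
    then show ?case using p tco_const_mult[of c p] by (auto simp: T_sel mult_S_closed)
  next
    case (add r r')
    then have "r \<in> carrier T" "r' \<in> carrier T" by (simp_all add: T_sel)
    then show ?case using add p by (auto simp: T.l_distr tco_add' T_sel(4)[symmetric])
  next
    case (mult v r)
    have "r \<otimes>\<^bsub>T\<^esub> p \<in> carrier S" using mult by (auto simp: T_sel)
    have "mpoly_var A v \<otimes>\<^bsub>T\<^esub> r \<otimes>\<^bsub>T\<^esub> p = mpoly_var A v \<otimes>\<^bsub>T\<^esub> (r \<otimes>\<^bsub>T\<^esub> p)"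
      using mult p by (intro T.m_assoc) (auto simp: T_sel)
    moreover have "tco k (mpoly_var A v \<otimes>\<^bsub>T\<^esub> (r \<otimes>\<^bsub>T\<^esub> p)) = \<zero>" if "k \<in> K" for k
      using tco_var_mult[of v "r \<otimes>\<^bsub>T\<^esub> p" k] mult that K_diff[OF that]
      by (auto simp: T_sel a_minus_def)
    ultimately show ?case using mult p by (auto simp: T_sel(2)[symmetric] T_sel(1)[symmetric])
  qed
  have neg: "tco k (\<ominus>\<^bsub>T\<^esub> p) = \<zero>" if "p \<in> ?J" "k \<in> K" for p k
  proof -
    have "\<ominus>\<^bsub>T\<^esub> p = \<ominus>\<^bsub>T\<^esub> \<one>\<^bsub>T\<^esub> \<otimes>\<^bsub>T\<^esub> p" using that by (simp add: T.l_minus)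
    moreover have "\<dots> \<in> ?J" using that by (intro l) auto
    ultimately show ?thesis using that by simp
  qed
  show ?thesis
  proof (rule idealI)
    show "ring T" by (rule T.ring_axioms)
    show "subgroup ?J (add_monoid T)"
      by (rule T.add.subgroupI) (use z neg in \<open>auto simp: tco_add' a_inv_def[symmetric]\<close>)
    show "r \<otimes>\<^bsub>T\<^esub> p \<in> ?J" if "p \<in> ?J" "r \<in> carrier T" for p r using l that by blast
    show "p \<otimes>\<^bsub>T\<^esub> r \<in> ?J" if "p \<in> ?J" "r \<in> carrier T" for p r
      using l[OF that] that by (simp add: T.m_comm)
  qed
qed

text \<open>A generator of \<open>I\<close> has degree n + 1, so its coordinates in \<open>K\<close>
  are zero by \<open>tco_xip\<close>, and \<open>tco_ideal\<close> extends this to the whole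
  ideal.\<close>

lemma tco_I: "p \<in> I \<Longrightarrow> k \<in> K \<Longrightarrow> tco k p = \<zero>"
proof -
  have "I \<subseteq> {p \<in> carrier T. \<forall>k\<in>K. tco k p = \<zero>}"
    unfolding xi_ideal_def
    by (rule T.genideal_minimal[OF tco_ideal]) (auto simp: tco_xip K_def)
  then show "p \<in> I \<Longrightarrow> k \<in> K \<Longrightarrow> tco k p = \<zero>" by blast
qed

text \<open>The coordinate on the quotient. By \<open>tco_I\<close> the image of a class is a
  singleton.\<close>

definition cf :: "nat multiset \<Rightarrow> (nat, 'a) mpoly set \<Rightarrow> 'a" where
  "cf k X = the_elem (tco k ` X)"

lemma cl_mem: "p \<in> carrier T \<Longrightarrow> z \<in> cl p \<longleftrightarrow> (\<exists>i\<in>I. z = i \<oplus>\<^bsub>T\<^esub> p)"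
  by (auto simp: pp_class_def a_r_coset_def')

lemma cl_self: "p \<in> carrier T \<Longrightarrow> p \<in> cl p"
  unfolding pp_class_def by (rule I.a_rcos_self)

lemma cf_cl [simp]:
  assumes "p \<in> carrier T" "k \<in> K"
  shows "cf k (cl p) = tco k p"
proof -
  have "tco k ` cl p = {tco k p}"
  proof
    show "tco k ` cl p \<subseteq> {tco k p}"
      using assms tco_I in_S by (auto simp: cl_mem tco_add' I.a_Hcarr)
    show "{tco k p} \<subseteq> tco k ` cl p" using cl_self[OF assms(1)] by auto
  qed
  then show ?thesis by (simp add: cf_def)
qed

lemma cf_closed [simp]: "X \<in> carrier P \<Longrightarrow> k \<in> K \<Longrightarrow> cf k X \<in> carrier A"
  using in_S by (auto simp: carrier_P)

lemma cf_add:
  assumes "X \<in> carrier P" "Y \<in> carrier P" "k \<in> K"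
  shows "cf k (X \<oplus>\<^bsub>P\<^esub> Y) = cf k X \<oplus> cf k Y"
proof -
  obtain p r where "X = cl p" "Y = cl r" "p \<in> carrier T" "r \<in> carrier T"
    using assms by (auto simp: carrier_P)
  then show ?thesis using assms(3) by (simp add: tco_add' flip: cl.hom_add)
qed

lemma cf_const_mult:
  assumes "X \<in> carrier P" "a \<in> carrier A" "k \<in> K"
  shows "cf k (pc a \<otimes>\<^bsub>P\<^esub> X) = a \<otimes> cf k X"
proof -
  obtain p where p: "X = cl p" "p \<in> carrier T" using assms by (auto simp: carrier_P)
  then have "cf k (pc a \<otimes>\<^bsub>P\<^esub> X) = tco k (mpoly_const A a \<otimes>\<^bsub>T\<^esub> p)"
    using assms by (simp add: pp_const_def flip: cl.hom_mult)
  then show ?thesis using assms p tco_const_mult[of a p k] by (simp add: T_sel)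
qed

lemma cf_zero [simp]: "k \<in> K \<Longrightarrow> cf k \<zero>\<^bsub>P\<^esub> = \<zero>"
  by (metis T_sel(5) T.zero_closed cf_cl cl.hom_zero tco_zero)

lemma cf_Xi: "k \<in> K \<Longrightarrow> set_mset l \<subseteq> {..<d} \<Longrightarrow> cf k (Xi l) = (if k = l then \<one> else \<zero>)"
  by (simp add: tco_xip K_def)

lemma empty_K [simp]: "{#} \<in> K" by (simp add: K_def)

lemma pp_proj_cf:
  assumes "X \<in> carrier P"
  shows "pp_proj X = cf {#} X"
proof -
  obtain p where p: "X = cl p" "p \<in> carrier T" using assms by (auto simp: carrier_P)
  have "z \<in> carrier T" if "z \<in> X" for z
    using that p by (auto simp: cl_mem I.a_Hcarr)
  then have "(\<lambda>p. p {#}) ` X = tco {#} ` X"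
    using tco_empty in_S by (intro image_cong) auto
  then show ?thesis by (simp add: pp_proj_def cf_def)
qed

lemma cf_sum:
  assumes "finite F" "\<And>j. j \<in> F \<Longrightarrow> f j \<in> carrier P" "k \<in> K"
  shows "cf k (\<Oplus>\<^bsub>P\<^esub>j\<in>F. f j) = (\<Oplus>j\<in>F. cf k (f j))"
  using assms(1,2)
proof (induction F rule: finite_induct)
  case empty then show ?case using assms(3) by simp
next
  case (insert j F)
  then show ?case using assms(3) by (simp add: cf_add Pi_def)
qed

text \<open>The additive span of the a \<xi>^(k) with k in \<open>K\<close>, as an inductive set, so
  that \<open>pp_induct\<close> comes for free once everything is shown to lie in it.\<close>

inductive_set span where
  basis: "a \<in> carrier A \<Longrightarrow> k \<in> K \<Longrightarrow> pc a \<otimes>\<^bsub>P\<^esub> Xi k \<in> span"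
| add: "X \<in> span \<Longrightarrow> Y \<in> span \<Longrightarrow> X \<oplus>\<^bsub>P\<^esub> Y \<in> span"

lemma span_closed: "X \<in> span \<Longrightarrow> X \<in> carrier P"
  by (induction rule: span.induct) auto

lemma span_basis: "a \<in> carrier A \<Longrightarrow> set_mset k \<subseteq> {..<d} \<Longrightarrow> pc a \<otimes>\<^bsub>P\<^esub> Xi k \<in> span"
proof (cases "size k \<le> n")
  case False
  assume a: "a \<in> carrier A" "set_mset k \<subseteq> {..<d}"
  \<comment> \<open>A twisted power of degree above n is zero; it is exhibited in the span as the
    basis element at the empty index with coefficient zero.\<close>
  then have "pc a \<otimes>\<^bsub>P\<^esub> Xi k = pc \<zero> \<otimes>\<^bsub>P\<^esub> Xi {#}" using False by (simp add: Xi_zero)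
  then show ?thesis using span.basis[of \<zero> "{#}"] by simp
qed (auto intro: span.basis simp: K_def)

lemma span_px: "X \<in> span \<Longrightarrow> i < d \<Longrightarrow> px i \<otimes>\<^bsub>P\<^esub> X \<in> span"
proof (induction rule: span.induct)
  case (basis a k)
  have "px i \<otimes>\<^bsub>P\<^esub> (pc a \<otimes>\<^bsub>P\<^esub> Xi k) = pc a \<otimes>\<^bsub>P\<^esub> (px i \<otimes>\<^bsub>P\<^esub> Xi k)"
    using basis by (simp add: P.m_lcomm)
  also have "\<dots> = pc a \<otimes>\<^bsub>P\<^esub> Xi (add_mset i k) \<oplus>\<^bsub>P\<^esub> pc (\<ominus> (a \<otimes> shift i (count k i))) \<otimes>\<^bsub>P\<^esub> Xi k"
    using basis by (simp add: px_Xi a_minus_def P.r_distr P.r_minus P.l_minus P.m_assoc)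
  finally have eq: "px i \<otimes>\<^bsub>P\<^esub> (pc a \<otimes>\<^bsub>P\<^esub> Xi k) = \<dots>" .
  show ?case
    unfolding eq by (intro span.add span_basis) (use basis in \<open>auto simp: K_def\<close>)
next
  case (add X Y)
  then show ?case by (auto simp: P.r_distr span_closed intro: span.add)
qed

text \<open>The span contains the constants and is stable under the \<xi>_i by
  \<open>span_px\<close>, and these generate the quotient.\<close>

lemma span_all: "X \<in> carrier P \<Longrightarrow> X \<in> span"
proof -
  assume "X \<in> carrier P"
  then obtain p where p: "X = cl p" "p \<in> carrier T" by (auto simp: carrier_P)
  have "cl p \<in> span" using in_S[OF p(2)]
  proof (induction rule: poly_induct)
    case (const c)
    have "cl (mpoly_const A c) = pc c \<otimes>\<^bsub>P\<^esub> Xi {#}" using const by (simp add: Xi_empty pp_const_def)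
    then show ?case using const span_basis[of c "{#}"] by simp
  next
    case (add p r)
    then have "cl (p \<oplus>\<^bsub>S\<^esub> r) = cl p \<oplus>\<^bsub>P\<^esub> cl r" using cl.hom_add[of p r] by (simp add: T_sel)
    then show ?case using add span.add by simp
  next
    case (mult i p)
    then have "cl (mpoly_var A i \<otimes>\<^bsub>S\<^esub> p) = px i \<otimes>\<^bsub>P\<^esub> cl p"
      using cl.hom_mult[of "mpoly_var A i" p] by (simp add: T_sel pp_xi_def)
    then show ?case using mult span_px by simp
  qed
  then show ?thesis using p by simp
qed

lemma pp_induct [consumes 1, case_names basis add]:
  assumes "X \<in> carrier P"
    and "\<And>a k. a \<in> carrier A \<Longrightarrow> k \<in> K \<Longrightarrow> Q (pc a \<otimes>\<^bsub>P\<^esub> Xi k)"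
    and "\<And>X Y. X \<in> carrier P \<Longrightarrow> Y \<in> carrier P \<Longrightarrow> Q X \<Longrightarrow> Q Y \<Longrightarrow> Q (X \<oplus>\<^bsub>P\<^esub> Y)"
  shows "Q X"
  using span_all[OF assms(1)] by (induction rule: span.induct) (use assms span_closed in auto)

text \<open>Both sides are additive; on a \<xi>^(l) the coordinates are a at l and zero
  elsewhere.\<close>

lemma pp_expand:
  assumes "X \<in> carrier P"
  shows "X = (\<Oplus>\<^bsub>P\<^esub>k\<in>K. pc (cf k X) \<otimes>\<^bsub>P\<^esub> Xi k)"
  using assms
proof (induction rule: pp_induct)
  case (basis a l)
  have "(\<Oplus>\<^bsub>P\<^esub>k\<in>K. pc (cf k (pc a \<otimes>\<^bsub>P\<^esub> Xi l)) \<otimes>\<^bsub>P\<^esub> Xi k) = (\<Oplus>\<^bsub>P\<^esub>k\<in>K. if l = k then pc a \<otimes>\<^bsub>P\<^esub> Xi k else \<zero>\<^bsub>P\<^esub>)"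
    using basis by (intro P.finsum_cong') (auto simp: cf_const_mult cf_Xi K_def simp del: cf_cl)
  then show ?case using basis P.finsum_singleton[of l K "\<lambda>k. pc a \<otimes>\<^bsub>P\<^esub> Xi k"] by simp
next
  case (add X Y)
  have "(\<Oplus>\<^bsub>P\<^esub>k\<in>K. pc (cf k (X \<oplus>\<^bsub>P\<^esub> Y)) \<otimes>\<^bsub>P\<^esub> Xi k) =
    (\<Oplus>\<^bsub>P\<^esub>k\<in>K. pc (cf k X) \<otimes>\<^bsub>P\<^esub> Xi k \<oplus>\<^bsub>P\<^esub> pc (cf k Y) \<otimes>\<^bsub>P\<^esub> Xi k)"
    using add by (intro P.finsum_cong') (auto simp: cf_add P.l_distr)
  also have "\<dots> = (\<Oplus>\<^bsub>P\<^esub>k\<in>K. pc (cf k X) \<otimes>\<^bsub>P\<^esub> Xi k) \<oplus>\<^bsub>P\<^esub> (\<Oplus>\<^bsub>P\<^esub>k\<in>K. pc (cf k Y) \<otimes>\<^bsub>P\<^esub> Xi k)"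
    using add by (intro P.finsum_addf) auto
  finally show ?case using add by simp
qed

end

section \<open>Tensor products\<close>

lemma UN_const_image: "X \<noteq> {} \<Longrightarrow> (\<And>z. z \<in> X \<Longrightarrow> f z = c) \<Longrightarrow> (\<Union>z\<in>X. f z) = c"
  by auto

lemma keys_frag_extendI:
  "(\<And>p. p \<in> Poly_Mapping.keys c \<Longrightarrow> Poly_Mapping.keys (f p) \<subseteq> S) \<Longrightarrow> Poly_Mapping.keys (frag_extend f c) \<subseteq> S"
  by (rule order_trans[OF keys_frag_extend]) (rule UN_least)

lemma (in abelian_group) eq_if_minus_zero:
  assumes "u \<in> carrier G" "v \<in> carrier G" "u \<ominus> v = \<zero>"
  shows "u = v"
proof -
  have "u = (u \<ominus> v) \<oplus> v" using assms(1,2) by (simp add: a_minus_def a_assoc l_neg)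
  then show ?thesis using assms by simp
qed

lemma (in abelian_group) eq_add_if_minus_minus_zero:
  assumes "u \<in> carrier G" "v \<in> carrier G" "w \<in> carrier G" "u \<ominus> v \<ominus> w = \<zero>"
  shows "u = v \<oplus> w"
proof -
  have "u \<ominus> v = w" using assms by (rule_tac eq_if_minus_zero) auto
  then have "v \<oplus> w = v \<oplus> (u \<ominus> v)" by simp
  also have "\<dots> = (u \<ominus> v) \<oplus> v" using assms(1,2) by (intro a_comm) auto
  also have "\<dots> = u" using assms(1,2) by (simp add: a_minus_def a_assoc l_neg)
  finally show ?thesis by simp
qed

text \<open>Abelian groups with closed scalar operations: general enough for M \<otimes> \<Omega>, M
  \<otimes> P_1, M \<otimes> \<Omega>^2 and for the product whose left factor carries the Taylor
  structure.\<close>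

locale tensor_pair = M: abelian_group M + N: abelian_group N
  for A :: "('a, 'z) ring_scheme" and M :: "('a, 'm, 'y) module_scheme"
    and N :: "('a, 'n, 'w) module_scheme" +
  assumes smult_M: "a \<in> carrier A \<Longrightarrow> m \<in> carrier M \<Longrightarrow> a \<odot>\<^bsub>M\<^esub> m \<in> carrier M"
    and smult_N: "a \<in> carrier A \<Longrightarrow> n \<in> carrier N \<Longrightarrow> a \<odot>\<^bsub>N\<^esub> n \<in> carrier N"
begin

abbreviation G where "G \<equiv> free_Abelian_group (carrier M \<times> carrier N)"
abbreviation T where "T \<equiv> tensor A M N"
abbreviation cl where "cl \<equiv> tensor_class A M N"
abbreviation el where "el \<equiv> tensor_elt A M N"
abbreviation Nul where "Nul \<equiv> tensor_null A M N"

definition rels :: "('m \<times> 'n \<Rightarrow>\<^sub>0 int) set" where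
  "rels = {frag_of (m \<oplus>\<^bsub>M\<^esub> m', n) - frag_of (m, n) - frag_of (m', n) | m m' n.
         m \<in> carrier M \<and> m' \<in> carrier M \<and> n \<in> carrier N} \<union>
      {frag_of (m, n \<oplus>\<^bsub>N\<^esub> n') - frag_of (m, n) - frag_of (m, n') | m n n'.
         m \<in> carrier M \<and> n \<in> carrier N \<and> n' \<in> carrier N} \<union>
      {frag_of (a \<odot>\<^bsub>M\<^esub> m, n) - frag_of (m, a \<odot>\<^bsub>N\<^esub> n) | a m n.
         a \<in> carrier A \<and> m \<in> carrier M \<and> n \<in> carrier N}"

lemma Nul_eq: "Nul = generate G rels"
  by (simp add: tensor_null_def rels_def)

lemma keys_diffI: "Poly_Mapping.keys u \<subseteq> S \<Longrightarrow> Poly_Mapping.keys v \<subseteq> S \<Longrightarrow> Poly_Mapping.keys (u - v) \<subseteq> S"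
  using keys_diff[of u v] by blast

lemma keys_addI: "Poly_Mapping.keys u \<subseteq> S \<Longrightarrow> Poly_Mapping.keys v \<subseteq> S \<Longrightarrow> Poly_Mapping.keys (u + v) \<subseteq> S"
  using keys_add[of u v] by blast

lemma rels_carrier: "rels \<subseteq> carrier G"
proof
  fix z assume "z \<in> rels"
  then show "z \<in> carrier G" unfolding rels_def
    by (elim UnE CollectE exE conjE) (simp_all add: keys_diffI smult_M smult_N)
qed

interpretation G: comm_group G by (rule abelian_free_Abelian_group)

lemma subgroup_Nul: "subgroup Nul G"
  unfolding Nul_eq by (rule G.generate_is_subgroup[OF rels_carrier])

lemma normal_Nul: "Nul \<lhd> G"
  by (rule G.subgroup_imp_normal[OF subgroup_Nul])

interpretation Nul: normal Nul G by (rule normal_Nul)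

lemma T_sel:
  "carrier T = cl ` carrier G"
  "ring.add T = set_mult G"
  "ring.zero T = Nul"
  "\<one>\<^bsub>T\<^esub> = el \<one>\<^bsub>M\<^esub> \<one>\<^bsub>N\<^esub>"
  "a \<odot>\<^bsub>T\<^esub> X = tensor_map A M N (\<lambda>m. a \<odot>\<^bsub>M\<^esub> m) (\<lambda>n. n) X"
  by (simp_all add: tensor_def Let_def carrier_FactGroup tensor_class_def[abs_def])

lemma cl_def': "cl z = Nul #>\<^bsub>G\<^esub> z"
  by (simp add: tensor_class_def)

lemma T_FactGroup:
  "carrier T = carrier (G Mod Nul)" "ring.add T = monoid.mult (G Mod Nul)"
  "ring.zero T = \<one>\<^bsub>G Mod Nul\<^esub>"
  by (simp_all add: tensor_def Let_def)

lemma abelian_group_T: "abelian_group T"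
proof -
  interpret Q: comm_group "G Mod Nul" by (rule G.abelian_FactGroup[OF subgroup_Nul])
  show ?thesis
    by (rule abelian_groupI; unfold T_FactGroup; (rule Q.m_closed Q.one_closed Q.m_assoc Q.m_comm Q.l_one Q.l_inv_ex; assumption)?)
qed

sublocale T: abelian_group T by (rule abelian_group_T)

lemma cl_closed [simp]: "Poly_Mapping.keys z \<subseteq> carrier M \<times> carrier N \<Longrightarrow> cl z \<in> carrier T"
  by (simp add: T_sel)

lemma cl_add:
  "Poly_Mapping.keys z \<subseteq> carrier M \<times> carrier N \<Longrightarrow> Poly_Mapping.keys w \<subseteq> carrier M \<times> carrier N
    \<Longrightarrow> cl (z + w) = cl z \<oplus>\<^bsub>T\<^esub> cl w"
  using Nul.rcos_sum[of z w] by (simp add: T_sel cl_def')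

lemma cl_zero: "cl 0 = \<zero>\<^bsub>T\<^esub>"
  using G.coset_mult_one[OF Nul.subset] by (simp add: T_sel cl_def')

lemma cl_minus: "Poly_Mapping.keys z \<subseteq> carrier M \<times> carrier N \<Longrightarrow> cl (- z) = \<ominus>\<^bsub>T\<^esub> cl z"
  using cl_add[of "- z" z] cl_zero by (intro T.minus_equality[symmetric]) simp_all

lemma cl_diff:
  "Poly_Mapping.keys z \<subseteq> carrier M \<times> carrier N \<Longrightarrow> Poly_Mapping.keys w \<subseteq> carrier M \<times> carrier N
    \<Longrightarrow> cl (z - w) = cl z \<ominus>\<^bsub>T\<^esub> cl w"
  using cl_add[of z "- w"] cl_minus[of w] by (simp add: a_minus_def)

lemma cl_rel: "z \<in> rels \<Longrightarrow> cl z = \<zero>\<^bsub>T\<^esub>"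
  using G.coset_join2[OF _ subgroup_Nul, of z] rels_carrier generate.incl[of z rels G]
  by (auto simp: T_sel cl_def' Nul_eq)

lemma el_def': "el m n = cl (frag_of (m, n))"
  by (simp add: tensor_elt_def)

lemma el_closed [simp]: "m \<in> carrier M \<Longrightarrow> n \<in> carrier N \<Longrightarrow> el m n \<in> carrier T"
  by (simp add: el_def')

lemma el_add1:
  assumes "m \<in> carrier M" "m' \<in> carrier M" "n \<in> carrier N"
  shows "el (m \<oplus>\<^bsub>M\<^esub> m') n = el m n \<oplus>\<^bsub>T\<^esub> el m' n"
proof -
  have "frag_of (m \<oplus>\<^bsub>M\<^esub> m', n) - frag_of (m, n) - frag_of (m', n) \<in> rels"
    unfolding rels_def using assms by blast
  then have "cl (frag_of (m \<oplus>\<^bsub>M\<^esub> m', n) - frag_of (m, n) - frag_of (m', n)) = \<zero>\<^bsub>T\<^esub>" by (rule cl_rel)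
  moreover have "cl (frag_of (m \<oplus>\<^bsub>M\<^esub> m', n) - frag_of (m, n) - frag_of (m', n)) = el (m \<oplus>\<^bsub>M\<^esub> m') n \<ominus>\<^bsub>T\<^esub> el m n \<ominus>\<^bsub>T\<^esub> el m' n"
    using assms by (simp add: el_def' cl_diff keys_diffI)
  ultimately show ?thesis using assms by (rule_tac T.eq_add_if_minus_minus_zero) auto
qed

lemma el_add2:
  assumes "m \<in> carrier M" "n \<in> carrier N" "n' \<in> carrier N"
  shows "el m (n \<oplus>\<^bsub>N\<^esub> n') = el m n \<oplus>\<^bsub>T\<^esub> el m n'"
proof -
  have "frag_of (m, n \<oplus>\<^bsub>N\<^esub> n') - frag_of (m, n) - frag_of (m, n') \<in> rels"
    unfolding rels_def using assms by blast
  then have "cl (frag_of (m, n \<oplus>\<^bsub>N\<^esub> n') - frag_of (m, n) - frag_of (m, n')) = \<zero>\<^bsub>T\<^esub>" by (rule cl_rel)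
  moreover have "cl (frag_of (m, n \<oplus>\<^bsub>N\<^esub> n') - frag_of (m, n) - frag_of (m, n')) = el m (n \<oplus>\<^bsub>N\<^esub> n') \<ominus>\<^bsub>T\<^esub> el m n \<ominus>\<^bsub>T\<^esub> el m n'"
    using assms by (simp add: el_def' cl_diff keys_diffI)
  ultimately show ?thesis using assms by (rule_tac T.eq_add_if_minus_minus_zero) auto
qed

lemma el_balanced:
  assumes "a \<in> carrier A" "m \<in> carrier M" "n \<in> carrier N"
  shows "el (a \<odot>\<^bsub>M\<^esub> m) n = el m (a \<odot>\<^bsub>N\<^esub> n)"
proof -
  have "frag_of (a \<odot>\<^bsub>M\<^esub> m, n) - frag_of (m, a \<odot>\<^bsub>N\<^esub> n) \<in> rels"
    unfolding rels_def using assms by blast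
  then have "cl (frag_of (a \<odot>\<^bsub>M\<^esub> m, n) - frag_of (m, a \<odot>\<^bsub>N\<^esub> n)) = \<zero>\<^bsub>T\<^esub>" by (rule cl_rel)
  moreover have "cl (frag_of (a \<odot>\<^bsub>M\<^esub> m, n) - frag_of (m, a \<odot>\<^bsub>N\<^esub> n)) = el (a \<odot>\<^bsub>M\<^esub> m) n \<ominus>\<^bsub>T\<^esub> el m (a \<odot>\<^bsub>N\<^esub> n)"
    using assms by (simp add: el_def' cl_diff smult_M smult_N)
  ultimately show ?thesis using assms by (rule_tac T.eq_if_minus_zero) (simp_all add: smult_M smult_N)
qed

lemma el_zero1 [simp]: "n \<in> carrier N \<Longrightarrow> el \<zero>\<^bsub>M\<^esub> n = \<zero>\<^bsub>T\<^esub>"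
  using el_add1[of "\<zero>\<^bsub>M\<^esub>" "\<zero>\<^bsub>M\<^esub>" n] T.add.r_cancel_one'[of "el \<zero>\<^bsub>M\<^esub> n" "el \<zero>\<^bsub>M\<^esub> n"] by simp

lemma el_zero2 [simp]: "m \<in> carrier M \<Longrightarrow> el m \<zero>\<^bsub>N\<^esub> = \<zero>\<^bsub>T\<^esub>"
  using el_add2[of m "\<zero>\<^bsub>N\<^esub>" "\<zero>\<^bsub>N\<^esub>"] T.add.r_cancel_one'[of "el m \<zero>\<^bsub>N\<^esub>" "el m \<zero>\<^bsub>N\<^esub>"] by simp

lemma el_minus1: "m \<in> carrier M \<Longrightarrow> n \<in> carrier N \<Longrightarrow> el (\<ominus>\<^bsub>M\<^esub> m) n = \<ominus>\<^bsub>T\<^esub> el m n"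
  using el_add1[of "\<ominus>\<^bsub>M\<^esub> m" m n] by (intro T.minus_equality[symmetric]) (simp_all add: M.l_neg)

text \<open>No case for negatives arises because -(m \<otimes> n) = (-m) \<otimes> n. The predicate
  is therefore carried through the free group for a representative and its negative at once.\<close>

lemma tensor_induct [consumes 1, case_names elt add]:
  assumes X: "X \<in> carrier T"
    and e: "\<And>m n. m \<in> carrier M \<Longrightarrow> n \<in> carrier N \<Longrightarrow> P (el m n)"
    and a: "\<And>X Y. X \<in> carrier T \<Longrightarrow> Y \<in> carrier T \<Longrightarrow> P X \<Longrightarrow> P Y \<Longrightarrow> P (X \<oplus>\<^bsub>T\<^esub> Y)"
  shows "P X"
proof -
  obtain z where z: "X = cl z" "Poly_Mapping.keys z \<subseteq> carrier M \<times> carrier N"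
    using X by (auto simp: T_sel)
  have "P (cl z) \<and> P (cl (- z))"
    using z(2)
  proof (rule free_Abelian_group_induct[where P = "\<lambda>z. P (cl z) \<and> P (cl (- z))"])
    show "P (cl 0) \<and> P (cl (- 0))" using e[of "\<zero>\<^bsub>M\<^esub>" "\<zero>\<^bsub>N\<^esub>"] by (simp add: cl_zero)
  next
    fix x y
    assume xy: "Poly_Mapping.keys x \<subseteq> carrier M \<times> carrier N" "Poly_Mapping.keys y \<subseteq> carrier M \<times> carrier N"
      and P: "P (cl x) \<and> P (cl (- x))" "P (cl y) \<and> P (cl (- y))"
    have "cl (x - y) = cl x \<oplus>\<^bsub>T\<^esub> cl (- y)" "cl (- (x - y)) = cl y \<oplus>\<^bsub>T\<^esub> cl (- x)"
      using cl_add[of x "- y"] cl_add[of y "- x"] xy by simp_all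
    then show "P (cl (x - y)) \<and> P (cl (- (x - y)))"
      using a[of "cl x" "cl (- y)"] a[of "cl y" "cl (- x)"] xy P by simp
  next
    fix p assume "p \<in> carrier M \<times> carrier N"
    then obtain m n where p: "p = (m, n)" "m \<in> carrier M" "n \<in> carrier N" by auto
    then have "cl (- frag_of p) = el (\<ominus>\<^bsub>M\<^esub> m) n" by (simp add: cl_minus el_minus1) (simp add: el_def')
    then show "P (cl (frag_of p)) \<and> P (cl (- frag_of p))" using e p by (simp add: el_def'[symmetric])
  qed
  then show ?thesis using z by simp
qed

text \<open>A homomorphism that kills the relators kills the subgroup they generate. The maps
  \<open>lift\<close> and \<open>tensor_map\<close> and the product of algebras are well defined for
  this reason.\<close>

lemma hom_const_on_class:
  assumes B: "abelian_group B" and h: "h \<in> hom G (add_monoid B)"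
    and r: "\<And>z. z \<in> rels \<Longrightarrow> h z = \<zero>\<^bsub>B\<^esub>"
    and z: "Poly_Mapping.keys z \<subseteq> carrier M \<times> carrier N" and z': "z' \<in> cl z"
  shows "h z' = h z"
proof -
  interpret B: abelian_group B by fact
  have gh: "group_hom G (add_monoid B) h"
    using h by (simp add: group_hom_def group_hom_axioms_def B.a_group)
  then interpret h: group_hom G "add_monoid B" h .
  have null: "h u = \<zero>\<^bsub>B\<^esub> \<and> u \<in> carrier G" if "u \<in> Nul" for u
    using that unfolding Nul_eq
  proof (induction rule: generate.induct)
    case one then show ?case using h.hom_one by simp
  next
    case (incl u) then show ?case using r rels_carrier by blast
  next
    case (inv u)
    then have "u \<in> carrier G" using rels_carrier by blast
    then show ?case using h.hom_inv[of u] r[OF inv] by (simp add: a_inv_def[symmetric] keys_minus)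
  next
    case (eng u v)
    then show ?case using h.hom_mult[of u v] by (simp add: keys_addI)
  qed
  obtain u where u: "u \<in> Nul" "z' = u + z" using z' by (auto simp: cl_def' r_coset_def)
  then show ?thesis using h.hom_mult[of u z] null[OF u(1)] z h.hom_closed[of z] by simp
qed

lemma cl_self: "Poly_Mapping.keys z \<subseteq> carrier M \<times> carrier N \<Longrightarrow> z \<in> cl z"
  using G.rcos_self[OF _ subgroup_Nul, of z] by (simp add: cl_def')

text \<open>The homomorphism attached to a bilinear map by the universal property; its values on
  elementary tensors determine it, so the choice is harmless.\<close>

definition lift :: "('c, 'u) ring_scheme \<Rightarrow> ('m \<Rightarrow> 'n \<Rightarrow> 'c) \<Rightarrow> ('m \<times> 'n \<Rightarrow>\<^sub>0 int) set \<Rightarrow> 'c" where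
  "lift B f = (SOME h. h \<in> hom (add_monoid T) (add_monoid B) \<and>
     (\<forall>m\<in>carrier M. \<forall>n\<in>carrier N. h (el m n) = f m n))"

definition bilinear :: "('c, 'u) ring_scheme \<Rightarrow> ('m \<Rightarrow> 'n \<Rightarrow> 'c) \<Rightarrow> bool" where
  "bilinear B f \<longleftrightarrow> 
    (\<forall>m\<in>carrier M. \<forall>n\<in>carrier N. f m n \<in> carrier B) \<and>
    (\<forall>m\<in>carrier M. \<forall>m'\<in>carrier M. \<forall>n\<in>carrier N. f (m \<oplus>\<^bsub>M\<^esub> m') n = f m n \<oplus>\<^bsub>B\<^esub> f m' n) \<and>
    (\<forall>m\<in>carrier M. \<forall>n\<in>carrier N. \<forall>n'\<in>carrier N. f m (n \<oplus>\<^bsub>N\<^esub> n') = f m n \<oplus>\<^bsub>B\<^esub> f m n') \<and>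
    (\<forall>a\<in>carrier A. \<forall>m\<in>carrier M. \<forall>n\<in>carrier N. f (a \<odot>\<^bsub>M\<^esub> m) n = f m (a \<odot>\<^bsub>N\<^esub> n))"

lemma bilinear_kills_rels:
  assumes B: "abelian_group B" and f: "bilinear B f" and h: "h \<in> hom G (add_monoid B)"
    and hf: "\<And>m n. m \<in> carrier M \<Longrightarrow> n \<in> carrier N \<Longrightarrow> h (frag_of (m, n)) = f m n"
    and z: "z \<in> rels"
  shows "h z = \<zero>\<^bsub>B\<^esub>"
proof -
  interpret B: abelian_group B by fact
  have gh: "group_hom G (add_monoid B) h"
    using h by (simp add: group_hom_def group_hom_axioms_def B.a_group)
  then interpret h: group_hom G "add_monoid B" h .
  have minus: "h (u - v) = h u \<ominus>\<^bsub>B\<^esub> h v" if "u \<in> carrier G" "v \<in> carrier G" for u v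
    using h.hom_mult[of u "- v"] h.hom_inv[of v] that
    by (simp add: a_minus_def a_inv_def[symmetric] keys_minus)
  have hc: "h u \<in> carrier B" if "u \<in> carrier G" for u using h.hom_closed[OF that] by simp
  show ?thesis using z unfolding rels_def
  proof (elim UnE CollectE exE conjE)
    fix m m' n assume *: "z = frag_of (m \<oplus>\<^bsub>M\<^esub> m', n) - frag_of (m, n) - frag_of (m', n)"
      "m \<in> carrier M" "m' \<in> carrier M" "n \<in> carrier N"
    have c: "f m n \<in> carrier B" "f m' n \<in> carrier B" using f * by (simp_all add: bilinear_def)
    have "h z = (f m n \<oplus>\<^bsub>B\<^esub> f m' n) \<ominus>\<^bsub>B\<^esub> f m n \<ominus>\<^bsub>B\<^esub> f m' n"
      using * f by (simp add: minus keys_diffI hf bilinear_def)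
    then show ?thesis using c
      by (simp add: a_minus_def B.a_ac B.r_neg1 B.r_neg B.r_neg2) 
  next
    fix m n n' assume *: "z = frag_of (m, n \<oplus>\<^bsub>N\<^esub> n') - frag_of (m, n) - frag_of (m, n')"
      "m \<in> carrier M" "n' \<in> carrier N" "n \<in> carrier N"
    have c: "f m n \<in> carrier B" "f m n' \<in> carrier B" using f * by (simp_all add: bilinear_def)
    have "h z = (f m n \<oplus>\<^bsub>B\<^esub> f m n') \<ominus>\<^bsub>B\<^esub> f m n \<ominus>\<^bsub>B\<^esub> f m n'"
      using * f by (simp add: minus keys_diffI hf bilinear_def)
    then show ?thesis using c
      by (simp add: a_minus_def B.a_ac B.r_neg1 B.r_neg B.r_neg2) 
  next
    fix a m n assume *: "z = frag_of (a \<odot>\<^bsub>M\<^esub> m, n) - frag_of (m, a \<odot>\<^bsub>N\<^esub> n)"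
      "a \<in> carrier A" "m \<in> carrier M" "n \<in> carrier N"
    have "h z = f (a \<odot>\<^bsub>M\<^esub> m) n \<ominus>\<^bsub>B\<^esub> f m (a \<odot>\<^bsub>N\<^esub> n)"
      using * by (simp add: minus hf smult_M smult_N)
    then show ?thesis using * f by (simp add: bilinear_def smult_N a_minus_def B.r_neg)
  qed
qed

text \<open>The universal property of the free abelian group, followed by that of the quotient,
  since a bilinear map kills the relators.\<close>

lemma lift_ex:
  assumes B: "abelian_group B" and f: "bilinear B f"
  shows "\<exists>h. h \<in> hom (add_monoid T) (add_monoid B) \<and> (\<forall>m\<in>carrier M. \<forall>n\<in>carrier N. h (el m n) = f m n)"
proof -
  interpret B: abelian_group B by fact
  have "(\<lambda>(m, n). f m n) ` (carrier M \<times> carrier N) \<subseteq> carrier (add_monoid B)"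
    using f by (auto simp: bilinear_def)
  then obtain h where h: "h \<in> hom G (add_monoid B)"
    "\<And>p. p \<in> carrier M \<times> carrier N \<Longrightarrow> h (frag_of p) = (\<lambda>(m, n). f m n) p"
    using comm_group.free_Abelian_group_universal[OF B.a_comm_group] by metis
  have hf: "h (frag_of (m, n)) = f m n" if "m \<in> carrier M" "n \<in> carrier N" for m n
    using h(2)[of "(m, n)"] that by simp
  note const = hom_const_on_class[OF B h(1) bilinear_kills_rels[OF B f h(1) hf]]
  have "h y = h z" if "y \<in> carrier G" "z \<in> carrier G" "Nul #>\<^bsub>G\<^esub> y = Nul #>\<^bsub>G\<^esub> z" for y z
    using const[of z y] cl_self[of y] that by (simp add: cl_def')
  then obtain g where g: "g \<in> hom (G Mod Nul) (add_monoid B)" "\<And>z. z \<in> carrier G \<Longrightarrow> g (Nul #>\<^bsub>G\<^esub> z) = h z"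
    using FactGroup_universal[OF h(1) normal_Nul] by metis
  have "g \<in> hom (add_monoid T) (add_monoid B)" using g(1) by (simp add: hom_def T_FactGroup)
  moreover have "g (el m n) = f m n" if "m \<in> carrier M" "n \<in> carrier N" for m n
    using g(2)[of "frag_of (m, n)"] hf that by (simp add: el_def' cl_def')
  ultimately show ?thesis by blast
qed

context
  fixes B :: "('c, 'u) ring_scheme" and f
  assumes B: "abelian_group B" and f: "bilinear B f"
begin

lemma lift_hom: "lift B f \<in> hom (add_monoid T) (add_monoid B)"
  and lift_el: "m \<in> carrier M \<Longrightarrow> n \<in> carrier N \<Longrightarrow> lift B f (el m n) = f m n"
  using someI_ex[OF lift_ex[OF B f]] by (simp_all add: lift_def)

lemma lift_closed: "X \<in> carrier T \<Longrightarrow> lift B f X \<in> carrier B"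
  using hom_in_carrier[OF lift_hom] by simp

lemma lift_add: "X \<in> carrier T \<Longrightarrow> Y \<in> carrier T \<Longrightarrow> lift B f (X \<oplus>\<^bsub>T\<^esub> Y) = lift B f X \<oplus>\<^bsub>B\<^esub> lift B f Y"
  using hom_mult[OF lift_hom] by simp

end

context
  fixes M' :: "('a, 'm2, 'y2) module_scheme" and N' :: "('a, 'n2, 'w2) module_scheme" and f g
  assumes pair': "tensor_pair A M' N'"
    and f: "\<And>m. m \<in> carrier M \<Longrightarrow> f m \<in> carrier M'"
      "\<And>m m'. m \<in> carrier M \<Longrightarrow> m' \<in> carrier M \<Longrightarrow> f (m \<oplus>\<^bsub>M\<^esub> m') = f m \<oplus>\<^bsub>M'\<^esub> f m'"
    and g: "\<And>n. n \<in> carrier N \<Longrightarrow> g n \<in> carrier N'"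
      "\<And>n n'. n \<in> carrier N \<Longrightarrow> n' \<in> carrier N \<Longrightarrow> g (n \<oplus>\<^bsub>N\<^esub> n') = g n \<oplus>\<^bsub>N'\<^esub> g n'"
    and fg: "\<And>a m n. a \<in> carrier A \<Longrightarrow> m \<in> carrier M \<Longrightarrow> n \<in> carrier N \<Longrightarrow>
      tensor_elt A M' N' (f (a \<odot>\<^bsub>M\<^esub> m)) (g n) = tensor_elt A M' N' (f m) (g (a \<odot>\<^bsub>N\<^esub> n))"
begin

interpretation T': tensor_pair A M' N' by (rule pair')

private abbreviation F where "F \<equiv> frag_extend (\<lambda>(m, n). frag_of (f m, g n))"

text \<open>Joint balancing of \<open>f\<close> and \<open>g\<close> takes the place of linearity of
  each. In this form it is checked for multiplication by \<Theta>(f) and for wedging with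
  dx_i.\<close>

lemma tensor_map_bilinear: "bilinear (tensor A M' N') (\<lambda>m n. T'.el (f m) (g n))"
  unfolding bilinear_def using f g fg by (simp add: T'.el_add1 T'.el_add2)

private lemma F_closed: "Poly_Mapping.keys z \<subseteq> carrier M \<times> carrier N \<Longrightarrow>
    Poly_Mapping.keys (F z) \<subseteq> carrier M' \<times> carrier N'"
  by (rule keys_frag_extendI) (drule (1) subsetD, auto simp: f(1) g(1))

lemma tensor_map_cl:
  assumes z: "Poly_Mapping.keys z \<subseteq> carrier M \<times> carrier N"
  shows "tensor_map A M' N' f g (cl z) = T'.cl (F z)"
proof -
  have h: "(\<lambda>z. T'.cl (F z)) \<in> hom G (add_monoid (tensor A M' N'))"
    using F_closed by (intro homI) (simp_all add: T'.cl_add frag_extend_add)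
  have "T'.cl (F z') = T'.cl (F z)" if "z' \<in> cl z" for z'
    by (rule hom_const_on_class[OF T'.abelian_group_T h _ z that],
        rule bilinear_kills_rels[OF T'.abelian_group_T tensor_map_bilinear h])
      (simp_all add: T'.el_def')
  moreover have "cl z \<noteq> {}" using cl_self[OF z] by blast
  ultimately show ?thesis unfolding tensor_map_def by (rule_tac UN_const_image)
qed

lemma tensor_map_el:
  "m \<in> carrier M \<Longrightarrow> n \<in> carrier N \<Longrightarrow> tensor_map A M' N' f g (el m n) = T'.el (f m) (g n)"
  by (simp add: el_def' tensor_map_cl T'.el_def')

lemma tensor_map_closed: "X \<in> carrier T \<Longrightarrow> tensor_map A M' N' f g X \<in> carrier (tensor A M' N')"
  using F_closed T'.cl_closed unfolding T_sel(1) by (elim imageE) (simp add: tensor_map_cl)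

lemma tensor_map_add:
  assumes "X \<in> carrier T" "Y \<in> carrier T"
  shows "tensor_map A M' N' f g (X \<oplus>\<^bsub>T\<^esub> Y) =
    tensor_map A M' N' f g X \<oplus>\<^bsub>tensor A M' N'\<^esub> tensor_map A M' N' f g Y"
proof -
  obtain z w where zw: "X = cl z" "Y = cl w" "Poly_Mapping.keys z \<subseteq> carrier M \<times> carrier N"
    "Poly_Mapping.keys w \<subseteq> carrier M \<times> carrier N"
    using assms unfolding T_sel(1) by (elim imageE) simp
  have "tensor_map A M' N' f g (cl (z + w)) = T'.cl (F z + F w)"
    using zw by (simp add: tensor_map_cl keys_addI frag_extend_add)
  then show ?thesis
    using zw by (simp add: tensor_map_cl cl_add T'.cl_add F_closed)
qed

end

end

lemma as_algebra_sel [simp]: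
  "carrier (as_algebra f B) = carrier B"
  "monoid.mult (as_algebra f B) = monoid.mult B"
  "monoid.one (as_algebra f B) = monoid.one B"
  "ring.zero (as_algebra f B) = ring.zero B"
  "ring.add (as_algebra f B) = ring.add B"
  "smult (as_algebra f B) = (\<lambda>a b. f a \<otimes>\<^bsub>B\<^esub> b)"
  by (simp_all add: as_algebra_def)

section \<open>The tensor product of two algebras as a ring\<close>

locale tensor_algebra = M: cring M + N: cring N
  for A :: "('a, 'z) ring_scheme" and M :: "('a, 'm, 'y) module_scheme"
    and N :: "('a, 'n, 'w) module_scheme" +
  assumes smult_M: "a \<in> carrier A \<Longrightarrow> m \<in> carrier M \<Longrightarrow> a \<odot>\<^bsub>M\<^esub> m \<in> carrier M"
    and smult_N: "a \<in> carrier A \<Longrightarrow> n \<in> carrier N \<Longrightarrow> a \<odot>\<^bsub>N\<^esub> n \<in> carrier N"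
    and smult_mult_M: "a \<in> carrier A \<Longrightarrow> m \<in> carrier M \<Longrightarrow> m' \<in> carrier M \<Longrightarrow>
      (a \<odot>\<^bsub>M\<^esub> m) \<otimes>\<^bsub>M\<^esub> m' = a \<odot>\<^bsub>M\<^esub> (m \<otimes>\<^bsub>M\<^esub> m')"
    and smult_mult_N: "a \<in> carrier A \<Longrightarrow> n \<in> carrier N \<Longrightarrow> n' \<in> carrier N \<Longrightarrow>
      (a \<odot>\<^bsub>N\<^esub> n) \<otimes>\<^bsub>N\<^esub> n' = a \<odot>\<^bsub>N\<^esub> (n \<otimes>\<^bsub>N\<^esub> n')"
begin

sublocale tensor_pair A M N
  by unfold_locales (auto simp: smult_M smult_N)

text \<open>The product on representatives in the free abelian group; the product in
  \<open>tensor\<close> is the union of its classes over all representatives.\<close>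

definition mu where
  "mu z w = frag_extend (\<lambda>(m, n). frag_extend (\<lambda>(m', n'). frag_of (m \<otimes>\<^bsub>M\<^esub> m', n \<otimes>\<^bsub>N\<^esub> n')) w) z"

lemma mu_closed:
  assumes "Poly_Mapping.keys z \<subseteq> carrier M \<times> carrier N" "Poly_Mapping.keys w \<subseteq> carrier M \<times> carrier N"
  shows "Poly_Mapping.keys (mu z w) \<subseteq> carrier M \<times> carrier N"
  unfolding mu_def
proof (rule keys_frag_extendI)
  fix p assume "p \<in> Poly_Mapping.keys z"
  then obtain m n where p: "p = (m, n)" "m \<in> carrier M" "n \<in> carrier N" using assms(1) by blast
  have "Poly_Mapping.keys (frag_extend (\<lambda>(m', n'). frag_of (m \<otimes>\<^bsub>M\<^esub> m', n \<otimes>\<^bsub>N\<^esub> n')) w) \<subseteq> carrier M \<times> carrier N"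
  proof (rule keys_frag_extendI)
    fix p' assume "p' \<in> Poly_Mapping.keys w"
    then obtain m' n' where "p' = (m', n')" "m' \<in> carrier M" "n' \<in> carrier N" using assms(2) by blast
    then show "Poly_Mapping.keys ((\<lambda>(m', n'). frag_of (m \<otimes>\<^bsub>M\<^esub> m', n \<otimes>\<^bsub>N\<^esub> n')) p') \<subseteq> carrier M \<times> carrier N"
      using p by simp
  qed
  then show "Poly_Mapping.keys ((\<lambda>(m, n). frag_extend (\<lambda>(m', n'). frag_of (m \<otimes>\<^bsub>M\<^esub> m', n \<otimes>\<^bsub>N\<^esub> n')) w) p)
      \<subseteq> carrier M \<times> carrier N"
    using p by simp
qed

lemma mu_add1: "mu (z + z') w = mu z w + mu z' w"
  by (simp add: mu_def frag_extend_add)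

lemma mu_diff2: "mu z (w - w') = mu z w - mu z w'"
  unfolding mu_def using subset_UNIV[of "Poly_Mapping.keys z"]
  by (induction z rule: frag_induction) (auto simp: frag_extend_diff)

lemma mu_of: "mu (frag_of (m, n)) (frag_of (m', n')) = frag_of (m \<otimes>\<^bsub>M\<^esub> m', n \<otimes>\<^bsub>N\<^esub> n')"
  by (simp add: mu_def)

lemma mu_comm:
  assumes z: "Poly_Mapping.keys z \<subseteq> carrier M \<times> carrier N" and w: "Poly_Mapping.keys w \<subseteq> carrier M \<times> carrier N"
  shows "mu z w = mu w z"
  using z
proof (rule free_Abelian_group_induct[where P = "\<lambda>z. mu z w = mu w z"])
  show "mu 0 w = mu w 0" using mu_diff2[of w 0 0] by (simp add: mu_def)
next
  fix u v assume "mu u w = mu w u" "mu v w = mu w v"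
  then show "mu (u - v) w = mu w (u - v)" 
    by (simp add: mu_diff2) (simp add: mu_def frag_extend_diff)
next
  fix p assume p: "p \<in> carrier M \<times> carrier N"
  show "mu (frag_of p) w = mu w (frag_of p)"
    using w
  proof (rule free_Abelian_group_induct[where P = "\<lambda>w. mu (frag_of p) w = mu w (frag_of p)"])
    show "mu (frag_of p) 0 = mu 0 (frag_of p)" using mu_diff2[of "frag_of p" 0 0] by (simp add: mu_def)
  next
    fix u v assume "mu (frag_of p) u = mu u (frag_of p)" "mu (frag_of p) v = mu v (frag_of p)"
    then show "mu (frag_of p) (u - v) = mu (u - v) (frag_of p)"
      by (simp add: mu_diff2) (simp add: mu_def frag_extend_diff)
  next
    fix p' assume "p' \<in> carrier M \<times> carrier N"
    then show "mu (frag_of p) (frag_of p') = mu (frag_of p') (frag_of p)"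
      using p by (auto simp: mu_of M.m_comm N.m_comm)
  qed
qed

lemma mu_hom:
  assumes w: "Poly_Mapping.keys w \<subseteq> carrier M \<times> carrier N"
  shows "(\<lambda>z. cl (mu z w)) \<in> hom G (add_monoid T)"
  using mu_closed[OF _ w] by (intro homI) (simp_all add: cl_add mu_add1)

text \<open>Induction on the fixed right argument reduces to a single generator, where
  distributivity in both factors and compatibility of scalars with products apply.\<close>

lemma mu_bilinear:
  assumes w: "Poly_Mapping.keys w \<subseteq> carrier M \<times> carrier N"
  shows "bilinear T (\<lambda>m n. cl (mu (frag_of (m, n)) w))"
proof -
  let ?Q = "\<lambda>w. \<forall>m\<in>carrier M. \<forall>n\<in>carrier N. 
      (\<forall>m'\<in>carrier M. cl (mu (frag_of (m \<oplus>\<^bsub>M\<^esub> m', n)) w) = cl (mu (frag_of (m, n)) w) \<oplus>\<^bsub>T\<^esub> cl (mu (frag_of (m', n)) w)) \<and>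
      (\<forall>n'\<in>carrier N. cl (mu (frag_of (m, n \<oplus>\<^bsub>N\<^esub> n')) w) = cl (mu (frag_of (m, n)) w) \<oplus>\<^bsub>T\<^esub> cl (mu (frag_of (m, n')) w)) \<and>
      (\<forall>a\<in>carrier A. cl (mu (frag_of (a \<odot>\<^bsub>M\<^esub> m, n)) w) = cl (mu (frag_of (m, a \<odot>\<^bsub>N\<^esub> n)) w))"
  have "?Q w"
    using w
  proof (rule free_Abelian_group_induct[where P = ?Q])
    have "mu z 0 = 0" for z using mu_diff2[of z 0 0] by simp
    then show "?Q 0" by (simp add: cl_zero)
  next
    fix u v assume uv: "Poly_Mapping.keys u \<subseteq> carrier M \<times> carrier N" "Poly_Mapping.keys v \<subseteq> carrier M \<times> carrier N"
      and Q: "?Q u" "?Q v"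
    have e: "cl (mu (frag_of (m, n)) (u - v)) = cl (mu (frag_of (m, n)) u) \<ominus>\<^bsub>T\<^esub> cl (mu (frag_of (m, n)) v)"
      if "m \<in> carrier M" "n \<in> carrier N" for m n
      using that uv by (simp add: mu_diff2 cl_diff mu_closed)
    have c: "cl (mu (frag_of (m, n)) u) \<in> carrier T" "cl (mu (frag_of (m, n)) v) \<in> carrier T"
      if "m \<in> carrier M" "n \<in> carrier N" for m n
      using that uv by (simp_all add: mu_closed)
    show "?Q (u - v)"
      using Q by (auto simp: e c smult_M smult_N a_minus_def T.minus_add T.a_ac)
  next
    fix p assume "p \<in> carrier M \<times> carrier N"
    then obtain m0 n0 where p: "p = (m0, n0)" "m0 \<in> carrier M" "n0 \<in> carrier N" by auto
    then show "?Q (frag_of p)"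
      by (auto simp: mu_of el_def'[symmetric] M.l_distr N.l_distr el_add1 el_add2 smult_mult_M smult_mult_N el_balanced)
  qed
  then show ?thesis unfolding bilinear_def using w by (simp add: mu_closed)
qed

lemma mu_const1:
  assumes w: "Poly_Mapping.keys w \<subseteq> carrier M \<times> carrier N" and z: "Poly_Mapping.keys z \<subseteq> carrier M \<times> carrier N"
    and z': "z' \<in> cl z"
  shows "cl (mu z' w) = cl (mu z w)"
  by (rule hom_const_on_class[OF abelian_group_T mu_hom[OF w] _ z z'],
      rule bilinear_kills_rels[OF abelian_group_T mu_bilinear[OF w] mu_hom[OF w]]) simp_all

lemma cl_subset:
  assumes "Poly_Mapping.keys z \<subseteq> carrier M \<times> carrier N" "z' \<in> cl z"
  shows "Poly_Mapping.keys z' \<subseteq> carrier M \<times> carrier N"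
proof -
  obtain u where u: "u \<in> Nul" "z' = u + z" using assms(2) by (auto simp: cl_def' r_coset_def)
  then have "Poly_Mapping.keys u \<subseteq> carrier M \<times> carrier N"
    using subgroup.mem_carrier[OF subgroup_Nul u(1)] by simp
  then show ?thesis using assms(1) u(2) by (simp add: keys_addI)
qed

text \<open>Independence of the left representative is \<open>mu_const1\<close>; commutativity of
  \<open>mu\<close> transfers it to the right one.\<close>

lemma mult_cl:
  assumes z: "Poly_Mapping.keys z \<subseteq> carrier M \<times> carrier N" and w: "Poly_Mapping.keys w \<subseteq> carrier M \<times> carrier N"
  shows "cl z \<otimes>\<^bsub>T\<^esub> cl w = cl (mu z w)"
proof -
  have "cl (mu z' w') = cl (mu z w)" if "z' \<in> cl z" "w' \<in> cl w" for z' w'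
  proof -
    note z' = cl_subset[OF z that(1)] and w' = cl_subset[OF w that(2)]
    have "cl (mu z' w') = cl (mu z w')" by (rule mu_const1[OF w' z that(1)])
    also have "\<dots> = cl (mu w' z)" using mu_comm[OF z w'] by simp
    also have "\<dots> = cl (mu w z)" by (rule mu_const1[OF z w that(2)])
    finally show ?thesis using mu_comm[OF z w] by simp
  qed
  then have "(\<Union>z'\<in>cl z. \<Union>w'\<in>cl w. cl (mu z' w')) = cl (mu z w)"
    using cl_self[OF z] cl_self[OF w] by (metis (no_types, lifting) UN_const_image empty_iff)
  then show ?thesis by (simp add: tensor_def Let_def mu_def)
qed

lemma mult_el:
  assumes "m \<in> carrier M" "n \<in> carrier N" "m' \<in> carrier M" "n' \<in> carrier N"
  shows "el m n \<otimes>\<^bsub>T\<^esub> el m' n' = el (m \<otimes>\<^bsub>M\<^esub> m') (n \<otimes>\<^bsub>N\<^esub> n')"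
  using assms by (simp add: el_def' mult_cl mu_of)

lemma cring_T: "cring T"
proof -
  have closed: "X \<otimes>\<^bsub>T\<^esub> Y \<in> carrier T" if "X \<in> carrier T" "Y \<in> carrier T" for X Y
    using that by (auto simp: T_sel(1)) (auto simp: mult_cl mu_closed intro!: imageI)
  have comm: "X \<otimes>\<^bsub>T\<^esub> Y = Y \<otimes>\<^bsub>T\<^esub> X" if "X \<in> carrier T" "Y \<in> carrier T" for X Y
    using that by (auto simp: T_sel(1) mult_cl mu_comm)
  have distr: "(X \<oplus>\<^bsub>T\<^esub> Y) \<otimes>\<^bsub>T\<^esub> Z = X \<otimes>\<^bsub>T\<^esub> Z \<oplus>\<^bsub>T\<^esub> Y \<otimes>\<^bsub>T\<^esub> Z"
    if XYZ: "X \<in> carrier T" "Y \<in> carrier T" "Z \<in> carrier T" for X Y Z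
  proof -
    obtain u v w where "X = cl u" "Y = cl v" "Z = cl w" "Poly_Mapping.keys u \<subseteq> carrier M \<times> carrier N"
      "Poly_Mapping.keys v \<subseteq> carrier M \<times> carrier N" "Poly_Mapping.keys w \<subseteq> carrier M \<times> carrier N"
      using XYZ by (auto simp: T_sel(1))
    then show ?thesis by (simp add: mult_cl mu_closed mu_add1 cl_add keys_addI flip: cl_add)
  qed
  have distr2: "Z \<otimes>\<^bsub>T\<^esub> (X \<oplus>\<^bsub>T\<^esub> Y) = Z \<otimes>\<^bsub>T\<^esub> X \<oplus>\<^bsub>T\<^esub> Z \<otimes>\<^bsub>T\<^esub> Y"
    if "X \<in> carrier T" "Y \<in> carrier T" "Z \<in> carrier T" for X Y Z
    using distr[OF that] comm that closed by simp
  have one: "\<one>\<^bsub>T\<^esub> \<otimes>\<^bsub>T\<^esub> X = X" if "X \<in> carrier T" for X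
    using that
  proof (induction rule: tensor_induct)
    case (elt m n) then show ?case by (simp add: T_sel(4) mult_el)
  next
    case (add X Y) then show ?case by (simp add: T_sel(4) distr2)
  qed
  have assoc: "(X \<otimes>\<^bsub>T\<^esub> Y) \<otimes>\<^bsub>T\<^esub> Z = X \<otimes>\<^bsub>T\<^esub> (Y \<otimes>\<^bsub>T\<^esub> Z)"
    if X: "X \<in> carrier T" and Y: "Y \<in> carrier T" and Z: "Z \<in> carrier T" for X Y Z
    using X
  proof (induction rule: tensor_induct)
    case (elt m n)
    note mn = elt
    show ?case using Y
    proof (induction rule: tensor_induct)
      case (elt m' n')
      note mn' = elt
      show ?case using Z
      proof (induction rule: tensor_induct)
        case (elt m'' n'')
        then show ?case using mn mn' by (simp add: mult_el M.m_assoc N.m_assoc)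
      next
        case (add X Y) then show ?case using mn mn' by (simp add: distr2 closed)
      qed
    next
      case (add X Y) then show ?case using mn Z by (simp add: distr2 distr closed)
    qed
  next
    case (add U V) then show ?case using Y Z by (simp add: distr closed)
  qed
  show ?thesis
  proof (rule cringI)
    show "comm_monoid T"
    proof (rule comm_monoidI)
      show "\<one>\<^bsub>T\<^esub> \<in> carrier T" by (simp add: T_sel(4))
      show "X \<otimes>\<^bsub>T\<^esub> Y = Y \<otimes>\<^bsub>T\<^esub> X" if "X \<in> carrier T" "Y \<in> carrier T" for X Y
        by (rule comm[OF that])
    qed (simp_all only: closed one assoc)
  qed (simp_all add: abelian_group_T distr)
qed

sublocale T: cring T by (rule cring_T)

end

section \<open>Taylor maps and symmetry\<close>

lemma (in ring_hom_cring) hom_nat_pow: "a \<in> carrier R \<Longrightarrow> h (a [^]\<^bsub>R\<^esub> (n::nat)) = h a [^]\<^bsub>S\<^esub> n"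
  by (induction n) simp_all

lemma (in abelian_group) add_minus_cancel_mid:
  "\<lbrakk>u \<in> carrier G; v \<in> carrier G; w \<in> carrier G\<rbrakk> \<Longrightarrow> v \<oplus> (u \<oplus> w) \<ominus> u = v \<oplus> w"
  by (simp add: a_minus_def a_assoc a_comm[of u w] r_neg)

text \<open>\<open>Q i\<close> is the image of q_i in A. That the Taylor maps treat it as a scalar
  is the trace that the base ring leaves here.\<close>

locale taylor = twisted_poly A d \<sigma> x
  for A :: "'a tring" (structure) and d :: nat and \<sigma> :: "nat \<Rightarrow> 'a \<Rightarrow> 'a" and x :: "nat \<Rightarrow> 'a" +
  fixes Q :: "nat \<Rightarrow> 'a" and \<Theta> :: "nat \<Rightarrow> 'a \<Rightarrow> (nat, 'a) mpoly set"
  assumes Q_closed [simp]: "i < d \<Longrightarrow> Q i \<in> carrier A"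
    and sigma_pow: "i < d \<Longrightarrow> (\<sigma> i ^^ j) (x i) = Q i [^] j \<otimes> x i"
    and Theta_hom: "\<Theta> n \<in> ring_hom A (principal_parts A d \<sigma> x n)"
    and Theta_Q: "i < d \<Longrightarrow> \<Theta> n (Q i) = pp_const A d \<sigma> x n (Q i)"
    and Theta_x: "i < d \<Longrightarrow> \<Theta> n (x i) =
        pp_const A d \<sigma> x n (x i) \<oplus>\<^bsub>principal_parts A d \<sigma> x n\<^esub> pp_xi A d \<sigma> x n i"
    and Theta_proj: "f \<in> carrier A \<Longrightarrow> pp_proj (\<Theta> n f) = f"
begin

definition Qn :: "nat \<Rightarrow> nat \<Rightarrow> 'a" where "Qn i n = (\<Oplus>k\<in>{..<n}. Q i [^] k)"

lemma Qn_closed [simp]: "i < d \<Longrightarrow> Qn i n \<in> carrier A"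
  unfolding Qn_def by (intro finsum_closed) auto

lemma Qn_0 [simp]: "Qn i 0 = \<zero>"
  by (simp add: Qn_def)

lemma Qn_Suc: "i < d \<Longrightarrow> Qn i (Suc n) = Qn i n \<oplus> Q i [^] n"
  unfolding Qn_def lessThan_Suc by (subst finsum_insert) (auto simp: a_comm Pi_def)

end

section \<open>The comultiplication with left factor of degree one\<close>

locale taylor_step = taylor A d \<sigma> x Q \<Theta>
  for A :: "'a tring" (structure) and d \<sigma> x Q \<Theta> + 
  fixes m :: nat
begin

sublocale P1: principal_parts_ring A d \<sigma> x "Suc 0" ..
sublocale Pm: principal_parts_ring A d \<sigma> x m ..
sublocale Ps: principal_parts_ring A d \<sigma> x "Suc m" ..

abbreviation "M1 \<equiv> pp_algebra_taylor A d \<sigma> x \<Theta> (Suc 0)"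
abbreviation "Mm \<equiv> pp_algebra A d \<sigma> x m"

sublocale Th: ring_hom_cring A P1.P "\<Theta> (Suc 0)"
  by (rule ring_hom_cringI[OF is_cring P1.P.is_cring Theta_hom])

sublocale Thm: ring_hom_cring A Pm.P "\<Theta> m"
  by (rule ring_hom_cringI[OF is_cring Pm.P.is_cring Theta_hom])

sublocale Ths: ring_hom_cring A Ps.P "\<Theta> (Suc m)"
  by (rule ring_hom_cringI[OF is_cring Ps.P.is_cring Theta_hom])

sublocale TA: tensor_algebra A M1 Mm
proof -
  interpret M1: cring M1 by (rule cring_cong[OF P1.P.is_cring]) simp_all
  interpret Mm: cring Mm by (rule cring_cong[OF Pm.P.is_cring]) simp_all
  show "tensor_algebra A M1 Mm"
    by unfold_locales (simp_all add: P1.P.m_assoc Pm.P.m_assoc)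
qed

abbreviation "B \<equiv> tensor A M1 Mm"
abbreviation "e \<equiv> tensor_elt A M1 Mm"

lemma e_mult: "p \<in> carrier P1.P \<Longrightarrow> X \<in> carrier Pm.P \<Longrightarrow> p' \<in> carrier P1.P \<Longrightarrow> X' \<in> carrier Pm.P \<Longrightarrow>
    e p X \<otimes>\<^bsub>B\<^esub> e p' X' = e (p \<otimes>\<^bsub>P1.P\<^esub> p') (X \<otimes>\<^bsub>Pm.P\<^esub> X')"
  using TA.mult_el by simp

lemma e_closed [simp]: "p \<in> carrier P1.P \<Longrightarrow> X \<in> carrier Pm.P \<Longrightarrow> e p X \<in> carrier B"
  using TA.el_closed by simp

lemma e_add1: "p \<in> carrier P1.P \<Longrightarrow> p' \<in> carrier P1.P \<Longrightarrow> X \<in> carrier Pm.P \<Longrightarrow>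
    e (p \<oplus>\<^bsub>P1.P\<^esub> p') X = e p X \<oplus>\<^bsub>B\<^esub> e p' X"
  using TA.el_add1 by simp

lemma e_add2: "p \<in> carrier P1.P \<Longrightarrow> X \<in> carrier Pm.P \<Longrightarrow> X' \<in> carrier Pm.P \<Longrightarrow>
    e p (X \<oplus>\<^bsub>Pm.P\<^esub> X') = e p X \<oplus>\<^bsub>B\<^esub> e p X'"
  using TA.el_add2 by simp

text \<open>The left factor is a module through the Taylor map, so a scalar leaving the right factor
  arrives on the left as \<Theta>(a). The twist in the binomial formula comes from this
  rule.\<close>

lemma e_bal: "p \<in> carrier P1.P \<Longrightarrow> X \<in> carrier Pm.P \<Longrightarrow> a \<in> carrier A \<Longrightarrow>
    e (\<Theta> (Suc 0) a \<otimes>\<^bsub>P1.P\<^esub> p) X = e p (Pm.pc a \<otimes>\<^bsub>Pm.P\<^esub> X)"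
  using TA.el_balanced by simp

lemma B_one: "\<one>\<^bsub>B\<^esub> = e \<one>\<^bsub>P1.P\<^esub> \<one>\<^bsub>Pm.P\<^esub>"
  using TA.T_sel(4) by simp

lemma e_zero1 [simp]: "X \<in> carrier Pm.P \<Longrightarrow> e \<zero>\<^bsub>P1.P\<^esub> X = \<zero>\<^bsub>B\<^esub>"
  using TA.el_zero1 by simp

lemma e_zero2 [simp]: "p \<in> carrier P1.P \<Longrightarrow> e p \<zero>\<^bsub>Pm.P\<^esub> = \<zero>\<^bsub>B\<^esub>"
  using TA.el_zero2 by simp

lemma shift_eq: "i < d \<Longrightarrow> shift i j = x i \<ominus> Q i [^] j \<otimes> x i"
  by (simp add: shift_def sigma_pow)

definition phi :: "'a \<Rightarrow> _" where "phi a = e (P1.pc a) \<one>\<^bsub>Pm.P\<^esub>"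
definition tt :: "nat \<Rightarrow> _" where "tt i = e (P1.px i) \<one>\<^bsub>Pm.P\<^esub> \<oplus>\<^bsub>B\<^esub> e \<one>\<^bsub>P1.P\<^esub> (Pm.px i)"

sublocale E: poly_eval A "{..<d}" B phi tt
proof unfold_locales
  show "phi \<in> ring_hom A B"
    by (rule ring_hom_memI) (auto simp: phi_def e_mult e_add1 B_one)
  show "tt i \<in> carrier B" if "i \<in> {..<d}" for i using that by (simp add: tt_def)
qed

lemma ev_hom': "E.ev \<in> ring_hom T B"
  using E.ev_hom by (simp add: ring_hom_def T_sel)

sublocale EH: ring_hom_cring T B E.ev
  by (rule ring_hom_cringI[OF T.is_cring TA.T.is_cring ev_hom'])

lemma Theta_Qx: fixes j :: nat shows "i < d \<Longrightarrow> \<Theta> (Suc 0) (Q i [^] j \<otimes> x i) =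
    P1.pc (Q i [^] j) \<otimes>\<^bsub>P1.P\<^esub> (P1.pc (x i) \<oplus>\<^bsub>P1.P\<^esub> P1.px i)"
  using Th.hom_mult[of "Q i [^] j" "x i"] Th.hom_nat_pow[of "Q i" j] P1.pc.hom_nat_pow[of "Q i" j]
  by (simp add: x_closed Theta_Q Theta_x)

text \<open>In degree one the twisted square \<xi>_i (\<xi>_i + x_i - q_i x_i) is zero.\<close>

lemma px1_rel_eq:
  assumes "i < d"
  shows "(P1.pc (x i) \<oplus>\<^bsub>P1.P\<^esub> P1.px i) \<otimes>\<^bsub>P1.P\<^esub> P1.px i = P1.pc (Q i \<otimes> x i) \<otimes>\<^bsub>P1.P\<^esub> P1.px i"
proof -
  have "\<zero>\<^bsub>P1.P\<^esub> = (P1.px i \<oplus>\<^bsub>P1.P\<^esub> P1.pc (shift i (Suc 0))) \<otimes>\<^bsub>P1.P\<^esub> P1.px i"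
    using P1.Xi_add[of i "{#i#}"] assms P1.Xi_zero[of "{#i, i#}"] by (simp add: P1.Xi_single)
  also have "\<dots> = ((P1.pc (x i) \<oplus>\<^bsub>P1.P\<^esub> P1.px i) \<otimes>\<^bsub>P1.P\<^esub> P1.px i) \<ominus>\<^bsub>P1.P\<^esub> P1.pc (Q i \<otimes> x i) \<otimes>\<^bsub>P1.P\<^esub> P1.px i"
    using assms by (simp add: shift_eq x_closed a_minus_def P1.P.l_distr P1.P.a_ac P1.P.l_minus)
  finally show ?thesis
    by (rule_tac P1.P.eq_if_minus_zero) (use assms in \<open>simp_all add: x_closed\<close>)
qed

lemma px1_rel_neq:
  assumes "i < d" "j < d" "i \<noteq> j"
  shows "P1.px i \<otimes>\<^bsub>P1.P\<^esub> P1.px j = \<zero>\<^bsub>P1.P\<^esub>"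
  using P1.Xi_add[of i "{#j#}"] assms P1.Xi_zero[of "{#i, j#}"] by (simp add: P1.Xi_single)

text \<open>The summands of the binomial formula. If j does not occur in k, the difference of
  multisets is k itself, but the coefficient is then the q-number of zero.\<close>

abbreviation s where
  "s k j \<equiv> e (P1.pc (Qn j (count k j)) \<otimes>\<^bsub>P1.P\<^esub> P1.px j) (Pm.Xi (k - {#j#}))"

text \<open>As x_i + \<xi>_i is \<Theta>(x_i), the part (x_i + \<xi>_i) \<otimes> 1 equals 1
  \<otimes> x_i, and only q_i^c x_i stays on the left.\<close>

lemma ev_fac:
  assumes i: "i < d"
  shows "E.ev (fac i c) = e \<one>\<^bsub>P1.P\<^esub> (Pm.px i \<oplus>\<^bsub>Pm.P\<^esub> Pm.pc (x i)) \<ominus>\<^bsub>B\<^esub> e (P1.pc (Q i [^] c \<otimes> x i)) \<one>\<^bsub>Pm.P\<^esub>"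
proof -
  have "E.ev (fac i c) = tt i \<oplus>\<^bsub>B\<^esub> phi (x i \<ominus> Q i [^] c \<otimes> x i)"
    using i by (simp add: shift_eq x_closed)
  also have "phi (x i \<ominus> Q i [^] c \<otimes> x i) = phi (x i) \<ominus>\<^bsub>B\<^esub> phi (Q i [^] c \<otimes> x i)"
  proof -
    interpret H: ring_hom_cring A B phi
      by (rule ring_hom_cringI[OF is_cring TA.T.is_cring E.hom])
    show ?thesis using i by (simp add: a_minus_def x_closed)
  qed
  also have "tt i \<oplus>\<^bsub>B\<^esub> (phi (x i) \<ominus>\<^bsub>B\<^esub> phi (Q i [^] c \<otimes> x i)) =
     e \<one>\<^bsub>P1.P\<^esub> (Pm.px i) \<oplus>\<^bsub>B\<^esub> e (P1.pc (x i) \<oplus>\<^bsub>P1.P\<^esub> P1.px i) \<one>\<^bsub>Pm.P\<^esub> \<ominus>\<^bsub>B\<^esub> e (P1.pc (Q i [^] c \<otimes> x i)) \<one>\<^bsub>Pm.P\<^esub>"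
    using i unfolding tt_def phi_def by (simp add: x_closed e_add1 a_minus_def TA.T.a_ac)
  also have "e (P1.pc (x i) \<oplus>\<^bsub>P1.P\<^esub> P1.px i) \<one>\<^bsub>Pm.P\<^esub> = e \<one>\<^bsub>P1.P\<^esub> (Pm.pc (x i))"
    using e_bal[of "\<one>\<^bsub>P1.P\<^esub>" "\<one>\<^bsub>Pm.P\<^esub>" "x i"] i by (simp add: x_closed Theta_x[of i "Suc 0"])
  finally show ?thesis using i by (simp add: x_closed e_add2)
qed

text \<open>Moved to the left factor, q_i^c x_i becomes q_i^c (x_i + \<xi>_i). The surplus q_i^c
  \<xi>_i \<otimes> X is the source of the q-numbers.\<close>

lemma ev_fac_one:
  assumes i: "i < d" and X: "X \<in> carrier Pm.P"
  shows "E.ev (fac i c) \<otimes>\<^bsub>B\<^esub> e \<one>\<^bsub>P1.P\<^esub> X =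
    e \<one>\<^bsub>P1.P\<^esub> ((Pm.px i \<oplus>\<^bsub>Pm.P\<^esub> Pm.pc (shift i c)) \<otimes>\<^bsub>Pm.P\<^esub> X) \<oplus>\<^bsub>B\<^esub> e (P1.pc (Q i [^] c) \<otimes>\<^bsub>P1.P\<^esub> P1.px i) X"
proof -
  let ?a = "Q i [^] c \<otimes> x i"
  have a: "?a \<in> carrier A" "x i \<in> carrier A" using i by (simp_all add: x_closed)
  have "e \<one>\<^bsub>P1.P\<^esub> (Pm.pc ?a \<otimes>\<^bsub>Pm.P\<^esub> X) = e (P1.pc ?a) X \<oplus>\<^bsub>B\<^esub> e (P1.pc (Q i [^] c) \<otimes>\<^bsub>P1.P\<^esub> P1.px i) X"
    using e_bal[of "\<one>\<^bsub>P1.P\<^esub>" X ?a] i a X Theta_Qx[OF i, of c] by (simp add: P1.P.r_distr e_add1)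
  moreover have "(Pm.px i \<oplus>\<^bsub>Pm.P\<^esub> Pm.pc (shift i c)) \<otimes>\<^bsub>Pm.P\<^esub> X \<oplus>\<^bsub>Pm.P\<^esub> Pm.pc ?a \<otimes>\<^bsub>Pm.P\<^esub> X
      = (Pm.px i \<oplus>\<^bsub>Pm.P\<^esub> Pm.pc (x i)) \<otimes>\<^bsub>Pm.P\<^esub> X"
    using i X a by (simp add: shift_eq a_minus_def Pm.P.l_distr Pm.P.a_assoc Pm.P.l_minus Pm.P.l_neg)
  then have "e \<one>\<^bsub>P1.P\<^esub> ((Pm.px i \<oplus>\<^bsub>Pm.P\<^esub> Pm.pc (shift i c)) \<otimes>\<^bsub>Pm.P\<^esub> X) \<oplus>\<^bsub>B\<^esub> e \<one>\<^bsub>P1.P\<^esub> (Pm.pc ?a \<otimes>\<^bsub>Pm.P\<^esub> X)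
     = e \<one>\<^bsub>P1.P\<^esub> ((Pm.px i \<oplus>\<^bsub>Pm.P\<^esub> Pm.pc (x i)) \<otimes>\<^bsub>Pm.P\<^esub> X)"
    using i X a by (simp flip: e_add2)
  ultimately have *: "e \<one>\<^bsub>P1.P\<^esub> ((Pm.px i \<oplus>\<^bsub>Pm.P\<^esub> Pm.pc (shift i c)) \<otimes>\<^bsub>Pm.P\<^esub> X)
      \<oplus>\<^bsub>B\<^esub> (e (P1.pc ?a) X \<oplus>\<^bsub>B\<^esub> e (P1.pc (Q i [^] c) \<otimes>\<^bsub>P1.P\<^esub> P1.px i) X) =
      e \<one>\<^bsub>P1.P\<^esub> ((Pm.px i \<oplus>\<^bsub>Pm.P\<^esub> Pm.pc (x i)) \<otimes>\<^bsub>Pm.P\<^esub> X)"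
    by simp
  have "E.ev (fac i c) \<otimes>\<^bsub>B\<^esub> e \<one>\<^bsub>P1.P\<^esub> X =
      e \<one>\<^bsub>P1.P\<^esub> ((Pm.px i \<oplus>\<^bsub>Pm.P\<^esub> Pm.pc (x i)) \<otimes>\<^bsub>Pm.P\<^esub> X) \<ominus>\<^bsub>B\<^esub> e (P1.pc ?a) X"
    unfolding ev_fac[OF i] using i X a by (simp add: a_minus_def TA.T.l_distr TA.T.l_minus e_mult del: P1.pc.hom_mult Pm.pc.hom_mult)
  also have "\<dots> = e \<one>\<^bsub>P1.P\<^esub> ((Pm.px i \<oplus>\<^bsub>Pm.P\<^esub> Pm.pc (shift i c)) \<otimes>\<^bsub>Pm.P\<^esub> X) \<oplus>\<^bsub>B\<^esub> e (P1.pc (Q i [^] c) \<otimes>\<^bsub>P1.P\<^esub> P1.px i) X"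
    unfolding *[symmetric] using i X a
    by (intro TA.T.add_minus_cancel_mid) (simp_all del: P1.pc.hom_mult Pm.pc.hom_mult)
  finally show ?thesis .
qed

text \<open>
  In degree one, \<open>\<xi>\<^sub>j (x\<^sub>i + \<xi>\<^sub>i)\<close> is \<open>x\<^sub>i \<xi>\<^sub>j\<close> for \<open>i \<noteq> j\<close> and \<open>q\<^sub>i x\<^sub>i \<xi>\<^sub>i\<close> for \<open>i = j\<close>, which moves
  the scalar \<open>x\<^sub>i\<close> to the right factor at the cost of one power of \<open>q\<^sub>i\<close>.
\<close>

lemma ev_fac_px:
  assumes i: "i < d" and j: "j < d" and u: "u \<in> carrier A" and X: "X \<in> carrier Pm.P"
    and c: "c = (if i = j then Suc c' else c')"
  shows "E.ev (fac i c) \<otimes>\<^bsub>B\<^esub> e (P1.pc u \<otimes>\<^bsub>P1.P\<^esub> P1.px j) X =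
    e (P1.pc u \<otimes>\<^bsub>P1.P\<^esub> P1.px j) ((Pm.px i \<oplus>\<^bsub>Pm.P\<^esub> Pm.pc (shift i c')) \<otimes>\<^bsub>Pm.P\<^esub> X)"
proof -
  let ?a = "Q i [^] c \<otimes> x i" and ?b = "Q i [^] c' \<otimes> x i" and ?v = "P1.pc u \<otimes>\<^bsub>P1.P\<^esub> P1.px j"
  have a: "?a \<in> carrier A" "?b \<in> carrier A" "x i \<in> carrier A" "?v \<in> carrier P1.P"
    using i j u by (simp_all add: x_closed)
  have px: "P1.pc ?a \<otimes>\<^bsub>P1.P\<^esub> P1.px j = \<Theta> (Suc 0) ?b \<otimes>\<^bsub>P1.P\<^esub> P1.px j"
  proof (cases "i = j")
    case True
    have "\<Theta> (Suc 0) ?b \<otimes>\<^bsub>P1.P\<^esub> P1.px j =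
        P1.pc (Q i [^] c') \<otimes>\<^bsub>P1.P\<^esub> ((P1.pc (x i) \<oplus>\<^bsub>P1.P\<^esub> P1.px i) \<otimes>\<^bsub>P1.P\<^esub> P1.px i)"
      unfolding Theta_Qx[OF i] using True i by (simp add: x_closed P1.P.m_assoc)
    also have "\<dots> = P1.pc ?a \<otimes>\<^bsub>P1.P\<^esub> P1.px j"
      unfolding px1_rel_eq[OF i] using True i c by (simp add: x_closed P1.P.m_assoc)
    finally show ?thesis by simp
  next
    case False
    then show ?thesis unfolding Theta_Qx[OF i] using i j c
      by (simp add: x_closed P1.P.m_assoc P1.P.l_distr px1_rel_neq)
  qed
  have "P1.pc ?a \<otimes>\<^bsub>P1.P\<^esub> ?v = P1.pc u \<otimes>\<^bsub>P1.P\<^esub> (P1.pc ?a \<otimes>\<^bsub>P1.P\<^esub> P1.px j)"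
    using a(1) u j by (simp add: P1.P.m_lcomm del: P1.pc.hom_mult)
  also have "\<dots> = \<Theta> (Suc 0) ?b \<otimes>\<^bsub>P1.P\<^esub> ?v"
    unfolding px using a(2) u j by (simp add: P1.P.m_lcomm del: Th.hom_mult)
  finally have "e (P1.pc ?a \<otimes>\<^bsub>P1.P\<^esub> ?v) X = e ?v (Pm.pc ?b \<otimes>\<^bsub>Pm.P\<^esub> X)"
    using e_bal[of ?v X ?b] a X by simp
  moreover have "E.ev (fac i c) \<otimes>\<^bsub>B\<^esub> e ?v X =
      e ?v ((Pm.px i \<oplus>\<^bsub>Pm.P\<^esub> Pm.pc (x i)) \<otimes>\<^bsub>Pm.P\<^esub> X) \<ominus>\<^bsub>B\<^esub> e (P1.pc ?a \<otimes>\<^bsub>P1.P\<^esub> ?v) X"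
    unfolding ev_fac[OF i] using i j u X a by (simp add: a_minus_def TA.T.l_distr TA.T.l_minus e_mult del: P1.pc.hom_mult Pm.pc.hom_mult)
  moreover have "(Pm.px i \<oplus>\<^bsub>Pm.P\<^esub> Pm.pc (shift i c')) \<otimes>\<^bsub>Pm.P\<^esub> X \<oplus>\<^bsub>Pm.P\<^esub> Pm.pc ?b \<otimes>\<^bsub>Pm.P\<^esub> X
      = (Pm.px i \<oplus>\<^bsub>Pm.P\<^esub> Pm.pc (x i)) \<otimes>\<^bsub>Pm.P\<^esub> X"
    using i X a by (simp add: shift_eq a_minus_def Pm.P.l_distr Pm.P.a_assoc Pm.P.l_minus Pm.P.l_neg)
  then have "e ?v ((Pm.px i \<oplus>\<^bsub>Pm.P\<^esub> Pm.pc (shift i c')) \<otimes>\<^bsub>Pm.P\<^esub> X) \<oplus>\<^bsub>B\<^esub> e ?v (Pm.pc ?b \<otimes>\<^bsub>Pm.P\<^esub> X)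
     = e ?v ((Pm.px i \<oplus>\<^bsub>Pm.P\<^esub> Pm.pc (x i)) \<otimes>\<^bsub>Pm.P\<^esub> X)"
    using i X a by (simp flip: e_add2)
  ultimately have "E.ev (fac i c) \<otimes>\<^bsub>B\<^esub> e ?v X =
     (e ?v ((Pm.px i \<oplus>\<^bsub>Pm.P\<^esub> Pm.pc (shift i c')) \<otimes>\<^bsub>Pm.P\<^esub> X) \<oplus>\<^bsub>B\<^esub> e ?v (Pm.pc ?b \<otimes>\<^bsub>Pm.P\<^esub> X)) \<ominus>\<^bsub>B\<^esub> e ?v (Pm.pc ?b \<otimes>\<^bsub>Pm.P\<^esub> X)"
    by simp
  then show ?thesis
    using i X a by (simp add: a_minus_def TA.T.a_assoc TA.T.r_neg del: P1.pc.hom_mult Pm.pc.hom_mult)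
qed

end

context taylor_step begin

text \<open>Twisted binomial formula up to left degree one. A new factor for the variable i acts on
  1 \<otimes> \<xi>^(k) with the surplus q_i^{k_i} \<xi>_i \<otimes> \<xi>^(k) and on the other
  summands through the right factor alone; the coefficient grows by (k_i + 1) = (k_i) +
  q_i^{k_i}.\<close>

lemma ev_xip:
  "set_mset k \<subseteq> {..<d} \<Longrightarrow> E.ev (xip k) = e \<one>\<^bsub>P1.P\<^esub> (Pm.Xi k) \<oplus>\<^bsub>B\<^esub> (\<Oplus>\<^bsub>B\<^esub>j\<in>{..<d}. s k j)"
proof (induction k)
  case empty
  have "(\<Oplus>\<^bsub>B\<^esub>j\<in>{..<d}. s {#} j) = \<zero>\<^bsub>B\<^esub>"
    by (rule TA.T.add.finprod_one_eqI) simp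
  then show ?case unfolding xip_empty Pm.Xi_empty EH.hom_one by (simp add: B_one)
next
  case (add i k)
  then have i: "i < d" by simp
  define F where "F = E.ev (fac i (count k i))"
  have F: "F \<in> carrier B" unfolding F_def using i by (intro EH.hom_closed) simp
  have sc: "s k' j \<in> carrier B" if "j < d" for k' j using that by simp
  let ?W = "e (P1.pc (Q i [^] count k i) \<otimes>\<^bsub>P1.P\<^esub> P1.px i) (Pm.Xi k)"
  have W: "?W \<in> carrier B" using i by simp
  \<comment> \<open>Only the summand belonging to \<open>i\<close> receives the surplus
    term.\<close>
  have step: "s (add_mset i k) j = F \<otimes>\<^bsub>B\<^esub> s k j \<oplus>\<^bsub>B\<^esub> (if i = j then ?W else \<zero>\<^bsub>B\<^esub>)" if j: "j < d" for j
  proof (cases "i = j")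
    case True
    have "s (add_mset i k) i = e (P1.pc (Qn i (count k i)) \<otimes>\<^bsub>P1.P\<^esub> P1.px i) (Pm.Xi k) \<oplus>\<^bsub>B\<^esub> ?W"
      using i by (simp add: Qn_Suc P1.P.l_distr e_add1)
    moreover have "F \<otimes>\<^bsub>B\<^esub> s k i = e (P1.pc (Qn i (count k i)) \<otimes>\<^bsub>P1.P\<^esub> P1.px i) (Pm.Xi k)"
    proof (cases "count k i")
      case 0
      then show ?thesis using i F by simp
    next
      case (Suc c')
      then have k: "add_mset i (k - {#i#}) = k" "count (k - {#i#}) i = c'"
        by (auto simp: count_greater_zero_iff[symmetric] simp del: count_greater_zero_iff)
      \<comment> \<open>Passing \<xi>_i on the left lowers the exponent of q_i from k_i to
        \<open>c'\<close>, which is the index of the factor that \<xi>^(k-e_i) lacks compared with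
        \<xi>^(k).\<close>
      have "F \<otimes>\<^bsub>B\<^esub> s k i = e (P1.pc (Qn i (count k i)) \<otimes>\<^bsub>P1.P\<^esub> P1.px i)
          ((Pm.px i \<oplus>\<^bsub>Pm.P\<^esub> Pm.pc (shift i c')) \<otimes>\<^bsub>Pm.P\<^esub> Pm.Xi (k - {#i#}))"
        unfolding F_def using i Suc by (intro ev_fac_px) simp_all
      also have "(Pm.px i \<oplus>\<^bsub>Pm.P\<^esub> Pm.pc (shift i c')) \<otimes>\<^bsub>Pm.P\<^esub> Pm.Xi (k - {#i#}) = Pm.Xi k"
        using Pm.Xi_add[OF i, of "k - {#i#}"] k by simp
      finally show ?thesis .
    qed
    ultimately show ?thesis using True by simp
  next
    case False
    show ?thesis
    proof (cases "j \<in># k")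
      case True
      have "F \<otimes>\<^bsub>B\<^esub> s k j = e (P1.pc (Qn j (count k j)) \<otimes>\<^bsub>P1.P\<^esub> P1.px j)
          ((Pm.px i \<oplus>\<^bsub>Pm.P\<^esub> Pm.pc (shift i (count k i))) \<otimes>\<^bsub>Pm.P\<^esub> Pm.Xi (k - {#j#}))"
        unfolding F_def using i j False by (intro ev_fac_px) simp_all
      also have "(Pm.px i \<oplus>\<^bsub>Pm.P\<^esub> Pm.pc (shift i (count k i))) \<otimes>\<^bsub>Pm.P\<^esub> Pm.Xi (k - {#j#}) = Pm.Xi (add_mset i k - {#j#})"
        using Pm.Xi_add[OF i, of "k - {#j#}"] False True by simp
      finally show ?thesis using False i j sc[OF j] by simp
    next
      case nin: False
      then have "count k j = 0" by (simp add: not_in_iff)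
      then show ?thesis using False i j F by simp
    qed
  qed
  have "(\<Oplus>\<^bsub>B\<^esub>j\<in>{..<d}. s (add_mset i k) j) =
      (\<Oplus>\<^bsub>B\<^esub>j\<in>{..<d}. F \<otimes>\<^bsub>B\<^esub> s k j \<oplus>\<^bsub>B\<^esub> (if i = j then ?W else \<zero>\<^bsub>B\<^esub>))"
    by (rule TA.T.finsum_cong') (use step F sc W in auto)
  also have "\<dots> = (\<Oplus>\<^bsub>B\<^esub>j\<in>{..<d}. F \<otimes>\<^bsub>B\<^esub> s k j) \<oplus>\<^bsub>B\<^esub> (\<Oplus>\<^bsub>B\<^esub>j\<in>{..<d}. if i = j then ?W else \<zero>\<^bsub>B\<^esub>)"
    using F sc W by (intro TA.T.finsum_addf) auto
  also have "(\<Oplus>\<^bsub>B\<^esub>j\<in>{..<d}. if i = j then ?W else \<zero>\<^bsub>B\<^esub>) = ?W"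
    using TA.T.finsum_singleton[of i "{..<d}" "\<lambda>_. ?W"] i W by simp
  also have "(\<Oplus>\<^bsub>B\<^esub>j\<in>{..<d}. F \<otimes>\<^bsub>B\<^esub> s k j) = F \<otimes>\<^bsub>B\<^esub> (\<Oplus>\<^bsub>B\<^esub>j\<in>{..<d}. s k j)"
    using F sc by (intro TA.T.finsum_rdistr[symmetric]) auto
  finally have sum: "(\<Oplus>\<^bsub>B\<^esub>j\<in>{..<d}. s (add_mset i k) j) = F \<otimes>\<^bsub>B\<^esub> (\<Oplus>\<^bsub>B\<^esub>j\<in>{..<d}. s k j) \<oplus>\<^bsub>B\<^esub> ?W" .
  have sumc: "(\<Oplus>\<^bsub>B\<^esub>j\<in>{..<d}. s k j) \<in> carrier B" using sc by (intro TA.T.finsum_closed) auto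
  have "E.ev (xip (add_mset i k)) = F \<otimes>\<^bsub>B\<^esub> E.ev (xip k)"
    unfolding xip_add[OF i] F_def using i by (intro EH.hom_mult) simp_all
  also have "\<dots> = F \<otimes>\<^bsub>B\<^esub> e \<one>\<^bsub>P1.P\<^esub> (Pm.Xi k) \<oplus>\<^bsub>B\<^esub> F \<otimes>\<^bsub>B\<^esub> (\<Oplus>\<^bsub>B\<^esub>j\<in>{..<d}. s k j)"
    using add F sumc by (simp add: TA.T.r_distr)
  also have "F \<otimes>\<^bsub>B\<^esub> e \<one>\<^bsub>P1.P\<^esub> (Pm.Xi k) = e \<one>\<^bsub>P1.P\<^esub> (Pm.Xi (add_mset i k)) \<oplus>\<^bsub>B\<^esub> ?W"
    unfolding F_def Pm.Xi_add[OF i] using i by (intro ev_fac_one) simp_all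
  finally show ?case unfolding sum using F sumc W by (simp only: TA.T.a_ac e_closed Pm.cl.hom_closed xip_closed P1.P.one_closed TA.T.m_closed TA.T.a_closed)
qed

text \<open>For |k| > m + 1 even \<xi>^(k-e_j) has degree above m and is zero in the right factor.
  So the evaluation factors through the principal parts of order m + 1.\<close>

lemma ev_xip_zero:
  assumes k: "set_mset k \<subseteq> {..<d}" "size k > Suc m"
  shows "E.ev (xip k) = \<zero>\<^bsub>B\<^esub>"
proof -
  have "s k j = \<zero>\<^bsub>B\<^esub>" if j: "j < d" for j
  proof (cases "j \<in># k")
    case True
    have "set_mset (k - {#j#}) \<subseteq> {..<d}" using k(1) by (auto dest: in_diffD)
    moreover have "size (k - {#j#}) > m" using k(2) True by (simp add: size_Diff_singleton)
    ultimately have "Pm.Xi (k - {#j#}) = \<zero>\<^bsub>Pm.P\<^esub>" by (rule Pm.Xi_zero)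
    then show ?thesis using j by simp
  next
    case False
    then have "count k j = 0" by (simp add: not_in_iff)
    then show ?thesis using j by simp
  qed
  then have "(\<Oplus>\<^bsub>B\<^esub>j\<in>{..<d}. s k j) = \<zero>\<^bsub>B\<^esub>"
    by (intro TA.T.add.finprod_one_eqI) simp
  moreover have "Pm.Xi k = \<zero>\<^bsub>Pm.P\<^esub>" using k by (intro Pm.Xi_zero) simp_all
  ultimately show ?thesis using ev_xip[OF k(1)] by simp
qed

lemma ev_I:
  assumes "p \<in> Ps.I"
  shows "E.ev p = \<zero>\<^bsub>B\<^esub>"
proof -
  have "xip k \<in> a_kernel T B E.ev" if "set_mset k \<subseteq> {..<d}" "size k = Suc m + 1" for k
    using ev_xip_zero[of k] that xip_closed[of k] unfolding a_kernel_def' by simp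
  then have "{xip k |k. set_mset k \<subseteq> {..<d} \<and> size k = Suc m + 1} \<subseteq> a_kernel T B E.ev" by blast
  then have "Ps.I \<subseteq> a_kernel T B E.ev"
    unfolding xi_ideal_def
    by (rule T.genideal_minimal[OF ring_hom_ring.kernel_is_ideal[OF ring_hom_ringI2[OF T.ring_axioms TA.T.ring_axioms ev_hom']]])
  then have "p \<in> a_kernel T B E.ev" using assms by blast
  then show ?thesis unfolding a_kernel_def' by simp
qed

text \<open>The comultiplication \<delta>_{1,m}, made extensional as the description in
  \<open>pp_delta\<close> demands.\<close>

definition D where "D = (\<lambda>X\<in>carrier Ps.P. the_elem (E.ev ` X))"

lemma D_cl:
  assumes "p \<in> carrier T"
  shows "D (Ps.cl p) = E.ev p"
proof -
  have "E.ev ` Ps.cl p = {E.ev p}"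
  proof
    show "E.ev ` Ps.cl p \<subseteq> {E.ev p}"
      using assms by (auto simp: Ps.cl_mem Ps.I.a_Hcarr ev_I)
    show "{E.ev p} \<subseteq> E.ev ` Ps.cl p" using Ps.cl_self[OF assms] by auto
  qed
  then show ?thesis using assms by (simp add: D_def)
qed

lemma D_hom: "D \<in> ring_hom Ps.P B"
proof (rule ring_hom_memI)
  fix X Y assume X: "X \<in> carrier Ps.P" and Y: "Y \<in> carrier Ps.P"
  then obtain p r where pr: "X = Ps.cl p" "Y = Ps.cl r" "p \<in> carrier T" "r \<in> carrier T"
    by (auto simp: Ps.carrier_P)
  show "D X \<in> carrier B" unfolding pr(1) D_cl[OF pr(3)] using pr(3) by (rule EH.hom_closed)
  have "D (Ps.cl (p \<otimes>\<^bsub>T\<^esub> r)) = D X \<otimes>\<^bsub>B\<^esub> D Y" unfolding pr(1,2) using pr(3,4) by (simp only: D_cl T.m_closed EH.hom_mult)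
  then show "D (X \<otimes>\<^bsub>Ps.P\<^esub> Y) = D X \<otimes>\<^bsub>B\<^esub> D Y" using pr by simp
  have "D (Ps.cl (p \<oplus>\<^bsub>T\<^esub> r)) = D X \<oplus>\<^bsub>B\<^esub> D Y" unfolding pr(1,2) using pr(3,4) by (simp only: D_cl T.a_closed EH.hom_add)
  then show "D (X \<oplus>\<^bsub>Ps.P\<^esub> Y) = D X \<oplus>\<^bsub>B\<^esub> D Y" using pr by simp
next
  have "D (Ps.cl \<one>\<^bsub>T\<^esub>) = \<one>\<^bsub>B\<^esub>" by (simp only: D_cl T.one_closed EH.hom_one)
  then show "D \<one>\<^bsub>Ps.P\<^esub> = \<one>\<^bsub>B\<^esub>" by simp
qed

lemma D_pc: "a \<in> carrier A \<Longrightarrow> D (Ps.pc a) = phi a"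
  unfolding pp_const_def[of A d \<sigma> x "Suc m"] by (subst D_cl) simp_all

lemma D_px: "i < d \<Longrightarrow> D (Ps.px i) = tt i"
  unfolding pp_xi_def[of A d \<sigma> x "Suc m"] by (subst D_cl) simp_all

text \<open>Constants and the \<xi>_i generate the principal parts as a ring. Together with
  existence this evaluates the description in \<open>pp_delta\<close>.\<close>

lemma D_unique:
  assumes D': "D' \<in> ring_hom Ps.P B" "D' \<in> extensional (carrier Ps.P)"
    and c: "\<And>a. a \<in> carrier A \<Longrightarrow> D' (Ps.pc a) = phi a" and v: "\<And>i. i < d \<Longrightarrow> D' (Ps.px i) = tt i"
  shows "D' = D"
proof (rule extensionalityI[OF D'(2)])
  show "D \<in> extensional (carrier Ps.P)" by (simp add: D_def)
  interpret D': ring_hom_cring Ps.P B D' by (rule ring_hom_cringI[OF Ps.P.is_cring TA.T.is_cring D'(1)])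
  interpret D: ring_hom_cring Ps.P B D by (rule ring_hom_cringI[OF Ps.P.is_cring TA.T.is_cring D_hom])
  fix X assume "X \<in> carrier Ps.P"
  then obtain p where p: "X = Ps.cl p" "p \<in> carrier T" by (auto simp: Ps.carrier_P)
  have "D' (Ps.cl p) = D (Ps.cl p)" using Ps.in_S[OF p(2)]
  proof (induction rule: poly_induct)
    case (const a)
    then show ?case using c[OF const] D_pc[OF const] by (simp add: pp_const_def)
  next
    case (add p r)
    then have "Ps.cl (p \<oplus>\<^bsub>S\<^esub> r) = Ps.cl p \<oplus>\<^bsub>Ps.P\<^esub> Ps.cl r" "p \<in> carrier T" "r \<in> carrier T"
      using Ps.cl.hom_add[of p r] by (simp_all add: T_sel)
    then show ?case using add D'.hom_add[of "Ps.cl p" "Ps.cl r"] D.hom_add[of "Ps.cl p" "Ps.cl r"] by simp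
  next
    case (mult i p)
    then have "Ps.cl (mpoly_var A i \<otimes>\<^bsub>S\<^esub> p) = Ps.px i \<otimes>\<^bsub>Ps.P\<^esub> Ps.cl p" "p \<in> carrier T" "i < d"
      using Ps.cl.hom_mult[of "mpoly_var A i" p] by (simp_all add: T_sel pp_xi_def)
    then show ?case using mult D'.hom_mult[of "Ps.px i" "Ps.cl p"] D.hom_mult[of "Ps.px i" "Ps.cl p"]
      v[of i] D_px[of i] by simp
  qed
  then show "D' X = D X" using p by simp
qed

lemma delta_eq: "pp_delta A d \<sigma> x \<Theta> (Suc 0) m = D"
  unfolding pp_delta_def Let_def add_Suc add_0
proof (rule the_equality)
  show "D \<in> extensional (carrier Ps.P) \<and> D \<in> ring_hom Ps.P B \<and>
      (\<forall>a\<in>carrier A. D (Ps.pc a) = e (P1.pc a) \<one>\<^bsub>Mm\<^esub>) \<and>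
      (\<forall>i<d. D (Ps.px i) = e (P1.px i) \<one>\<^bsub>Mm\<^esub> \<oplus>\<^bsub>B\<^esub> e \<one>\<^bsub>M1\<^esub> (Pm.px i))"
    using D_hom D_pc D_px by (simp add: phi_def tt_def) (simp add: D_def)
next
  fix D' assume "D' \<in> extensional (carrier Ps.P) \<and> D' \<in> ring_hom Ps.P B \<and>
      (\<forall>a\<in>carrier A. D' (Ps.pc a) = e (P1.pc a) \<one>\<^bsub>Mm\<^esub>) \<and>
      (\<forall>i<d. D' (Ps.px i) = e (P1.px i) \<one>\<^bsub>Mm\<^esub> \<oplus>\<^bsub>B\<^esub> e \<one>\<^bsub>M1\<^esub> (Pm.px i))"
  then show "D' = D" by (intro D_unique) (simp_all add: phi_def tt_def)
qed

section \<open>Coefficients in the twisted tensor product\<close>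

definition L :: "nat multiset \<Rightarrow> _ \<Rightarrow> _" where
  "L l = TA.lift P1.P (\<lambda>p X. p \<otimes>\<^bsub>P1.P\<^esub> \<Theta> (Suc 0) (Pm.cf l X))"

text \<open>p \<otimes> a X equals \<Theta>(a) p \<otimes> X, so the coefficient of \<xi>^(l) in the
  right factor can be collected on the left only through \<Theta>.\<close>

lemma L_bilinear: "l \<in> Pm.K \<Longrightarrow> TA.bilinear P1.P (\<lambda>p X. p \<otimes>\<^bsub>P1.P\<^esub> \<Theta> (Suc 0) (Pm.cf l X))"
  unfolding TA.bilinear_def
  by (simp add: P1.P.l_distr P1.P.r_distr Pm.cf_add Pm.cf_const_mult P1.P.m_assoc P1.P.m_lcomm del: Pm.cf_cl)

context
  fixes l assumes l: "l \<in> Pm.K"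
begin

lemma L_e: "p \<in> carrier P1.P \<Longrightarrow> X \<in> carrier Pm.P \<Longrightarrow> L l (e p X) = p \<otimes>\<^bsub>P1.P\<^esub> \<Theta> (Suc 0) (Pm.cf l X)"
  unfolding L_def using TA.lift_el[OF P1.P.abelian_group_axioms L_bilinear[OF l], of p X] by simp

lemma L_closed [simp]: "X \<in> carrier B \<Longrightarrow> L l X \<in> carrier P1.P"
  unfolding L_def using TA.lift_closed[OF P1.P.abelian_group_axioms L_bilinear[OF l]] by simp

lemma L_add: "X \<in> carrier B \<Longrightarrow> Y \<in> carrier B \<Longrightarrow> L l (X \<oplus>\<^bsub>B\<^esub> Y) = L l X \<oplus>\<^bsub>P1.P\<^esub> L l Y"
  unfolding L_def using TA.lift_add[OF P1.P.abelian_group_axioms L_bilinear[OF l]] by simp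

lemma phi_closed [simp]: "a \<in> carrier A \<Longrightarrow> phi a \<in> carrier B"
  by (simp add: phi_def)

lemma L_phi:
  assumes "X \<in> carrier B" and a: "a \<in> carrier A"
  shows "L l (phi a \<otimes>\<^bsub>B\<^esub> X) = P1.pc a \<otimes>\<^bsub>P1.P\<^esub> L l X"
  using assms(1)
proof (induction rule: TA.tensor_induct)
  case (elt p X)
  then have "p \<in> carrier P1.P" "X \<in> carrier Pm.P" by simp_all
  then show ?case using a l
    by (simp add: phi_def e_mult L_e P1.P.m_assoc del: Pm.cf_cl)
next
  case (add X Y)
  then show ?case using a by (simp add: TA.T.r_distr L_add P1.P.r_distr)
qed

context
  fixes k0 assumes k0: "k0 \<in> P1.K"
begin

text \<open>The coefficient at \<xi>^(k0) \<otimes> \<xi>^(l), for the usual A-structure of the left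
  factor.\<close>

definition G where "G X = P1.cf k0 (L l X)"

lemma G_closed [simp]: "X \<in> carrier B \<Longrightarrow> G X \<in> carrier A"
  using k0 by (simp add: G_def)

lemma G_add: "X \<in> carrier B \<Longrightarrow> Y \<in> carrier B \<Longrightarrow> G (X \<oplus>\<^bsub>B\<^esub> Y) = G X \<oplus> G Y"
  using k0 by (simp add: G_def L_add P1.cf_add)

lemma G_phi: "X \<in> carrier B \<Longrightarrow> a \<in> carrier A \<Longrightarrow> G (phi a \<otimes>\<^bsub>B\<^esub> X) = a \<otimes> G X"
  using k0 by (simp add: G_def L_phi P1.cf_const_mult)

lemma G_zero: "G \<zero>\<^bsub>B\<^esub> = \<zero>"
  using G_phi[of "\<zero>\<^bsub>B\<^esub>" \<zero>] by simp

lemma G_sum: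
  assumes "finite F" "\<And>j. j \<in> F \<Longrightarrow> f j \<in> carrier B"
  shows "G (\<Oplus>\<^bsub>B\<^esub>j\<in>F. f j) = (\<Oplus>j\<in>F. G (f j))"
  using assms
proof (induction F rule: finite_induct)
  case empty then show ?case by (simp add: G_zero)
next
  case (insert j F)
  then show ?case by (simp add: G_add Pi_def TA.T.finsum_closed)
qed

lemma G_ev_xip:
  assumes k: "set_mset k \<subseteq> {..<d}"
  shows "G (E.ev (xip k)) = (if l = k \<and> k0 = {#} then \<one> else \<zero>) \<oplus>
    (\<Oplus>j\<in>{..<d}. if l = k - {#j#} \<and> k0 = {#j#} then Qn j (count k j) else \<zero>)"
proof -
  have sc: "s k j \<in> carrier B" if "j < d" for j using that by simp
  have "G (s k j) = (if l = k - {#j#} \<and> k0 = {#j#} then Qn j (count k j) else \<zero>)" if j: "j < d" for j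
  proof -
    have "set_mset (k - {#j#}) \<subseteq> {..<d}" using k by (auto dest: in_diffD)
    then have "Pm.cf l (Pm.Xi (k - {#j#})) = (if l = k - {#j#} then \<one> else \<zero>)" by (rule Pm.cf_Xi[OF l])
    then have G1: "G (s k j) = (if l = k - {#j#} then P1.cf k0 (P1.pc (Qn j (count k j)) \<otimes>\<^bsub>P1.P\<^esub> P1.px j) else \<zero>)"
      using j k0 by (simp add: G_def L_e del: Pm.cf_cl P1.cf_cl)
    have G2: "P1.cf k0 (P1.pc (Qn j (count k j)) \<otimes>\<^bsub>P1.P\<^esub> P1.px j) = Qn j (count k j) \<otimes> (if k0 = {#j#} then \<one> else \<zero>)"
      using P1.cf_const_mult[of "P1.px j" "Qn j (count k j)" k0] P1.cf_Xi[OF k0, of "{#j#}"] j k0 by (simp add: P1.Xi_single)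
    show ?thesis unfolding G1 G2 using j by simp
  qed
  then have "G (\<Oplus>\<^bsub>B\<^esub>j\<in>{..<d}. s k j) = (\<Oplus>j\<in>{..<d}. if l = k - {#j#} \<and> k0 = {#j#} then Qn j (count k j) else \<zero>)"
    using sc by (subst G_sum) (auto intro!: finsum_cong')
  moreover have "G (e \<one>\<^bsub>P1.P\<^esub> (Pm.Xi k)) = (if l = k \<and> k0 = {#} then \<one> else \<zero>)"
  proof -
    have "Pm.cf l (Pm.Xi k) = (if l = k then \<one> else \<zero>)" using k by (rule Pm.cf_Xi[OF l])
    then have G1: "G (e \<one>\<^bsub>P1.P\<^esub> (Pm.Xi k)) = (if l = k then P1.cf k0 \<one>\<^bsub>P1.P\<^esub> else \<zero>)"
      using k0 by (simp add: G_def L_e del: Pm.cf_cl P1.cf_cl)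
    have G2: "P1.cf k0 \<one>\<^bsub>P1.P\<^esub> = (if k0 = {#} then \<one> else \<zero>)"
      using P1.cf_Xi[OF k0, of "{#}"] by (simp add: P1.Xi_empty)
    show ?thesis unfolding G1 G2 by simp
  qed
  moreover have "(\<Oplus>\<^bsub>B\<^esub>j\<in>{..<d}. s k j) \<in> carrier B" using sc by (intro TA.T.finsum_closed) auto
  ultimately show ?thesis unfolding ev_xip[OF k] by (simp add: G_add)
qed

lemma G_D:
  assumes X: "X \<in> carrier Ps.P"
  shows "G (D X) = (\<Oplus>k\<in>Ps.K. Ps.cf k X \<otimes> G (E.ev (xip k)))"
proof -
  interpret DH: ring_hom_cring Ps.P B D by (rule ring_hom_cringI[OF Ps.P.is_cring TA.T.is_cring D_hom])
  have c: "Ps.pc (Ps.cf k X) \<otimes>\<^bsub>Ps.P\<^esub> Ps.Xi k \<in> carrier Ps.P" if "k \<in> Ps.K" for k using that X by simp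
  have ev: "E.ev (xip k) \<in> carrier B" for k by (rule EH.hom_closed) simp
  have "D X = D (\<Oplus>\<^bsub>Ps.P\<^esub>k\<in>Ps.K. Ps.pc (Ps.cf k X) \<otimes>\<^bsub>Ps.P\<^esub> Ps.Xi k)"
    using Ps.pp_expand[OF X] by simp
  also have "\<dots> = (\<Oplus>\<^bsub>B\<^esub>k\<in>Ps.K. D (Ps.pc (Ps.cf k X) \<otimes>\<^bsub>Ps.P\<^esub> Ps.Xi k))"
    using c by (subst DH.hom_finsum) (auto simp: comp_def)
  also have "\<dots> = (\<Oplus>\<^bsub>B\<^esub>k\<in>Ps.K. phi (Ps.cf k X) \<otimes>\<^bsub>B\<^esub> E.ev (xip k))"
  proof (rule TA.T.finsum_cong')
    show "D (Ps.pc (Ps.cf k X) \<otimes>\<^bsub>Ps.P\<^esub> Ps.Xi k) = phi (Ps.cf k X) \<otimes>\<^bsub>B\<^esub> E.ev (xip k)" if "k \<in> Ps.K" for k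
      using DH.hom_mult[of "Ps.pc (Ps.cf k X)" "Ps.Xi k"] that X D_pc[of "Ps.cf k X"] D_cl[of "xip k"] by simp
  qed (use X ev in auto)
  finally have "G (D X) = (\<Oplus>k\<in>Ps.K. G (phi (Ps.cf k X) \<otimes>\<^bsub>B\<^esub> E.ev (xip k)))"
    using X ev by (simp add: G_sum)
  also have "\<dots> = (\<Oplus>k\<in>Ps.K. Ps.cf k X \<otimes> G (E.ev (xip k)))"
    using X ev by (intro finsum_cong') (auto simp: G_phi)
  finally show ?thesis .
qed

end

text \<open>Terms with left factor 1 come only from 1 \<otimes> \<xi>^(k) in the binomial
  formula.\<close>

lemma G_D_empty:
  assumes X: "X \<in> carrier Ps.P"
  shows "G {#} (D X) = Ps.cf l X"
proof -
  have k0: "{#} \<in> P1.K" by (rule P1.empty_K)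
  have lK: "l \<in> Ps.K" using l by (auto simp: Pm.K_def Ps.K_def)
  have "G {#} (E.ev (xip k)) = (if l = k then \<one> else \<zero>)" if k: "k \<in> Ps.K" for k
    using G_ev_xip[OF k0, of k] k by (simp add: Ps.K_def finsum_zero)
  then have "G {#} (D X) = (\<Oplus>k\<in>Ps.K. if l = k then Ps.cf k X else \<zero>)"
    unfolding G_D[OF k0 X] using X by (intro finsum_cong') (auto simp del: Ps.cf_cl)
  also have "\<dots> = Ps.cf l X"
    using finsum_singleton[of l Ps.K "\<lambda>k. Ps.cf k X"] lK X by simp
  finally show ?thesis .
qed

text \<open>The twisted power whose image contains \<xi>_i \<otimes> \<xi>^(l) is \<xi>^(l+e_i),
  with coefficient (l_i + 1).\<close>

lemma G_D_single:
  assumes X: "X \<in> carrier Ps.P" and i: "i < d"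
  shows "G {#i#} (D X) = Qn i (Suc (count l i)) \<otimes> Ps.cf (add_mset i l) X"
proof -
  have k0: "{#i#} \<in> P1.K" using i by (simp add: P1.K_def)
  have lK: "add_mset i l \<in> Ps.K" using l i by (auto simp: Pm.K_def Ps.K_def)
  have "G {#i#} (E.ev (xip k)) = (if add_mset i l = k then Qn i (Suc (count l i)) else \<zero>)" if k: "k \<in> Ps.K" for k
  proof -
    have "(\<Oplus>j\<in>{..<d}. if l = k - {#j#} \<and> {#i#} = {#j#} then Qn j (count k j) else \<zero>)
      = (\<Oplus>j\<in>{..<d}. if i = j then (if l = k - {#j#} then Qn j (count k j) else \<zero>) else \<zero>)"
      by (rule finsum_cong') auto
    also have "\<dots> = (if l = k - {#i#} then Qn i (count k i) else \<zero>)"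
      using finsum_singleton[of i "{..<d}" "\<lambda>j. if l = k - {#j#} then Qn j (count k j) else \<zero>"] i by simp
    also have "\<dots> = (if add_mset i l = k then Qn i (Suc (count l i)) else \<zero>)"
    proof (cases "i \<in># k")
      case True
      then have "l = k - {#i#} \<longleftrightarrow> add_mset i l = k" by auto
      then show ?thesis by auto
    next
      \<comment> \<open>Here the difference of multisets leaves \<open>k\<close> unchanged, so l = k
        can satisfy the condition by accident; the q-number of zero removes that case.\<close>
      case False
      then have "count k i = 0" by (simp add: not_in_iff)
      then show ?thesis using False by auto
    qed
    finally show ?thesis using G_ev_xip[OF k0, of k] k i by (simp add: Ps.K_def)
  qed
  then have "G {#i#} (D X) = (\<Oplus>k\<in>Ps.K. if add_mset i l = k then Ps.cf k X \<otimes> Qn i (Suc (count l i)) else \<zero>)"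
    unfolding G_D[OF k0 X] using X i by (intro finsum_cong') (auto simp del: Ps.cf_cl)
  also have "\<dots> = Ps.cf (add_mset i l) X \<otimes> Qn i (Suc (count l i))"
    using finsum_singleton[of "add_mset i l" Ps.K "\<lambda>k. Ps.cf k X \<otimes> Qn i (Suc (count l i))"] lK X i by simp
  finally show ?thesis using X i lK by (simp add: m_comm)
qed

text \<open>\<open>L\<close> returns \<Theta>_1 of the coefficient of the right factor. A further
  coefficient of it is where composition of operators comes from.\<close>

lemma G_e_one:
  assumes "k0 \<in> P1.K" "X \<in> carrier Pm.P"
  shows "G k0 (e \<one>\<^bsub>P1.P\<^esub> X) = P1.cf k0 (\<Theta> (Suc 0) (Pm.cf l X))"
  using assms l by (simp add: G_def[OF assms(1)] L_e del: Pm.cf_cl)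

end

end

lemma (in abelian_group) add_minus_cancel:
  "\<lbrakk>u \<in> carrier G; w \<in> carrier G\<rbrakk> \<Longrightarrow> u \<oplus> w \<ominus> u = w"
  by (simp add: a_minus_def a_comm[of u w] a_assoc r_neg)

section \<open>Consequences of symmetry for the divided operators\<close>

locale symmetric_taylor = taylor A d \<sigma> x Q \<Theta>
  for A :: "'a tring" (structure) and d \<sigma> x Q \<Theta> +
  assumes symmetric: "f \<in> carrier A \<Longrightarrow> pp_delta A d \<sigma> x \<Theta> (Suc 0) m (\<Theta> (Suc m) f) =
        tensor_elt A (pp_algebra_taylor A d \<sigma> x \<Theta> (Suc 0)) (pp_algebra A d \<sigma> x m)
          \<one>\<^bsub>principal_parts A d \<sigma> x (Suc 0)\<^esub> (\<Theta> m f)"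
begin

abbreviation co where "co \<equiv> principal_parts_ring.cf A d \<sigma> x"

text \<open>The operator \<partial>^[k], read off in the lowest order in which \<xi>^(k) survives;
  \<open>co_eq_dp\<close> gives the same value in all higher orders.\<close>

definition dp :: "nat multiset \<Rightarrow> 'a \<Rightarrow> 'a" where
  "dp k f = co k (\<Theta> (size k) f)"

text \<open>Symmetry reads \<delta>(\<Theta>_{m+1}(f)) = 1 \<otimes> \<Theta>_m(f). Coefficients at
  1 \<otimes> \<xi>^(l) show that the coordinates of the Taylor maps do not depend on the order of
  truncation; those at \<xi>_i \<otimes> \<xi>^(l) give the rule for composing \<partial>_i with
  \<partial>^[l].\<close>

lemma co_step:
  assumes f: "f \<in> carrier A" and l: "set_mset l \<subseteq> {..<d}" "size l \<le> m"
  shows "co l (\<Theta> (Suc m) f) = co l (\<Theta> m f)"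
    and "i < d \<Longrightarrow> co {#i#} (\<Theta> (Suc 0) (co l (\<Theta> m f))) = Qn i (Suc (count l i)) \<otimes> co (add_mset i l) (\<Theta> (Suc m) f)"
proof -
  interpret X: taylor_step A d \<sigma> x Q \<Theta> m by unfold_locales
  have lK: "l \<in> X.Pm.K" using l by (simp add: X.Pm.K_def)
  have sym: "X.D (\<Theta> (Suc m) f) = X.e \<one>\<^bsub>X.P1.P\<^esub> (\<Theta> m f)"
    using symmetric[OF f, of m] by (simp add: X.delta_eq)
  have c: "\<Theta> (Suc m) f \<in> carrier X.Ps.P" "\<Theta> m f \<in> carrier X.Pm.P" using f by simp_all
  have a: "co l (\<Theta> m f) \<in> carrier A" using X.Pm.cf_closed[OF c(2) lK] .
  have "X.G l {#} (X.D (\<Theta> (Suc m) f)) = co {#} (\<Theta> (Suc 0) (co l (\<Theta> m f)))"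
    unfolding sym by (rule X.G_e_one[OF lK X.P1.empty_K c(2)])
  also have "\<dots> = co l (\<Theta> m f)"
    using Theta_proj[OF a, of "Suc 0"] X.P1.pp_proj_cf[of "\<Theta> (Suc 0) (co l (\<Theta> m f))"] a by simp
  finally show "co l (\<Theta> (Suc m) f) = co l (\<Theta> m f)"
    using X.G_D_empty[OF lK c(1)] by simp
  assume i: "i < d"
  have iK: "{#i#} \<in> X.P1.K" using i by (simp add: X.P1.K_def)
  have "X.G l {#i#} (X.D (\<Theta> (Suc m) f)) = co {#i#} (\<Theta> (Suc 0) (co l (\<Theta> m f)))"
    unfolding sym by (rule X.G_e_one[OF lK iK c(2)])
  then show "co {#i#} (\<Theta> (Suc 0) (co l (\<Theta> m f))) = Qn i (Suc (count l i)) \<otimes> co (add_mset i l) (\<Theta> (Suc m) f)"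
    using X.G_D_single[OF lK c(1) i] by simp
qed

lemma co_eq_dp:
  assumes f: "f \<in> carrier A" and l: "set_mset l \<subseteq> {..<d}" "size l \<le> n"
  shows "co l (\<Theta> n f) = dp l f"
  using l(2)
proof (induction n rule: dec_induct)
  case base show ?case by (simp add: dp_def)
next
  case (step n) then show ?case using f l(1) by (simp add: co_step(1))
qed

lemma dp_dp:
  assumes "f \<in> carrier A" "set_mset l \<subseteq> {..<d}" "i < d"
  shows "dp {#i#} (dp l f) = Qn i (Suc (count l i)) \<otimes> dp (add_mset i l) f"
  using co_step(2)[OF assms(1,2) order_refl assms(3)] by (simp add: dp_def)

lemma dp_add:
  assumes "f \<in> carrier A" "g \<in> carrier A" "set_mset k \<subseteq> {..<d}"
  shows "dp k (f \<oplus> g) = dp k f \<oplus> dp k g"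
proof -
  interpret X: taylor_step A d \<sigma> x Q \<Theta> "size k" by unfold_locales
  have "k \<in> X.Pm.K" using assms by (simp add: X.Pm.K_def)
  then show ?thesis unfolding dp_def using assms by (simp add: X.Pm.cf_add)
qed

lemma dp_closed:
  assumes "f \<in> carrier A" "set_mset k \<subseteq> {..<d}"
  shows "dp k f \<in> carrier A"
proof -
  interpret X: taylor_step A d \<sigma> x Q \<Theta> "size k" by unfold_locales
  have "k \<in> X.Pm.K" using assms by (simp add: X.Pm.K_def)
  then show ?thesis unfolding dp_def using assms by simp
qed

lemma dp_const:
  assumes c: "c \<in> carrier A" "\<And>n. \<Theta> n c = pp_const A d \<sigma> x n c" and f: "f \<in> carrier A" "set_mset k \<subseteq> {..<d}"
  shows "dp k (c \<otimes> f) = c \<otimes> dp k f"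
proof -
  interpret X: taylor_step A d \<sigma> x Q \<Theta> "size k" by unfold_locales
  have "k \<in> X.Pm.K" using f by (simp add: X.Pm.K_def)
  then show ?thesis unfolding dp_def using f c(1) by (simp add: c(2) X.Pm.cf_const_mult)
qed

lemma dp_empty: "f \<in> carrier A \<Longrightarrow> dp {#} f = f"
proof -
  assume f: "f \<in> carrier A"
  interpret X: taylor_step A d \<sigma> x Q \<Theta> 0 by unfold_locales
  show ?thesis using X.Pm.pp_proj_cf[of "\<Theta> 0 f"] Theta_proj[OF f, of 0] f by (simp add: dp_def)
qed

context
  fixes n :: nat
begin

interpretation X: taylor_step A d \<sigma> x Q \<Theta> n by unfold_locales

text \<open>In order one \<xi>_j kills \<xi>_i for i \<noteq> j, and \<xi>_j^2 = (q_j x_j - x_j)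
  \<xi>_j.\<close>

lemma px_mult:
  assumes "Y \<in> carrier X.P1.P" and j: "j < d"
  shows "X.P1.px j \<otimes>\<^bsub>X.P1.P\<^esub> Y =
    X.P1.pc (co {#} Y \<oplus> (Q j \<otimes> x j \<ominus> x j) \<otimes> co {#j#} Y) \<otimes>\<^bsub>X.P1.P\<^esub> X.P1.px j"
  using assms(1)
proof (induction rule: X.P1.pp_induct)
  case (basis a k)
  have jK: "{#j#} \<in> X.P1.K" using j by (simp add: X.P1.K_def)
  have kd: "set_mset k \<subseteq> {..<d}" using basis by (simp add: X.P1.K_def)
  have cf: "co {#} (X.P1.pc a \<otimes>\<^bsub>X.P1.P\<^esub> X.P1.Xi k) = (if k = {#} then a else \<zero>)"
    "co {#j#} (X.P1.pc a \<otimes>\<^bsub>X.P1.P\<^esub> X.P1.Xi k) = (if k = {#j#} then a else \<zero>)"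
    using basis kd jK X.P1.cf_Xi[OF X.P1.empty_K kd] X.P1.cf_Xi[OF jK kd]
    by (simp_all add: X.P1.cf_const_mult del: X.P1.cf_cl)
  have "k = {#} \<or> (\<exists>i<d. k = {#i#})"
    using basis(2) by (cases k) (auto simp: X.P1.K_def)
  then consider "k = {#}" | i where "i < d" "k = {#i#}" by blast
  then show ?case
  proof cases
    case 1
    then show ?thesis unfolding cf using basis j by (simp add: X.P1.Xi_empty x_closed X.P1.P.m_comm)
  next
    case 2
    show ?thesis
    proof (cases "i = j")
      case True
      have "X.P1.px j \<otimes>\<^bsub>X.P1.P\<^esub> X.P1.px j = X.P1.pc (Q j \<otimes> x j \<ominus> x j) \<otimes>\<^bsub>X.P1.P\<^esub> X.P1.px j"
      proof -
        have "X.P1.px j \<otimes>\<^bsub>X.P1.P\<^esub> X.P1.px j =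
            (X.P1.pc (x j) \<oplus>\<^bsub>X.P1.P\<^esub> X.P1.px j) \<otimes>\<^bsub>X.P1.P\<^esub> X.P1.px j \<ominus>\<^bsub>X.P1.P\<^esub> X.P1.pc (x j) \<otimes>\<^bsub>X.P1.P\<^esub> X.P1.px j"
          using j by (simp add: x_closed X.P1.P.l_distr X.P1.P.add_minus_cancel)
        also have "\<dots> = X.P1.pc (Q j \<otimes> x j \<ominus> x j) \<otimes>\<^bsub>X.P1.P\<^esub> X.P1.px j"
          unfolding X.px1_rel_eq[OF j] using j
          by (simp add: x_closed a_minus_def X.P1.P.l_distr X.P1.P.l_minus)
        finally show ?thesis by (simp del: X.P1.pc.hom_mult)
      qed
      moreover have "X.P1.pc (Q j \<otimes> x j \<ominus> x j) \<in> carrier X.P1.P" using j by (simp add: x_closed)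
      ultimately have "X.P1.px j \<otimes>\<^bsub>X.P1.P\<^esub> (X.P1.pc a \<otimes>\<^bsub>X.P1.P\<^esub> X.P1.px j) =
          (X.P1.pc (Q j \<otimes> x j \<ominus> x j) \<otimes>\<^bsub>X.P1.P\<^esub> X.P1.pc a) \<otimes>\<^bsub>X.P1.P\<^esub> X.P1.px j"
        using basis j by (simp only: X.P1.P.m_lcomm[of "X.P1.px j"] X.P1.px_closed X.P1.pc.hom_closed
            X.P1.P.m_assoc X.P1.P.m_lcomm)
      then show ?thesis unfolding cf using basis j True 2
        by (simp add: X.P1.Xi_single x_closed)
    next
      case False
      then show ?thesis unfolding cf using basis j 2 X.px1_rel_neq[of j i]
        by (simp add: X.P1.Xi_single x_closed X.P1.P.m_lcomm[of "X.P1.px j"])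
    qed
  qed
next
  case (add X Y)
  have jK: "{#j#} \<in> X.P1.K" using j by (simp add: X.P1.K_def)
  then have c: "co {#} X \<in> carrier A" "co {#} Y \<in> carrier A" "co {#j#} X \<in> carrier A" "co {#j#} Y \<in> carrier A"
    using add by simp_all
  then show ?case using add j jK
    by (simp add: X.P1.cf_add X.P1.P.r_distr x_closed X.P1.P.l_distr r_distr X.P1.P.a_ac)
qed

text \<open>By additivity X is a scalar times 1 or times some \<xi>_j, and the latter case is
  \<open>px_mult\<close>. For Y = \<Theta>(g) in classical coordinates the bracket is
  \<sigma>_i(g).\<close>

lemma co_mult:
  assumes "X \<in> carrier X.P1.P" and Y: "Y \<in> carrier X.P1.P" and i: "i < d"
  shows "co {#i#} (X \<otimes>\<^bsub>X.P1.P\<^esub> Y) = co {#} X \<otimes> co {#i#} Y \<oplus>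
    co {#i#} X \<otimes> (co {#} Y \<oplus> (Q i \<otimes> x i \<ominus> x i) \<otimes> co {#i#} Y)"
  using assms(1)
proof (induction rule: X.P1.pp_induct)
  case (basis a k)
  have iK: "{#i#} \<in> X.P1.K" using i by (simp add: X.P1.K_def)
  have kd: "set_mset k \<subseteq> {..<d}" using basis by (simp add: X.P1.K_def)
  have c: "co {#} Y \<in> carrier A" "co {#i#} Y \<in> carrier A" using Y iK by simp_all
  have cf: "co {#} (X.P1.pc a \<otimes>\<^bsub>X.P1.P\<^esub> X.P1.Xi k) = (if k = {#} then a else \<zero>)"
    "co {#i#} (X.P1.pc a \<otimes>\<^bsub>X.P1.P\<^esub> X.P1.Xi k) = (if k = {#i#} then a else \<zero>)"
    using basis kd iK X.P1.cf_Xi[OF X.P1.empty_K kd] X.P1.cf_Xi[OF iK kd]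
    by (simp_all add: X.P1.cf_const_mult del: X.P1.cf_cl)
  have "k = {#} \<or> (\<exists>i<d. k = {#i#})"
    using basis(2) by (cases k) (auto simp: X.P1.K_def)
  then consider "k = {#}" | j where "j < d" "k = {#j#}" by blast
  then show ?case
  proof cases
    case 1
    then show ?thesis unfolding cf using basis c i iK Y by (simp add: X.P1.Xi_empty x_closed X.P1.cf_const_mult)
  next
    case 2
    have jK: "{#j#} \<in> X.P1.K" using 2 by (simp add: X.P1.K_def)
    have cj: "co {#j#} Y \<in> carrier A" using Y jK by simp
    let ?b = "co {#} Y \<oplus> (Q j \<otimes> x j \<ominus> x j) \<otimes> co {#j#} Y"
    have b: "?b \<in> carrier A" using c cj 2 by (simp add: x_closed)
    have "X.P1.pc a \<otimes>\<^bsub>X.P1.P\<^esub> X.P1.Xi k \<otimes>\<^bsub>X.P1.P\<^esub> Y = X.P1.pc (a \<otimes> ?b) \<otimes>\<^bsub>X.P1.P\<^esub> X.P1.px j"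
      using 2 basis Y b px_mult[OF Y 2(1)] by (simp add: X.P1.Xi_single X.P1.P.m_assoc del: X.P1.pc.hom_add)
    moreover have "co {#i#} (X.P1.pc (a \<otimes> ?b) \<otimes>\<^bsub>X.P1.P\<^esub> X.P1.px j) = (if i = j then a \<otimes> ?b else \<zero>)"
      using X.P1.cf_const_mult[of "X.P1.px j" "a \<otimes> ?b" "{#i#}"] X.P1.cf_Xi[OF iK, of "{#j#}"] 2 basis b iK
      by (simp add: X.P1.Xi_single del: X.P1.pc.hom_add X.P1.pc.hom_mult)
    ultimately show ?thesis unfolding cf using 2 basis c i by (simp add: x_closed)
  qed
next
  case (add X X')
  have iK: "{#i#} \<in> X.P1.K" using i by (simp add: X.P1.K_def)
  then have c: "co {#} X \<in> carrier A" "co {#} X' \<in> carrier A" "co {#i#} X \<in> carrier A" "co {#i#} X' \<in> carrier A"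
    "co {#} Y \<in> carrier A" "co {#i#} Y \<in> carrier A"
    using add Y by simp_all
  then show ?case using add i iK Y
    by (simp add: X.P1.cf_add X.P1.P.l_distr x_closed l_distr a_ac)
qed

lemma dp_mult:
  assumes f: "f \<in> carrier A" and g: "g \<in> carrier A" and i: "i < d"
  shows "dp {#i#} (f \<otimes> g) = f \<otimes> dp {#i#} g \<oplus> dp {#i#} f \<otimes> (g \<oplus> (Q i \<otimes> x i \<ominus> x i) \<otimes> dp {#i#} g)"
proof -
  have "dp {#i#} (f \<otimes> g) = co {#i#} (\<Theta> (Suc 0) f \<otimes>\<^bsub>X.P1.P\<^esub> \<Theta> (Suc 0) g)"
    using f g by (simp add: dp_def)
  also have "\<dots> = co {#} (\<Theta> (Suc 0) f) \<otimes> co {#i#} (\<Theta> (Suc 0) g) \<oplus>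
    co {#i#} (\<Theta> (Suc 0) f) \<otimes> (co {#} (\<Theta> (Suc 0) g) \<oplus> (Q i \<otimes> x i \<ominus> x i) \<otimes> co {#i#} (\<Theta> (Suc 0) g))"
    using f g i by (intro co_mult) simp_all
  finally show ?thesis
    using co_eq_dp[OF f, of "{#}" "Suc 0"] co_eq_dp[OF g, of "{#}" "Suc 0"]
      co_eq_dp[OF f, of "{#i#}" "Suc 0"] co_eq_dp[OF g, of "{#i#}" "Suc 0"] f g i
    by (simp add: dp_empty)
qed

text \<open>The A-linear functional with value a_k on \<xi>^(k) vanishes on \<Theta>_n(A) by
  hypothesis. Since \<xi>_i \<Theta>(g) = \<Theta>(x_i g) - x_i \<Theta>(g), it vanishes on every
  polynomial class times \<Theta>(g), and for g = 1 in particular on \<xi>^(k).\<close>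

lemma dp_independent:
  assumes a: "\<And>k. k \<in> X.Pm.K \<Longrightarrow> a k \<in> carrier A"
    and z: "\<And>g. g \<in> carrier A \<Longrightarrow> (\<Oplus>k\<in>X.Pm.K. a k \<otimes> dp k g) = \<zero>"
    and k: "k \<in> X.Pm.K"
  shows "a k = \<zero>"
proof -
  define \<psi> where "\<psi> X = (\<Oplus>k\<in>X.Pm.K. a k \<otimes> co k X)" for X
  have closed: "\<psi> X \<in> carrier A" if "X \<in> carrier X.Pm.P" for X
    unfolding \<psi>_def using a that by (intro finsum_closed) auto
  have psi_add: "\<psi> (X \<oplus>\<^bsub>X.Pm.P\<^esub> Y) = \<psi> X \<oplus> \<psi> Y" if "X \<in> carrier X.Pm.P" "Y \<in> carrier X.Pm.P" for X Y
  proof -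
    have "\<psi> (X \<oplus>\<^bsub>X.Pm.P\<^esub> Y) = (\<Oplus>k\<in>X.Pm.K. a k \<otimes> co k X \<oplus> a k \<otimes> co k Y)"
      unfolding \<psi>_def using a that by (intro finsum_cong') (auto simp: X.Pm.cf_add r_distr)
    also have "\<dots> = \<psi> X \<oplus> \<psi> Y"
      unfolding \<psi>_def using a that by (intro finsum_addf) auto
    finally show ?thesis .
  qed
  have lin: "\<psi> (X.Pm.pc b \<otimes>\<^bsub>X.Pm.P\<^esub> X) = b \<otimes> \<psi> X" if b: "b \<in> carrier A" and X: "X \<in> carrier X.Pm.P" for b X
  proof -
    have "\<psi> (X.Pm.pc b \<otimes>\<^bsub>X.Pm.P\<^esub> X) = (\<Oplus>k\<in>X.Pm.K. b \<otimes> (a k \<otimes> co k X))"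
      unfolding \<psi>_def using a that by (intro finsum_cong') (auto simp: X.Pm.cf_const_mult m_lcomm)
    also have "\<dots> = b \<otimes> \<psi> X"
      unfolding \<psi>_def using a that by (intro finsum_rdistr[symmetric]) auto
    finally show ?thesis .
  qed
  have zero: "\<psi> (\<Theta> n g) = \<zero>" if g: "g \<in> carrier A" for g
  proof -
    have "\<psi> (\<Theta> n g) = (\<Oplus>k\<in>X.Pm.K. a k \<otimes> dp k g)"
      unfolding \<psi>_def using a g co_eq_dp[OF g]
      by (intro finsum_cong') (auto simp: X.Pm.K_def dp_closed)
    then show ?thesis using z[OF g] by simp
  qed
  \<comment> \<open>The quantifier over \<open>g\<close> belongs to the induction claim: the case of
    \<xi>_i applies the hypothesis both to g and to x_i g.\<close>
  have all: "\<forall>g\<in>carrier A. \<psi> (X.Pm.cl p \<otimes>\<^bsub>X.Pm.P\<^esub> \<Theta> n g) = \<zero>" if "p \<in> carrier S" for p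
    using that
  proof (induction rule: poly_induct)
    case (const c)
    then show ?case using lin zero by (simp flip: pp_const_def)
  next
    case (add p r)
    then have "X.Pm.cl (p \<oplus>\<^bsub>S\<^esub> r) = X.Pm.cl p \<oplus>\<^bsub>X.Pm.P\<^esub> X.Pm.cl r" "X.Pm.cl p \<in> carrier X.Pm.P" "X.Pm.cl r \<in> carrier X.Pm.P"
      using X.Pm.cl.hom_add[of p r] by (simp_all add: T_sel)
    then show ?case using add psi_add by (simp add: X.Pm.P.l_distr)
  next
    case (mult i p)
    then have i: "i < d" and p: "X.Pm.cl (mpoly_var A i \<otimes>\<^bsub>S\<^esub> p) = X.Pm.px i \<otimes>\<^bsub>X.Pm.P\<^esub> X.Pm.cl p" "X.Pm.cl p \<in> carrier X.Pm.P"
      using X.Pm.cl.hom_mult[of "mpoly_var A i" p] by (simp_all add: T_sel pp_xi_def)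
    show ?case
    proof
      fix g assume g: "g \<in> carrier A"
      let ?Y = "X.Pm.cl p \<otimes>\<^bsub>X.Pm.P\<^esub> \<Theta> n g"
      have Y: "?Y \<in> carrier X.Pm.P" using p g by simp
      have "X.Pm.px i \<otimes>\<^bsub>X.Pm.P\<^esub> ?Y \<oplus>\<^bsub>X.Pm.P\<^esub> X.Pm.pc (x i) \<otimes>\<^bsub>X.Pm.P\<^esub> ?Y = X.Pm.cl p \<otimes>\<^bsub>X.Pm.P\<^esub> \<Theta> n (x i \<otimes> g)"
        using p g i Theta_x[OF i, of n] by (simp add: x_closed X.Pm.P.l_distr X.Pm.P.r_distr X.Pm.P.m_ac X.Pm.P.a_ac)
      then have "\<psi> (X.Pm.px i \<otimes>\<^bsub>X.Pm.P\<^esub> ?Y) \<oplus> \<psi> (X.Pm.pc (x i) \<otimes>\<^bsub>X.Pm.P\<^esub> ?Y) = \<psi> (X.Pm.cl p \<otimes>\<^bsub>X.Pm.P\<^esub> \<Theta> n (x i \<otimes> g))"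
        using psi_add[of "X.Pm.px i \<otimes>\<^bsub>X.Pm.P\<^esub> ?Y" "X.Pm.pc (x i) \<otimes>\<^bsub>X.Pm.P\<^esub> ?Y"] Y i by (simp add: x_closed)
      moreover have "\<psi> (X.Pm.cl p \<otimes>\<^bsub>X.Pm.P\<^esub> \<Theta> n (x i \<otimes> g)) = \<zero>" using mult g i m_closed[OF x_closed[OF i] g] by blast
      moreover have "\<psi> (X.Pm.pc (x i) \<otimes>\<^bsub>X.Pm.P\<^esub> ?Y) = \<zero>"
        using lin[OF x_closed[OF i] Y] mult g i by (simp add: x_closed)
      ultimately have "\<psi> (X.Pm.px i \<otimes>\<^bsub>X.Pm.P\<^esub> ?Y) = \<zero>" using closed[of "X.Pm.px i \<otimes>\<^bsub>X.Pm.P\<^esub> ?Y"] i Y by simp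
      then show "\<psi> (X.Pm.cl (mpoly_var A i \<otimes>\<^bsub>S\<^esub> p) \<otimes>\<^bsub>X.Pm.P\<^esub> \<Theta> n g) = \<zero>"
        using p i g by (simp add: X.Pm.P.m_assoc)
    qed
  qed
  have "\<psi> (X.Pm.Xi k) = \<zero>"
    using bspec[OF all[OF X.Pm.in_S[OF xip_closed]] one_closed, of k] by simp
  moreover have "\<psi> (X.Pm.Xi k) = (\<Oplus>l\<in>X.Pm.K. if k = l then a l else \<zero>)"
    unfolding \<psi>_def using a k
    by (intro finsum_cong') (auto simp: X.Pm.cf_Xi X.Pm.K_def simp del: X.Pm.cf_cl)
  moreover have "\<dots> = a k" using finsum_singleton[of k X.Pm.K a] a k by simp
  ultimately show ?thesis by simp
qed

end

end

section \<open>Rings of twisted differential operators\<close>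

definition multi_indices :: "nat \<Rightarrow> nat \<Rightarrow> nat multiset set" where
  "multi_indices d n = {k. set_mset k \<subseteq> {..<d} \<and> size k \<le> n}"

text \<open>Scalars that commute with the \<partial>_i and \<sigma>_i. Elements coming from R are of
  this kind, in particular the inverses of the q-numbers.\<close>

definition twisted_constants ::
    "('a, 'z) ring_scheme \<Rightarrow> nat \<Rightarrow> (nat multiset \<Rightarrow> 'a \<Rightarrow> 'a) \<Rightarrow> (nat \<Rightarrow> 'a \<Rightarrow> 'a) \<Rightarrow> 'a set" where
  "twisted_constants A d dp sg = {c \<in> carrier A. \<forall>j<d. dp {#j#} c = \<zero>\<^bsub>A\<^esub> \<and> sg j c = c}"

text \<open>
  The operators \<open>dp k\<close> play the role of the twisted divided powers \<open>\<partial>\<^sup>[\<^sup>k\<^sup>]\<close>, and \<open>qn i n\<close> that of the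
  \<open>q\<^sub>i\<close>-number of \<open>n\<close>.
\<close>

locale twisted_divided_powers = cring A
  for A :: "('a, 'z) ring_scheme" (structure) +
  fixes d :: nat and dp :: "nat multiset \<Rightarrow> 'a \<Rightarrow> 'a" and sg :: "nat \<Rightarrow> 'a \<Rightarrow> 'a" and qn :: "nat \<Rightarrow> nat \<Rightarrow> 'a"
  assumes dp_closed: "f \<in> carrier A \<Longrightarrow> set_mset k \<subseteq> {..<d} \<Longrightarrow> dp k f \<in> carrier A"
    and dp_add: "f \<in> carrier A \<Longrightarrow> g \<in> carrier A \<Longrightarrow> set_mset k \<subseteq> {..<d} \<Longrightarrow> dp k (f \<oplus> g) = dp k f \<oplus> dp k g"
    and dp_empty: "f \<in> carrier A \<Longrightarrow> dp {#} f = f"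
    and sg_hom: "i < d \<Longrightarrow> sg i \<in> ring_hom A A"
    and dp_mult: "f \<in> carrier A \<Longrightarrow> g \<in> carrier A \<Longrightarrow> i < d \<Longrightarrow>
      dp {#i#} (f \<otimes> g) = dp {#i#} f \<otimes> g \<oplus> sg i f \<otimes> dp {#i#} g"
    and dp_dp: "f \<in> carrier A \<Longrightarrow> set_mset k \<subseteq> {..<d} \<Longrightarrow> i < d \<Longrightarrow>
      dp {#i#} (dp k f) = qn i (Suc (count k i)) \<otimes> dp (add_mset i k) f"
    and qn_closed: "i < d \<Longrightarrow> qn i n \<in> carrier A"
    and qn_one: "i < d \<Longrightarrow> qn i (Suc 0) = \<one>"
    and qn_inv: "i < d \<Longrightarrow> \<exists>v\<in>twisted_constants A d dp sg. qn i (Suc n) \<otimes> v = \<one>"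
    and independent: "(\<And>k. k \<in> multi_indices d n \<Longrightarrow> a k \<in> carrier A) \<Longrightarrow>
      (\<And>g. g \<in> carrier A \<Longrightarrow> (\<Oplus>k\<in>multi_indices d n. a k \<otimes> dp k g) = \<zero>) \<Longrightarrow> k \<in> multi_indices d n \<Longrightarrow> a k = \<zero>"
begin

abbreviation C where "C \<equiv> twisted_constants A d dp sg"
abbreviation K where "K \<equiv> multi_indices d"

lemmas C_def = twisted_constants_def and K_def = multi_indices_def

lemma finite_K [simp]: "finite (K n)"
proof (rule finite_subset)
  show "K n \<subseteq> (\<Union>n\<le>n. multisets_of_size {..<d} n)" by (auto simp: multisets_of_size_def K_def)
qed auto

lemma K_mono: "n \<le> m \<Longrightarrow> K n \<subseteq> K m"
  by (auto simp: K_def)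

lemma K_set: "k \<in> K n \<Longrightarrow> set_mset k \<subseteq> {..<d}"
  by (simp add: K_def)

definition opr :: "(nat multiset \<Rightarrow> 'a) \<Rightarrow> nat multiset set \<Rightarrow> 'a \<Rightarrow> 'a" where
  "opr a F = (\<lambda>g\<in>carrier A. \<Oplus>k\<in>F. a k \<otimes> dp k g)"

text \<open>Each operator is a sum over a full set \<open>K n\<close>, so two of them can be
  compared after padding the coefficients with zeros.\<close>

definition DO :: "('a \<Rightarrow> 'a) set" where
  "DO = {opr a (K n) | a n. \<forall>k\<in>K n. a k \<in> carrier A}"

definition padd :: "('a \<Rightarrow> 'a) \<Rightarrow> ('a \<Rightarrow> 'a) \<Rightarrow> 'a \<Rightarrow> 'a" where
  "padd f g = (\<lambda>x\<in>carrier A. f x \<oplus> g x)"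

definition psm :: "'a \<Rightarrow> ('a \<Rightarrow> 'a) \<Rightarrow> 'a \<Rightarrow> 'a" where
  "psm a f = (\<lambda>x\<in>carrier A. a \<otimes> f x)"

definition Rdp :: "nat multiset \<Rightarrow> 'a \<Rightarrow> 'a" where
  "Rdp k = restrict (dp k) (carrier A)"

abbreviation cmp where "cmp \<equiv> compose (carrier A)"

definition idA :: "'a \<Rightarrow> 'a" where "idA = (\<lambda>x\<in>carrier A. x)"
definition zeroA :: "'a \<Rightarrow> 'a" where "zeroA = (\<lambda>x\<in>carrier A. \<zero>)"

lemma opr_closed: "F \<subseteq> K n \<Longrightarrow> (\<And>k. k \<in> F \<Longrightarrow> a k \<in> carrier A) \<Longrightarrow> g \<in> carrier A \<Longrightarrow> opr a F g \<in> carrier A"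
  unfolding opr_def by (auto intro!: finsum_closed dp_closed dest: subsetD K_set)

lemma opr_extend:
  assumes "n \<le> m" "\<And>k. k \<in> K n \<Longrightarrow> a k \<in> carrier A"
  shows "opr a (K n) = opr (\<lambda>k. if k \<in> K n then a k else \<zero>) (K m)"
  unfolding opr_def
proof (rule restrict_ext)
  fix g assume g: "g \<in> carrier A"
  show "(\<Oplus>k\<in>K n. a k \<otimes> dp k g) = (\<Oplus>k\<in>K m. (if k \<in> K n then a k else \<zero>) \<otimes> dp k g)"
    using assms(2) K_mono[OF assms(1)] dp_closed[OF g K_set[of _ m]]
    by (intro add.finprod_mono_neutral_cong_left) auto
qed

lemma DO_pairE:
  assumes "f \<in> DO" "g \<in> DO"
  obtains a b n where "f = opr a (K n)" "g = opr b (K n)" "\<And>k. k \<in> K n \<Longrightarrow> a k \<in> carrier A" "\<And>k. k \<in> K n \<Longrightarrow> b k \<in> carrier A"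
proof -
  obtain a n b m where *: "f = opr a (K n)" "\<And>k. k \<in> K n \<Longrightarrow> a k \<in> carrier A"
    "g = opr b (K m)" "\<And>k. k \<in> K m \<Longrightarrow> b k \<in> carrier A"
    using assms unfolding DO_def by blast
  show thesis
    by (rule that[of "\<lambda>k. if k \<in> K n then a k else \<zero>" "max n m" "\<lambda>k. if k \<in> K m then b k else \<zero>"])
      (use * opr_extend[of n "max n m" a] opr_extend[of m "max n m" b] in simp_all)
qed

lemma DO_closed [simp]: "f \<in> DO \<Longrightarrow> g \<in> carrier A \<Longrightarrow> f g \<in> carrier A"
  unfolding DO_def using opr_closed[OF order_refl] by blast

lemma DO_ext: "f \<in> DO \<Longrightarrow> f \<in> extensional (carrier A)"
  unfolding DO_def opr_def by auto

lemma DO_eqI: "f \<in> DO \<Longrightarrow> f' \<in> DO \<Longrightarrow> (\<And>g. g \<in> carrier A \<Longrightarrow> f g = f' g) \<Longrightarrow> f = f'"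
  using extensionalityI[OF DO_ext DO_ext] by blast

lemma opr_padd:
  assumes "\<And>k. k \<in> K n \<Longrightarrow> a k \<in> carrier A" "\<And>k. k \<in> K n \<Longrightarrow> b k \<in> carrier A"
  shows "padd (opr a (K n)) (opr b (K n)) = opr (\<lambda>k. a k \<oplus> b k) (K n)"
  unfolding padd_def opr_def
proof (rule restrict_ext)
  fix g assume g: "g \<in> carrier A"
  have "(\<Oplus>k\<in>K n. (a k \<oplus> b k) \<otimes> dp k g) = (\<Oplus>k\<in>K n. a k \<otimes> dp k g \<oplus> b k \<otimes> dp k g)"
    using assms g by (intro finsum_cong') (auto simp: l_distr dp_closed K_set)
  also have "\<dots> = (\<Oplus>k\<in>K n. a k \<otimes> dp k g) \<oplus> (\<Oplus>k\<in>K n. b k \<otimes> dp k g)"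
    using assms g by (intro finsum_addf) (auto simp: dp_closed K_set)
  finally show "(\<lambda>g\<in>carrier A. \<Oplus>k\<in>K n. a k \<otimes> dp k g) g \<oplus> (\<lambda>g\<in>carrier A. \<Oplus>k\<in>K n. b k \<otimes> dp k g) g =
      (\<Oplus>k\<in>K n. (a k \<oplus> b k) \<otimes> dp k g)" using g by simp
qed

lemma opr_psm:
  assumes "\<And>k. k \<in> K n \<Longrightarrow> a k \<in> carrier A" "c \<in> carrier A"
  shows "psm c (opr a (K n)) = opr (\<lambda>k. c \<otimes> a k) (K n)"
  unfolding psm_def opr_def
proof (rule restrict_ext)
  fix g assume g: "g \<in> carrier A"
  have "(\<Oplus>k\<in>K n. (c \<otimes> a k) \<otimes> dp k g) = (\<Oplus>k\<in>K n. c \<otimes> (a k \<otimes> dp k g))"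
    using assms g by (intro finsum_cong') (auto simp: m_assoc dp_closed K_set)
  also have "\<dots> = c \<otimes> (\<Oplus>k\<in>K n. a k \<otimes> dp k g)"
    using assms g by (intro finsum_rdistr[symmetric]) (auto simp: dp_closed K_set)
  finally show "c \<otimes> (\<lambda>g\<in>carrier A. \<Oplus>k\<in>K n. a k \<otimes> dp k g) g =
      (\<Oplus>k\<in>K n. (c \<otimes> a k) \<otimes> dp k g)" using g by simp
qed

lemma DO_padd [simp]:
  assumes "f \<in> DO" "g \<in> DO"
  shows "padd f g \<in> DO"
proof -
  obtain a b n where *: "f = opr a (K n)" "g = opr b (K n)"
    "\<And>k. k \<in> K n \<Longrightarrow> a k \<in> carrier A" "\<And>k. k \<in> K n \<Longrightarrow> b k \<in> carrier A"
    using DO_pairE[OF assms] by metis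
  then show ?thesis
    unfolding DO_def by (intro CollectI exI[of _ "\<lambda>k. a k \<oplus> b k"] exI[of _ n]) (simp add: opr_padd)
qed

lemma DO_psm [simp]:
  assumes "f \<in> DO" "c \<in> carrier A"
  shows "psm c f \<in> DO"
proof -
  obtain a n where "f = opr a (K n)" "\<And>k. k \<in> K n \<Longrightarrow> a k \<in> carrier A"
    using assms(1) unfolding DO_def by blast
  then show ?thesis
    unfolding DO_def using assms(2) by (intro CollectI exI[of _ "\<lambda>k. c \<otimes> a k"] exI[of _ n]) (simp add: opr_psm)
qed

lemma psm_Rdp_opr:
  assumes "a \<in> carrier A" "k \<in> K n"
  shows "psm a (Rdp k) = opr (\<lambda>l. if k = l then a else \<zero>) (K n)"
  unfolding psm_def opr_def
proof (rule restrict_ext)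
  fix g assume g: "g \<in> carrier A"
  have "(\<Oplus>l\<in>K n. (if k = l then a else \<zero>) \<otimes> dp l g) = (\<Oplus>l\<in>K n. if k = l then a \<otimes> dp l g else \<zero>)"
    using assms g by (intro finsum_cong') (auto simp: dp_closed K_set)
  also have "\<dots> = a \<otimes> dp k g"
    using finsum_singleton[of k "K n" "\<lambda>l. a \<otimes> dp l g"] assms g by (auto simp: dp_closed K_set)
  finally show "a \<otimes> Rdp k g = (\<Oplus>l\<in>K n. (if k = l then a else \<zero>) \<otimes> dp l g)" using g by (simp add: Rdp_def)
qed

lemma DO_basis: "a \<in> carrier A \<Longrightarrow> set_mset k \<subseteq> {..<d} \<Longrightarrow> psm a (Rdp k) \<in> DO"
  unfolding DO_def
  by (intro CollectI exI[of _ "\<lambda>l. if k = l then a else \<zero>"] exI[of _ "size k"] conjI psm_Rdp_opr)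
     (auto simp: K_def)

lemma Rdp_psm: "set_mset k \<subseteq> {..<d} \<Longrightarrow> Rdp k = psm \<one> (Rdp k)"
  unfolding psm_def Rdp_def by (intro restrict_ext) (simp add: dp_closed)

lemma DO_Rdp [simp]: "set_mset k \<subseteq> {..<d} \<Longrightarrow> Rdp k \<in> DO"
  using DO_basis[of \<one> k] Rdp_psm[of k] by simp

lemma idA_Rdp: "idA = Rdp {#}"
  unfolding idA_def Rdp_def by (intro restrict_ext) (simp add: dp_empty)

lemma DO_idA [simp]: "idA \<in> DO"
  by (simp add: idA_Rdp)

lemma zeroA_psm: "zeroA = psm \<zero> idA"
  unfolding zeroA_def psm_def idA_def by (intro restrict_ext) simp

lemma DO_zeroA [simp]: "zeroA \<in> DO"
  by (simp add: zeroA_psm)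

lemma DO_induct_basis [consumes 1, case_names basis add]:
  assumes f: "f \<in> DO"
    and b: "\<And>a k. a \<in> carrier A \<Longrightarrow> set_mset k \<subseteq> {..<d} \<Longrightarrow> P (psm a (Rdp k))"
    and p: "\<And>f g. f \<in> DO \<Longrightarrow> g \<in> DO \<Longrightarrow> P f \<Longrightarrow> P g \<Longrightarrow> P (padd f g)"
  shows "P f"
proof -
  obtain a n where a: "f = opr a (K n)" "\<And>k. k \<in> K n \<Longrightarrow> a k \<in> carrier A"
    using f unfolding DO_def by blast
  have "F \<subseteq> K n \<Longrightarrow> opr a F \<in> DO \<and> P (opr a F)" if "finite F" for F
    using that
  proof (induction F rule: finite_induct)
    case empty
    \<comment> \<open>The empty sum is presented as zero times the identity, because the predicate
      is given only on scaled basis operators and their sums.\<close>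
    have "opr a {} = psm \<zero> (Rdp {#})"
      unfolding opr_def psm_def Rdp_def by (intro restrict_ext) (simp add: dp_empty)
    then show ?case using b[of \<zero> "{#}"] DO_basis[of \<zero> "{#}"] by simp
  next
    case (insert k F)
    then have k: "a k \<in> carrier A" "set_mset k \<subseteq> {..<d}" using a(2) K_set by auto
    have "opr a (insert k F) = padd (psm (a k) (Rdp k)) (opr a F)"
      unfolding padd_def
    proof (rule extensionalityI[of _ "carrier A"])
      fix g assume g: "g \<in> carrier A"
      have "(\<lambda>k. a k \<otimes> dp k g) \<in> F \<rightarrow> carrier A"
        using insert.prems g a(2) by (auto intro!: dp_closed m_closed dest: K_set)
      then show "opr a (insert k F) g = (\<lambda>x\<in>carrier A. psm (a k) (Rdp k) x \<oplus> opr a F x) g"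
        using insert.hyps k g by (simp add: opr_def psm_def Rdp_def dp_closed)
    qed (simp_all add: opr_def)
    then show ?case using insert k b p DO_basis by simp
  qed
  from this[OF finite_K order_refl] show ?thesis using a(1) by simp
qed

lemma DO_additive:
  assumes "f \<in> DO" "g \<in> carrier A" "h \<in> carrier A"
  shows "f (g \<oplus> h) = f g \<oplus> f h"
  using assms(1)
proof (induction rule: DO_induct_basis)
  case (basis a k)
  then show ?case using assms by (simp add: psm_def Rdp_def dp_add dp_closed r_distr)
next
  case (add f f')
  then show ?case using assms by (simp add: padd_def a_ac)
qed

definition par :: "nat \<Rightarrow> 'a \<Rightarrow> 'a" where "par i = Rdp {#i#}"

lemma par_DO [simp]: "i < d \<Longrightarrow> par i \<in> DO"
  by (simp add: par_def)

lemma par_apply: "g \<in> carrier A \<Longrightarrow> par i g = dp {#i#} g"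
  by (simp add: par_def Rdp_def)

lemma sg_closed [simp]: "i < d \<Longrightarrow> f \<in> carrier A \<Longrightarrow> sg i f \<in> carrier A"
  using ring_hom_closed[OF sg_hom] by simp

text \<open>The Leibniz rule followed by the composition rule. Both have counterparts on modules,
  which makes the comparison in \<open>Phi_par\<close> possible.\<close>

lemma par_basis:
  assumes "a \<in> carrier A" "set_mset k \<subseteq> {..<d}" "i < d"
  shows "cmp (par i) (psm a (Rdp k)) =
    padd (psm (dp {#i#} a) (Rdp k)) (psm (sg i a \<otimes> qn i (Suc (count k i))) (Rdp (add_mset i k)))"
  unfolding compose_def padd_def psm_def
  using assms by (intro restrict_ext)
    (simp add: Rdp_def par_apply dp_closed dp_mult dp_dp m_assoc qn_closed)

lemma cmp_padd_right:
  assumes "f \<in> DO" "g \<in> DO" "g' \<in> DO"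
  shows "cmp f (padd g g') = padd (cmp f g) (cmp f g')"
  unfolding compose_def padd_def using assms by (intro restrict_ext) (simp add: DO_additive)

lemma cmp_padd_left: "cmp (padd f f') g = padd (cmp f g) (cmp f' g)" if "g \<in> DO"
  unfolding compose_def padd_def using that by (intro restrict_ext) simp

lemma cmp_psm_left: "cmp (psm a f) g = psm a (cmp f g)" if "g \<in> DO"
  unfolding compose_def psm_def using that by (intro restrict_ext) simp

lemma cmp_par_DO [simp]:
  assumes "f \<in> DO" "i < d"
  shows "cmp (par i) f \<in> DO"
  using assms(1)
proof (induction rule: DO_induct_basis)
  case (basis a k)
  then show ?case using assms(2) by (simp add: par_basis DO_basis dp_closed qn_closed)
next
  case (add f f')
  then show ?case using assms(2) by (simp add: cmp_padd_right)
qed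

text \<open>The composition rule divided by the q-number (k_i + 1): here invertibility
  enters.\<close>

lemma Rdp_add:
  assumes "set_mset k \<subseteq> {..<d}" "i < d" "v \<in> carrier A" "qn i (Suc (count k i)) \<otimes> v = \<one>"
  shows "Rdp (add_mset i k) = psm v (cmp (par i) (Rdp k))"
  unfolding psm_def compose_def Rdp_def
proof (rule restrict_ext)
  fix g assume g: "g \<in> carrier A"
  have "v \<otimes> dp {#i#} (dp k g) = (qn i (Suc (count k i)) \<otimes> v) \<otimes> dp (add_mset i k) g"
    using assms(1-3) g by (simp add: dp_dp dp_closed qn_closed m_ac)
  then show "dp (add_mset i k) g = v \<otimes> (\<lambda>x\<in>carrier A. par i (restrict (dp k) (carrier A) x)) g"
    using assms g by (simp add: par_apply dp_closed)
qed

lemma C_closed: "c \<in> C \<Longrightarrow> c \<in> carrier A"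
  by (simp add: C_def)

text \<open>Generation as an induction rule: \<open>Rdp_add\<close> reaches every \<partial>^[k]
  from the identity. Composition occurs only on the left and with a single \<partial>_i, which suits
  proofs by induction on the left factor of a composite.\<close>

lemma DO_induct [consumes 1, case_names id add smult par]:
  assumes f: "f \<in> DO"
    and i: "P idA"
    and p: "\<And>f g. f \<in> DO \<Longrightarrow> g \<in> DO \<Longrightarrow> P f \<Longrightarrow> P g \<Longrightarrow> P (padd f g)"
    and s: "\<And>a f. a \<in> carrier A \<Longrightarrow> f \<in> DO \<Longrightarrow> P f \<Longrightarrow> P (psm a f)"
    and c: "\<And>i f. i < d \<Longrightarrow> f \<in> DO \<Longrightarrow> P f \<Longrightarrow> P (cmp (par i) f)"
  shows "P f"
  using f
proof (induction rule: DO_induct_basis)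
  case (basis a k)
  have "P (Rdp k)" using basis(2)
  proof (induction k)
    case empty then show ?case using i by (simp add: idA_Rdp)
  next
    case (add i k)
    then have k: "set_mset k \<subseteq> {..<d}" "i < d" by simp_all
    obtain v where v: "v \<in> C" "qn i (Suc (count k i)) \<otimes> v = \<one>" using qn_inv[OF k(2)] by blast
    show ?case unfolding Rdp_add[OF k C_closed[OF v(1)] v(2)]
      using k v(1) add by (intro s c) (simp_all add: C_closed)
  qed
  then show ?case using basis s by simp
next
  case (add f g)
  then show ?case using p by blast
qed

lemma cmp_assoc: "h \<in> DO \<Longrightarrow> cmp (cmp f g) h = cmp f (cmp g h)"
  unfolding compose_def by (intro restrict_ext) simp

lemma cmp_idA [simp]: "f \<in> DO \<Longrightarrow> cmp idA f = f" "f \<in> DO \<Longrightarrow> cmp f idA = f"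
  by (rule extensionalityI[OF _ DO_ext]; simp add: compose_def idA_def)+

text \<open>Induction on the left factor spares a formula for the composite of \<partial>^[k] and
  \<partial>^[l].\<close>

lemma cmp_DO [simp]:
  assumes "f \<in> DO" "g \<in> DO"
  shows "cmp f g \<in> DO"
  using assms(1)
proof (induction rule: DO_induct)
  case id then show ?case using assms by simp
next
  case (add f f') then show ?case using assms by (simp add: cmp_padd_left)
next
  case (smult a f) then show ?case using assms by (simp add: cmp_psm_left)
next
  case (par i f) then show ?case using assms by (simp add: cmp_assoc)
qed

definition Dring :: "('a \<Rightarrow> 'a) ring" where
  "Dring = \<lparr>carrier = DO, monoid.mult = cmp, monoid.one = idA, ring.zero = zeroA, ring.add = padd\<rparr>"

lemma Dring_sel [simp]:
  "carrier Dring = DO" "monoid.mult Dring = cmp" "monoid.one Dring = idA" "ring.zero Dring = zeroA" "ring.add Dring = padd"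
  by (simp_all add: Dring_def)

lemma ring_Dring: "ring Dring"
proof (rule ringI)
  show "abelian_group Dring"
  proof (rule abelian_groupI; unfold Dring_sel)
    show "padd (padd f g) h = padd f (padd g h)" if "f \<in> DO" "g \<in> DO" "h \<in> DO" for f g h
      by (rule DO_eqI) (use that in simp_all, use that in \<open>simp add: padd_def a_assoc\<close>)
    show "padd f g = padd g f" if "f \<in> DO" "g \<in> DO" for f g
      by (rule DO_eqI) (use that in simp_all, use that in \<open>simp add: padd_def a_comm\<close>)
    show "padd zeroA f = f" if "f \<in> DO" for f
      by (rule DO_eqI) (use that in simp_all, use that in \<open>simp add: padd_def zeroA_def\<close>)
    show "\<exists>g\<in>DO. padd g f = zeroA" if f: "f \<in> DO" for f
    proof (rule bexI)
      show "psm (\<ominus> \<one>) f \<in> DO" using f by simp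
      then show "padd (psm (\<ominus> \<one>) f) f = zeroA"
        using f by (intro DO_eqI) (simp_all, simp add: padd_def psm_def zeroA_def l_minus l_neg)
    qed
  qed simp_all
  show "monoid Dring"
    by (rule monoidI) (simp_all add: cmp_assoc)
qed (simp_all add: cmp_padd_left cmp_padd_right)

text \<open>The embedding of A into the operators along which their modules become
  A-modules.\<close>

definition mulop :: "'a \<Rightarrow> 'a \<Rightarrow> 'a" where "mulop a = psm a idA"

lemma mulop_DO [simp]: "a \<in> carrier A \<Longrightarrow> mulop a \<in> DO"
  by (simp add: mulop_def)

lemma mulop_apply: "g \<in> carrier A \<Longrightarrow> mulop a g = a \<otimes> g"
  by (simp add: mulop_def psm_def idA_def)

lemma psm_mulop: "f \<in> DO \<Longrightarrow> psm a f = cmp (mulop a) f"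
  by (simp add: mulop_def cmp_psm_left)

lemma mulop_add: "a \<in> carrier A \<Longrightarrow> b \<in> carrier A \<Longrightarrow> mulop (a \<oplus> b) = padd (mulop a) (mulop b)"
  by (rule DO_eqI) (simp_all, simp add: mulop_apply padd_def l_distr)

lemma mulop_mult: "a \<in> carrier A \<Longrightarrow> b \<in> carrier A \<Longrightarrow> mulop (a \<otimes> b) = cmp (mulop a) (mulop b)"
  by (rule DO_eqI) (simp_all, simp add: mulop_apply compose_def m_assoc)

lemma mulop_one: "mulop \<one> = idA"
  by (rule DO_eqI) (simp_all, simp add: mulop_apply idA_def)

lemma par_mulop:
  assumes "i < d" "a \<in> carrier A"
  shows "cmp (par i) (mulop a) = padd (mulop (dp {#i#} a)) (cmp (mulop (sg i a)) (par i))"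
proof (rule DO_eqI)
  show "cmp (par i) (mulop a) \<in> DO" "padd (mulop (dp {#i#} a)) (cmp (mulop (sg i a)) (par i)) \<in> DO"
    using assms by (simp_all add: dp_closed)
  show "cmp (par i) (mulop a) g = padd (mulop (dp {#i#} a)) (cmp (mulop (sg i a)) (par i)) g"
    if "g \<in> carrier A" for g
    using assms that by (simp add: compose_def padd_def mulop_apply par_apply dp_mult dp_closed)
qed

text \<open>For distinct i and j both composites are \<partial>^[e_i+e_j], the q-number of one being
  1.\<close>

lemma par_comm:
  assumes "i < d" "j < d"
  shows "cmp (par i) (par j) = cmp (par j) (par i)"
proof (cases "i = j")
  case False
  show ?thesis
  proof (rule DO_eqI)
    show "cmp (par i) (par j) g = cmp (par j) (par i) g" if g: "g \<in> carrier A" for g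
      using assms False g dp_dp[OF g, of "{#j#}" i] dp_dp[OF g, of "{#i#}" j]
      by (simp add: compose_def par_apply dp_closed qn_one add_mset_commute)
  qed (use assms in simp_all)
qed simp

end

section \<open>Inverse q-factorials\<close>

context twisted_divided_powers begin

lemma C_mult: "c \<in> C \<Longrightarrow> c' \<in> C \<Longrightarrow> c \<otimes> c' \<in> C"
  unfolding C_def by (simp add: dp_mult ring_hom_mult[OF sg_hom])

text \<open>The Leibniz rule for 1 as a product of 1 and 1 gives \<partial>_j(1) = \<partial>_j(1) +
  \<partial>_j(1).\<close>

lemma C_one: "\<one> \<in> C"
proof -
  have "dp {#j#} \<one> = \<zero>" if j: "j < d" for j
  proof -
    have "dp {#j#} \<one> = dp {#j#} \<one> \<oplus> dp {#j#} \<one>"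
      using dp_mult[of \<one> \<one> j] ring_hom_one[OF sg_hom[OF j]] dp_closed[of \<one> "{#j#}"] j by simp
    then show ?thesis using dp_closed[of \<one> "{#j#}"] j by simp
  qed
  then show ?thesis using ring_hom_one[OF sg_hom] by (simp add: C_def)
qed

text \<open>The inverse is chosen among the constants, so that it commutes with the \<partial>_i.
  The index is shifted: \<open>qinv i n\<close> inverts the q-number of n + 1.\<close>

definition qinv :: "nat \<Rightarrow> nat \<Rightarrow> 'a" where
  "qinv i n = (SOME v. v \<in> C \<and> qn i (Suc n) \<otimes> v = \<one>)"

lemma qinv: assumes "i < d" shows "qinv i n \<in> C" "qn i (Suc n) \<otimes> qinv i n = \<one>"
proof -
  have "\<exists>v. v \<in> C \<and> qn i (Suc n) \<otimes> v = \<one>" using qn_inv[OF assms] by blast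
  from someI_ex[OF this] show "qinv i n \<in> C" "qn i (Suc n) \<otimes> qinv i n = \<one>" unfolding qinv_def by blast+
qed

text \<open>The inverse of the \<open>q\<close>-factorial of the multi-exponent \<open>k\<close>.\<close>

definition ufac :: "nat multiset \<Rightarrow> 'a" where
  "ufac k = (\<Otimes>i\<in>{..<d}. \<Otimes>n\<in>{..<count k i}. qinv i n)"

lemma C_prod: "finite F \<Longrightarrow> (\<And>i. i \<in> F \<Longrightarrow> f i \<in> C) \<Longrightarrow> finprod A f F \<in> C"
proof (induction F rule: finite_induct)
  case empty then show ?case by (simp add: C_one)
next
  case (insert i F)
  then have "f \<in> F \<rightarrow> carrier A" "f i \<in> carrier A" by (auto dest: C_closed)
  then show ?case using insert by (simp add: C_mult)
qed

lemma ufac_C: "ufac k \<in> C"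
  unfolding ufac_def by (intro C_prod) (auto simp: qinv)

lemma ufac_closed [simp]: "ufac k \<in> carrier A"
  by (rule C_closed[OF ufac_C])

lemma ufac_empty: "ufac {#} = \<one>"
  unfolding ufac_def by (intro finprod_one_eqI) simp

lemma ufac_add:
  assumes i: "i < d"
  shows "ufac (add_mset i k) = qinv i (count k i) \<otimes> ufac k"
proof -
  let ?g = "\<lambda>k i. \<Otimes>n\<in>{..<count k i}. qinv i n"
  have d: "{..<d} = insert i ({..<d} - {i})" using i by auto
  have q: "qinv j n \<in> carrier A" if "j < d" for j n using qinv(1)[OF that] by (rule C_closed)
  have gm: "(\<Otimes>n\<in>{..<m}. qinv j n) \<in> carrier A" if "j < d" for j m using that q by (intro finprod_closed) auto
  then have g: "?g k j \<in> carrier A" if "j < d" for j k using that by simp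
  have "ufac (add_mset i k) = ?g (add_mset i k) i \<otimes> (\<Otimes>j\<in>{..<d} - {i}. ?g (add_mset i k) j)"
    unfolding ufac_def using i gm by (subst d, subst finprod_insert) auto
  also have "(\<Otimes>j\<in>{..<d} - {i}. ?g (add_mset i k) j) = (\<Otimes>j\<in>{..<d} - {i}. ?g k j)"
    using i q by (intro finprod_cong') auto
  also have "?g (add_mset i k) i = qinv i (count k i) \<otimes> ?g k i"
    using i q by (simp add: lessThan_Suc Pi_def)
  finally have "ufac (add_mset i k) = qinv i (count k i) \<otimes> (?g k i \<otimes> (\<Otimes>j\<in>{..<d} - {i}. ?g k j))"
    using i g q by (simp add: m_assoc Pi_def)
  also have "?g k i \<otimes> (\<Otimes>j\<in>{..<d} - {i}. ?g k j) = ufac k"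
    unfolding ufac_def using i g by (subst (2) d, subst finprod_insert) auto
  finally show ?thesis .
qed

lemma qn_ufac:
  assumes "i < d"
  shows "qn i (Suc (count k i)) \<otimes> ufac (add_mset i k) = ufac k"
  using assms qinv[OF assms, of "count k i"]
  by (simp add: ufac_add C_closed qn_closed m_assoc[symmetric])

end

section \<open>From commuting twisted derivations to modules over the operators\<close>

locale twisted_module = twisted_divided_powers A d dp sg qn + M: Module.module A M
  for A :: "('a, 'z) ring_scheme" (structure) and d dp sg qn and M :: "('a, 'm) module" +
  fixes pd :: "nat \<Rightarrow> 'm \<Rightarrow> 'm"
  assumes pd_closed: "i < d \<Longrightarrow> s \<in> carrier M \<Longrightarrow> pd i s \<in> carrier M"
    and pd_add: "i < d \<Longrightarrow> s \<in> carrier M \<Longrightarrow> t \<in> carrier M \<Longrightarrow> pd i (s \<oplus>\<^bsub>M\<^esub> t) = pd i s \<oplus>\<^bsub>M\<^esub> pd i t"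
    and pd_smult: "i < d \<Longrightarrow> a \<in> carrier A \<Longrightarrow> s \<in> carrier M \<Longrightarrow>
      pd i (a \<odot>\<^bsub>M\<^esub> s) = dp {#i#} a \<odot>\<^bsub>M\<^esub> s \<oplus>\<^bsub>M\<^esub> sg i a \<odot>\<^bsub>M\<^esub> pd i s"
    and pd_comm: "i < d \<Longrightarrow> j < d \<Longrightarrow> s \<in> carrier M \<Longrightarrow> pd i (pd j s) = pd j (pd i s)"
begin

text \<open>Outside of the carrier the iterates must commute as well for \<open>fold_mset\<close> to be usable.\<close>

definition pdx :: "nat \<Rightarrow> 'm \<Rightarrow> 'm" where
  "pdx i s = (if i < d \<and> s \<in> carrier M then pd i s else s)"

sublocale pdx: comp_fun_commute pdx
  by unfold_locales (auto simp: pdx_def fun_eq_iff pd_closed pd_comm)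

definition pw :: "nat multiset \<Rightarrow> 'm \<Rightarrow> 'm" where "pw k s = fold_mset pdx s k"

lemma pw_empty [simp]: "pw {#} s = s"
  and pw_add: "pw (add_mset i k) s = pdx i (pw k s)"
  by (simp_all add: pw_def)

lemma pdx_closed: "s \<in> carrier M \<Longrightarrow> pdx i s \<in> carrier M"
  by (simp add: pdx_def pd_closed)

lemma pw_closed [simp]: "s \<in> carrier M \<Longrightarrow> pw k s \<in> carrier M"
  by (induction k) (simp_all add: pw_add pdx_closed)

lemma pw_plus: "s \<in> carrier M \<Longrightarrow> t \<in> carrier M \<Longrightarrow> pw k (s \<oplus>\<^bsub>M\<^esub> t) = pw k s \<oplus>\<^bsub>M\<^esub> pw k t"
  by (induction k) (simp_all add: pw_add pdx_def pd_add)

text \<open>The action that \<partial>^[k] is forced to have: iterated derivations divided by the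
  q-factorial of k.\<close>

definition Tm :: "nat multiset \<Rightarrow> 'm \<Rightarrow> 'm" where "Tm k s = ufac k \<odot>\<^bsub>M\<^esub> pw k s"

lemma Tm_closed [simp]: "s \<in> carrier M \<Longrightarrow> Tm k s \<in> carrier M"
  by (simp add: Tm_def)

lemma Tm_plus: "s \<in> carrier M \<Longrightarrow> t \<in> carrier M \<Longrightarrow> Tm k (s \<oplus>\<^bsub>M\<^esub> t) = Tm k s \<oplus>\<^bsub>M\<^esub> Tm k t"
  by (simp add: Tm_def pw_plus M.smult_r_distr)

lemma Tm_empty: "s \<in> carrier M \<Longrightarrow> Tm {#} s = s"
  by (simp add: Tm_def ufac_empty)

lemma pd_const:
  assumes "c \<in> C" "i < d" "s \<in> carrier M"
  shows "pd i (c \<odot>\<^bsub>M\<^esub> s) = c \<odot>\<^bsub>M\<^esub> pd i s"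
  using assms by (simp add: pd_smult C_def pd_closed)

text \<open>The inverse factorial is a constant and passes through \<partial>_i; what is left over
  is a single q-number, exactly as in \<open>dp_dp\<close>.\<close>

lemma pd_Tm:
  assumes "i < d" "s \<in> carrier M"
  shows "pd i (Tm k s) = qn i (Suc (count k i)) \<odot>\<^bsub>M\<^esub> Tm (add_mset i k) s"
proof -
  have "pd i (Tm k s) = ufac k \<odot>\<^bsub>M\<^esub> pd i (pw k s)"
    unfolding Tm_def using assms by (intro pd_const ufac_C) simp_all
  also have "\<dots> = (qn i (Suc (count k i)) \<otimes> ufac (add_mset i k)) \<odot>\<^bsub>M\<^esub> pd i (pw k s)"
    using assms by (simp add: qn_ufac)
  also have "\<dots> = qn i (Suc (count k i)) \<odot>\<^bsub>M\<^esub> Tm (add_mset i k) s"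
    using assms by (simp add: Tm_def pw_add pdx_def pd_closed M.smult_assoc1 qn_closed)
  finally show ?thesis .
qed

definition act :: "(nat multiset \<Rightarrow> 'a) \<Rightarrow> nat multiset set \<Rightarrow> 'm \<Rightarrow> 'm" where
  "act a F s = (\<Oplus>\<^bsub>M\<^esub>k\<in>F. a k \<odot>\<^bsub>M\<^esub> Tm k s)"

lemma act_extend:
  assumes "n \<le> m" "\<And>k. k \<in> K n \<Longrightarrow> a k \<in> carrier A" "s \<in> carrier M"
  shows "act a (K n) s = act (\<lambda>k. if k \<in> K n then a k else \<zero>) (K m) s"
  unfolding act_def using assms K_mono[OF assms(1)]
  by (intro M.add.finprod_mono_neutral_cong_left) (auto simp: M.smult_l_null)

text \<open>Linear independence, applied to the difference of the two coefficient families.\<close>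

lemma opr_zero_coeff:
  assumes "opr a (K n) = opr b (K n)" "\<And>k. k \<in> K n \<Longrightarrow> a k \<in> carrier A" "\<And>k. k \<in> K n \<Longrightarrow> b k \<in> carrier A"
    "k \<in> K n"
  shows "a k = b k"
proof -
  have "a k \<ominus> b k = \<zero>"
  proof (rule independent[of n "\<lambda>k. a k \<ominus> b k"])
    fix g assume g: "g \<in> carrier A"
    have s: "(\<Oplus>k\<in>K n. a k \<otimes> dp k g) \<in> carrier A" "(\<Oplus>k\<in>K n. b k \<otimes> dp k g) \<in> carrier A"
      using assms(2,3) g by (simp_all add: finsum_closed Pi_def dp_closed K_set)
    have eq: "(\<Oplus>k\<in>K n. a k \<otimes> dp k g) = (\<Oplus>k\<in>K n. b k \<otimes> dp k g)"
      using fun_cong[OF assms(1), of g] g by (simp add: opr_def)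
    have "(\<Oplus>k\<in>K n. a k \<otimes> dp k g) = (\<Oplus>k\<in>K n. (a k \<ominus> b k) \<otimes> dp k g \<oplus> b k \<otimes> dp k g)"
      using assms(2,3) g
      by (intro finsum_cong') (auto simp: dp_closed K_set l_distr[symmetric] a_minus_def a_assoc l_neg)
    also have "\<dots> = (\<Oplus>k\<in>K n. (a k \<ominus> b k) \<otimes> dp k g) \<oplus> (\<Oplus>k\<in>K n. b k \<otimes> dp k g)"
      using assms(2,3) g by (intro finsum_addf) (auto simp: dp_closed K_set)
    finally show "(\<Oplus>k\<in>K n. (a k \<ominus> b k) \<otimes> dp k g) = \<zero>"
      using eq s assms(2,3) g add.r_cancel_one'[of "\<Oplus>k\<in>K n. b k \<otimes> dp k g" "\<Oplus>k\<in>K n. (a k \<ominus> b k) \<otimes> dp k g"]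
      by (auto intro!: finsum_closed dp_closed dest: K_set)
  qed (use assms in auto)
  then show ?thesis using assms(2,3)[OF assms(4)] by simp
qed

text \<open>An operator acts through its coefficients. Independence makes these unique up to padding
  by zeros, so the description is meaningful.\<close>

definition Phi :: "('a \<Rightarrow> 'a) \<Rightarrow> 'm \<Rightarrow> 'm" where
  "Phi f s = (THE t. \<exists>a n. (\<forall>k\<in>K n. a k \<in> carrier A) \<and> f = opr a (K n) \<and> t = act a (K n) s)"

lemma Phi_opr:
  assumes a: "\<And>k. k \<in> K n \<Longrightarrow> a k \<in> carrier A" and s: "s \<in> carrier M"
  shows "Phi (opr a (K n)) s = act a (K n) s"
  unfolding Phi_def
proof (rule the_equality)
  show "\<exists>b m. (\<forall>k\<in>K m. b k \<in> carrier A) \<and> opr a (K n) = opr b (K m) \<and> act a (K n) s = act b (K m) s"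
    using a by blast
next
  fix t assume "\<exists>b m. (\<forall>k\<in>K m. b k \<in> carrier A) \<and> opr a (K n) = opr b (K m) \<and> t = act b (K m) s"
  then obtain b m where b: "\<And>k. k \<in> K m \<Longrightarrow> b k \<in> carrier A" "opr a (K n) = opr b (K m)" "t = act b (K m) s"
    by blast
  \<comment> \<open>The two presentations may have different orders, so both are padded to the
    larger one before coefficients are compared.\<close>
  let ?a = "\<lambda>k. if k \<in> K n then a k else \<zero>" and ?b = "\<lambda>k. if k \<in> K m then b k else \<zero>"
  let ?N = "max n m"
  have "opr ?a (K ?N) = opr ?b (K ?N)"
    using opr_extend[of n ?N a] opr_extend[of m ?N b] a b by simp
  then have "?a k = ?b k" if "k \<in> K ?N" for k
    by (rule opr_zero_coeff) (use a b that in auto)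
  then have "act ?a (K ?N) s = act ?b (K ?N) s"
    unfolding act_def using b s by (intro M.finsum_cong') auto
  then show "t = act a (K n) s"
    using act_extend[of n ?N a s] act_extend[of m ?N b s] a b s by simp
qed

lemma act_closed: "(\<And>k. k \<in> F \<Longrightarrow> a k \<in> carrier A) \<Longrightarrow> s \<in> carrier M \<Longrightarrow> act a F s \<in> carrier M"
  unfolding act_def by (intro M.finsum_closed) auto

lemma Phi_closed [simp]: "f \<in> DO \<Longrightarrow> s \<in> carrier M \<Longrightarrow> Phi f s \<in> carrier M"
  unfolding DO_def using Phi_opr act_closed by force

lemma Phi_padd:
  assumes "f \<in> DO" "g \<in> DO" "s \<in> carrier M"
  shows "Phi (padd f g) s = Phi f s \<oplus>\<^bsub>M\<^esub> Phi g s"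
proof -
  obtain a b n where *: "f = opr a (K n)" "g = opr b (K n)"
    "\<And>k. k \<in> K n \<Longrightarrow> a k \<in> carrier A" "\<And>k. k \<in> K n \<Longrightarrow> b k \<in> carrier A"
    using DO_pairE[OF assms(1,2)] by metis
  have "act (\<lambda>k. a k \<oplus> b k) (K n) s = (\<Oplus>\<^bsub>M\<^esub>k\<in>K n. a k \<odot>\<^bsub>M\<^esub> Tm k s \<oplus>\<^bsub>M\<^esub> b k \<odot>\<^bsub>M\<^esub> Tm k s)"
    unfolding act_def using * assms(3) by (intro M.finsum_cong') (auto simp: M.smult_l_distr)
  also have "\<dots> = act a (K n) s \<oplus>\<^bsub>M\<^esub> act b (K n) s"
    unfolding act_def using * assms(3) by (intro M.finsum_addf) auto
  finally have sum: "act (\<lambda>k. a k \<oplus> b k) (K n) s = act a (K n) s \<oplus>\<^bsub>M\<^esub> act b (K n) s" .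
  have "padd f g = opr (\<lambda>k. a k \<oplus> b k) (K n)" using opr_padd[of n a b] * by simp
  then have "Phi (padd f g) s = act (\<lambda>k. a k \<oplus> b k) (K n) s"
    using * assms(3) by (simp only:) (intro Phi_opr, simp_all)
  then show ?thesis using sum * assms(3) by (simp add: Phi_opr)
qed

lemma Phi_basis:
  assumes "a \<in> carrier A" "set_mset k \<subseteq> {..<d}" "s \<in> carrier M"
  shows "Phi (psm a (Rdp k)) s = a \<odot>\<^bsub>M\<^esub> Tm k s"
proof -
  have k: "k \<in> K (size k)" using assms(2) by (simp add: K_def)
  have "act (\<lambda>l. if k = l then a else \<zero>) (K (size k)) s =
      (\<Oplus>\<^bsub>M\<^esub>l\<in>K (size k). if k = l then a \<odot>\<^bsub>M\<^esub> Tm l s else \<zero>\<^bsub>M\<^esub>)"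
    unfolding act_def using assms by (intro M.finsum_cong') (auto simp: M.smult_l_null)
  also have "\<dots> = a \<odot>\<^bsub>M\<^esub> Tm k s"
    using M.finsum_singleton[of k "K (size k)" "\<lambda>l. a \<odot>\<^bsub>M\<^esub> Tm l s"] k assms by auto
  finally show ?thesis
    unfolding psm_Rdp_opr[OF assms(1) k] using assms by (subst Phi_opr) auto
qed

lemma Phi_id: "s \<in> carrier M \<Longrightarrow> Phi idA s = s"
  using Phi_basis[of \<one> "{#}" s] Rdp_psm[of "{#}"] by (simp add: idA_Rdp Tm_empty)

lemma Phi_psm:
  assumes "f \<in> DO" "a \<in> carrier A" "s \<in> carrier M"
  shows "Phi (psm a f) s = a \<odot>\<^bsub>M\<^esub> Phi f s"
  using assms(1)
proof (induction rule: DO_induct_basis)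
  case (basis b k)
  have "psm a (psm b (Rdp k)) = psm (a \<otimes> b) (Rdp k)"
    unfolding psm_def using assms(2) basis by (intro restrict_ext) (simp add: m_assoc)
  then show ?case using assms basis by (simp add: Phi_basis M.smult_assoc1)
next
  case (add f g)
  have "psm a (padd f g) = padd (psm a f) (psm a g)"
    unfolding psm_def padd_def using assms(2) add by (intro restrict_ext) (simp add: r_distr)
  then show ?case using assms add by (simp add: Phi_padd M.smult_r_distr)
qed

text \<open>On a \<partial>^[k] the left side is expanded by \<open>par_basis\<close>, the right
  side by the Leibniz rule on M and \<open>pd_Tm\<close>, with the same two terms.\<close>

lemma Phi_par:
  assumes "f \<in> DO" "i < d" "s \<in> carrier M"
  shows "Phi (cmp (par i) f) s = pd i (Phi f s)"
  using assms(1)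
proof (induction rule: DO_induct_basis)
  case (basis a k)
  then show ?case using assms(2,3)
    by (simp add: par_basis Phi_padd DO_basis dp_closed qn_closed Phi_basis pd_smult pd_Tm M.smult_assoc1)
next
  case (add f g)
  then show ?case using assms by (simp add: cmp_padd_right Phi_padd pd_add)
qed

text \<open>Induction on the left operator; the case of \<partial>_i is \<open>Phi_par\<close>, the
  others are additivity and A-linearity in the operator.\<close>

lemma Phi_cmp:
  assumes "f \<in> DO" "g \<in> DO" "s \<in> carrier M"
  shows "Phi (cmp f g) s = Phi f (Phi g s)"
  using assms(1)
proof (induction rule: DO_induct)
  case id then show ?case using assms by (simp add: Phi_id)
next
  case (add f f') then show ?case using assms by (simp add: cmp_padd_left Phi_padd)
next
  case (smult a f) then show ?case using assms by (simp add: cmp_psm_left Phi_psm)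
next
  case (par i f) then show ?case using assms by (simp add: cmp_assoc Phi_par)
qed

lemma Phi_plus:
  assumes "f \<in> DO" "s \<in> carrier M" "t \<in> carrier M"
  shows "Phi f (s \<oplus>\<^bsub>M\<^esub> t) = Phi f s \<oplus>\<^bsub>M\<^esub> Phi f t"
  using assms(1)
proof (induction rule: DO_induct_basis)
  case (basis a k) then show ?case using assms by (simp add: Phi_basis Tm_plus M.smult_r_distr)
next
  case (add f g) then show ?case using assms by (simp add: Phi_padd M.a_ac)
qed

lemma Phi_mulop: "a \<in> carrier A \<Longrightarrow> s \<in> carrier M \<Longrightarrow> Phi (mulop a) s = a \<odot>\<^bsub>M\<^esub> s"
  by (simp add: mulop_def Phi_psm Phi_id)

lemma Phi_par': "i < d \<Longrightarrow> s \<in> carrier M \<Longrightarrow> Phi (par i) s = pd i s"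
  using Phi_par[of idA i s] by (simp add: Phi_id)

definition dmod :: "('a \<Rightarrow> 'a, 'm) module" where
  "dmod = \<lparr>carrier = carrier M, monoid.mult = monoid.mult M, monoid.one = monoid.one M,
     ring.zero = ring.zero M, ring.add = ring.add M, smult = Phi\<rparr>"

lemma dmod_sel [simp]:
  "carrier dmod = carrier M" "ring.zero dmod = \<zero>\<^bsub>M\<^esub>" "ring.add dmod = ring.add M" "smult dmod = Phi"
  by (simp_all add: dmod_def)

lemma left_module_dmod: "left_module Dring dmod"
proof -
  interpret D: ring Dring by (rule ring_Dring)
  interpret N: abelian_group dmod
    by (rule abelian_groupI) (auto simp: M.a_ac intro: bexI[of _ "\<ominus>\<^bsub>M\<^esub> _"] M.l_neg)
  show ?thesis
    by unfold_locales (simp_all add: Phi_padd Phi_plus Phi_cmp Phi_id)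
qed

end

locale twisted_module_pair =
  M: twisted_module A d dp sg qn M pdM + N: twisted_module A d dp sg qn N pdN
  for A :: "('a, 'z) ring_scheme" (structure) and d dp sg qn
    and M :: "('a, 'm) module" and pdM and N :: "('a, 'm) module" and pdN
begin

text \<open>One direction is \<open>DO_induct\<close>; for the other, the operators
  \<open>mulop a\<close> and \<open>par i\<close> act as the scalars and the derivations one started
  with.\<close>

lemma hom_dmod_iff:
  "h \<in> module_hom A M N \<and> (\<forall>i<d. \<forall>s\<in>carrier M. h (pdM i s) = pdN i (h s)) \<longleftrightarrow>
    h \<in> module_hom M.Dring M.dmod N.dmod"
proof
  assume h: "h \<in> module_hom A M N \<and> (\<forall>i<d. \<forall>s\<in>carrier M. h (pdM i s) = pdN i (h s))"
  then have c: "h \<in> carrier M \<rightarrow>\<^sub>E carrier N"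
    and h_add: "\<And>s t. s \<in> carrier M \<Longrightarrow> t \<in> carrier M \<Longrightarrow> h (s \<oplus>\<^bsub>M\<^esub> t) = h s \<oplus>\<^bsub>N\<^esub> h t"
    and lin: "\<And>a s. a \<in> carrier A \<Longrightarrow> s \<in> carrier M \<Longrightarrow> h (a \<odot>\<^bsub>M\<^esub> s) = a \<odot>\<^bsub>N\<^esub> h s"
    and h_par: "\<And>i s. i < d \<Longrightarrow> s \<in> carrier M \<Longrightarrow> h (pdM i s) = pdN i (h s)"
    by (simp_all add: module_hom_def)
  have hc: "h s \<in> carrier N" if "s \<in> carrier M" for s using c that by auto
  have "\<forall>s\<in>carrier M. h (M.Phi f s) = N.Phi f (h s)" if "f \<in> M.DO" for f
    using that
  proof (induction rule: M.DO_induct)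
    case id then show ?case by (simp add: M.Phi_id N.Phi_id hc)
  next
    case (add f g) then show ?case by (simp add: M.Phi_padd N.Phi_padd hc h_add)
  next
    case (smult a f) then show ?case by (simp add: M.Phi_psm N.Phi_psm hc lin)
  next
    case (par i f) then show ?case by (simp add: M.Phi_par N.Phi_par hc h_par)
  qed
  then show "h \<in> module_hom M.Dring M.dmod N.dmod"
    unfolding module_hom_def using c h_add by simp
next
  assume h: "h \<in> module_hom M.Dring M.dmod N.dmod"
  then have c: "h \<in> carrier M \<rightarrow>\<^sub>E carrier N"
    and h_add: "\<And>s t. s \<in> carrier M \<Longrightarrow> t \<in> carrier M \<Longrightarrow> h (s \<oplus>\<^bsub>M\<^esub> t) = h s \<oplus>\<^bsub>N\<^esub> h t"
    and lin: "\<And>f s. f \<in> M.DO \<Longrightarrow> s \<in> carrier M \<Longrightarrow> h (M.Phi f s) = N.Phi f (h s)"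
    by (simp_all add: module_hom_def)
  have hc: "h s \<in> carrier N" if "s \<in> carrier M" for s using c that by auto
  show "h \<in> module_hom A M N \<and> (\<forall>i<d. \<forall>s\<in>carrier M. h (pdM i s) = pdN i (h s))"
    unfolding module_hom_def
    using c h_add lin[OF M.mulop_DO] lin[OF M.par_DO] hc
    by (simp add: M.Phi_mulop N.Phi_mulop M.Phi_par' N.Phi_par')
qed

end

section \<open>From modules over the operators to twisted derivations\<close>

locale operator_module = twisted_divided_powers A d dp sg qn + N: left_module Dring N
  for A :: "('a, 'z) ring_scheme" (structure) and d dp sg qn and N :: "('a \<Rightarrow> 'a, 'm) module"
begin

definition amod :: "('a, 'm) module" where
  "amod = \<lparr>carrier = carrier N, monoid.mult = monoid.mult N, monoid.one = monoid.one N,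
     ring.zero = ring.zero N, ring.add = ring.add N, smult = (\<lambda>a s. mulop a \<odot>\<^bsub>N\<^esub> s)\<rparr>"

definition apd :: "nat \<Rightarrow> 'm \<Rightarrow> 'm" where "apd i s = par i \<odot>\<^bsub>N\<^esub> s"

lemma amod_sel [simp]:
  "carrier amod = carrier N" "ring.zero amod = \<zero>\<^bsub>N\<^esub>" "ring.add amod = ring.add N"
  "smult amod = (\<lambda>a s. mulop a \<odot>\<^bsub>N\<^esub> s)"
  by (simp_all add: amod_def)

lemma N_simps:
  "f \<in> DO \<Longrightarrow> s \<in> carrier N \<Longrightarrow> f \<odot>\<^bsub>N\<^esub> s \<in> carrier N"
  "f \<in> DO \<Longrightarrow> g \<in> DO \<Longrightarrow> s \<in> carrier N \<Longrightarrow> padd f g \<odot>\<^bsub>N\<^esub> s = f \<odot>\<^bsub>N\<^esub> s \<oplus>\<^bsub>N\<^esub> g \<odot>\<^bsub>N\<^esub> s"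
  "f \<in> DO \<Longrightarrow> s \<in> carrier N \<Longrightarrow> t \<in> carrier N \<Longrightarrow> f \<odot>\<^bsub>N\<^esub> (s \<oplus>\<^bsub>N\<^esub> t) = f \<odot>\<^bsub>N\<^esub> s \<oplus>\<^bsub>N\<^esub> f \<odot>\<^bsub>N\<^esub> t"
  "f \<in> DO \<Longrightarrow> g \<in> DO \<Longrightarrow> s \<in> carrier N \<Longrightarrow> cmp f g \<odot>\<^bsub>N\<^esub> s = f \<odot>\<^bsub>N\<^esub> (g \<odot>\<^bsub>N\<^esub> s)"
  "s \<in> carrier N \<Longrightarrow> idA \<odot>\<^bsub>N\<^esub> s = s"
  using N.smult_closed[of f s] N.smult_l_distr[of f g s] N.smult_r_distr[of f s t] N.smult_assoc[of f g s]
    N.smult_one[of s] by simp_all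

lemma module_amod: "Module.module A amod"
proof (rule moduleI)
  show "abelian_group amod"
    by (rule abelian_groupI) (auto simp: N.a_ac intro: bexI[of _ "\<ominus>\<^bsub>N\<^esub> _"] N.l_neg)
qed (simp_all add: is_cring N_simps mulop_add mulop_mult mulop_one)

text \<open>The relations \<open>par_mulop\<close> and \<open>par_comm\<close> in the ring become
  the Leibniz rule and the commutation of the derivations.\<close>

sublocale TM: twisted_module A d dp sg qn amod apd
proof -
  interpret M: Module.module A amod by (rule module_amod)
  show "twisted_module A d dp sg qn amod apd"
  proof unfold_locales
    fix i a s assume *: "i < d" "a \<in> carrier A" "s \<in> carrier amod"
    have "apd i (a \<odot>\<^bsub>amod\<^esub> s) = cmp (par i) (mulop a) \<odot>\<^bsub>N\<^esub> s"
      using * by (simp add: apd_def N_simps)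
    also have "\<dots> = dp {#i#} a \<odot>\<^bsub>amod\<^esub> s \<oplus>\<^bsub>amod\<^esub> sg i a \<odot>\<^bsub>amod\<^esub> apd i s"
      using * by (simp add: par_mulop N_simps apd_def dp_closed)
    finally show "apd i (a \<odot>\<^bsub>amod\<^esub> s) = dp {#i#} a \<odot>\<^bsub>amod\<^esub> s \<oplus>\<^bsub>amod\<^esub> sg i a \<odot>\<^bsub>amod\<^esub> apd i s" .
  next
    fix i j s assume *: "i < d" "j < d" "s \<in> carrier amod"
    then show "apd i (apd j s) = apd j (apd i s)"
      using par_comm[of i j] by (simp add: apd_def flip: N_simps(4))
  qed (simp_all add: apd_def N_simps)
qed

end

section \<open>Twisted connections in coordinates\<close>

text \<open>N is free of finite rank with basis \<open>b\<close> and dual basis \<open>co\<close>,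
  both given as data so that the \<xi>^(k) and their coordinates can be inserted directly.\<close>

locale tensor_free = M: Module.module A M + tensor_pair A M N
  for A :: "('a, 'z) ring_scheme" and M :: "('a, 'm, 'y) module_scheme" and N :: "('a, 'n, 'w) module_scheme" +
  fixes F :: "'k set" and b :: "'k \<Rightarrow> 'n" and co :: "'k \<Rightarrow> 'n \<Rightarrow> 'a"
  assumes finite_F: "finite F"
    and b_closed: "k \<in> F \<Longrightarrow> b k \<in> carrier N"
    and co_closed: "k \<in> F \<Longrightarrow> n \<in> carrier N \<Longrightarrow> co k n \<in> carrier A"
    and co_add: "k \<in> F \<Longrightarrow> n \<in> carrier N \<Longrightarrow> n' \<in> carrier N \<Longrightarrow> co k (n \<oplus>\<^bsub>N\<^esub> n') = co k n \<oplus>\<^bsub>A\<^esub> co k n'"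
    and co_smult: "k \<in> F \<Longrightarrow> a \<in> carrier A \<Longrightarrow> n \<in> carrier N \<Longrightarrow> co k (a \<odot>\<^bsub>N\<^esub> n) = a \<otimes>\<^bsub>A\<^esub> co k n"
    and co_b: "k \<in> F \<Longrightarrow> l \<in> F \<Longrightarrow> co k (b l) = (if k = l then \<one>\<^bsub>A\<^esub> else \<zero>\<^bsub>A\<^esub>)"
    and expand: "n \<in> carrier N \<Longrightarrow> n = (\<Oplus>\<^bsub>N\<^esub>k\<in>F. co k n \<odot>\<^bsub>N\<^esub> b k)"
begin

definition coord :: "'k \<Rightarrow> ('m \<times> 'n \<Rightarrow>\<^sub>0 int) set \<Rightarrow> 'm" where
  "coord k = lift M (\<lambda>m n. co k n \<odot>\<^bsub>M\<^esub> m)"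

lemma coord_bilinear: "k \<in> F \<Longrightarrow> bilinear M (\<lambda>m n. co k n \<odot>\<^bsub>M\<^esub> m)"
  unfolding bilinear_def
  by (simp add: co_closed co_add co_smult M.smult_l_distr M.smult_r_distr M.smult_assoc1[symmetric] M.R.m_comm)

context
  fixes k assumes k: "k \<in> F"
begin

lemma coord_el: "m \<in> carrier M \<Longrightarrow> n \<in> carrier N \<Longrightarrow> coord k (el m n) = co k n \<odot>\<^bsub>M\<^esub> m"
  unfolding coord_def using lift_el[OF M.abelian_group_axioms coord_bilinear[OF k]] .

lemma coord_closed: "X \<in> carrier T \<Longrightarrow> coord k X \<in> carrier M"
  unfolding coord_def using lift_closed[OF M.abelian_group_axioms coord_bilinear[OF k]] .

lemma coord_add: "X \<in> carrier T \<Longrightarrow> Y \<in> carrier T \<Longrightarrow> coord k (X \<oplus>\<^bsub>T\<^esub> Y) = coord k X \<oplus>\<^bsub>M\<^esub> coord k Y"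
  unfolding coord_def using lift_add[OF M.abelian_group_axioms coord_bilinear[OF k]] .

end

lemma el_sum:
  assumes m: "m \<in> carrier M" and f: "\<And>k. k \<in> J \<Longrightarrow> f k \<in> carrier N" and J: "finite J"
  shows "el m (\<Oplus>\<^bsub>N\<^esub>k\<in>J. f k) = (\<Oplus>\<^bsub>T\<^esub>k\<in>J. el m (f k))"
  using J f
proof (induction J rule: finite_induct)
  case empty then show ?case using m by simp
next
  case (insert k J)
  then show ?case using m by (simp add: el_add2 Pi_def N.finsum_closed)
qed

text \<open>Scalars of the right factor move to the left: m \<otimes> n is the sum of the co_k(n) m
  \<otimes> b_k. Elements of the tensor product are thus families in M.\<close>

lemma tensor_expand:
  assumes "X \<in> carrier T"
  shows "X = (\<Oplus>\<^bsub>T\<^esub>k\<in>F. el (coord k X) (b k))"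
  using assms
proof (induction rule: tensor_induct)
  case (elt m n)
  have "el m n = el m (\<Oplus>\<^bsub>N\<^esub>k\<in>F. co k n \<odot>\<^bsub>N\<^esub> b k)" using expand[OF elt(2)] by simp
  also have "\<dots> = (\<Oplus>\<^bsub>T\<^esub>k\<in>F. el m (co k n \<odot>\<^bsub>N\<^esub> b k))"
    using elt by (intro el_sum finite_F smult_N co_closed b_closed)
  also have "\<dots> = (\<Oplus>\<^bsub>T\<^esub>k\<in>F. el (coord k (el m n)) (b k))"
    using elt by (intro T.finsum_cong') (auto simp: coord_el co_closed b_closed smult_N el_balanced)
  finally show ?case .
next
  case (add X Y)
  have "(\<Oplus>\<^bsub>T\<^esub>k\<in>F. el (coord k (X \<oplus>\<^bsub>T\<^esub> Y)) (b k)) =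
    (\<Oplus>\<^bsub>T\<^esub>k\<in>F. el (coord k X) (b k) \<oplus>\<^bsub>T\<^esub> el (coord k Y) (b k))"
    using add by (intro T.finsum_cong') (auto simp: coord_add coord_closed b_closed el_add1)
  also have "\<dots> = (\<Oplus>\<^bsub>T\<^esub>k\<in>F. el (coord k X) (b k)) \<oplus>\<^bsub>T\<^esub> (\<Oplus>\<^bsub>T\<^esub>k\<in>F. el (coord k Y) (b k))"
    using add by (intro T.finsum_addf) (auto simp: coord_closed b_closed)
  finally show ?case using add by simp
qed

lemma tensor_eqI:
  assumes "X \<in> carrier T" "Y \<in> carrier T" "\<And>k. k \<in> F \<Longrightarrow> coord k X = coord k Y"
  shows "X = Y"
proof -
  have "(\<Oplus>\<^bsub>T\<^esub>k\<in>F. el (coord k X) (b k)) = (\<Oplus>\<^bsub>T\<^esub>k\<in>F. el (coord k Y) (b k))"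
    using assms by (intro T.finsum_cong') (auto simp: coord_closed b_closed)
  then show ?thesis using tensor_expand[OF assms(1)] tensor_expand[OF assms(2)] by simp
qed

lemma coord_zero: "k \<in> F \<Longrightarrow> coord k \<zero>\<^bsub>T\<^esub> = \<zero>\<^bsub>M\<^esub>"
  using coord_el[of k "\<zero>\<^bsub>M\<^esub>" "b k"] by (simp add: b_closed co_closed M.smult_r_null)

definition of_coords :: "('k \<Rightarrow> 'm) \<Rightarrow> ('m \<times> 'n \<Rightarrow>\<^sub>0 int) set" where
  "of_coords f = (\<Oplus>\<^bsub>T\<^esub>k\<in>F. el (f k) (b k))"

lemma of_coords_closed: "(\<And>k. k \<in> F \<Longrightarrow> f k \<in> carrier M) \<Longrightarrow> of_coords f \<in> carrier T"
  unfolding of_coords_def by (intro T.finsum_closed) (auto simp: b_closed)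

lemma coord_sum:
  assumes k: "k \<in> F" and J: "finite J" and f: "\<And>l. l \<in> J \<Longrightarrow> f l \<in> carrier T"
  shows "coord k (\<Oplus>\<^bsub>T\<^esub>l\<in>J. f l) = (\<Oplus>\<^bsub>M\<^esub>l\<in>J. coord k (f l))"
  using J f
proof (induction J rule: finite_induct)
  case empty then show ?case using k by (simp add: coord_zero)
next
  case (insert l J)
  then show ?case using k by (simp add: coord_add coord_closed Pi_def T.finsum_closed)
qed

lemma coord_of_coords:
  assumes k: "k \<in> F" and f: "\<And>k. k \<in> F \<Longrightarrow> f k \<in> carrier M"
  shows "coord k (of_coords f) = f k"
proof -
  have "coord k (of_coords f) = (\<Oplus>\<^bsub>M\<^esub>l\<in>F. coord k (el (f l) (b l)))"
    unfolding of_coords_def using f by (intro coord_sum k finite_F) (auto simp: b_closed)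
  also have "\<dots> = (\<Oplus>\<^bsub>M\<^esub>l\<in>F. if k = l then f l else \<zero>\<^bsub>M\<^esub>)"
    using f k by (intro M.finsum_cong') (auto simp: coord_el b_closed co_b M.smult_l_null)
  also have "\<dots> = f k" using M.finsum_singleton[of k F f] k f finite_F by auto
  finally show ?thesis .
qed

end

lemma (in principal_parts_ring) pp_eqI:
  assumes "X \<in> carrier P" "Y \<in> carrier P" "\<And>k. k \<in> K \<Longrightarrow> cf k X = cf k Y"
  shows "X = Y"
proof -
  have "(\<Oplus>\<^bsub>P\<^esub>k\<in>K. pc (cf k X) \<otimes>\<^bsub>P\<^esub> Xi k) = (\<Oplus>\<^bsub>P\<^esub>k\<in>K. pc (cf k Y) \<otimes>\<^bsub>P\<^esub> Xi k)"
    using assms by (intro P.finsum_cong') auto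
  then show ?thesis using pp_expand[OF assms(1)] pp_expand[OF assms(2)] by simp
qed

text \<open>The coordinate at the empty index is the constant coefficient, and taking constant
  coefficients is multiplicative.\<close>

lemma (in principal_parts_ring) cf_empty_mult:
  assumes "X \<in> carrier P" "Y \<in> carrier P"
  shows "cf {#} (X \<otimes>\<^bsub>P\<^esub> Y) = cf {#} X \<otimes> cf {#} Y"
proof -
  obtain p r where pr: "X = cl p" "Y = cl r" "p \<in> carrier T" "r \<in> carrier T"
    using assms by (auto simp: carrier_P)
  have "tco {#} (p \<otimes>\<^bsub>T\<^esub> r) = tco {#} p \<otimes> tco {#} r"
    using pr(3,4) tco_empty[of p] tco_empty[of r] tco_empty[of "p \<otimes>\<^bsub>S\<^esub> r"]
    by (simp add: T_sel mult_S_closed) (simp add: mult_S)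
  then show ?thesis using pr by (simp flip: cl.hom_mult)
qed

locale twisted_connections = symmetric_taylor A d \<sigma> x Q \<Theta>
  for A :: "'a tring" (structure) and d \<sigma> x Q \<Theta> +
  assumes classical: "i < d \<Longrightarrow> f \<in> carrier A \<Longrightarrow> \<sigma> i f = f \<oplus> (Q i \<otimes> x i \<ominus> x i) \<otimes> dp {#i#} f"
begin

sublocale P1: principal_parts_ring A d \<sigma> x "Suc 0" ..

sublocale Th: ring_hom_cring A P1.P "\<Theta> (Suc 0)"
  by (rule ring_hom_cringI[OF is_cring P1.P.is_cring Theta_hom])

abbreviation "\<Omega> \<equiv> tw_omega A d \<sigma> x"
abbreviation "PA \<equiv> pp_algebra A d \<sigma> x (Suc 0)"

lemma Omega_sel [simp]:
  "carrier \<Omega> = {X \<in> carrier P1.P. co {#} X = \<zero>}"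
  "ring.add \<Omega> = ring.add P1.P" "ring.zero \<Omega> = \<zero>\<^bsub>P1.P\<^esub>" "smult \<Omega> = (\<lambda>a X. P1.pc a \<otimes>\<^bsub>P1.P\<^esub> X)"
  using P1.pp_proj_cf by (auto simp: tw_omega_def)

lemma single_K [simp]: "i < d \<Longrightarrow> {#i#} \<in> P1.K"
  by (simp add: P1.K_def)

lemma K1_set: "k \<in> P1.K \<Longrightarrow> set_mset k \<subseteq> {..<d}"
  by (simp add: P1.K_def)

lemma K1_cases: "k \<in> P1.K \<Longrightarrow> k = {#} \<or> (\<exists>i<d. k = {#i#})"
  by (cases k) (auto simp: P1.K_def)

lemma co_px: "i < d \<Longrightarrow> k \<in> P1.K \<Longrightarrow> co k (P1.px i) = (if k = {#i#} then \<one> else \<zero>)"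
  using P1.cf_Xi[of k "{#i#}"] by (simp add: P1.Xi_single)

lemma co_neg: "k \<in> P1.K \<Longrightarrow> X \<in> carrier P1.P \<Longrightarrow> co k (\<ominus>\<^bsub>P1.P\<^esub> X) = \<ominus> co k X"
  using P1.cf_add[of "\<ominus>\<^bsub>P1.P\<^esub> X" X k] by (intro minus_equality[symmetric]) (simp_all add: P1.P.l_neg)

lemma abelian_group_Omega: "abelian_group \<Omega>"
proof (rule abelian_groupI)
  fix X assume X: "X \<in> carrier \<Omega>"
  then show "\<exists>Y\<in>carrier \<Omega>. Y \<oplus>\<^bsub>\<Omega>\<^esub> X = \<zero>\<^bsub>\<Omega>\<^esub>"
    by (intro bexI[of _ "\<ominus>\<^bsub>P1.P\<^esub> X"]) (simp_all add: P1.P.l_neg co_neg)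
qed (simp_all add: P1.P.a_ac P1.cf_add)

sublocale Om: abelian_group \<Omega> by (rule abelian_group_Omega)

lemma px_Omega: "i < d \<Longrightarrow> P1.px i \<in> carrier \<Omega>"
  by (simp add: co_px)

lemma smult_Omega: "a \<in> carrier A \<Longrightarrow> X \<in> carrier \<Omega> \<Longrightarrow> a \<odot>\<^bsub>\<Omega>\<^esub> X \<in> carrier \<Omega>"
  by (simp add: P1.cf_const_mult)

text \<open>A form has no coordinate at the empty index. The sum is formed in \<Omega>, whose
  carrier is smaller than that of P_1, so its coordinates are computed by a separate induction on
  the index set.\<close>

lemma Omega_expand:
  assumes X: "X \<in> carrier \<Omega>"
  shows "X = (\<Oplus>\<^bsub>\<Omega>\<^esub>i\<in>{..<d}. co {#i#} X \<odot>\<^bsub>\<Omega>\<^esub> P1.px i)"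
proof -
  let ?f = "\<lambda>i. co {#i#} X \<odot>\<^bsub>\<Omega>\<^esub> P1.px i"
  have XP: "X \<in> carrier P1.P" using X by simp
  have f: "?f i \<in> carrier \<Omega>" if "i < d" for i
    using that XP by (intro smult_Omega px_Omega) simp_all
  have sum: "co k (\<Oplus>\<^bsub>\<Omega>\<^esub>i\<in>J. ?f i) = (\<Oplus>i\<in>J. co k (?f i)) \<and> (\<Oplus>\<^bsub>\<Omega>\<^esub>i\<in>J. ?f i) \<in> carrier \<Omega>"
    if "J \<subseteq> {..<d}" "finite J" "k \<in> P1.K" for J k
    using that(2,1)
  proof (induction J rule: finite_induct)
    case empty then show ?case using that by simp
  next
    case (insert i J)
    then have i: "i < d" "?f i \<in> carrier P1.P" and sJ: "(\<Oplus>\<^bsub>\<Omega>\<^esub>i\<in>J. ?f i) \<in> carrier P1.P"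
      and fJ: "\<And>j. j \<in> J \<Longrightarrow> ?f j \<in> carrier \<Omega>" using f by auto
    have "(\<Oplus>\<^bsub>\<Omega>\<^esub>i\<in>insert i J. ?f i) = ?f i \<oplus>\<^bsub>\<Omega>\<^esub> (\<Oplus>\<^bsub>\<Omega>\<^esub>i\<in>J. ?f i)"
      using insert fJ f[OF i(1)] by (intro Om.finsum_insert) auto
    moreover have "(\<Oplus>i\<in>insert i J. co k (?f i)) = co k (?f i) \<oplus> (\<Oplus>i\<in>J. co k (?f i))"
      using insert fJ i that(3) by (intro finsum_insert) auto
    ultimately show ?case using insert f[OF i(1)] i sJ that(3) by (auto simp: P1.cf_add)
  qed
  show ?thesis
  proof (rule P1.pp_eqI)
    show "(\<Oplus>\<^bsub>\<Omega>\<^esub>i\<in>{..<d}. ?f i) \<in> carrier P1.P" using sum[of "{..<d}" "{#}"] by simp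
    fix k assume k: "k \<in> P1.K"
    have "co k (\<Oplus>\<^bsub>\<Omega>\<^esub>i\<in>{..<d}. ?f i) = (\<Oplus>i\<in>{..<d}. co k (?f i))"
      using sum[of "{..<d}" k] k by simp
    also have "\<dots> = (\<Oplus>i\<in>{..<d}. if k = {#i#} then co k X else \<zero>)"
      using XP k by (intro finsum_cong') (auto simp: P1.cf_const_mult co_px)
    also have "\<dots> = co k X"
      using K1_cases[OF k]
    proof
      assume "k = {#}"
      then show ?thesis using X by (simp add: finsum_zero)
    next
      assume "\<exists>i<d. k = {#i#}"
      then obtain i where i: "i < d" "k = {#i#}" by blast
      then show ?thesis using finsum_singleton[of i "{..<d}" "\<lambda>_. co k X"] XP k by simp
    qed
    finally show "co k X = co k (\<Oplus>\<^bsub>\<Omega>\<^esub>i\<in>{..<d}. ?f i)" by simp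
  qed (rule XP)
qed

end

section \<open>Components of a twisted connection\<close>

locale connection_module = twisted_connections A d \<sigma> x Q \<Theta> + M: Module.module A M
  for A :: "'a tring" (structure) and d \<sigma> x Q \<Theta> and M :: "('a, 'm) module"
begin

sublocale TO: tensor_free A M \<Omega> "{..<d}" P1.px "\<lambda>i. co {#i#}"
proof -
  interpret O: abelian_group \<Omega> by (rule abelian_group_Omega)
  show "tensor_free A M \<Omega> {..<d} P1.px (\<lambda>i. co {#i#})"
  proof unfold_locales
    show "X = (\<Oplus>\<^bsub>\<Omega>\<^esub>i\<in>{..<d}. co {#i#} X \<odot>\<^bsub>\<Omega>\<^esub> P1.px i)" if "X \<in> carrier \<Omega>" for X
      using that by (rule Omega_expand)
  qed (auto simp: P1.cf_add P1.cf_const_mult co_px)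
qed

sublocale TP: tensor_free A M PA P1.K P1.Xi co
proof -
  interpret O: cring PA by (rule cring_cong[OF P1.P.is_cring]) simp_all
  show "tensor_free A M PA P1.K P1.Xi co"
  proof unfold_locales
    show "X = (\<Oplus>\<^bsub>PA\<^esub>k\<in>P1.K. co k X \<odot>\<^bsub>PA\<^esub> P1.Xi k)" if "X \<in> carrier PA" for X
    proof -
      \<comment> \<open>The two records share carrier, addition and zero, and finite sums see
        nothing else.\<close>
      have "(\<Oplus>\<^bsub>PA\<^esub>k\<in>P1.K. co k X \<odot>\<^bsub>PA\<^esub> P1.Xi k) = (\<Oplus>\<^bsub>P1.P\<^esub>k\<in>P1.K. P1.pc (co k X) \<otimes>\<^bsub>P1.P\<^esub> P1.Xi k)"
        by (simp add: finsum_def finprod_def)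
      then show ?thesis using P1.pp_expand[of X] that by simp
    qed
  qed (auto simp: P1.cf_add P1.cf_const_mult P1.cf_Xi[OF _ K1_set] simp del: P1.cf_cl)
qed

end

context connection_module begin

abbreviation iota where "iota \<equiv> tensor_map A M PA (\<lambda>m. m) (\<lambda>\<omega>. \<omega>)"
abbreviation mulT where "mulT f \<equiv> tensor_map A M PA (\<lambda>m. m) (\<lambda>p. \<Theta> (Suc 0) f \<otimes>\<^bsub>P1.P\<^esub> p)"

lemma iota_el: "m \<in> carrier M \<Longrightarrow> w \<in> carrier \<Omega> \<Longrightarrow> iota (TO.el m w) = TP.el m w"
  by (rule TO.tensor_map_el[OF TP.tensor_pair_axioms])
     (use TP.el_balanced in auto)

lemma iota_closed: "X \<in> carrier TO.T \<Longrightarrow> iota X \<in> carrier TP.T"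
  by (rule TO.tensor_map_closed[OF TP.tensor_pair_axioms])
     (use TP.el_balanced in auto)

lemma iota_add: "X \<in> carrier TO.T \<Longrightarrow> Y \<in> carrier TO.T \<Longrightarrow> iota (X \<oplus>\<^bsub>TO.T\<^esub> Y) = iota X \<oplus>\<^bsub>TP.T\<^esub> iota Y"
  by (rule TO.tensor_map_add[OF TP.tensor_pair_axioms])
     (use TP.el_balanced in auto)

lemma coord_iota:
  assumes "X \<in> carrier TO.T"
  shows "TP.coord {#} (iota X) = \<zero>\<^bsub>M\<^esub>" and "i < d \<Longrightarrow> TP.coord {#i#} (iota X) = TO.coord i X"
proof -
  have "TP.coord {#} (iota X) = \<zero>\<^bsub>M\<^esub> \<and> (\<forall>i<d. TP.coord {#i#} (iota X) = TO.coord i X)"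
    using assms
  proof (induction rule: TO.tensor_induct)
    case (elt m w)
    then have "w \<in> carrier PA" "co {#} w = \<zero>" by simp_all
    then show ?case using elt by (simp add: iota_el TP.coord_el TO.coord_el M.smult_l_null del: Omega_sel(1) as_algebra_sel(1))
  next
    case (add X Y)
    then show ?case by (simp add: iota_add iota_closed TP.coord_add TO.coord_add)
  qed
  then show "TP.coord {#} (iota X) = \<zero>\<^bsub>M\<^esub>" "i < d \<Longrightarrow> TP.coord {#i#} (iota X) = TO.coord i X" by simp_all
qed

context
  fixes f assumes f: "f \<in> carrier A"
begin

lemma mulT_bal: "a \<in> carrier A \<Longrightarrow> m \<in> carrier M \<Longrightarrow> p \<in> carrier PA \<Longrightarrow>
    TP.el (a \<odot>\<^bsub>M\<^esub> m) (\<Theta> (Suc 0) f \<otimes>\<^bsub>P1.P\<^esub> p) = TP.el m (\<Theta> (Suc 0) f \<otimes>\<^bsub>P1.P\<^esub> (a \<odot>\<^bsub>PA\<^esub> p))"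
  using TP.el_balanced[of a m "\<Theta> (Suc 0) f \<otimes>\<^bsub>P1.P\<^esub> p"] f by (simp add: P1.P.m_lcomm)

lemma mulT_el: "m \<in> carrier M \<Longrightarrow> p \<in> carrier PA \<Longrightarrow> mulT f (TP.el m p) = TP.el m (\<Theta> (Suc 0) f \<otimes>\<^bsub>P1.P\<^esub> p)"
  by (rule TP.tensor_map_el[OF TP.tensor_pair_axioms])
     (use f mulT_bal in \<open>auto simp: P1.P.r_distr\<close>)

lemma mulT_closed: "X \<in> carrier TP.T \<Longrightarrow> mulT f X \<in> carrier TP.T"
  by (rule TP.tensor_map_closed[OF TP.tensor_pair_axioms])
     (use f mulT_bal in \<open>auto simp: P1.P.r_distr\<close>)

lemma mulT_add: "X \<in> carrier TP.T \<Longrightarrow> Y \<in> carrier TP.T \<Longrightarrow> mulT f (X \<oplus>\<^bsub>TP.T\<^esub> Y) = mulT f X \<oplus>\<^bsub>TP.T\<^esub> mulT f Y"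
  by (rule TP.tensor_map_add[OF TP.tensor_pair_axioms])
     (use f mulT_bal in \<open>auto simp: P1.P.r_distr\<close>)

lemma co_Theta: "co {#} (\<Theta> (Suc 0) f) = f" "i < d \<Longrightarrow> co {#i#} (\<Theta> (Suc 0) f) = dp {#i#} f"
  using co_eq_dp[OF f, of "{#}" "Suc 0"] co_eq_dp[OF f, of "{#i#}" "Suc 0"] dp_empty[OF f] by simp_all

text \<open>By \<open>co_mult\<close> the coordinate of \<Theta>(f) p at \<xi>_i is f p_i +
  \<partial>_i(f) (p_0 + (q_i x_i - x_i) p_i). Classicality collects the multiples of p_i into
  \<sigma>_i(f) p_i.\<close>

lemma coord_mulT:
  assumes "X \<in> carrier TP.T"
  shows "TP.coord {#} (mulT f X) = f \<odot>\<^bsub>M\<^esub> TP.coord {#} X"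
    and "i < d \<Longrightarrow> TP.coord {#i#} (mulT f X) =
      dp {#i#} f \<odot>\<^bsub>M\<^esub> TP.coord {#} X \<oplus>\<^bsub>M\<^esub> \<sigma> i f \<odot>\<^bsub>M\<^esub> TP.coord {#i#} X"
proof -
  have d: "dp {#i#} f \<in> carrier A" if "i < d" for i using dp_closed[OF f, of "{#i#}"] that by simp
  have "TP.coord {#} (mulT f X) = f \<odot>\<^bsub>M\<^esub> TP.coord {#} X \<and> (\<forall>i<d. TP.coord {#i#} (mulT f X) =
      dp {#i#} f \<odot>\<^bsub>M\<^esub> TP.coord {#} X \<oplus>\<^bsub>M\<^esub> \<sigma> i f \<odot>\<^bsub>M\<^esub> TP.coord {#i#} X)"
    using assms
  proof (induction rule: TP.tensor_induct)
    case (elt m p)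
    then have p: "p \<in> carrier P1.P" and fp: "\<Theta> (Suc 0) f \<otimes>\<^bsub>P1.P\<^esub> p \<in> carrier P1.P" using f by simp_all
    have c: "co {#} p \<in> carrier A" "\<And>i. i < d \<Longrightarrow> co {#i#} p \<in> carrier A" using p by simp_all
    have 0: "co {#} (\<Theta> (Suc 0) f \<otimes>\<^bsub>P1.P\<^esub> p) = f \<otimes> co {#} p"
      using f p by (simp add: P1.cf_empty_mult co_Theta)
    have i: "co {#i#} (\<Theta> (Suc 0) f \<otimes>\<^bsub>P1.P\<^esub> p) = dp {#i#} f \<otimes> co {#} p \<oplus> \<sigma> i f \<otimes> co {#i#} p" if i: "i < d" for i
    proof -
      have "co {#i#} (\<Theta> (Suc 0) f \<otimes>\<^bsub>P1.P\<^esub> p) =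
          f \<otimes> co {#i#} p \<oplus> dp {#i#} f \<otimes> (co {#} p \<oplus> (Q i \<otimes> x i \<ominus> x i) \<otimes> co {#i#} p)"
        using co_mult[of "\<Theta> (Suc 0) f" p i] f p i by (simp add: co_Theta)
      also have "\<dots> = dp {#i#} f \<otimes> co {#} p \<oplus> (f \<oplus> (Q i \<otimes> x i \<ominus> x i) \<otimes> dp {#i#} f) \<otimes> co {#i#} p"
        using f c i d[OF i] x_closed[OF i] by (simp add: l_distr r_distr a_ac m_ac)
      finally show ?thesis using classical[OF i f] by simp
    qed
    show ?case using elt f c d sigma_closed[OF _ f] 
      by (simp add: mulT_el TP.coord_el[OF P1.empty_K] TP.coord_el[OF single_K] fp 0 i M.smult_assoc1 M.smult_l_distr)
  next
    case (add X Y)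
    have cl: "TP.coord k X \<in> carrier M" "TP.coord k Y \<in> carrier M" if "k \<in> P1.K" for k
      using that add by (simp_all add: TP.coord_closed)
    show ?case using add f d sigma_closed[OF _ f] cl
      by (simp add: mulT_add mulT_closed TP.coord_add M.smult_r_distr M.a_ac)
  qed
  then show "TP.coord {#} (mulT f X) = f \<odot>\<^bsub>M\<^esub> TP.coord {#} X"
    "i < d \<Longrightarrow> TP.coord {#i#} (mulT f X) = dp {#i#} f \<odot>\<^bsub>M\<^esub> TP.coord {#} X \<oplus>\<^bsub>M\<^esub> \<sigma> i f \<odot>\<^bsub>M\<^esub> TP.coord {#i#} X"
    by simp_all
qed

end

lemma TP_eqI:
  assumes "X \<in> carrier TP.T" "Y \<in> carrier TP.T" "TP.coord {#} X = TP.coord {#} Y"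
    "\<And>i. i < d \<Longrightarrow> TP.coord {#i#} X = TP.coord {#i#} Y"
  shows "X = Y"
  using assms(1,2) by (rule TP.tensor_eqI) (use K1_cases assms in blast)

context
  fixes D :: "('a, 'm) conn"
  assumes D: "D \<in> carrier M \<rightarrow>\<^sub>E carrier TO.T"
begin

definition ThM where "ThM s = TP.el s \<one>\<^bsub>PA\<^esub> \<oplus>\<^bsub>TP.T\<^esub> iota (D s)"

lemma D_closed: "s \<in> carrier M \<Longrightarrow> D s \<in> carrier TO.T"
  using D by auto

lemma ThM_closed: "s \<in> carrier M \<Longrightarrow> ThM s \<in> carrier TP.T"
  unfolding ThM_def by (intro TP.T.a_closed TP.el_closed iota_closed D_closed) simp_all

lemma coord_ThM:
  assumes s: "s \<in> carrier M"
  shows "TP.coord {#} (ThM s) = s" and "i < d \<Longrightarrow> TP.coord {#i#} (ThM s) = TO.coord i (D s)"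
proof -
  have e: "TP.el s \<one>\<^bsub>PA\<^esub> \<in> carrier TP.T" "\<one>\<^bsub>PA\<^esub> \<in> carrier PA" using s by (auto intro: TP.el_closed)
  have one: "co k \<one>\<^bsub>P1.P\<^esub> = (if k = {#} then \<one> else \<zero>)" if "k \<in> P1.K" for k
    using P1.cf_Xi[OF that, of "{#}"] by (simp add: P1.Xi_empty)
  show "TP.coord {#} (ThM s) = s"
    unfolding ThM_def TP.coord_add[OF P1.empty_K e(1) iota_closed[OF D_closed[OF s]]]
    using s one[of "{#}"] coord_iota(1)[OF D_closed[OF s]] TP.coord_el[OF P1.empty_K s e(2)] by simp
  show "TP.coord {#i#} (ThM s) = TO.coord i (D s)" if i: "i < d"
    unfolding ThM_def TP.coord_add[OF single_K[OF i] e(1) iota_closed[OF D_closed[OF s]]]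
    using s i one[OF single_K[OF i]] coord_iota(2)[OF D_closed[OF s] i] TP.coord_el[OF single_K[OF i] s e(2)]
      TO.coord_closed[of i "D s"] D_closed[OF s]
    by (simp add: M.smult_l_null)
qed

lemma twisted_connection_ThM:
  "twisted_connection A d \<sigma> x \<Theta> M D \<longleftrightarrow>
    (\<forall>s\<in>carrier M. \<forall>t\<in>carrier M. ThM (s \<oplus>\<^bsub>M\<^esub> t) = ThM s \<oplus>\<^bsub>TP.T\<^esub> ThM t) \<and>
    (\<forall>f\<in>carrier A. \<forall>s\<in>carrier M. ThM (f \<odot>\<^bsub>M\<^esub> s) = mulT f (ThM s))"
  unfolding twisted_connection_def Let_def ThM_def One_nat_def as_algebra_sel(2,3) using D by blast

text \<open>The two conditions on \<open>ThM\<close> are compared coordinatewise. At the empty index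
  they hold trivially, since \<open>ThM s\<close> has coordinate s there; at \<xi>_i they are
  additivity and the twisted Leibniz rule of the i-th component.\<close>

lemma twisted_connection_iff:
  "twisted_connection A d \<sigma> x \<Theta> M D \<longleftrightarrow>
    (\<forall>i<d. \<forall>s\<in>carrier M. \<forall>t\<in>carrier M.
      TO.coord i (D (s \<oplus>\<^bsub>M\<^esub> t)) = TO.coord i (D s) \<oplus>\<^bsub>M\<^esub> TO.coord i (D t)) \<and>
    (\<forall>i<d. \<forall>f\<in>carrier A. \<forall>s\<in>carrier M.
      TO.coord i (D (f \<odot>\<^bsub>M\<^esub> s)) = dp {#i#} f \<odot>\<^bsub>M\<^esub> s \<oplus>\<^bsub>M\<^esub> \<sigma> i f \<odot>\<^bsub>M\<^esub> TO.coord i (D s))"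
  unfolding twisted_connection_ThM
proof (intro conj_cong)
  show "(\<forall>s\<in>carrier M. \<forall>t\<in>carrier M. ThM (s \<oplus>\<^bsub>M\<^esub> t) = ThM s \<oplus>\<^bsub>TP.T\<^esub> ThM t) \<longleftrightarrow>
    (\<forall>i<d. \<forall>s\<in>carrier M. \<forall>t\<in>carrier M.
      TO.coord i (D (s \<oplus>\<^bsub>M\<^esub> t)) = TO.coord i (D s) \<oplus>\<^bsub>M\<^esub> TO.coord i (D t))" (is "?L \<longleftrightarrow> ?R")
  proof
    assume ?L
    then show ?R
      using coord_ThM(2) TP.coord_add[OF single_K] ThM_closed M.a_closed by metis
  next
    assume R: ?R
    show ?L
      by (intro ballI TP_eqI)
        (use R in \<open>simp_all add: ThM_closed coord_ThM TP.coord_add\<close>)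
  qed
  show "(\<forall>f\<in>carrier A. \<forall>s\<in>carrier M. ThM (f \<odot>\<^bsub>M\<^esub> s) = mulT f (ThM s)) \<longleftrightarrow>
    (\<forall>i<d. \<forall>f\<in>carrier A. \<forall>s\<in>carrier M.
      TO.coord i (D (f \<odot>\<^bsub>M\<^esub> s)) = dp {#i#} f \<odot>\<^bsub>M\<^esub> s \<oplus>\<^bsub>M\<^esub> \<sigma> i f \<odot>\<^bsub>M\<^esub> TO.coord i (D s))" (is "?L \<longleftrightarrow> ?R")
  proof
    assume ?L
    then show ?R
      using coord_ThM coord_mulT(2) ThM_closed M.smult_closed by metis
  next
    assume R: ?R
    show ?L
      by (intro ballI TP_eqI)
        (use R in \<open>simp_all add: ThM_closed coord_ThM mulT_closed coord_mulT\<close>)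
  qed
qed

end

end

section \<open>Horizontal maps in coordinates\<close>

locale connection_module_pair =
  M: connection_module A d \<sigma> x Q \<Theta> M + N: connection_module A d \<sigma> x Q \<Theta> N
  for A :: "'a tring" (structure) and d \<sigma> x Q \<Theta> and M :: "('a, 'm) module" and N :: "('a, 'm) module"
begin

lemma coord_tensor_map:
  assumes h: "h \<in> module_hom A M N" and X: "X \<in> carrier M.TO.T"
  shows "tensor_map A N M.\<Omega> h (\<lambda>\<omega>. \<omega>) X \<in> carrier N.TO.T"
    and "i < d \<Longrightarrow> N.TO.coord i (tensor_map A N M.\<Omega> h (\<lambda>\<omega>. \<omega>) X) = h (M.TO.coord i X)"
proof -
  have hc: "\<And>m. m \<in> carrier M \<Longrightarrow> h m \<in> carrier N"
    and h_add: "\<And>m m'. m \<in> carrier M \<Longrightarrow> m' \<in> carrier M \<Longrightarrow> h (m \<oplus>\<^bsub>M\<^esub> m') = h m \<oplus>\<^bsub>N\<^esub> h m'"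
    and h_lin: "\<And>a m. a \<in> carrier A \<Longrightarrow> m \<in> carrier M \<Longrightarrow> h (a \<odot>\<^bsub>M\<^esub> m) = a \<odot>\<^bsub>N\<^esub> h m"
    using h by (auto simp: module_hom_def)
  have bal: "\<And>a m w. a \<in> carrier A \<Longrightarrow> m \<in> carrier M \<Longrightarrow> w \<in> carrier M.\<Omega> \<Longrightarrow>
      N.TO.el (h (a \<odot>\<^bsub>M\<^esub> m)) w = N.TO.el (h m) (a \<odot>\<^bsub>M.\<Omega>\<^esub> w)"
    using N.TO.el_balanced hc h_lin by simp
  note tm = M.TO.tensor_map_el[OF N.TO.tensor_pair_axioms hc h_add _ _ bal]
    M.TO.tensor_map_closed[OF N.TO.tensor_pair_axioms hc h_add _ _ bal]
    M.TO.tensor_map_add[OF N.TO.tensor_pair_axioms hc h_add _ _ bal]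
  show "tensor_map A N M.\<Omega> h (\<lambda>\<omega>. \<omega>) X \<in> carrier N.TO.T"
    using X by (intro tm(2)) auto
  assume i: "i < d"
  show "N.TO.coord i (tensor_map A N M.\<Omega> h (\<lambda>\<omega>. \<omega>) X) = h (M.TO.coord i X)"
    using X
  proof (induction rule: M.TO.tensor_induct)
    case (elt m w)
    then have "tensor_map A N M.\<Omega> h (\<lambda>\<omega>. \<omega>) (M.TO.el m w) = N.TO.el (h m) w" by (intro tm(1)) auto
    then show ?case using elt i hc h_lin by (simp add: M.TO.coord_el N.TO.coord_el)
  next
    case (add X Y)
    then have "tensor_map A N M.\<Omega> h (\<lambda>\<omega>. \<omega>) (X \<oplus>\<^bsub>M.TO.T\<^esub> Y) =
      tensor_map A N M.\<Omega> h (\<lambda>\<omega>. \<omega>) X \<oplus>\<^bsub>N.TO.T\<^esub> tensor_map A N M.\<Omega> h (\<lambda>\<omega>. \<omega>) Y"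
      "tensor_map A N M.\<Omega> h (\<lambda>\<omega>. \<omega>) X \<in> carrier N.TO.T" "tensor_map A N M.\<Omega> h (\<lambda>\<omega>. \<omega>) Y \<in> carrier N.TO.T"
      using tm(2,3) by auto
    then show ?case using add i by (simp add: N.TO.coord_add M.TO.coord_add M.TO.coord_closed h_add)
  qed
qed

text \<open>The map induced by \<open>h\<close> applies h to each coordinate, and coordinates
  separate the elements of N \<otimes> \<Omega>.\<close>

lemma connection_hom_iff:
  assumes h: "h \<in> module_hom A M N" and DM: "DM \<in> carrier M \<rightarrow>\<^sub>E carrier M.TO.T" and DN: "DN \<in> carrier N \<rightarrow>\<^sub>E carrier N.TO.T"
  shows "(\<forall>s\<in>carrier M. tensor_map A N M.\<Omega> h (\<lambda>\<omega>. \<omega>) (DM s) = DN (h s)) \<longleftrightarrow>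
    (\<forall>i<d. \<forall>s\<in>carrier M. h (M.TO.coord i (DM s)) = N.TO.coord i (DN (h s)))"
proof -
  have c: "DM s \<in> carrier M.TO.T" "DN (h s) \<in> carrier N.TO.T" if "s \<in> carrier M" for s
    using that DM DN h by (auto simp: module_hom_def)
  show ?thesis
  proof (intro iffI ballI allI impI)
    fix i s assume *: "\<forall>s\<in>carrier M. tensor_map A N M.\<Omega> h (\<lambda>\<omega>. \<omega>) (DM s) = DN (h s)" "i < d" "s \<in> carrier M"
    then show "h (M.TO.coord i (DM s)) = N.TO.coord i (DN (h s))"
      using coord_tensor_map(2)[OF h c(1)[OF *(3)] *(2)] by simp
  next
    fix s assume *: "\<forall>i<d. \<forall>s\<in>carrier M. h (M.TO.coord i (DM s)) = N.TO.coord i (DN (h s))" "s \<in> carrier M"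
    show "tensor_map A N M.\<Omega> h (\<lambda>\<omega>. \<omega>) (DM s) = DN (h s)"
      by (rule N.TO.tensor_eqI)
        (use * coord_tensor_map[OF h c(1)[OF *(2)]] c(2)[OF *(2)] in auto)
  qed
qed

end

section \<open>Exterior squares and integrability\<close>

locale exterior = Nm: Module.module A N + tensor_pair A N N
  for A :: "('a, 'z) ring_scheme" and N :: "('a, 'n, 'w) module_scheme"
begin

abbreviation E where "E \<equiv> exterior_null A N"
abbreviation W where "W \<equiv> exterior_square A N"
abbreviation q where "q X \<equiv> E +>\<^bsub>T\<^esub> X"

lemma T_smult_eq: "(\<odot>\<^bsub>T\<^esub>) a = tensor_map A N N (\<lambda>m. a \<odot>\<^bsub>N\<^esub> m) (\<lambda>n. n)"
  by (simp add: fun_eq_iff T_sel(5))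

context
  fixes a assumes a: "a \<in> carrier A"
begin

lemma T_smult_bal: "c \<in> carrier A \<Longrightarrow> m \<in> carrier N \<Longrightarrow> n \<in> carrier N \<Longrightarrow>
    el (a \<odot>\<^bsub>N\<^esub> (c \<odot>\<^bsub>N\<^esub> m)) n = el (a \<odot>\<^bsub>N\<^esub> m) (c \<odot>\<^bsub>N\<^esub> n)"
  using a el_balanced[of c "a \<odot>\<^bsub>N\<^esub> m" n] Nm.smult_assoc1[of a c m] Nm.smult_assoc1[of c a m]
  by (simp add: Nm.R.m_comm)

lemma T_smult_el: "m \<in> carrier N \<Longrightarrow> n \<in> carrier N \<Longrightarrow> a \<odot>\<^bsub>T\<^esub> el m n = el (a \<odot>\<^bsub>N\<^esub> m) n"
  unfolding T_smult_eq
  by (rule tensor_map_el[OF tensor_pair_axioms]) (use a T_smult_bal in \<open>auto simp: Nm.smult_r_distr\<close>)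

lemma T_smult_closed: "X \<in> carrier T \<Longrightarrow> a \<odot>\<^bsub>T\<^esub> X \<in> carrier T"
  unfolding T_smult_eq
  by (rule tensor_map_closed[OF tensor_pair_axioms]) (use a T_smult_bal in \<open>auto simp: Nm.smult_r_distr\<close>)

lemma T_smult_add: "X \<in> carrier T \<Longrightarrow> Y \<in> carrier T \<Longrightarrow> a \<odot>\<^bsub>T\<^esub> (X \<oplus>\<^bsub>T\<^esub> Y) = a \<odot>\<^bsub>T\<^esub> X \<oplus>\<^bsub>T\<^esub> a \<odot>\<^bsub>T\<^esub> Y"
  unfolding T_smult_eq
  by (rule tensor_map_add[OF tensor_pair_axioms]) (use a T_smult_bal in \<open>auto simp: Nm.smult_r_distr\<close>)

lemma T_smult_zero: "a \<odot>\<^bsub>T\<^esub> \<zero>\<^bsub>T\<^esub> = \<zero>\<^bsub>T\<^esub>"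
  using T_smult_el[of "\<zero>\<^bsub>N\<^esub>" "\<zero>\<^bsub>N\<^esub>"] a by simp

end

definition gens where "gens = {a \<odot>\<^bsub>T\<^esub> el n n | a n. a \<in> carrier A \<and> n \<in> carrier N}"

lemma E_eq: "E = generate (add_monoid T) gens"
  by (simp add: exterior_null_def gens_def)

lemma gens_closed: "gens \<subseteq> carrier T"
  by (auto simp: gens_def T_smult_closed)

lemma subgroup_E: "subgroup E (add_monoid T)"
  unfolding E_eq using T.add.generate_is_subgroup gens_closed by simp

sublocale E: abelian_subgroup E T
  by (intro abelian_subgroupI3 additive_subgroup.intro subgroup_E T.abelian_group_axioms)

text \<open>The negative of a generator is a generator, with -a in place of a, so no case for
  inverses remains.\<close>

lemma E_induct [consumes 1, case_names zero gen add]: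
  assumes X: "X \<in> E"
    and z: "P \<zero>\<^bsub>T\<^esub>" and g: "\<And>a n. a \<in> carrier A \<Longrightarrow> n \<in> carrier N \<Longrightarrow> P (el (a \<odot>\<^bsub>N\<^esub> n) n)"
    and p: "\<And>X Y. X \<in> E \<Longrightarrow> Y \<in> E \<Longrightarrow> P X \<Longrightarrow> P Y \<Longrightarrow> P (X \<oplus>\<^bsub>T\<^esub> Y)"
  shows "P X"
  using X unfolding E_eq
proof (induction rule: generate.induct)
  case one then show ?case using z by simp
next
  case (incl h)
  then show ?case using g by (auto simp: gens_def T_smult_el)
next
  case (inv h)
  then obtain a n where h: "h = a \<odot>\<^bsub>T\<^esub> el n n" "a \<in> carrier A" "n \<in> carrier N" by (auto simp: gens_def)
  have "\<ominus>\<^bsub>T\<^esub> h = el (\<ominus>\<^bsub>N\<^esub> (a \<odot>\<^bsub>N\<^esub> n)) n" using h by (simp add: T_smult_el el_minus1)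
  also have "\<dots> = el ((\<ominus>\<^bsub>A\<^esub> a) \<odot>\<^bsub>N\<^esub> n) n" using h by (simp add: Nm.smult_l_minus)
  finally show ?case using g[of "\<ominus>\<^bsub>A\<^esub> a" n] h by (simp add: a_inv_def)
next
  case (eng X Y)
  then show ?case using p[unfolded E_eq] by simp
qed

lemma W_sel:
  "carrier W = q ` carrier T" "ring.zero W = E" "ring.add W = set_add T"
  "a \<odot>\<^bsub>W\<^esub> X = (\<Union>z\<in>X. q (a \<odot>\<^bsub>T\<^esub> z))"
  by (auto simp: exterior_square_def A_RCOSETS_def')

lemma W_FactGroup:
  "carrier W = carrier (T A_Mod E)" "ring.add W = monoid.mult (T A_Mod E)" "ring.zero W = \<one>\<^bsub>T A_Mod E\<^esub>"
  by (simp_all add: exterior_square_def A_FactGroup_def')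

lemma abelian_group_W: "abelian_group W"
proof -
  interpret Q: comm_group "T A_Mod E" by (rule E.a_factorgroup_is_comm_group)
  show ?thesis
    by (rule abelian_groupI; unfold W_FactGroup; (rule Q.m_closed Q.one_closed Q.m_assoc Q.m_comm Q.l_one Q.l_inv_ex; assumption)?)
qed

sublocale W: abelian_group W by (rule abelian_group_W)

lemma q_closed [simp]: "X \<in> carrier T \<Longrightarrow> q X \<in> carrier W"
  by (simp add: W_sel)

lemma q_add: "X \<in> carrier T \<Longrightarrow> Y \<in> carrier T \<Longrightarrow> q (X \<oplus>\<^bsub>T\<^esub> Y) = q X \<oplus>\<^bsub>W\<^esub> q Y"
  by (simp add: W_sel E.a_rcos_sum)

lemma q_E: "X \<in> E \<Longrightarrow> q X = \<zero>\<^bsub>W\<^esub>"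
  by (simp add: W_sel E.a_rcos_const)

lemma q_mem: "X \<in> carrier T \<Longrightarrow> z \<in> q X \<longleftrightarrow> (\<exists>u\<in>E. z = u \<oplus>\<^bsub>T\<^esub> X)"
  by (auto simp: a_r_coset_def')

text \<open>The generating set already contains all scalar multiples of the n \<otimes> n, hence the
  subgroup it generates is a submodule.\<close>

lemma E_smult:
  assumes a: "a \<in> carrier A" and X: "X \<in> E"
  shows "a \<odot>\<^bsub>T\<^esub> X \<in> E"
  using X
proof (induction rule: E_induct)
  case zero then show ?case using a E.zero_closed by (simp add: T_smult_zero)
next
  case (gen c n)
  have "a \<odot>\<^bsub>T\<^esub> el (c \<odot>\<^bsub>N\<^esub> n) n = (a \<otimes>\<^bsub>A\<^esub> c) \<odot>\<^bsub>T\<^esub> el n n"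
    using gen a by (simp add: T_smult_el Nm.smult_assoc1)
  then have "a \<odot>\<^bsub>T\<^esub> el (c \<odot>\<^bsub>N\<^esub> n) n \<in> gens" using gen a unfolding gens_def by auto
  then show ?case unfolding E_eq by (rule generate.incl)
next
  case (add X Y)
  then show ?case using a by (simp add: T_smult_add E.a_Hcarr)
qed

lemma W_smult_q:
  assumes a: "a \<in> carrier A" and X: "X \<in> carrier T"
  shows "a \<odot>\<^bsub>W\<^esub> q X = q (a \<odot>\<^bsub>T\<^esub> X)"
proof -
  have "q (a \<odot>\<^bsub>T\<^esub> z) = q (a \<odot>\<^bsub>T\<^esub> X)" if z: "z \<in> q X" for z
  proof -
    obtain u where u: "u \<in> E" "z = u \<oplus>\<^bsub>T\<^esub> X" using z X by (auto simp: q_mem)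
    then have "q (a \<odot>\<^bsub>T\<^esub> z) = q (a \<odot>\<^bsub>T\<^esub> u) \<oplus>\<^bsub>W\<^esub> q (a \<odot>\<^bsub>T\<^esub> X)"
      using a X by (simp add: T_smult_add T_smult_closed q_add E.a_Hcarr)
    then show ?thesis using a X u q_E[OF E_smult[OF a u(1)]] by (simp add: T_smult_closed)
  qed
  moreover have "q X \<noteq> {}" using E.a_rcos_self[OF X] by auto
  ultimately show ?thesis unfolding W_sel(4) by (rule_tac UN_const_image)
qed

lemma W_smult_closed: "a \<in> carrier A \<Longrightarrow> X \<in> carrier W \<Longrightarrow> a \<odot>\<^bsub>W\<^esub> X \<in> carrier W"
  unfolding W_sel(1) by (elim imageE) (simp add: W_smult_q T_smult_closed)

lemma wedge_q: "wedge A N n n' = q (el n n')"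
  by (simp add: wedge_def)

lemma wedge_closed [simp]: "n \<in> carrier N \<Longrightarrow> n' \<in> carrier N \<Longrightarrow> wedge A N n n' \<in> carrier W"
  by (simp add: wedge_q)

lemma wedge_add1: "n \<in> carrier N \<Longrightarrow> n' \<in> carrier N \<Longrightarrow> n'' \<in> carrier N \<Longrightarrow>
    wedge A N (n \<oplus>\<^bsub>N\<^esub> n') n'' = wedge A N n n'' \<oplus>\<^bsub>W\<^esub> wedge A N n' n''"
  by (simp add: wedge_q el_add1 q_add)

lemma wedge_add2: "n \<in> carrier N \<Longrightarrow> n' \<in> carrier N \<Longrightarrow> n'' \<in> carrier N \<Longrightarrow>
    wedge A N n (n' \<oplus>\<^bsub>N\<^esub> n'') = wedge A N n n' \<oplus>\<^bsub>W\<^esub> wedge A N n n''"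
  by (simp add: wedge_q el_add2 q_add)

lemma wedge_smult: "a \<in> carrier A \<Longrightarrow> n \<in> carrier N \<Longrightarrow> n' \<in> carrier N \<Longrightarrow>
    wedge A N (a \<odot>\<^bsub>N\<^esub> n) n' = a \<odot>\<^bsub>W\<^esub> wedge A N n n'"
  by (simp add: wedge_q W_smult_q T_smult_el)

lemma wedge_self: "n \<in> carrier N \<Longrightarrow> wedge A N n n = \<zero>\<^bsub>W\<^esub>"
proof -
  assume n: "n \<in> carrier N"
  have "\<one>\<^bsub>A\<^esub> \<odot>\<^bsub>T\<^esub> el n n \<in> gens" using n unfolding gens_def by blast
  then have "el n n \<in> E" unfolding E_eq using n by (auto simp: T_smult_el intro: generate.incl)
  then show ?thesis by (simp add: wedge_q q_E)
qed

text \<open>Polarisation: expand the wedge of n + n' with itself, which is zero.\<close>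

lemma wedge_anti:
  assumes n: "n \<in> carrier N" "n' \<in> carrier N"
  shows "wedge A N n n' \<oplus>\<^bsub>W\<^esub> wedge A N n' n = \<zero>\<^bsub>W\<^esub>"
proof -
  have "wedge A N (n \<oplus>\<^bsub>N\<^esub> n') (n \<oplus>\<^bsub>N\<^esub> n') = wedge A N n n' \<oplus>\<^bsub>W\<^esub> wedge A N n' n"
    using n by (subst wedge_add1) (simp_all add: wedge_add2 wedge_self)
  then show ?thesis using wedge_self[of "n \<oplus>\<^bsub>N\<^esub> n'"] n by simp
qed

context
  fixes u v :: "'n \<Rightarrow> 'a"
  assumes uc: "\<And>n. n \<in> carrier N \<Longrightarrow> u n \<in> carrier A" and vc: "\<And>n. n \<in> carrier N \<Longrightarrow> v n \<in> carrier A"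
    and ua: "\<And>n n'. n \<in> carrier N \<Longrightarrow> n' \<in> carrier N \<Longrightarrow> u (n \<oplus>\<^bsub>N\<^esub> n') = u n \<oplus>\<^bsub>A\<^esub> u n'"
    and va: "\<And>n n'. n \<in> carrier N \<Longrightarrow> n' \<in> carrier N \<Longrightarrow> v (n \<oplus>\<^bsub>N\<^esub> n') = v n \<oplus>\<^bsub>A\<^esub> v n'"
    and us: "\<And>a n. a \<in> carrier A \<Longrightarrow> n \<in> carrier N \<Longrightarrow> u (a \<odot>\<^bsub>N\<^esub> n) = a \<otimes>\<^bsub>A\<^esub> u n"
    and vs: "\<And>a n. a \<in> carrier A \<Longrightarrow> n \<in> carrier N \<Longrightarrow> v (a \<odot>\<^bsub>N\<^esub> n) = a \<otimes>\<^bsub>A\<^esub> v n"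
begin

text \<open>The 2 by 2 determinant of two linear functionals. For coordinate functionals it becomes,
  on the exterior square, the coordinate at dx_k wedge dx_l.\<close>

definition alt where "alt n n' = u n \<otimes>\<^bsub>A\<^esub> v n' \<ominus>\<^bsub>A\<^esub> v n \<otimes>\<^bsub>A\<^esub> u n'"

lemma alt_closed: "n \<in> carrier N \<Longrightarrow> n' \<in> carrier N \<Longrightarrow> alt n n' \<in> carrier A"
  by (simp add: alt_def uc vc)

lemma alt_smult: "a \<in> carrier A \<Longrightarrow> n \<in> carrier N \<Longrightarrow> n' \<in> carrier N \<Longrightarrow> alt (a \<odot>\<^bsub>N\<^esub> n) n' = a \<otimes>\<^bsub>A\<^esub> alt n n'"
  by (simp add: alt_def uc vc us vs a_minus_def Nm.R.r_distr Nm.R.r_minus Nm.R.m_assoc)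

lemma alt_bilinear: "bilinear A alt"
  unfolding bilinear_def alt_def
  by (simp add: uc vc ua va us vs a_minus_def Nm.R.l_distr Nm.R.r_distr Nm.R.minus_add Nm.R.a_ac Nm.R.m_ac)

definition altT where "altT = lift A alt"

lemmas altT_el = lift_el[OF Nm.R.abelian_group_axioms alt_bilinear, folded altT_def]
  and altT_closed = lift_closed[OF Nm.R.abelian_group_axioms alt_bilinear, folded altT_def]
  and altT_add = lift_add[OF Nm.R.abelian_group_axioms alt_bilinear, folded altT_def]

lemma altT_smult:
  assumes "X \<in> carrier T" and a: "a \<in> carrier A"
  shows "altT (a \<odot>\<^bsub>T\<^esub> X) = a \<otimes>\<^bsub>A\<^esub> altT X"
  using assms(1)
proof (induction rule: tensor_induct)
  case (elt m n) then show ?case using a by (simp add: T_smult_el altT_el alt_smult)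
next
  case (add X Y) then show ?case using a by (simp add: T_smult_add T_smult_closed altT_add altT_closed Nm.R.r_distr)
qed

lemma altT_zero: "altT \<zero>\<^bsub>T\<^esub> = \<zero>\<^bsub>A\<^esub>"
  using altT_smult[of "\<zero>\<^bsub>T\<^esub>" "\<zero>\<^bsub>A\<^esub>"] altT_closed[of "\<zero>\<^bsub>T\<^esub>"] by (simp add: T_smult_zero)

lemma altT_E: "X \<in> E \<Longrightarrow> altT X = \<zero>\<^bsub>A\<^esub>"
proof (induction rule: E_induct)
  case zero then show ?case by (rule altT_zero)
next
  case (gen a n)
  then show ?case by (simp add: altT_el alt_smult) (simp add: alt_def uc vc Nm.R.m_comm a_minus_def Nm.R.r_neg)
next
  case (add X Y) then show ?case by (simp add: altT_add E.a_Hcarr)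
qed

definition altW where "altW X = the_elem (altT ` X)"

lemma altW_q:
  assumes "X \<in> carrier T"
  shows "altW (q X) = altT X"
proof -
  have "altT ` q X = {altT X}"
  proof
    show "altT ` q X \<subseteq> {altT X}"
      using assms altT_E altT_closed by (auto simp: q_mem altT_add E.a_Hcarr)
    show "{altT X} \<subseteq> altT ` q X" using E.a_rcos_self[OF assms] by auto
  qed
  then show ?thesis by (simp add: altW_def)
qed

lemma altW_closed: "Y \<in> carrier W \<Longrightarrow> altW Y \<in> carrier A"
  unfolding W_sel(1) by (elim imageE) (simp add: altW_q altT_closed)

lemma altW_add: "Y \<in> carrier W \<Longrightarrow> Z \<in> carrier W \<Longrightarrow> altW (Y \<oplus>\<^bsub>W\<^esub> Z) = altW Y \<oplus>\<^bsub>A\<^esub> altW Z"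
  unfolding W_sel(1) by (elim imageE) (simp add: altW_q altT_add flip: q_add)

lemma altW_smult: "Y \<in> carrier W \<Longrightarrow> a \<in> carrier A \<Longrightarrow> altW (a \<odot>\<^bsub>W\<^esub> Y) = a \<otimes>\<^bsub>A\<^esub> altW Y"
  unfolding W_sel(1) by (elim imageE) (simp add: W_smult_q altW_q altT_smult T_smult_closed)

lemma altW_wedge: "n \<in> carrier N \<Longrightarrow> n' \<in> carrier N \<Longrightarrow> altW (wedge A N n n') = u n \<otimes>\<^bsub>A\<^esub> v n' \<ominus>\<^bsub>A\<^esub> v n \<otimes>\<^bsub>A\<^esub> u n'"
  by (simp add: wedge_q altW_q altT_el alt_def)

end

end

text \<open>Peeling off the last row and column leaves the pairs f(n,j) + f(j,n) and a diagonal
  entry. Pairing the terms, rather than identifying the sum with its negative, stays valid when 2 is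
  a zero divisor.\<close>

lemma (in abelian_group) alternating_sum_zero:
  assumes c: "\<And>i j. i < n \<Longrightarrow> j < n \<Longrightarrow> f i j \<in> carrier G"
    and s: "\<And>i. i < n \<Longrightarrow> f i i = \<zero>"
    and a: "\<And>i j. i < n \<Longrightarrow> j < n \<Longrightarrow> f i j \<oplus> f j i = \<zero>"
  shows "(\<Oplus>i\<in>{..<n::nat}. \<Oplus>j\<in>{..<n}. f i j) = \<zero>"
  using assms
proof (induction n)
  case 0 then show ?case by simp
next
  case (Suc n)
  have 1: "(\<Oplus>j\<in>{..<Suc n}. f i j) = f i n \<oplus> (\<Oplus>j\<in>{..<n}. f i j)" if "i < Suc n" for i
    unfolding lessThan_Suc using Suc.prems(1) that by (intro finsum_insert) auto
  have c: "(\<Oplus>j\<in>{..<n}. f i j) \<in> carrier G" if "i < Suc n" for i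
    using Suc.prems(1) that by (intro finsum_closed) auto
  have "(\<Oplus>i\<in>{..<Suc n}. \<Oplus>j\<in>{..<Suc n}. f i j) = (\<Oplus>i\<in>{..<Suc n}. f i n \<oplus> (\<Oplus>j\<in>{..<n}. f i j))"
    using 1 c Suc.prems(1) by (intro finsum_cong') auto
  also have "\<dots> = (f n n \<oplus> (\<Oplus>j\<in>{..<n}. f n j)) \<oplus> (\<Oplus>i\<in>{..<n}. f i n \<oplus> (\<Oplus>j\<in>{..<n}. f i j))"
    unfolding lessThan_Suc using c Suc.prems(1) by (intro finsum_insert) auto
  also have "(\<Oplus>i\<in>{..<n}. f i n \<oplus> (\<Oplus>j\<in>{..<n}. f i j)) = (\<Oplus>i\<in>{..<n}. f i n) \<oplus> (\<Oplus>i\<in>{..<n}. \<Oplus>j\<in>{..<n}. f i j)"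
    using c Suc.prems(1) by (intro finsum_addf) auto
  also have "(\<Oplus>i\<in>{..<n}. \<Oplus>j\<in>{..<n}. f i j) = \<zero>"
    using Suc.prems by (intro Suc.IH) auto
  also have "f n n = \<zero>" using Suc.prems(2) by simp
  also have "\<zero> \<oplus> (\<Oplus>j\<in>{..<n}. f n j) \<oplus> ((\<Oplus>i\<in>{..<n}. f i n) \<oplus> \<zero>) = (\<Oplus>j\<in>{..<n}. f n j) \<oplus> (\<Oplus>i\<in>{..<n}. f i n)"
    using Suc.prems(1) by (simp add: finsum_closed Pi_def)
  also have "\<dots> = (\<Oplus>j\<in>{..<n}. f n j \<oplus> f j n)"
    using Suc.prems(1) by (intro finsum_addf[symmetric]) auto
  also have "\<dots> = (\<Oplus>j\<in>{..<n}. \<zero>)" using Suc.prems(3) by (intro finsum_cong') auto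
  also have "\<dots> = \<zero>" by simp
  finally show ?case .
qed

context connection_module begin

lemma module_Omega: "Module.module A \<Omega>"
  by (rule moduleI)
     (simp_all add: is_cring abelian_group_Omega P1.cf_const_mult P1.P.l_distr P1.P.r_distr P1.P.m_assoc)

sublocale Ex: exterior A \<Omega>
proof -
  interpret O: Module.module A \<Omega> by (rule module_Omega)
  show "exterior A \<Omega>" by unfold_locales (auto simp: P1.cf_const_mult)
qed

abbreviation "\<Omega>2 \<equiv> exterior_square A \<Omega>"
abbreviation "wd \<equiv> wedge A \<Omega>"

sublocale TW: tensor_pair A M \<Omega>2
  by unfold_locales (simp_all add: Ex.W_smult_closed)

abbreviation wmap where "wmap i \<equiv> tensor_map A M \<Omega>2 (\<lambda>m. m) (\<lambda>\<omega>. wd \<omega> (P1.px i))"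

context
  fixes i assumes i: "i < d"
begin

lemma wmap_bal: "a \<in> carrier A \<Longrightarrow> m \<in> carrier M \<Longrightarrow> w \<in> carrier \<Omega> \<Longrightarrow>
    TW.el (a \<odot>\<^bsub>M\<^esub> m) (wd w (P1.px i)) = TW.el m (wd (a \<odot>\<^bsub>\<Omega>\<^esub> w) (P1.px i))"
  using TW.el_balanced[of a m "wd w (P1.px i)"] Ex.wedge_closed[OF _ px_Omega[OF i], of w]
    Ex.wedge_smult[OF _ _ px_Omega[OF i], of a w] by simp

lemma wmap_prems:
  "w \<in> carrier \<Omega> \<Longrightarrow> wd w (P1.px i) \<in> carrier \<Omega>2"
  "w \<in> carrier \<Omega> \<Longrightarrow> w' \<in> carrier \<Omega> \<Longrightarrow> wd (w \<oplus>\<^bsub>\<Omega>\<^esub> w') (P1.px i) = wd w (P1.px i) \<oplus>\<^bsub>\<Omega>2\<^esub> wd w' (P1.px i)"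
  using Ex.wedge_closed[OF _ px_Omega[OF i], of w] Ex.wedge_add1[OF _ _ px_Omega[OF i], of w w'] by simp_all

lemma wmap_el: "m \<in> carrier M \<Longrightarrow> w \<in> carrier \<Omega> \<Longrightarrow> wmap i (TO.el m w) = TW.el m (wd w (P1.px i))"
  by (rule TO.tensor_map_el[OF TW.tensor_pair_axioms _ _ wmap_prems wmap_bal]) simp_all

lemma wmap_closed: "X \<in> carrier TO.T \<Longrightarrow> wmap i X \<in> carrier TW.T"
  by (rule TO.tensor_map_closed[OF TW.tensor_pair_axioms _ _ wmap_prems wmap_bal]) simp_all

lemma wmap_add: "X \<in> carrier TO.T \<Longrightarrow> Y \<in> carrier TO.T \<Longrightarrow> wmap i (X \<oplus>\<^bsub>TO.T\<^esub> Y) = wmap i X \<oplus>\<^bsub>TW.T\<^esub> wmap i Y"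
  by (rule TO.tensor_map_add[OF TW.tensor_pair_axioms _ _ wmap_prems wmap_bal]) simp_all

lemma wmap_zero: "wmap i \<zero>\<^bsub>TO.T\<^esub> = \<zero>\<^bsub>TW.T\<^esub>"
  using wmap_add[of "\<zero>\<^bsub>TO.T\<^esub>" "\<zero>\<^bsub>TO.T\<^esub>"] wmap_closed[of "\<zero>\<^bsub>TO.T\<^esub>"] by simp

lemma wmap_sum:
  assumes "finite J" "\<And>j. j \<in> J \<Longrightarrow> f j \<in> carrier TO.T"
  shows "wmap i (\<Oplus>\<^bsub>TO.T\<^esub>j\<in>J. f j) = (\<Oplus>\<^bsub>TW.T\<^esub>j\<in>J. wmap i (f j))"
  using assms
proof (induction J rule: finite_induct)
  case empty then show ?case by (simp add: wmap_zero)
next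
  case (insert j J) then show ?case by (simp add: wmap_add wmap_closed Pi_def TO.T.finsum_closed)
qed

lemma wmap_expand:
  assumes X: "X \<in> carrier TO.T"
  shows "wmap i X = (\<Oplus>\<^bsub>TW.T\<^esub>j\<in>{..<d}. TW.el (TO.coord j X) (wd (P1.px j) (P1.px i)))"
proof -
  have c: "TO.coord j X \<in> carrier M" "P1.px j \<in> carrier \<Omega>" if "j < d" for j
    using that X px_Omega by (simp_all add: TO.coord_closed)
  have "wmap i X = wmap i (\<Oplus>\<^bsub>TO.T\<^esub>j\<in>{..<d}. TO.el (TO.coord j X) (P1.px j))"
    using TO.tensor_expand[OF X] by simp
  also have "\<dots> = (\<Oplus>\<^bsub>TW.T\<^esub>j\<in>{..<d}. wmap i (TO.el (TO.coord j X) (P1.px j)))"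
    using c by (intro wmap_sum) (auto intro!: TO.el_closed simp del: Omega_sel(1))
  also have "\<dots> = (\<Oplus>\<^bsub>TW.T\<^esub>j\<in>{..<d}. TW.el (TO.coord j X) (wd (P1.px j) (P1.px i)))"
    using c Ex.wedge_closed[OF px_Omega px_Omega[OF i]]
    by (intro TW.T.finsum_cong') (auto simp: wmap_el simp del: Omega_sel(1))
  finally show ?thesis .
qed

end

text \<open>The \<open>dx\<^sub>k \<and> dx\<^sub>l\<close>-coordinate on \<open>M \<otimes> \<Omega>\<^sup>2\<close>.\<close>

definition wcoord :: "nat \<Rightarrow> nat \<Rightarrow> _ \<Rightarrow> 'm" where
  "wcoord k l = TW.lift M (\<lambda>m \<theta>. Ex.altW (co {#k#}) (co {#l#}) \<theta> \<odot>\<^bsub>M\<^esub> m)"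

context
  fixes k l assumes kl: "k < d" "l < d"
begin

lemma co_lin:
  assumes "i < d"
  shows "\<And>n. n \<in> carrier \<Omega> \<Longrightarrow> co {#i#} n \<in> carrier A"
    "\<And>n n'. n \<in> carrier \<Omega> \<Longrightarrow> n' \<in> carrier \<Omega> \<Longrightarrow> co {#i#} (n \<oplus>\<^bsub>\<Omega>\<^esub> n') = co {#i#} n \<oplus> co {#i#} n'"
    "\<And>a n. a \<in> carrier A \<Longrightarrow> n \<in> carrier \<Omega> \<Longrightarrow> co {#i#} (a \<odot>\<^bsub>\<Omega>\<^esub> n) = a \<otimes> co {#i#} n"
  using assms by (simp_all add: P1.cf_add P1.cf_const_mult)

lemmas altW_rules = co_lin(1)[OF kl(1)] co_lin(1)[OF kl(2)] co_lin(2)[OF kl(1)] co_lin(2)[OF kl(2)]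
  co_lin(3)[OF kl(1)] co_lin(3)[OF kl(2)]

lemma altW_facts:
  "X \<in> carrier \<Omega>2 \<Longrightarrow> Ex.altW (co {#k#}) (co {#l#}) X \<in> carrier A"
  "X \<in> carrier \<Omega>2 \<Longrightarrow> Y \<in> carrier \<Omega>2 \<Longrightarrow> Ex.altW (co {#k#}) (co {#l#}) (X \<oplus>\<^bsub>\<Omega>2\<^esub> Y) =
    Ex.altW (co {#k#}) (co {#l#}) X \<oplus> Ex.altW (co {#k#}) (co {#l#}) Y"
  "a \<in> carrier A \<Longrightarrow> X \<in> carrier \<Omega>2 \<Longrightarrow> Ex.altW (co {#k#}) (co {#l#}) (a \<odot>\<^bsub>\<Omega>2\<^esub> X) =
    a \<otimes> Ex.altW (co {#k#}) (co {#l#}) X"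
  "n \<in> carrier \<Omega> \<Longrightarrow> n' \<in> carrier \<Omega> \<Longrightarrow> Ex.altW (co {#k#}) (co {#l#}) (wd n n') =
    co {#k#} n \<otimes> co {#l#} n' \<ominus> co {#l#} n \<otimes> co {#k#} n'"
     apply (rule Ex.altW_closed; (assumption | rule altW_rules; assumption))
    apply (rule Ex.altW_add; (assumption | rule altW_rules; assumption))
   apply (rule Ex.altW_smult; (assumption | rule altW_rules; assumption))
  apply (rule Ex.altW_wedge; (assumption | rule altW_rules; assumption))
  done

lemma wcoord_bilinear: "TW.bilinear M (\<lambda>m \<theta>. Ex.altW (co {#k#}) (co {#l#}) \<theta> \<odot>\<^bsub>M\<^esub> m)"
  unfolding TW.bilinear_def
  by (simp add: altW_facts M.smult_l_distr M.smult_r_distr M.smult_assoc1[symmetric] m_comm)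

lemmas wcoord_el = TW.lift_el[OF M.abelian_group_axioms wcoord_bilinear, folded wcoord_def]
  and wcoord_closed = TW.lift_closed[OF M.abelian_group_axioms wcoord_bilinear, folded wcoord_def]
  and wcoord_add = TW.lift_add[OF M.abelian_group_axioms wcoord_bilinear, folded wcoord_def]

text \<open>Wedging with dx_i reaches dx_k wedge dx_l from the coordinate of X at k if i = l, and
  from that at l, with a minus sign, if i = k.\<close>

lemma wcoord_wmap:
  assumes X: "X \<in> carrier TO.T" and i: "i < d"
  shows "wcoord k l (wmap i X) =
    (if l = i then TO.coord k X else \<zero>\<^bsub>M\<^esub>) \<ominus>\<^bsub>M\<^esub> (if k = i then TO.coord l X else \<zero>\<^bsub>M\<^esub>)"
  using X
proof (induction rule: TO.tensor_induct)
  case (elt m w)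
  have wc: "co {#j#} w \<in> carrier A" if "j < d" for j using that elt by simp
  have "wcoord k l (wmap i (TO.el m w)) = (co {#k#} w \<otimes> co {#l#} (P1.px i) \<ominus> co {#l#} w \<otimes> co {#k#} (P1.px i)) \<odot>\<^bsub>M\<^esub> m"
    using wcoord_el[OF elt(1) Ex.wedge_closed[OF elt(2) px_Omega[OF i]]] wmap_el[OF i elt]
      altW_facts(4)[OF elt(2) px_Omega[OF i]] by simp
  then show ?case
    using kl i elt wc TO.coord_el[OF _ elt]
    by (simp add: co_px a_minus_def M.smult_l_distr M.smult_l_minus M.smult_l_null)
next
  case (add X Y)
  then show ?case using kl i
    by (simp add: wmap_add wmap_closed wcoord_add TO.coord_add TO.coord_closed a_minus_def M.minus_add M.a_ac)
qed

lemma wcoord_zero: "wcoord k l \<zero>\<^bsub>TW.T\<^esub> = \<zero>\<^bsub>M\<^esub>"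
  using wcoord_add[of "\<zero>\<^bsub>TW.T\<^esub>" "\<zero>\<^bsub>TW.T\<^esub>"] wcoord_closed[of "\<zero>\<^bsub>TW.T\<^esub>"] by simp

lemma wcoord_sum:
  assumes "finite J" "\<And>j. j \<in> J \<Longrightarrow> f j \<in> carrier TW.T"
  shows "wcoord k l (\<Oplus>\<^bsub>TW.T\<^esub>j\<in>J. f j) = (\<Oplus>\<^bsub>M\<^esub>j\<in>J. wcoord k l (f j))"
  using assms
proof (induction J rule: finite_induct)
  case empty then show ?case by (simp add: wcoord_zero)
next
  case (insert j J) then show ?case by (simp add: wcoord_add wcoord_closed Pi_def TW.T.finsum_closed)
qed

end

section \<open>Integrability as commutation of the components\<close>

context
  fixes D :: "('a, 'm) conn"
  assumes D: "D \<in> carrier M \<rightarrow>\<^sub>E carrier TO.T"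
    and D_add: "\<And>i s t. i < d \<Longrightarrow> s \<in> carrier M \<Longrightarrow> t \<in> carrier M \<Longrightarrow>
      TO.coord i (D (s \<oplus>\<^bsub>M\<^esub> t)) = TO.coord i (D s) \<oplus>\<^bsub>M\<^esub> TO.coord i (D t)"
begin

abbreviation pdc where "pdc i s \<equiv> TO.coord i (D s)"

lemma Dc: "s \<in> carrier M \<Longrightarrow> D s \<in> carrier TO.T"
  using D by auto

lemma pdc_closed: "i < d \<Longrightarrow> s \<in> carrier M \<Longrightarrow> pdc i s \<in> carrier M"
  by (simp add: TO.coord_closed Dc)

lemma D_plus: "s \<in> carrier M \<Longrightarrow> t \<in> carrier M \<Longrightarrow> D (s \<oplus>\<^bsub>M\<^esub> t) = D s \<oplus>\<^bsub>TO.T\<^esub> D t"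
  by (rule TO.tensor_eqI) (simp_all add: Dc D_add TO.coord_add)

lemma D_zero: "D \<zero>\<^bsub>M\<^esub> = \<zero>\<^bsub>TO.T\<^esub>"
  using D_plus[of "\<zero>\<^bsub>M\<^esub>" "\<zero>\<^bsub>M\<^esub>"] Dc[of "\<zero>\<^bsub>M\<^esub>"] by simp

text \<open>The coordinate of D1(D(s)) at dx_k wedge dx_l is \<partial>_k \<partial>_l s -
  \<partial>_l \<partial>_k s.\<close>

lemma integrable_imp_commute:
  assumes int: "integrable_connection A d \<sigma> x M D" and kl: "k < d" "l < d" and s: "s \<in> carrier M"
  shows "pdc k (pdc l s) = pdc l (pdc k s)"
proof -
  obtain D1 where D1: "D1 \<in> hom (add_monoid TO.T) (add_monoid TW.T)"
    "\<And>m i. m \<in> carrier M \<Longrightarrow> i < d \<Longrightarrow> D1 (TO.el m (P1.px i)) = wmap i (D m)"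
    "\<And>s. s \<in> carrier M \<Longrightarrow> D1 (D s) = \<zero>\<^bsub>TW.T\<^esub>"
    using int unfolding integrable_connection_def Let_def One_nat_def by blast
  have e: "TO.el (pdc i s) (P1.px i) \<in> carrier TO.T" if "i < d" for i
    using that s pdc_closed px_Omega TO.el_closed by blast
  have gh: "group_hom (add_monoid TO.T) (add_monoid TW.T) D1"
    using D1(1) by (simp add: group_hom_def group_hom_axioms_def TO.T.a_group TW.T.a_group)
  have D1_sum: "D1 (\<Oplus>\<^bsub>TO.T\<^esub>j\<in>J. f j) = (\<Oplus>\<^bsub>TW.T\<^esub>j\<in>J. D1 (f j))"
    if "finite J" "\<And>j. j \<in> J \<Longrightarrow> f j \<in> carrier TO.T" for J :: "nat set" and f
    using that
  proof (induction J rule: finite_induct)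
    case empty then show ?case using group_hom.hom_one[OF gh] by simp
  next
    case (insert j J)
    then have "D1 (f j \<oplus>\<^bsub>TO.T\<^esub> (\<Oplus>\<^bsub>TO.T\<^esub>j\<in>J. f j)) = D1 (f j) \<oplus>\<^bsub>TW.T\<^esub> D1 (\<Oplus>\<^bsub>TO.T\<^esub>j\<in>J. f j)"
      using hom_mult[OF D1(1), of "f j" "\<Oplus>\<^bsub>TO.T\<^esub>j\<in>J. f j"] by (simp add: TO.T.finsum_closed Pi_def)
    then show ?case using insert hom_in_carrier[OF D1(1)] by (simp add: Pi_def)
  qed
  have "\<zero>\<^bsub>TW.T\<^esub> = D1 (\<Oplus>\<^bsub>TO.T\<^esub>i\<in>{..<d}. TO.el (pdc i s) (P1.px i))"
    using D1(3)[OF s] TO.tensor_expand[OF Dc[OF s]] by simp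
  also have "\<dots> = (\<Oplus>\<^bsub>TW.T\<^esub>i\<in>{..<d}. D1 (TO.el (pdc i s) (P1.px i)))"
    using e by (intro D1_sum) auto
  also have "\<dots> = (\<Oplus>\<^bsub>TW.T\<^esub>i\<in>{..<d}. wmap i (D (pdc i s)))"
    using s pdc_closed D1(2) wmap_closed Dc by (intro TW.T.finsum_cong') auto
  finally have "wcoord k l \<zero>\<^bsub>TW.T\<^esub> = wcoord k l (\<Oplus>\<^bsub>TW.T\<^esub>i\<in>{..<d}. wmap i (D (pdc i s)))" by simp
  also have "\<dots> = (\<Oplus>\<^bsub>M\<^esub>i\<in>{..<d}. wcoord k l (wmap i (D (pdc i s))))"
    using s pdc_closed wmap_closed Dc by (intro wcoord_sum kl) auto
  also have "\<dots> = (\<Oplus>\<^bsub>M\<^esub>i\<in>{..<d}. (if l = i then pdc k (pdc i s) else \<zero>\<^bsub>M\<^esub>) \<oplus>\<^bsub>M\<^esub> (if k = i then \<ominus>\<^bsub>M\<^esub> pdc l (pdc i s) else \<zero>\<^bsub>M\<^esub>))"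
    using s pdc_closed Dc kl by (intro M.finsum_cong') (auto simp: wcoord_wmap a_minus_def)
  also have "\<dots> = (\<Oplus>\<^bsub>M\<^esub>i\<in>{..<d}. if l = i then pdc k (pdc i s) else \<zero>\<^bsub>M\<^esub>) \<oplus>\<^bsub>M\<^esub>
      (\<Oplus>\<^bsub>M\<^esub>i\<in>{..<d}. if k = i then \<ominus>\<^bsub>M\<^esub> pdc l (pdc i s) else \<zero>\<^bsub>M\<^esub>)"
    using s pdc_closed kl by (intro M.finsum_addf) auto
  also have "\<dots> = pdc k (pdc l s) \<ominus>\<^bsub>M\<^esub> pdc l (pdc k s)"
    using M.finsum_singleton[of l "{..<d}" "\<lambda>i. pdc k (pdc i s)"]
      M.finsum_singleton[of k "{..<d}" "\<lambda>i. \<ominus>\<^bsub>M\<^esub> pdc l (pdc i s)"] s pdc_closed kl by (simp add: a_minus_def)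
  finally have "pdc k (pdc l s) \<ominus>\<^bsub>M\<^esub> pdc l (pdc k s) = \<zero>\<^bsub>M\<^esub>" using wcoord_zero[OF kl] by simp
  then show ?thesis by (rule_tac M.eq_if_minus_zero) (use s kl pdc_closed in auto)
qed

text \<open>D1(D(s)) is the double sum of the \<partial>_j \<partial>_i s \<otimes> (dx_j wedge
  dx_i), symmetric in the left factor and alternating in the right one.\<close>

lemma commute_imp_integrable:
  assumes comm: "\<And>k l s. k < d \<Longrightarrow> l < d \<Longrightarrow> s \<in> carrier M \<Longrightarrow> pdc k (pdc l s) = pdc l (pdc k s)"
  shows "integrable_connection A d \<sigma> x M D"
proof -
  \<comment> \<open>The only possible extension to forms: the form is written in coordinates, and D
    is applied to each of them before wedging with dx_i.\<close>
  define D1 where "D1 X = (\<Oplus>\<^bsub>TW.T\<^esub>i\<in>{..<d}. wmap i (D (TO.coord i X)))" for X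
  have w: "wmap i (D (TO.coord i X)) \<in> carrier TW.T" if "i < d" "X \<in> carrier TO.T" for i X
    using that by (simp add: wmap_closed Dc TO.coord_closed)
  have "D1 \<in> hom (add_monoid TO.T) (add_monoid TW.T)"
  proof (rule homI)
    fix X assume "X \<in> carrier (add_monoid TO.T)"
    then show "D1 X \<in> carrier (add_monoid TW.T)"
      unfolding D1_def using w by (simp add: TW.T.finsum_closed Pi_def)
  next
    fix X Y assume "X \<in> carrier (add_monoid TO.T)" "Y \<in> carrier (add_monoid TO.T)"
    then have XY: "X \<in> carrier TO.T" "Y \<in> carrier TO.T" by simp_all
    have "D1 (X \<oplus>\<^bsub>TO.T\<^esub> Y) = (\<Oplus>\<^bsub>TW.T\<^esub>i\<in>{..<d}. wmap i (D (TO.coord i X)) \<oplus>\<^bsub>TW.T\<^esub> wmap i (D (TO.coord i Y)))"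
      unfolding D1_def using XY w
      by (intro TW.T.finsum_cong') (auto simp: TO.coord_add TO.coord_closed D_plus Dc wmap_add)
    also have "\<dots> = D1 X \<oplus>\<^bsub>TW.T\<^esub> D1 Y"
      unfolding D1_def using XY w by (intro TW.T.finsum_addf) auto
    finally show "D1 (X \<otimes>\<^bsub>add_monoid TO.T\<^esub> Y) = D1 X \<otimes>\<^bsub>add_monoid TW.T\<^esub> D1 Y" by simp
  qed
  moreover have "D1 (TO.el m (P1.px i)) = wmap i (D m)" if m: "m \<in> carrier M" and i: "i < d" for m i
  proof -
    have c: "TO.coord j (TO.el m (P1.px i)) = (if i = j then m else \<zero>\<^bsub>M\<^esub>)" if "j < d" for j
      using TO.coord_el[OF _ m px_Omega[OF i], of j] that m i by (simp add: co_px M.smult_l_null)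
    have "D1 (TO.el m (P1.px i)) = (\<Oplus>\<^bsub>TW.T\<^esub>j\<in>{..<d}. if i = j then wmap j (D m) else \<zero>\<^bsub>TW.T\<^esub>)"
      unfolding D1_def using m
      by (intro TW.T.finsum_cong') (auto simp: c wmap_closed Dc D_zero wmap_zero)
    also have "\<dots> = wmap i (D m)"
      using TW.T.finsum_singleton[of i "{..<d}" "\<lambda>j. wmap j (D m)"] m i by (simp add: wmap_closed Dc)
    finally show ?thesis .
  qed
  moreover have "D1 (D s) = \<zero>\<^bsub>TW.T\<^esub>" if s: "s \<in> carrier M" for s
  proof -
    have wdc: "wd (P1.px j) (P1.px i) \<in> carrier \<Omega>2" if "j < d" "i < d" for i j
      using Ex.wedge_closed[OF px_Omega px_Omega] that .
    have pp: "pdc j (pdc i s) \<in> carrier M" if "j < d" "i < d" for i j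
      using that s by (simp add: pdc_closed)
    have "D1 (D s) = (\<Oplus>\<^bsub>TW.T\<^esub>i\<in>{..<d}. \<Oplus>\<^bsub>TW.T\<^esub>j\<in>{..<d}. TW.el (pdc j (pdc i s)) (wd (P1.px j) (P1.px i)))"
      unfolding D1_def using s wdc pp
      by (intro TW.T.finsum_cong') (auto simp: wmap_expand Dc pdc_closed TW.T.finsum_closed Pi_def)
    also have "\<dots> = \<zero>\<^bsub>TW.T\<^esub>"
    proof (rule TW.T.alternating_sum_zero)
      fix i j assume ij: "i < d" "j < d"
      show "TW.el (pdc j (pdc i s)) (wd (P1.px j) (P1.px i)) \<in> carrier TW.T"
        using pp wdc ij by simp
      show "TW.el (pdc j (pdc i s)) (wd (P1.px j) (P1.px i)) \<oplus>\<^bsub>TW.T\<^esub>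
          TW.el (pdc i (pdc j s)) (wd (P1.px i) (P1.px j)) = \<zero>\<^bsub>TW.T\<^esub>"
        using comm[OF ij s] pp ij wdc Ex.wedge_anti[OF px_Omega px_Omega] by (simp flip: TW.el_add2)
    next
      fix i assume "i < d"
      then show "TW.el (pdc i (pdc i s)) (wd (P1.px i) (P1.px i)) = \<zero>\<^bsub>TW.T\<^esub>"
        using Ex.wedge_self[OF px_Omega] pp by simp
    qed
    finally show ?thesis .
  qed
  ultimately show ?thesis
    unfolding integrable_connection_def Let_def One_nat_def by blast
qed

end

end

section \<open>Good coordinates\<close>

lemma subtring_sel:
  "carrier (subtring A S) = S"
  "monoid.mult (subtring A S) = monoid.mult A"
  "monoid.one (subtring A S) = monoid.one A"
  "ring.zero (subtring A S) = ring.zero A"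
  "ring.add (subtring A S) = ring.add A"
  by (simp_all add: subtring_def)

text \<open>Finite sums depend on the ring record, so those of the subring have to be identified
  with those of A; convolution products need this.\<close>

lemma finsum_subtring:
  assumes "abelian_group A" "abelian_group (subtring A S)" "S \<subseteq> carrier A"
    and "finite F" "\<And>j. j \<in> F \<Longrightarrow> f j \<in> S"
  shows "finsum (subtring A S) f F = finsum A f F"
proof -
  interpret A: abelian_group A by fact
  interpret B: abelian_group "subtring A S" by fact
  show ?thesis
    using assms(4,5)
  proof (induction F rule: finite_induct)
    case (insert j F)
    then have "finsum (subtring A S) f (insert j F) = f j \<oplus>\<^bsub>subtring A S\<^esub> finsum (subtring A S) f F"
      by (intro B.finsum_insert) (auto simp: subtring_sel)
    moreover have "finsum A f (insert j F) = f j \<oplus>\<^bsub>A\<^esub> finsum A f F"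
      using insert assms(3) by (intro A.finsum_insert) auto
    ultimately show ?case using insert by (simp add: subtring_sel)
  qed (simp add: subtring_sel)
qed

section \<open>Principal parts of a subring\<close>

locale subring_principal_parts = principal_parts_ring A d \<sigma> x n +
    B: principal_parts_ring "subtring A A0" d \<sigma> x n
  for A :: "'a tring" (structure) and d \<sigma> x n and A0 :: "'a set" +
  assumes A0: "A0 \<subseteq> carrier A"
begin

lemma sub_hom: "(\<lambda>a. a) \<in> ring_hom (subtring A A0) A"
  using A0 by (intro ring_hom_memI) (auto simp: subtring_sel)

lemma poly_sub: "p \<in> carrier B.T \<Longrightarrow> p \<in> carrier T"
  using A0 by (auto simp: T_sel B.T_sel carrier_S B.carrier_S subtring_sel)

lemma const_sub: "mpoly_const (subtring A A0) c = mpoly_const A c"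
  and var_sub: "mpoly_var (subtring A A0) v = mpoly_var A v"
  by (simp_all add: mpoly_const_def mpoly_var_def subtring_sel cong: if_cong)

lemma mult_sub:
  assumes "p \<in> carrier B.T" "r \<in> carrier B.T"
  shows "p \<otimes>\<^bsub>B.T\<^esub> r = p \<otimes>\<^bsub>T\<^esub> r"
proof
  fix m
  have c: "p k \<in> A0" "r k \<in> A0" for k using assms by (auto simp: B.T_sel B.carrier_S subtring_sel)
  have c': "p k \<otimes> r l \<in> A0" for k l
    using B.m_closed[of "p k" "r l"] c by (simp add: subtring_sel)
  show "(p \<otimes>\<^bsub>B.T\<^esub> r) m = (p \<otimes>\<^bsub>T\<^esub> r) m"
    unfolding T_sel B.T_sel mult_S B.mult_S
    using finsum_subtring[OF abelian_group_axioms B.abelian_group_axioms A0 finite_submultisets, where f = "\<lambda>k. p k \<otimes> r (m - k)"] c'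
    by (simp add: subtring_sel)
qed

lemma add_sub: "p \<oplus>\<^bsub>B.T\<^esub> r = p \<oplus>\<^bsub>T\<^esub> r"
  unfolding T_sel B.T_sel by (simp only: mpoly_ring_def subtring_sel ring.simps)

lemma one_sub: "\<one>\<^bsub>B.T\<^esub> = \<one>\<^bsub>T\<^esub>"
  unfolding T_sel B.T_sel by (simp only: mpoly_ring_def subtring_sel monoid.simps)

lemma poly_hom: "(\<lambda>p. p) \<in> ring_hom B.T T"
  apply (rule ring_hom_memI) 
     apply (erule poly_sub)
    apply (erule (1) mult_sub)
   apply (rule add_sub)
  apply (rule one_sub)
  done

lemma xip_sub: "set_mset k \<subseteq> {..<d} \<Longrightarrow> B.xip k = xip k"
proof (induction k)
  case empty
  then show ?case using ring_hom_one[OF poly_hom] by (simp add: xip_empty B.xip_empty)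
next
  case (add i k)
  then have i: "i < d" and k: "B.xip k = xip k" by auto
  have "B.shift i (count k i) = shift i (count k i)"
    using i ring_hom_cring.hom_a_inv[OF ring_hom_cringI[OF B.is_cring is_cring sub_hom], of "(\<sigma> i ^^ count k i) (x i)"] B.sigma_pow_closed[OF i]
    by (simp add: shift_def B.shift_def a_minus_def subtring_sel)
  then have fac: "B.fac i (count k i) = fac i (count k i)"
    by (simp only: const_sub var_sub add_sub)
  have "B.xip (add_mset i k) = B.fac i (count k i) \<otimes>\<^bsub>T\<^esub> B.xip k"
    unfolding B.xip_add[OF i] using i by (rule_tac mult_sub) simp_all
  then show ?case by (simp only: fac k xip_add[OF i])
qed

lemma cl_sub_hom: "cl \<in> ring_hom B.T P"
  using ring_hom_trans[OF poly_hom cl_hom] by (simp add: comp_def)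

text \<open>The ideal over the subring is generated by twisted powers that coincide with those over
  A, so it lies in the kernel of the projection to the principal parts of A.\<close>

lemma cl_sub_zero:
  assumes z: "z \<in> B.I"
  shows "cl z = \<zero>\<^bsub>P\<^esub>"
proof -
  have "ring_hom_ring B.T P cl"
    by (rule ring_hom_ringI2[OF B.T.ring_axioms P.ring_axioms cl_sub_hom])
  then have K: "ideal (a_kernel B.T P cl) B.T" by (rule ring_hom_ring.kernel_is_ideal)
  have "B.xip k \<in> a_kernel B.T P cl" if k: "set_mset k \<subseteq> {..<d}" "size k = n + 1" for k
  proof -
    have "cl (B.xip k) = \<zero>\<^bsub>P\<^esub>" unfolding xip_sub[OF k(1)] using k by (intro Xi_zero) simp_all
    then show ?thesis using B.xip_closed[of k] unfolding a_kernel_def' by blast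
  qed
  then have "B.I \<subseteq> a_kernel B.T P cl"
    unfolding xi_ideal_def[of "subtring A A0"] by (intro B.T.genideal_minimal[OF K]) blast
  then show ?thesis using z unfolding a_kernel_def' by blast
qed

text \<open>The map of principal parts induced by the inclusion, written as the union that occurs in
  \<open>good_taylor_map\<close>; the classes united in it all coincide.\<close>

definition ext :: "(nat, 'a) mpoly set \<Rightarrow> (nat, 'a) mpoly set" where "ext X = (\<Union>p\<in>X. cl p)"

lemma ext_cl: "p \<in> carrier B.T \<Longrightarrow> ext (B.cl p) = cl p"
proof -
  assume p: "p \<in> carrier B.T"
  have "cl r = cl p" if "r \<in> B.cl p" for r
  proof -
    obtain z where z: "z \<in> B.I" "r = z \<oplus>\<^bsub>T\<^esub> p" using \<open>r \<in> B.cl p\<close> unfolding B.cl_mem[OF p] add_sub by blast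
    then have "z \<in> carrier T" "p \<in> carrier T" using poly_sub p B.I.a_Hcarr by blast+
    then show ?thesis using z cl_sub_zero[OF z(1)] by simp
  qed
  then show ?thesis unfolding ext_def using B.cl_self[OF p] by blast
qed

lemma ext_hom: "ext \<in> ring_hom B.P P"
proof (rule ring_hom_memI)
  fix X Y assume "X \<in> carrier B.P" "Y \<in> carrier B.P"
  then obtain p r where "X = B.cl p" "Y = B.cl r" "p \<in> carrier B.T" "r \<in> carrier B.T"
    by (auto simp: B.carrier_P)
  then show "ext (X \<otimes>\<^bsub>B.P\<^esub> Y) = ext X \<otimes>\<^bsub>P\<^esub> ext Y" "ext (X \<oplus>\<^bsub>B.P\<^esub> Y) = ext X \<oplus>\<^bsub>P\<^esub> ext Y"
    by (simp_all add: ext_cl ring_hom_mult[OF cl_sub_hom] ring_hom_add[OF cl_sub_hom] flip: B.cl.hom_mult B.cl.hom_add)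
next
  show "ext \<one>\<^bsub>B.P\<^esub> = \<one>\<^bsub>P\<^esub>" by (metis B.T.one_closed B.cl.hom_one cl.hom_one one_sub ext_cl)
  show "ext X \<in> carrier P" if "X \<in> carrier B.P" for X
    using that ext_cl ring_hom_closed[OF cl_sub_hom] unfolding B.carrier_P by auto
qed

lemma ext_const: "a \<in> A0 \<Longrightarrow> ext (B.pc a) = pc a"
  using B.const_in_T[of a] by (simp add: pp_const_def ext_cl const_sub subtring_sel)

lemma ext_px: "i < d \<Longrightarrow> ext (B.px i) = px i"
  using B.var_in_T[of i] by (simp add: pp_xi_def ext_cl var_sub)

lemma cf_ext: "X \<in> carrier B.P \<Longrightarrow> cf {#} (ext X) = pp_proj X"
  using tco_empty B.tco_empty poly_sub in_S B.in_S
  by (auto simp: B.carrier_P ext_cl B.pp_proj_cf)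

text \<open>The extension of scalars from \<open>A0\<close> to \<open>A = R \<otimes> A0\<close> of a Taylor map.\<close>

context
  fixes R :: "'r tring" and \<eta> :: "'r \<Rightarrow> 'a" and \<theta> \<theta>0
  assumes R: "cring R" and eta: "\<eta> \<in> ring_hom R A"
    and span: "\<And>b W. b \<in> carrier A \<Longrightarrow> (\<And>r a. r \<in> carrier R \<Longrightarrow> a \<in> A0 \<Longrightarrow> \<eta> r \<otimes> a \<in> W) \<Longrightarrow>
      (\<And>b c. b \<in> carrier A \<Longrightarrow> c \<in> carrier A \<Longrightarrow> b \<in> W \<Longrightarrow> c \<in> W \<Longrightarrow> b \<oplus> c \<in> W) \<Longrightarrow> b \<in> W"
    and theta: "\<theta> \<in> hom (add_monoid A) (add_monoid P)"
    and theta0: "\<theta>0 \<in> ring_hom (subtring A A0) B.P"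
    and theta_theta0: "\<And>r a. r \<in> carrier R \<Longrightarrow> a \<in> A0 \<Longrightarrow> \<theta> (\<eta> r \<otimes> a) = pc (\<eta> r) \<otimes>\<^bsub>P\<^esub> ext (\<theta>0 a)"
begin

lemma generated:
  assumes "b \<in> carrier A" "\<And>r a. r \<in> carrier R \<Longrightarrow> a \<in> A0 \<Longrightarrow> Q (\<eta> r \<otimes> a)"
    and "\<And>b c. b \<in> carrier A \<Longrightarrow> c \<in> carrier A \<Longrightarrow> Q b \<Longrightarrow> Q c \<Longrightarrow> Q (b \<oplus> c)"
  shows "Q b"
  using span[where W = "{b. Q b}", OF assms(1)] assms(2,3) by blast

lemma theta_cl: "b \<in> carrier A \<Longrightarrow> \<theta> b \<in> carrier P"
  using hom_in_carrier[OF theta] by simp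

lemma theta_add: "b \<in> carrier A \<Longrightarrow> c \<in> carrier A \<Longrightarrow> \<theta> (b \<oplus> c) = \<theta> b \<oplus>\<^bsub>P\<^esub> \<theta> c"
  using hom_mult[OF theta] by simp

lemma eta_facts:
  "r \<in> carrier R \<Longrightarrow> \<eta> r \<in> carrier A" "\<eta> \<one>\<^bsub>R\<^esub> = \<one>" "\<one>\<^bsub>R\<^esub> \<in> carrier R"
  "r \<in> carrier R \<Longrightarrow> r' \<in> carrier R \<Longrightarrow> r \<otimes>\<^bsub>R\<^esub> r' \<in> carrier R"
  "r \<in> carrier R \<Longrightarrow> r' \<in> carrier R \<Longrightarrow> \<eta> (r \<otimes>\<^bsub>R\<^esub> r') = \<eta> r \<otimes> \<eta> r'"
proof -
  interpret R: cring R by (rule R)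
  show "r \<in> carrier R \<Longrightarrow> \<eta> r \<in> carrier A" "\<eta> \<one>\<^bsub>R\<^esub> = \<one>" "\<one>\<^bsub>R\<^esub> \<in> carrier R"
    "r \<in> carrier R \<Longrightarrow> r' \<in> carrier R \<Longrightarrow> r \<otimes>\<^bsub>R\<^esub> r' \<in> carrier R"
    "r \<in> carrier R \<Longrightarrow> r' \<in> carrier R \<Longrightarrow> \<eta> (r \<otimes>\<^bsub>R\<^esub> r') = \<eta> r \<otimes> \<eta> r'"
    using ring_hom_closed[OF eta] ring_hom_one[OF eta] ring_hom_mult[OF eta] by auto
qed

lemma ext_theta0:
  "a \<in> A0 \<Longrightarrow> ext (\<theta>0 a) \<in> carrier P"
  "a \<in> A0 \<Longrightarrow> b \<in> A0 \<Longrightarrow> ext (\<theta>0 (a \<otimes> b)) = ext (\<theta>0 a) \<otimes>\<^bsub>P\<^esub> ext (\<theta>0 b)"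
  "ext (\<theta>0 \<one>) = \<one>\<^bsub>P\<^esub>" "\<one> \<in> A0"
  using ring_hom_closed[OF ring_hom_trans[OF theta0 ext_hom]] ring_hom_mult[OF ring_hom_trans[OF theta0 ext_hom]]
    ring_hom_one[OF ring_hom_trans[OF theta0 ext_hom]] B.one_closed by (simp_all add: subtring_sel)

lemma theta_eta: "r \<in> carrier R \<Longrightarrow> \<theta> (\<eta> r) = pc (\<eta> r)"
  using theta_theta0[of r \<one>] ext_theta0(3,4) eta_facts(1)[of r] by simp

lemma theta_sub: "a \<in> A0 \<Longrightarrow> \<theta> a = ext (\<theta>0 a)"
  using theta_theta0[of "\<one>\<^bsub>R\<^esub>" a] A0 ext_theta0(1)[of a] eta_facts(2,3) by auto

text \<open>Two nested inductions over additive generators leave products of the form r a with r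
  from R and a from \<open>A0\<close>, where multiplicativity of \<open>\<theta>0\<close> and
  \<open>ext\<close> applies.\<close>

lemma theta_mult:
  assumes b: "b \<in> carrier A" and c: "c \<in> carrier A"
  shows "\<theta> (b \<otimes> c) = \<theta> b \<otimes>\<^bsub>P\<^esub> \<theta> c"
proof (rule generated[where Q = "\<lambda>b. \<theta> (b \<otimes> c) = \<theta> b \<otimes>\<^bsub>P\<^esub> \<theta> c", OF b])
  fix r a assume ra: "r \<in> carrier R" "a \<in> A0"
  have aA: "a \<in> carrier A" "\<eta> r \<in> carrier A" using ra A0 eta_facts(1) by auto
  show "\<theta> (\<eta> r \<otimes> a \<otimes> c) = \<theta> (\<eta> r \<otimes> a) \<otimes>\<^bsub>P\<^esub> \<theta> c"
  proof (rule generated[where Q = "\<lambda>c. \<theta> (\<eta> r \<otimes> a \<otimes> c) = \<theta> (\<eta> r \<otimes> a) \<otimes>\<^bsub>P\<^esub> \<theta> c", OF c])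
    fix r' a' assume ra': "r' \<in> carrier R" "a' \<in> A0"
    have aA': "a' \<in> carrier A" "\<eta> r' \<in> carrier A" using ra' A0 eta_facts(1) by auto
    have "a \<otimes> a' \<in> A0" using B.m_closed[of a a'] ra ra' by (simp add: subtring_sel)
    then have "\<theta> (\<eta> (r \<otimes>\<^bsub>R\<^esub> r') \<otimes> (a \<otimes> a')) = pc (\<eta> (r \<otimes>\<^bsub>R\<^esub> r')) \<otimes>\<^bsub>P\<^esub> ext (\<theta>0 (a \<otimes> a'))"
      using ra ra' eta_facts(4) theta_theta0 by blast
    also have "\<dots> = \<theta> (\<eta> r \<otimes> a) \<otimes>\<^bsub>P\<^esub> \<theta> (\<eta> r' \<otimes> a')"
      using ra ra' aA aA' by (simp add: theta_theta0 eta_facts ext_theta0 P.m_ac)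
    also have "\<eta> (r \<otimes>\<^bsub>R\<^esub> r') \<otimes> (a \<otimes> a') = \<eta> r \<otimes> a \<otimes> (\<eta> r' \<otimes> a')"
      using ra ra' aA aA' by (simp add: eta_facts m_ac)
    finally show "\<theta> (\<eta> r \<otimes> a \<otimes> (\<eta> r' \<otimes> a')) = \<theta> (\<eta> r \<otimes> a) \<otimes>\<^bsub>P\<^esub> \<theta> (\<eta> r' \<otimes> a')" .
  next
    fix b c assume "b \<in> carrier A" "c \<in> carrier A"
      "\<theta> (\<eta> r \<otimes> a \<otimes> b) = \<theta> (\<eta> r \<otimes> a) \<otimes>\<^bsub>P\<^esub> \<theta> b" "\<theta> (\<eta> r \<otimes> a \<otimes> c) = \<theta> (\<eta> r \<otimes> a) \<otimes>\<^bsub>P\<^esub> \<theta> c"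
    then show "\<theta> (\<eta> r \<otimes> a \<otimes> (b \<oplus> c)) = \<theta> (\<eta> r \<otimes> a) \<otimes>\<^bsub>P\<^esub> \<theta> (b \<oplus> c)"
      using aA by (simp add: theta_add r_distr P.r_distr theta_cl)
  qed
qed (use c in \<open>simp add: theta_add l_distr P.l_distr theta_cl\<close>)

lemma theta_ring_hom: "\<theta> \<in> ring_hom A P"
  using theta_sub[of \<one>] ext_theta0(3,4)
  by (intro ring_hom_memI) (auto simp: theta_cl theta_add theta_mult)

lemma theta_proj:
  assumes proj: "\<And>a. a \<in> A0 \<Longrightarrow> pp_proj (\<theta>0 a) = a" and "b \<in> carrier A"
  shows "pp_proj (\<theta> b) = b"
proof -
  have "cf {#} (\<theta> b) = b"
  proof (rule generated[where Q = "\<lambda>b. cf {#} (\<theta> b) = b", OF assms(2)])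
    fix r a assume ra: "r \<in> carrier R" "a \<in> A0"
    then show "cf {#} (\<theta> (\<eta> r \<otimes> a)) = \<eta> r \<otimes> a"
      using ring_hom_closed[OF theta0, of a]
      by (simp add: theta_theta0 cf_const_mult eta_facts ext_theta0 cf_ext proj subtring_sel)
  qed (simp add: theta_add cf_add theta_cl)
  then show ?thesis using assms(2) by (simp add: pp_proj_cf theta_cl)
qed

end

end

text \<open>The model presents A as R[X] \<otimes> A0 over R0[X], so the \<phi>(p) a generate A
  additively. A variable in p can be absorbed into a because x_v lies in \<open>A0\<close>; what
  remains are products of a scalar with an element of \<open>A0\<close>.\<close>

lemma good_model_generated:
  assumes model: "good_etale_coordinates_model R \<eta> A d x R0 A0"
    and R: "cring R" and A: "cring A" and eta: "\<eta> \<in> ring_hom R A" and x: "\<And>i. i < d \<Longrightarrow> x i \<in> A0"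
    and b: "b \<in> carrier A"
    and elt: "\<And>r a. r \<in> carrier R \<Longrightarrow> a \<in> A0 \<Longrightarrow> Q (\<eta> r \<otimes>\<^bsub>A\<^esub> a)"
    and add: "\<And>b c. b \<in> carrier A \<Longrightarrow> c \<in> carrier A \<Longrightarrow> Q b \<Longrightarrow> Q c \<Longrightarrow> Q (b \<oplus>\<^bsub>A\<^esub> c)"
  shows "Q b"
proof -
  interpret R: cring R by fact
  interpret A: cring A by fact
  let ?MR = "mpoly_tring R {..<d}" and ?M0 = "carrier (mpoly_ring (subtring R R0) {..<d})"
  let ?phi = "mpoly_eval R A \<eta> x"
  let ?cA = "as_algebra (\<lambda>a. a) ?MR" and ?cB = "as_algebra ?phi (subtring A A0)"
  have gm: "good_etale_model ?MR A ?phi ?M0 A0" and xA: "x \<in> {..<d} \<rightarrow> carrier A"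
    using model by (auto simp: good_etale_coordinates_model_def)
  obtain h where h: "h \<in> ring_iso (tensor (subtring ?MR ?M0) ?cA ?cB) A"
    "\<And>a b. a \<in> carrier ?MR \<Longrightarrow> b \<in> A0 \<Longrightarrow> h (tensor_elt (subtring ?MR ?M0) ?cA ?cB a b) = ?phi a \<otimes>\<^bsub>A\<^esub> b"
    using gm unfolding good_etale_model_def Let_def by auto
  have A0: "subring A0 A" and M0: "subring ?M0 ?MR" and sub: "?phi ` ?M0 \<subseteq> A0"
    using gm by (auto simp: good_etale_model_def ring_of_definition_def ideal_of_definition_def)
  have B: "abelian_group ?cB"
  proof (rule abelian_groupI)
    show "\<exists>z\<in>carrier ?cB. z \<oplus>\<^bsub>?cB\<^esub> y = \<zero>\<^bsub>?cB\<^esub>" if "y \<in> carrier ?cB" for y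
      using that subringE(5)[OF A0, of y] subringE(1)[OF A0] by (intro bexI[of _ "\<ominus>\<^bsub>A\<^esub> y"]) (auto simp: A.l_neg subtring_sel)
  qed (use subringE[OF A0] in \<open>auto simp: A.a_ac subset_iff subtring_sel\<close>)
  interpret P: poly_eval R "{..<d}" A \<eta> x
    using xA eta by unfold_locales auto
  have "cring ?MR" by (rule cring_cong[OF P.cring_S]) (simp_all add: mpoly_tring_sel)
  then interpret MR: cring ?MR .
  interpret cA: cring ?cA by (rule cring_cong[OF MR.is_cring]) simp_all
  interpret cB: abelian_group ?cB by (rule B)
  interpret TP: tensor_pair "subtring ?MR ?M0" ?cA ?cB
  proof unfold_locales
    show "a \<odot>\<^bsub>?cA\<^esub> m \<in> carrier ?cA" if "a \<in> carrier (subtring ?MR ?M0)" "m \<in> carrier ?cA" for a m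
      using that subringE(1)[OF M0] by (auto simp: subtring_sel)
    show "a \<odot>\<^bsub>?cB\<^esub> m \<in> carrier ?cB" if "a \<in> carrier (subtring ?MR ?M0)" "m \<in> carrier ?cB" for a m
      using that sub subringE(6)[OF A0] by (auto simp: subtring_sel)
  qed
  \<comment> \<open>The element \<open>a\<close> is kept arbitrary, since the case of a variable
    replaces it by x_v a.\<close>
  have phiQ: "Q (?phi p \<otimes>\<^bsub>A\<^esub> a)" if "p \<in> carrier P.S" "a \<in> A0" for p a
    using that
  proof (induction arbitrary: a rule: P.poly_induct)
    case (const c) then show ?case using elt by simp
  next
    case (add p r)
    then have "a \<in> carrier A" using subringE(1)[OF A0] by auto
    then show ?case using add assms(8) by (simp add: P.ev_add A.l_distr)
  next
    case (mult v p)
    then have "x v \<otimes>\<^bsub>A\<^esub> a \<in> A0" using x subringE(6)[OF A0] by auto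
    moreover have "x v \<in> carrier A" "a \<in> carrier A" using mult x subringE(1)[OF A0] by auto
    then have "?phi (mpoly_var R v \<otimes>\<^bsub>P.S\<^esub> p) \<otimes>\<^bsub>A\<^esub> a = ?phi p \<otimes>\<^bsub>A\<^esub> (x v \<otimes>\<^bsub>A\<^esub> a)"
      using mult by (simp add: P.ev_mult P.var_in_S A.m_ac)
    ultimately show ?case using mult by simp
  qed
  have "h \<in> ring_hom TP.T A" "h ` carrier TP.T = carrier A"
    using h(1) by (auto simp: ring_iso_def bij_betw_def)
  then obtain X where X: "X \<in> carrier TP.T" "b = h X" using b by auto
  have "Q (h X)" using X(1)
  proof (induction rule: TP.tensor_induct)
    case (elt m n)
    then show ?case using h(2) phiQ by (simp add: mpoly_tring_sel subtring_sel)
  next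
    case (add X Y)
    then show ?case using assms(8) \<open>h \<in> ring_hom TP.T A\<close>
      by (simp add: ring_hom_add ring_hom_closed)
  qed
  then show ?thesis using X by simp
qed

lemma huber_ring_cring: "huber_ring A \<Longrightarrow> cring A"
  by (simp add: huber_ring_def topological_cring_def)

lemma adic_hom_ring_hom: "adic_hom A B u \<Longrightarrow> u \<in> ring_hom A B"
  by (simp add: adic_hom_def huber_hom_def)

text \<open>Both readings of (good) coordinates end in the same algebraic facts about the Taylor
  maps, and from here on they are treated alike.\<close>

lemma coordinates_taylor:
  assumes alg: "twisted_adic_algebra R \<eta> A d \<sigma>"
    and x: "x \<in> {..<d} \<rightarrow> carrier A"
    and coords: "coordinates_with_taylor R \<eta> A d \<sigma> x \<Theta>"
  shows "\<Theta> n \<in> ring_hom A (principal_parts A d \<sigma> x n) \<and> \<Theta> n \<in> extensional (carrier A) \<and>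
    (\<forall>r\<in>carrier R. \<Theta> n (\<eta> r) = pp_const A d \<sigma> x n (\<eta> r)) \<and>
    (\<forall>i<d. \<Theta> n (x i) = pp_const A d \<sigma> x n (x i) \<oplus>\<^bsub>principal_parts A d \<sigma> x n\<^esub> pp_xi A d \<sigma> x n i) \<and>
    (\<forall>f\<in>carrier A. pp_proj (\<Theta> n f) = f)"
  using coords unfolding coordinates_with_taylor_def
proof (elim disjE exE conjE)
  assume "\<forall>n. taylor_map R \<eta> A d \<sigma> x n (\<Theta> n)"
  then have "taylor_map R \<eta> A d \<sigma> x n (\<Theta> n)" ..
  then show ?thesis by (simp add: taylor_map_def adic_hom_ring_hom)
next
  fix R0 A0
  assume model: "good_sigma_coordinates_model R \<eta> A d \<sigma> x R0 A0"
    and "\<forall>n. good_taylor_map R \<eta> A d \<sigma> x R0 A0 n (\<Theta> n)"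
  then have good: "good_taylor_map R \<eta> A d \<sigma> x R0 A0 n (\<Theta> n)" by blast
  have R: "cring R" and A: "cring A" and eta: "\<eta> \<in> ring_hom R A"
    and sigma: "\<And>i a. i < d \<Longrightarrow> a \<in> carrier A \<Longrightarrow> \<sigma> i a \<in> carrier A"
    using alg by (auto simp: twisted_adic_algebra_def huber_hom_def intro: huber_ring_cring adic_hom_ring_hom ring_hom_closed)
  have etale: "good_etale_coordinates_model R \<eta> A d x R0 A0"
    and sigma0: "\<And>i a. i < d \<Longrightarrow> a \<in> A0 \<Longrightarrow> \<sigma> i a \<in> A0"
    and alg0: "twisted_adic_algebra (subtring R R0) \<eta> (subtring A A0) d \<sigma>"
    and x0: "\<And>i. i < d \<Longrightarrow> x i \<in> A0"
    using model by (auto simp: good_sigma_coordinates_model_def sigma_coordinates_def subtring_sel)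
  have cring0: "cring (subtring A A0)"
    using alg0 by (simp add: twisted_adic_algebra_def huber_ring_cring)
  have A0: "A0 \<subseteq> carrier A"
    using etale subringE(1)
    by (auto simp: good_etale_coordinates_model_def good_etale_model_def ring_of_definition_def ideal_of_definition_def)
  interpret A: cring A by (rule A)
  interpret B: cring "subtring A A0" by (rule cring0)
  interpret S: subring_principal_parts A d \<sigma> x n A0
    by unfold_locales (use x sigma x0 sigma0 A0 in \<open>auto simp: subtring_sel\<close>)
  obtain \<theta>0 where th0: "taylor_map (subtring R R0) \<eta> (subtring A A0) d \<sigma> x n \<theta>0"
    and tt: "\<And>r a. r \<in> carrier R \<Longrightarrow> a \<in> A0 \<Longrightarrow> \<Theta> n (\<eta> r \<otimes>\<^bsub>A\<^esub> a) = S.pc (\<eta> r) \<otimes>\<^bsub>S.P\<^esub> S.ext (\<theta>0 a)"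
    and ext: "\<Theta> n \<in> extensional (carrier A)" and th: "\<Theta> n \<in> hom (add_monoid A) (add_monoid S.P)"
    using good unfolding good_taylor_map_def S.ext_def by blast
  have hom0: "\<theta>0 \<in> ring_hom (subtring A A0) S.B.P"
    and thx: "\<And>i. i < d \<Longrightarrow> \<theta>0 (x i) = S.B.pc (x i) \<oplus>\<^bsub>S.B.P\<^esub> S.B.px i"
    and proj0: "\<And>a. a \<in> A0 \<Longrightarrow> pp_proj (\<theta>0 a) = a"
    using th0 by (auto simp: taylor_map_def adic_hom_ring_hom subtring_sel)
  have gen: "b \<in> W" if "b \<in> carrier A" "\<And>r a. r \<in> carrier R \<Longrightarrow> a \<in> A0 \<Longrightarrow> \<eta> r \<otimes>\<^bsub>A\<^esub> a \<in> W"
    "\<And>b c. b \<in> carrier A \<Longrightarrow> c \<in> carrier A \<Longrightarrow> b \<in> W \<Longrightarrow> c \<in> W \<Longrightarrow> b \<oplus>\<^bsub>A\<^esub> c \<in> W" for b W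
    using good_model_generated[where Q = "\<lambda>b. b \<in> W", OF etale R A eta x0 that] .
  note prems = R eta gen th hom0 tt
  show ?thesis
  proof (intro conjI ballI allI impI)
    show "\<Theta> n \<in> ring_hom A S.P" by (rule S.theta_ring_hom[OF prems])
    show "\<Theta> n (\<eta> r) = S.pc (\<eta> r)" if "r \<in> carrier R" for r by (rule S.theta_eta[OF prems that])
    show "\<Theta> n (x i) = S.pc (x i) \<oplus>\<^bsub>S.P\<^esub> S.px i" if i: "i < d" for i
    proof -
      have c: "S.B.pc (x i) \<in> carrier S.B.P" "S.B.px i \<in> carrier S.B.P"
        using S.B.pc_hom S.B.px_closed[OF i] S.B.x_closed[OF i] by (blast intro: ring_hom_closed)+
      have "\<Theta> n (x i) = S.ext (S.B.pc (x i) \<oplus>\<^bsub>S.B.P\<^esub> S.B.px i)"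
        unfolding thx[OF i, symmetric] by (rule S.theta_sub[OF prems x0[OF i]])
      also have "\<dots> = S.pc (x i) \<oplus>\<^bsub>S.P\<^esub> S.px i"
        unfolding ring_hom_add[OF S.ext_hom c] S.ext_px[OF i] S.ext_const[OF x0[OF i]] by (rule refl)
      finally show ?thesis .
    qed
    show "pp_proj (\<Theta> n f) = f" if "f \<in> carrier A" for f by (rule S.theta_proj[OF prems proj0 that])
  qed (rule ext)
qed

text \<open>By freeness of P_1 the described coefficients are the coordinates of \<Theta>_1(f) at
  the \<xi>_j; the constant term is f because the projection is a retraction.\<close>

lemma (in symmetric_taylor) tw_partial_eq:
  assumes f: "f \<in> carrier A" and i: "i < d"
  shows "tw_partial A d \<sigma> x \<Theta> i f = dp {#i#} f"
proof -
  interpret P1: principal_parts_ring A d \<sigma> x "Suc 0" ..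
  let ?rhs = "\<lambda>c. P1.pc f \<oplus>\<^bsub>P1.P\<^esub> (\<Oplus>\<^bsub>P1.P\<^esub>j\<in>{..<d}. P1.pc (c j) \<otimes>\<^bsub>P1.P\<^esub> P1.px j)"
  have Th: "\<Theta> (Suc 0) f \<in> carrier P1.P" using ring_hom_closed[OF Theta_hom f] .
  have K1: "k = {#} \<or> (\<exists>j<d. k = {#j#})" if "k \<in> P1.K" for k
    using that by (cases k) (auto simp: P1.K_def)
  have single: "{#j#} \<in> P1.K" if "j < d" for j using that by (simp add: P1.K_def)
  have px: "co k (P1.px j) = (if k = {#j#} then \<one> else \<zero>)" if "k \<in> P1.K" "j < d" for j k
    using P1.cf_Xi[OF that(1), of "{#j#}"] that by (simp add: P1.Xi_single)
  have pcf: "co k (P1.pc f) = (if k = {#} then f else \<zero>)" if "k \<in> P1.K" for k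
    using P1.cf_const_mult[OF _ f that, of "P1.Xi {#}"] P1.cf_Xi[OF that, of "{#}"] f by (simp add: P1.Xi_empty)
  have rhs: "?rhs c \<in> carrier P1.P"
    "k \<in> P1.K \<Longrightarrow> co k (?rhs c) = (if k = {#} then f else \<zero>) \<oplus> (\<Oplus>j\<in>{..<d}. if k = {#j#} then c j else \<zero>)"
    if c: "\<And>j. j < d \<Longrightarrow> c j \<in> carrier A" for c k
  proof -
    have t: "P1.pc (c j) \<otimes>\<^bsub>P1.P\<^esub> P1.px j \<in> carrier P1.P" if "j < d" for j using c that by simp
    then have s: "(\<Oplus>\<^bsub>P1.P\<^esub>j\<in>{..<d}. P1.pc (c j) \<otimes>\<^bsub>P1.P\<^esub> P1.px j) \<in> carrier P1.P"
      by (intro P1.P.finsum_closed) auto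
    then show "?rhs c \<in> carrier P1.P" using f by simp
    assume k: "k \<in> P1.K"
    have "co k (\<Oplus>\<^bsub>P1.P\<^esub>j\<in>{..<d}. P1.pc (c j) \<otimes>\<^bsub>P1.P\<^esub> P1.px j) =
        (\<Oplus>j\<in>{..<d}. co k (P1.pc (c j) \<otimes>\<^bsub>P1.P\<^esub> P1.px j))"
      using t k by (rule_tac P1.cf_sum) auto
    also have "\<dots> = (\<Oplus>j\<in>{..<d}. if k = {#j#} then c j else \<zero>)"
      using c k by (intro finsum_cong') (auto simp: P1.cf_const_mult px)
    finally show "co k (?rhs c) = (if k = {#} then f else \<zero>) \<oplus> (\<Oplus>j\<in>{..<d}. if k = {#j#} then c j else \<zero>)"
      using s f k by (simp add: P1.cf_add pcf)
  qed
  have single_sum: "(\<Oplus>l\<in>{..<d}. if {#j#} = {#l#} then c l else \<zero>) = c j"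
    if "j < d" "\<And>l. l < d \<Longrightarrow> c l \<in> carrier A" for j and c :: "nat \<Rightarrow> 'a"
    using finsum_singleton[of j "{..<d}" c] that by simp
  have co1: "co {#j#} (\<Theta> (Suc 0) f) = dp {#j#} f" for j by (simp add: dp_def)
  define c0 where "c0 = (\<lambda>j\<in>{..<d}. dp {#j#} f)"
  have c0: "c0 j = dp {#j#} f" if "j < d" for j using that by (simp add: c0_def)
  have cl: "c0 j \<in> carrier A" if "j < d" for j using that f by (simp add: c0 dp_closed)
  have "\<Theta> (Suc 0) f = ?rhs c0"
  proof (rule P1.pp_eqI[OF Th rhs(1)[OF cl]])
    fix k assume k: "k \<in> P1.K"
    show "co k (\<Theta> (Suc 0) f) = co k (?rhs c0)"
      using K1[OF k]
    proof (elim disjE exE conjE)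
      assume k0: "k = {#}"
      have "co {#} (\<Theta> (Suc 0) f) = f" using P1.pp_proj_cf[OF Th] Theta_proj[OF f] by simp
      moreover have "co k (?rhs c0) = f"
        by (subst rhs(2)[OF cl k]) (use f k0 in \<open>simp_all add: finsum_zero\<close>)
      ultimately show ?thesis using k0 by simp
    next
      fix j assume j: "j < d" "k = {#j#}"
      show ?thesis
        by (subst rhs(2)[OF cl k]) (use j single_sum[OF j(1) cl] cl[OF j(1)] in \<open>simp_all add: co1 c0\<close>)
    qed
  qed
  moreover have "c = c0" if "c \<in> {..<d} \<rightarrow>\<^sub>E carrier A" "\<Theta> (Suc 0) f = ?rhs c" for c
  proof
    fix j
    have cc: "c l \<in> carrier A" if "l < d" for l using that \<open>c \<in> _\<close> by auto
    show "c j = c0 j"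
    proof (cases "j < d")
      case True
      then have "dp {#j#} f = co {#j#} (?rhs c)" using that(2) co1[of j] by simp
      also have "\<dots> = c j" by (subst rhs(2)[OF cc single[OF True]]) (use single_sum[OF True cc] cc[OF True] in simp_all)
      finally show ?thesis using True by (simp add: c0)
    next
      case False then show ?thesis using that(1) by (auto simp: PiE_def extensional_def c0_def)
    qed
  qed
  ultimately have "(THE c. c \<in> {..<d} \<rightarrow>\<^sub>E carrier A \<and> \<Theta> (Suc 0) f = ?rhs c) = c0"
    using cl by (intro the_equality) (auto simp: PiE_def c0_def)
  then show ?thesis unfolding tw_partial_def Let_def One_nat_def using i by (simp add: c0)
qed

lemma twisted_connectionsI:
  assumes alg: "twisted_adic_algebra R \<eta> A d \<sigma>"
    and x: "x \<in> {..<d} \<rightarrow> carrier A"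
    and q: "q_coordinates_with_taylor R \<eta> A d \<sigma> x q \<Theta>"
    and classical: "classical_coordinates A d \<sigma> x \<Theta>"
    and symmetric: "symmetric_coordinates R \<eta> A d \<sigma> x \<Theta>"
  shows "twisted_connections A d \<sigma> x (\<lambda>i. \<eta> (q i)) \<Theta>"
proof -
  have R: "cring R" and A: "cring A" and eta: "\<eta> \<in> ring_hom R A"
    and sigma: "\<And>i a. i < d \<Longrightarrow> a \<in> carrier A \<Longrightarrow> \<sigma> i a \<in> carrier A"
    and lin: "\<And>i r a. i < d \<Longrightarrow> r \<in> carrier R \<Longrightarrow> a \<in> carrier A \<Longrightarrow> \<sigma> i (\<eta> r \<otimes>\<^bsub>A\<^esub> a) = \<eta> r \<otimes>\<^bsub>A\<^esub> \<sigma> i a"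
    using alg by (auto simp: twisted_adic_algebra_def huber_hom_def intro: huber_ring_cring adic_hom_ring_hom ring_hom_closed)
  interpret R: cring R by (rule R)
  interpret A: cring A by (rule A)
  interpret eta: ring_hom_cring R A \<eta> by (rule ring_hom_cringI[OF R A eta])
  have qc: "q i \<in> carrier R" if "i < d" for i
    using q that by (auto simp: q_coordinates_with_taylor_def)
  have sx: "\<sigma> i (x i) = \<eta> (q i) \<otimes>\<^bsub>A\<^esub> x i" if "i < d" for i
    using q that qc[OF that] by (auto simp: q_coordinates_with_taylor_def)
  have "coordinates_with_taylor R \<eta> A d \<sigma> x \<Theta>"
    using q by (simp add: q_coordinates_with_taylor_def)
  note T = coordinates_taylor[OF alg x this]
  interpret ST: symmetric_taylor A d \<sigma> x "\<lambda>i. \<eta> (q i)" \<Theta>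
  proof unfold_locales
    \<comment> \<open>Powers of q_i come from R and pass through \<sigma>_i, so each iteration
      contributes one more factor q_i.\<close>
    show "(\<sigma> i ^^ j) (x i) = \<eta> (q i) [^]\<^bsub>A\<^esub> j \<otimes>\<^bsub>A\<^esub> x i" if i: "i < d" for i j
    proof (induction j)
      case 0 then show ?case using x i by (simp add: Pi_def)
    next
      case (Suc j)
      have "\<sigma> i (\<eta> (q i [^]\<^bsub>R\<^esub> j) \<otimes>\<^bsub>A\<^esub> x i) = \<eta> (q i [^]\<^bsub>R\<^esub> j) \<otimes>\<^bsub>A\<^esub> \<sigma> i (x i)"
        using i x qc by (intro lin) auto
      then show ?case using Suc i x qc sx[OF i] by (simp add: eta.hom_nat_pow A.m_assoc Pi_def)
    qed
    show "pp_delta A d \<sigma> x \<Theta> (Suc 0) m (\<Theta> (Suc m) f) =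
        tensor_elt A (pp_algebra_taylor A d \<sigma> x \<Theta> (Suc 0)) (pp_algebra A d \<sigma> x m)
          \<one>\<^bsub>principal_parts A d \<sigma> x (Suc 0)\<^esub> (\<Theta> m f)" if "f \<in> carrier A" for f m
      using symmetric that unfolding symmetric_coordinates_def
      by (metis add_Suc add_0)
  qed (use x sigma qc T in auto)
  show ?thesis
  proof unfold_locales
    fix i f assume i: "i < d" and f: "f \<in> carrier A"
    then show "\<sigma> i f = f \<oplus>\<^bsub>A\<^esub> (\<eta> (q i) \<otimes>\<^bsub>A\<^esub> x i \<ominus>\<^bsub>A\<^esub> x i) \<otimes>\<^bsub>A\<^esub> ST.dp {#i#} f"
      using classical sx[OF i] ST.tw_partial_eq[OF f i] unfolding classical_coordinates_def by simp
  qed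
qed

section \<open>The equivalence\<close>

lemma module_homD:
  assumes "h \<in> module_hom R M N"
  shows "h \<in> carrier M \<rightarrow> carrier N" "h \<in> extensional (carrier M)"
  using assms by (auto simp: module_hom_def PiE_def)

lemma module_hom_id:
  assumes "left_module R M"
  shows "(\<lambda>m\<in>carrier M. m) \<in> module_hom R M M"
proof -
  interpret M: left_module R M by fact
  show ?thesis by (auto simp: module_hom_def M.smult_closed)
qed

lemma module_hom_compose:
  assumes "left_module R M" "f \<in> module_hom R M N" "g \<in> module_hom R N P"
  shows "compose (carrier M) g f \<in> module_hom R M P"
proof -
  interpret M: left_module R M by fact
  have "f m \<in> carrier N" if "m \<in> carrier M" for m using that module_homD(1)[OF assms(2)] by auto
  then show ?thesis using assms(2,3) by (auto simp: module_hom_def compose_def M.smult_closed PiE_iff)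
qed

text \<open>Linear maps see a module only on its carrier, so records that differ elsewhere have the
  same arrows.\<close>

lemma module_hom_cong:
  assumes "carrier M = carrier M'" "ring.add M = ring.add M'" "left_module R M'"
    and "\<And>a m. a \<in> carrier R \<Longrightarrow> m \<in> carrier M' \<Longrightarrow> a \<odot>\<^bsub>M\<^esub> m = a \<odot>\<^bsub>M'\<^esub> m"
    and "carrier N = carrier N'" "ring.add N = ring.add N'"
    and "\<And>a n. a \<in> carrier R \<Longrightarrow> n \<in> carrier N' \<Longrightarrow> a \<odot>\<^bsub>N\<^esub> n = a \<odot>\<^bsub>N'\<^esub> n"
  shows "module_hom R M N = module_hom R M' N'"
  unfolding module_hom_def assms(1,2,5,6)
  by (intro Collect_cong conj_cong ball_cong refl) (auto simp: assms(4,7) PiE_iff)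

lemma module_hom_category_laws:
  assumes "f \<in> module_hom R M N"
  shows "compose (carrier M) (\<lambda>m\<in>carrier N. m) f = f"
    and "compose (carrier M) f (\<lambda>m\<in>carrier M. m) = f"
    and "compose (carrier M) h (compose (carrier M) g f) = compose (carrier M) (compose (carrier N) h g) f"
  using module_homD[OF assms] by (auto intro: Id_compose compose_Id compose_assoc)

lemma is_category_left_module_category: "is_category (left_module_category R)"
  unfolding is_category_def left_module_category_def
  by (auto simp: module_hom_id module_hom_compose intro: module_hom_category_laws)

text \<open>
  A fully faithful functor to left modules that is the identity on arrows is an equivalence if every
  left module agrees, on its carrier, with a module in the image.
\<close>

lemma equivalent_left_module_category:
  fixes C :: "('o, 'm \<Rightarrow> 'm) category" and R :: "('a, 'z) ring_scheme" and Fo :: "'o \<Rightarrow> ('a, 'm) module"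
    and Go :: "('a, 'm) module \<Rightarrow> 'o"
  assumes Fo: "\<And>X. X \<in> Obj C \<Longrightarrow> left_module R (Fo X)"
    and Hom: "\<And>X Y. X \<in> Obj C \<Longrightarrow> Y \<in> Obj C \<Longrightarrow> Hom C X Y = module_hom R (Fo X) (Fo Y)"
    and Ident: "\<And>X. X \<in> Obj C \<Longrightarrow> Ident C X = (\<lambda>m\<in>carrier (Fo X). m)"
    and Comp: "\<And>X Y Z g f. X \<in> Obj C \<Longrightarrow> Comp C X Y Z g f = compose (carrier (Fo X)) g f"
    and Go: "\<And>N. left_module R N \<Longrightarrow> Go N \<in> Obj C"
    and carrier: "\<And>N. left_module R N \<Longrightarrow> carrier (Fo (Go N)) = carrier N"
    and add: "\<And>N. left_module R N \<Longrightarrow> ring.add (Fo (Go N)) = ring.add N"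
    and smult: "\<And>N a m. left_module R N \<Longrightarrow> a \<in> carrier R \<Longrightarrow> m \<in> carrier N \<Longrightarrow> a \<odot>\<^bsub>Fo (Go N)\<^esub> m = a \<odot>\<^bsub>N\<^esub> m"
  shows "equivalent_categories C (left_module_category R :: (('a, 'm) module, 'm \<Rightarrow> 'm) category)"
proof -
  let ?D = "left_module_category R :: (('a, 'm) module, 'm \<Rightarrow> 'm) category"
  have D: "Obj ?D = {M. left_module R M}" "Hom ?D = module_hom R"
    "Ident ?D M = (\<lambda>m\<in>carrier M. m)" "Comp ?D M N P g f = compose (carrier M) g f" for M N P g f
    by (simp_all add: left_module_category_def)
  have FG: "module_hom R (Fo (Go M)) (Fo (Go N)) = module_hom R M N"
    "module_hom R (Fo (Go M)) N = module_hom R M N" "module_hom R M (Fo (Go N)) = module_hom R M N"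
    if "left_module R M" "left_module R N" for M N :: "('a, 'm) module"
    by (rule module_hom_cong; simp add: carrier add smult that)+
  have C: "is_category C"
    unfolding is_category_def
    by (auto simp: Hom Ident Comp module_hom_id module_hom_compose Fo intro: module_hom_category_laws)
  have F: "is_functor C ?D Fo (\<lambda>X Y f. f)"
    by (auto simp: is_functor_def D Fo Hom Ident Comp)
  have G: "is_functor ?D C Go (\<lambda>X Y f. f)"
    by (auto simp: is_functor_def D Go Hom Ident Comp FG carrier)
  \<comment> \<open>Both natural transformations consist of identity maps, regarded as arrows
    between records that agree on their carriers.\<close>
  have nat1: "naturally_isomorphic C C (\<lambda>X. Go (Fo X)) (\<lambda>X Y f. f) (\<lambda>X. X) (\<lambda>X Y f. f)"
    unfolding naturally_isomorphic_def iso_arrow_def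
    by (intro exI[of _ "\<lambda>X. \<lambda>m\<in>carrier (Fo X). m"])
       (auto simp: Hom Ident Comp Go Fo FG carrier module_hom_id module_hom_category_laws intro!: bexI[of _ "\<lambda>m\<in>carrier (Fo _). m"])
  have nat2: "naturally_isomorphic ?D ?D (\<lambda>X. Fo (Go X)) (\<lambda>X Y f. f) (\<lambda>X. X) (\<lambda>X Y f. f)"
    unfolding naturally_isomorphic_def iso_arrow_def
    by (intro exI[of _ "\<lambda>N. \<lambda>m\<in>carrier N. m"])
       (auto simp: D Go Fo FG carrier module_hom_id module_hom_category_laws intro!: bexI[of _ "\<lambda>m\<in>carrier _. m"])
  show ?thesis
    unfolding equivalent_categories_def
    by (intro conjI exI[of _ Fo] exI[of _ Go]
        exI[of _ "\<lambda>(_ :: 'o) (_ :: 'o) (f :: 'm \<Rightarrow> 'm). f"]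
        exI[of _ "\<lambda>(_ :: ('a, 'm) module) (_ :: ('a, 'm) module) (f :: 'm \<Rightarrow> 'm). f"]
        C is_category_left_module_category F G nat1 nat2)
qed

section \<open>The ring of operators of the given coordinates\<close>

locale twisted_operators = twisted_connections A d \<sigma> x Q \<Theta> + R: cring R
  for R :: "'r tring" and \<eta> :: "'r \<Rightarrow> 'a" and A :: "'a tring" (structure) and d \<sigma> x Q \<Theta> +
  assumes eta_hom: "\<eta> \<in> ring_hom R A"
    and Theta_eta: "r \<in> carrier R \<Longrightarrow> \<Theta> n (\<eta> r) = pp_const A d \<sigma> x n (\<eta> r)"
    and sigma_hom: "i < d \<Longrightarrow> \<sigma> i \<in> ring_hom A A"
    and sigma_eta: "i < d \<Longrightarrow> r \<in> carrier R \<Longrightarrow> \<sigma> i (\<eta> r) = \<eta> r"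
    and Qn_unit: "i < d \<Longrightarrow> \<exists>r\<in>carrier R. Qn i (Suc n) \<otimes> \<eta> r = \<one>"
begin

lemma eta_closed [simp]: "r \<in> carrier R \<Longrightarrow> \<eta> r \<in> carrier A"
  by (rule ring_hom_closed[OF eta_hom])

lemma dp_eta_mult: "r \<in> carrier R \<Longrightarrow> f \<in> carrier A \<Longrightarrow> set_mset k \<subseteq> {..<d} \<Longrightarrow> dp k (\<eta> r \<otimes> f) = \<eta> r \<otimes> dp k f"
  by (intro dp_const eta_closed Theta_eta)

text \<open>\<Theta>_1(\<eta>(r)) is a constant of P_1 and has no coordinate at any \<xi>_j.\<close>

lemma eta_constant:
  assumes r: "r \<in> carrier R"
  shows "\<eta> r \<in> twisted_constants A d dp \<sigma>"
proof -
  have "dp {#j#} (\<eta> r) = \<zero>" if j: "j < d" for j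
    using P1.cf_const_mult[OF _ eta_closed[OF r] single_K[OF j], of "P1.Xi {#}"] P1.cf_Xi[OF single_K[OF j], of "{#}"] r
    by (simp add: dp_def Theta_eta P1.Xi_empty)
  then show ?thesis using r sigma_eta by (simp add: twisted_constants_def)
qed

text \<open>In \<open>dp_mult\<close> the mixed term (q_i x_i - x_i) \<partial>_i(f) \<partial>_i(g)
  is grouped with g. Grouped with f instead, it completes f to \<sigma>_i(f) by
  classicality.\<close>

sublocale W: twisted_divided_powers A d dp \<sigma> Qn
proof unfold_locales
  fix i f g assume *: "f \<in> carrier A" "g \<in> carrier A" "i < d"
  have dc: "dp {#i#} f \<in> carrier A" "dp {#i#} g \<in> carrier A" using * by (simp_all add: dp_closed)
  have "dp {#i#} (f \<otimes> g) = f \<otimes> dp {#i#} g \<oplus> dp {#i#} f \<otimes> (g \<oplus> (Q i \<otimes> x i \<ominus> x i) \<otimes> dp {#i#} g)"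
    by (rule dp_mult[OF *])
  also have "\<dots> = dp {#i#} f \<otimes> g \<oplus> (f \<oplus> (Q i \<otimes> x i \<ominus> x i) \<otimes> dp {#i#} f) \<otimes> dp {#i#} g"
    using * dc x_closed[of i] by (simp add: l_distr r_distr m_ac a_ac)
  finally show "dp {#i#} (f \<otimes> g) = dp {#i#} f \<otimes> g \<oplus> \<sigma> i f \<otimes> dp {#i#} g"
    using classical * by simp
next
  fix i n assume i: "i < d"
  show "\<exists>v\<in>twisted_constants A d dp \<sigma>. Qn i (Suc n) \<otimes> v = \<one>"
    using Qn_unit[OF i] eta_constant by blast
next
  fix n a k
  assume *: "\<And>k. k \<in> multi_indices d n \<Longrightarrow> a k \<in> carrier A"
    "\<And>g. g \<in> carrier A \<Longrightarrow> (\<Oplus>k\<in>multi_indices d n. a k \<otimes> dp k g) = \<zero>" "k \<in> multi_indices d n"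
  interpret X: principal_parts_ring A d \<sigma> x n ..
  have "multi_indices d n = X.K" by (simp add: multi_indices_def X.K_def)
  then show "a k = \<zero>" using dp_independent[of n a k] * by simp
qed (auto simp: dp_closed dp_add dp_empty dp_dp Qn_Suc sigma_hom)

text \<open>The sum of the a_k \<partial>^[k] is \<psi> \<circ> \<Theta>_n for the A-linear \<psi>
  with value a_k on \<xi>^(k); it is R-linear because each \<partial>^[k] is.\<close>

lemma diff_op_closed:
  assumes "f \<in> W.DO"
  shows "f \<in> module_hom R (as_algebra \<eta> A) (as_algebra \<eta> A)"
    "\<exists>n. \<exists>\<psi>\<in>module_hom A (pp_algebra A d \<sigma> x n) (as_algebra (\<lambda>a. a) A). f = compose (carrier A) \<psi> (\<Theta> n)"
proof -
  obtain a n where f: "f = W.opr a (W.K n)" and a: "\<And>k. k \<in> W.K n \<Longrightarrow> a k \<in> carrier A"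
    using assms unfolding W.DO_def by blast
  interpret X: principal_parts_ring A d \<sigma> x n ..
  have K: "W.K n = X.K" by (simp add: multi_indices_def X.K_def)
  have "f (\<eta> r \<otimes> g) = \<eta> r \<otimes> f g" if "r \<in> carrier R" "g \<in> carrier A" for r g
  proof -
    have "f (\<eta> r \<otimes> g) = (\<Oplus>k\<in>W.K n. \<eta> r \<otimes> (a k \<otimes> dp k g))"
      unfolding f W.opr_def using that a
      by (auto intro!: finsum_cong' simp: dp_eta_mult W.K_set dp_closed m_lcomm)
    also have "\<dots> = \<eta> r \<otimes> f g"
      unfolding f W.opr_def using that a finsum_rdistr[of "W.K n" "\<eta> r" "\<lambda>k. a k \<otimes> dp k g"]
      by (simp add: Pi_def W.K_set dp_closed)
    finally show ?thesis .
  qed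
  then show "f \<in> module_hom R (as_algebra \<eta> A) (as_algebra \<eta> A)"
    using assms W.DO_ext by (auto simp: module_hom_def W.DO_additive PiE_iff)
  define \<psi> where "\<psi> = (\<lambda>X\<in>carrier X.P. \<Oplus>k\<in>X.K. a k \<otimes> co k X)"
  have ak: "a k \<in> carrier A" if "k \<in> X.K" for k using a that by (simp add: K)
  have "\<psi> (X \<oplus>\<^bsub>X.P\<^esub> Y) = \<psi> X \<oplus> \<psi> Y" if "X \<in> carrier X.P" "Y \<in> carrier X.P" for X Y
  proof -
    have "\<psi> (X \<oplus>\<^bsub>X.P\<^esub> Y) = (\<Oplus>k\<in>X.K. a k \<otimes> co k (X \<oplus>\<^bsub>X.P\<^esub> Y))"
      using that by (simp add: \<psi>_def)
    also have "\<dots> = (\<Oplus>k\<in>X.K. a k \<otimes> co k X \<oplus> a k \<otimes> co k Y)"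
      using that ak by (intro finsum_cong') (auto simp: X.cf_add r_distr)
    also have "\<dots> = \<psi> X \<oplus> \<psi> Y"
      unfolding \<psi>_def using that ak finsum_addf[of "\<lambda>k. a k \<otimes> co k X" X.K "\<lambda>k. a k \<otimes> co k Y"] by (simp add: Pi_def)
    finally show ?thesis .
  qed
  moreover have "\<psi> (X.pc b \<otimes>\<^bsub>X.P\<^esub> X) = b \<otimes> \<psi> X" if "b \<in> carrier A" "X \<in> carrier X.P" for b X
  proof -
    have "\<psi> (X.pc b \<otimes>\<^bsub>X.P\<^esub> X) = (\<Oplus>k\<in>X.K. b \<otimes> (a k \<otimes> co k X))"
      unfolding \<psi>_def using that ak by (auto intro!: finsum_cong' simp: X.cf_const_mult m_lcomm)
    also have "\<dots> = b \<otimes> \<psi> X"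
      unfolding \<psi>_def using that ak finsum_rdistr[of X.K b "\<lambda>k. a k \<otimes> co k X"] by (simp add: Pi_def)
    finally show ?thesis .
  qed
  moreover have "\<psi> X \<in> carrier A" if "X \<in> carrier X.P" for X
    unfolding \<psi>_def using that ak by (simp add: finsum_closed Pi_def)
  ultimately have psi: "\<psi> \<in> module_hom A (pp_algebra A d \<sigma> x n) (as_algebra (\<lambda>a. a) A)"
    by (auto simp: module_hom_def PiE_iff \<psi>_def)
  have "f = compose (carrier A) \<psi> (\<Theta> n)"
    unfolding f W.opr_def compose_def
  proof (rule restrict_ext)
    fix g assume g: "g \<in> carrier A"
    have "(\<Oplus>k\<in>W.K n. a k \<otimes> dp k g) = (\<Oplus>k\<in>X.K. a k \<otimes> co k (\<Theta> n g))"
      unfolding K using g ak by (intro finsum_cong') (auto simp: X.K_def co_eq_dp dp_closed)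
    then show "(\<Oplus>k\<in>W.K n. a k \<otimes> dp k g) = \<psi> (\<Theta> n g)"
      using ring_hom_closed[OF Theta_hom g] by (simp add: \<psi>_def)
  qed
  then show "\<exists>n. \<exists>\<psi>\<in>module_hom A (pp_algebra A d \<sigma> x n) (as_algebra (\<lambda>a. a) A). f = compose (carrier A) \<psi> (\<Theta> n)"
    using psi by blast
qed

text \<open>Expanding \<Theta>_n(g) in the \<xi>^(k) exhibits the values \<psi>(\<xi>^(k)) as the
  coefficients of the operator.\<close>

lemma compose_Theta_DO:
  assumes psi: "\<psi> \<in> module_hom A (pp_algebra A d \<sigma> x n) (as_algebra (\<lambda>a. a) A)"
  shows "compose (carrier A) \<psi> (\<Theta> n) \<in> W.DO"
proof -
  interpret X: principal_parts_ring A d \<sigma> x n ..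
  have K: "W.K n = X.K" by (simp add: multi_indices_def X.K_def)
  have psi_closed: "\<psi> X \<in> carrier A" if "X \<in> carrier X.P" for X
    using psi that by (auto simp: module_hom_def)
  have psi_add: "\<psi> (X \<oplus>\<^bsub>X.P\<^esub> Y) = \<psi> X \<oplus> \<psi> Y" if "X \<in> carrier X.P" "Y \<in> carrier X.P" for X Y
    using psi that by (simp add: module_hom_def)
  have psi_lin: "\<psi> (X.pc b \<otimes>\<^bsub>X.P\<^esub> X) = b \<otimes> \<psi> X" if "b \<in> carrier A" "X \<in> carrier X.P" for b X
    using psi that by (simp add: module_hom_def)
  have psi_zero: "\<psi> \<zero>\<^bsub>X.P\<^esub> = \<zero>" using psi_lin[of \<zero> "\<zero>\<^bsub>X.P\<^esub>"] psi_closed by simp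
  have psi_sum: "\<psi> (\<Oplus>\<^bsub>X.P\<^esub>k\<in>F. f k) = (\<Oplus>k\<in>F. \<psi> (f k))" if "finite F" "\<And>k. k \<in> F \<Longrightarrow> f k \<in> carrier X.P" for F :: "nat multiset set" and f
    using that
  proof (induction F rule: finite_induct)
    case empty then show ?case by (simp add: psi_zero)
  next
    case (insert k F) then show ?case by (simp add: psi_add psi_closed Pi_def)
  qed
  have "compose (carrier A) \<psi> (\<Theta> n) = W.opr (\<lambda>k. \<psi> (X.Xi k)) (W.K n)"
    unfolding compose_def W.opr_def K
  proof (rule restrict_ext)
    fix g assume g: "g \<in> carrier A"
    have Th: "\<Theta> n g \<in> carrier X.P" using ring_hom_closed[OF Theta_hom g] .
    have "\<psi> (\<Theta> n g) = \<psi> (\<Oplus>\<^bsub>X.P\<^esub>k\<in>X.K. X.pc (co k (\<Theta> n g)) \<otimes>\<^bsub>X.P\<^esub> X.Xi k)"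
      using X.pp_expand[OF Th] by simp
    also have "\<dots> = (\<Oplus>k\<in>X.K. \<psi> (X.pc (co k (\<Theta> n g)) \<otimes>\<^bsub>X.P\<^esub> X.Xi k))"
      using Th by (rule_tac psi_sum) simp_all
    also have "\<dots> = (\<Oplus>k\<in>X.K. \<psi> (X.Xi k) \<otimes> dp k g)"
      using g Th by (intro finsum_cong') (auto simp: psi_lin psi_closed X.K_def co_eq_dp dp_closed m_comm)
    finally show "\<psi> (\<Theta> n g) = (\<Oplus>k\<in>X.K. \<psi> (X.Xi k) \<otimes> dp k g)" .
  qed
  moreover have "\<forall>k\<in>W.K n. \<psi> (X.Xi k) \<in> carrier A" using psi_closed by simp
  ultimately show ?thesis unfolding W.DO_def by blast
qed

lemma diff_op_ring_eq: "diff_op_ring R \<eta> A d \<sigma> x \<Theta> = W.Dring"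
proof -
  have "{f \<in> module_hom R (as_algebra \<eta> A) (as_algebra \<eta> A).
      \<exists>n. \<exists>\<psi>\<in>module_hom A (pp_algebra A d \<sigma> x n) (as_algebra (\<lambda>a. a) A). f = compose (carrier A) \<psi> (\<Theta> n)} = W.DO"
    using diff_op_closed compose_Theta_DO by blast
  then show ?thesis
    by (simp add: diff_op_ring_def linear_endo_ring_def W.Dring_def W.idA_def W.zeroA_def W.padd_def[abs_def])
qed

text \<open>The i-th component of a connection, with the exported form of the coordinate function
  because the module now varies over a category.\<close>

abbreviation cpd :: "('a, 'm) module \<Rightarrow> ('a, 'm) conn \<Rightarrow> nat \<Rightarrow> 'm \<Rightarrow> 'm" where
  "cpd M D i s \<equiv> tensor_free.coord A M \<Omega> (\<lambda>i. co {#i#}) i (D s)"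

abbreviation conn_dmod :: "('a, 'm) module \<Rightarrow> ('a, 'm) conn \<Rightarrow> ('a \<Rightarrow> 'a, 'm) module" where
  "conn_dmod M D \<equiv> twisted_module.dmod A d dp \<sigma> Qn M (cpd M D)"

definition dmod_conn :: "('a \<Rightarrow> 'a, 'm) module \<Rightarrow> ('a, 'm) conn" where
  "dmod_conn N = (\<lambda>s\<in>carrier N. tensor_free.of_coords A (operator_module.amod A N) \<Omega> {..<d} P1.px
     (\<lambda>i. operator_module.apd A dp N i s))"

lemma connection_moduleI: "Module.module A M \<Longrightarrow> connection_module A d \<sigma> x Q \<Theta> M"
  by (intro connection_module.intro twisted_connections_axioms)

text \<open>Additivity and the Leibniz rule are \<open>twisted_connection_iff\<close>; commutation
  is integrability.\<close>

lemma connection_twisted_module: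
  assumes M: "Module.module A M" and D: "twisted_connection A d \<sigma> x \<Theta> M D" and int: "integrable_connection A d \<sigma> x M D"
  shows "twisted_module A d dp \<sigma> Qn M (cpd M D)"
proof -
  interpret CM: connection_module A d \<sigma> x Q \<Theta> M by (rule connection_moduleI[OF M])
  have DE: "D \<in> carrier M \<rightarrow>\<^sub>E carrier CM.TO.T"
    using D by (simp add: twisted_connection_def)
  then have Dc: "D s \<in> carrier CM.TO.T" if "s \<in> carrier M" for s using that by auto
  note iff = CM.twisted_connection_iff[OF DE, THEN iffD1, OF D]
  show ?thesis
  proof unfold_locales
    show "cpd M D i (cpd M D j s) = cpd M D j (cpd M D i s)" if "i < d" "j < d" "s \<in> carrier M" for i j s
      by (rule CM.integrable_imp_commute[OF DE _ int]) (use that iff in auto)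
  qed (use iff Dc in \<open>simp_all add: CM.TO.coord_closed\<close>)
qed

text \<open>The components of the constructed connection are the actions of the \<partial>_i on N,
  which satisfy the Leibniz rule and commute; the coordinate criteria are then read
  backwards.\<close>

lemma dmod_conn_object:
  assumes N: "left_module W.Dring N"
  defines "M \<equiv> operator_module.amod A N"
  shows "Module.module A M" "twisted_connection A d \<sigma> x \<Theta> M (dmod_conn N)"
    "integrable_connection A d \<sigma> x M (dmod_conn N)"
    "i < d \<Longrightarrow> s \<in> carrier N \<Longrightarrow> cpd M (dmod_conn N) i s = operator_module.apd A dp N i s"
proof -
  interpret O: operator_module A d dp \<sigma> Qn N
    by (intro operator_module.intro W.twisted_divided_powers_axioms N)
  show M: "Module.module A M" unfolding M_def by (rule O.module_amod)
  interpret CM: connection_module A d \<sigma> x Q \<Theta> M by (rule connection_moduleI[OF M])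
  have carrier: "carrier M = carrier N" by (simp add: M_def)
  have apd: "O.apd i s \<in> carrier M" if "i < d" "s \<in> carrier N" for i s
    using O.TM.pd_closed that by (simp add: M_def)
  have c: "cpd M (dmod_conn N) i s = O.apd i s" if "i < d" "s \<in> carrier N" for i s
    using CM.TO.coord_of_coords[of i "\<lambda>i. O.apd i s"] that apd by (simp add: dmod_conn_def M_def)
  then show "i < d \<Longrightarrow> s \<in> carrier N \<Longrightarrow> cpd M (dmod_conn N) i s = O.apd i s" .
  have DE: "dmod_conn N \<in> carrier M \<rightarrow>\<^sub>E carrier CM.TO.T"
    unfolding carrier dmod_conn_def M_def[symmetric] using apd by (auto intro!: CM.TO.of_coords_closed)
  have add: "cpd M (dmod_conn N) i (s \<oplus>\<^bsub>M\<^esub> t) = cpd M (dmod_conn N) i s \<oplus>\<^bsub>M\<^esub> cpd M (dmod_conn N) i t"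
    if "i < d" "s \<in> carrier M" "t \<in> carrier M" for i s t
  proof -
    have N: "s \<in> carrier N" "t \<in> carrier N" "s \<oplus>\<^bsub>M\<^esub> t \<in> carrier N"
      using that CM.M.a_closed[of s t] unfolding carrier by blast+
    show ?thesis
      unfolding c[OF that(1) N(1)] c[OF that(1) N(2)] c[OF that(1) N(3)]
      using O.TM.pd_add[of i s t] that unfolding M_def by blast
  qed
  show "twisted_connection A d \<sigma> x \<Theta> M (dmod_conn N)"
    unfolding CM.twisted_connection_iff[OF DE]
  proof (intro conjI allI ballI impI add)
    fix i f s assume *: "i < d" "f \<in> carrier A" "s \<in> carrier M"
    then have N: "s \<in> carrier N" "f \<odot>\<^bsub>M\<^esub> s \<in> carrier N" using CM.M.smult_closed carrier by blast+
    show "cpd M (dmod_conn N) i (f \<odot>\<^bsub>M\<^esub> s) =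
        dp {#i#} f \<odot>\<^bsub>M\<^esub> s \<oplus>\<^bsub>M\<^esub> \<sigma> i f \<odot>\<^bsub>M\<^esub> cpd M (dmod_conn N) i s"
      unfolding c[OF *(1) N(1)] c[OF *(1) N(2)] using O.TM.pd_smult[of i f s] * unfolding M_def by blast
  qed
  show "integrable_connection A d \<sigma> x M (dmod_conn N)"
  proof (rule CM.commute_imp_integrable[OF DE add])
    fix k l s assume *: "k < d" "l < d" "s \<in> carrier M"
    then have N: "s \<in> carrier N" "O.apd k s \<in> carrier N" "O.apd l s \<in> carrier N"
      using apd carrier by blast+
    show "cpd M (dmod_conn N) k (cpd M (dmod_conn N) l s) = cpd M (dmod_conn N) l (cpd M (dmod_conn N) k s)"
      unfolding c[OF *(1) N(1)] c[OF *(2) N(1)] c[OF *(1) N(3)] c[OF *(2) N(2)]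
      using O.TM.pd_comm[of k l s] * unfolding M_def by blast
  qed
qed

text \<open>Going from a module over the operators to a connection and back changes at most the
  values of the scalar multiplication outside the carriers, and arrows correspond without
  change.\<close>

lemma equivalence:
  "equivalent_categories
    (integrable_connection_category A d \<sigma> x \<Theta> :: (('a, 'm) module \<times> ('a, 'm) conn, 'm \<Rightarrow> 'm) category)
    (left_module_category (diff_op_ring R \<eta> A d \<sigma> x \<Theta>) :: (('a \<Rightarrow> 'a, 'm) module, 'm \<Rightarrow> 'm) category)"
proof -
  let ?C = "integrable_connection_category A d \<sigma> x \<Theta> :: (('a, 'm) module \<times> ('a, 'm) conn, 'm \<Rightarrow> 'm) category"
  let ?Fo = "\<lambda>(M, D). conn_dmod M D" and ?Go = "\<lambda>N. (operator_module.amod A N, dmod_conn N)"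
  have Obj: "(M, D) \<in> Obj ?C \<longleftrightarrow> Module.module A M \<and> twisted_connection A d \<sigma> x \<Theta> M D \<and> integrable_connection A d \<sigma> x M D" for M D
    by (simp add: integrable_connection_category_def)
  have TM: "twisted_module A d dp \<sigma> Qn M (cpd M D)" if "(M, D) \<in> Obj ?C" for M D
    using that connection_twisted_module unfolding Obj by blast
  have sel: "carrier (conn_dmod M D) = carrier M" "ring.add (conn_dmod M D) = ring.add M"
    "smult (conn_dmod M D) = twisted_module.Phi A d dp \<sigma> Qn M (cpd M D)" if "(M, D) \<in> Obj ?C" for M D
    using twisted_module.dmod_sel[OF TM[OF that]] by simp_all
  have Go: "?Go N \<in> Obj ?C" if "left_module W.Dring N" for N :: "('a \<Rightarrow> 'a, 'm) module"
    using dmod_conn_object[OF that] unfolding Obj by blast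
  have "equivalent_categories ?C (left_module_category W.Dring :: (('a \<Rightarrow> 'a, 'm) module, 'm \<Rightarrow> 'm) category)"
  proof (rule equivalent_left_module_category[where Fo = ?Fo and Go = ?Go])
    fix X Y assume XY: "X \<in> Obj ?C" "Y \<in> Obj ?C"
    obtain M D N E where eq: "X = (M, D)" "Y = (N, E)" by (cases X, cases Y)
    have MD: "(M, D) \<in> Obj ?C" and NE: "(N, E) \<in> Obj ?C" using XY by (simp_all add: eq)
    interpret P: connection_module_pair A d \<sigma> x Q \<Theta> M N
      using MD NE connection_moduleI unfolding Obj connection_module_pair_def by blast
    interpret TM: twisted_module_pair A d dp \<sigma> Qn M "cpd M D" N "cpd N E"
      using TM[OF MD] TM[OF NE] by (simp add: twisted_module_pair_def)
    have c: "D \<in> carrier M \<rightarrow>\<^sub>E carrier P.M.TO.T" "E \<in> carrier N \<rightarrow>\<^sub>E carrier P.N.TO.T"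
      using MD NE unfolding Obj by (simp_all add: twisted_connection_def)
    \<comment> \<open>An A-linear map is horizontal if and only if it commutes with the components,
      that is, with all operators.\<close>
    have "h \<in> Hom ?C X Y \<longleftrightarrow> h \<in> module_hom W.Dring (?Fo X) (?Fo Y)" for h
      using P.connection_hom_iff[OF _ c, of h] TM.hom_dmod_iff[of h]
      by (auto simp: eq integrable_connection_category_def)
    then show "Hom ?C X Y = module_hom W.Dring (?Fo X) (?Fo Y)" by blast
  next
    fix X assume X: "X \<in> Obj ?C"
    obtain M D where eq: "X = (M, D)" by (cases X)
    have MD: "(M, D) \<in> Obj ?C" using X by (simp add: eq)
    show "left_module W.Dring (?Fo X)" using twisted_module.left_module_dmod[OF TM[OF MD]] by (simp add: eq)
    show "Ident ?C X = (\<lambda>m\<in>carrier (?Fo X). m)"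
      using sel[OF MD] by (simp add: eq integrable_connection_category_def)
    show "Comp ?C X Y Z g f = compose (carrier (?Fo X)) g f" for Y Z g f
      using sel[OF MD] by (simp add: eq integrable_connection_category_def)
  next
    fix N :: "('a \<Rightarrow> 'a, 'm) module"
    assume N: "left_module W.Dring N"
    interpret O: operator_module A d dp \<sigma> Qn N
      by (intro operator_module.intro W.twisted_divided_powers_axioms N)
    show "?Go N \<in> Obj ?C" by (rule Go[OF N])
    show "carrier (?Fo (?Go N)) = carrier N" "ring.add (?Fo (?Go N)) = ring.add N"
      using sel[OF Go[OF N]] by simp_all
    interpret TM: twisted_module A d dp \<sigma> Qn O.amod "cpd O.amod (dmod_conn N)"
      by (rule TM[OF Go[OF N]])
    fix f s assume f: "f \<in> carrier W.Dring" and s: "s \<in> carrier N"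
    have fDO: "f \<in> W.DO" using f by simp
    \<comment> \<open>Two actions of the operators that agree on A and on the \<partial>_i agree on
      everything these generate.\<close>
    have "TM.Phi f s = f \<odot>\<^bsub>N\<^esub> s"
      using fDO
    proof (induction rule: W.DO_induct)
      case id then show ?case using s TM.Phi_id[of s] by (simp add: O.N_simps)
    next
      case (add f g) then show ?case using s TM.Phi_padd[of f g s] by (simp add: O.N_simps)
    next
      case (smult a f)
      then show ?case using s TM.Phi_psm[of f a s] by (simp add: O.N_simps W.psm_mulop)
    next
      case (par i f)
      then show ?case using s TM.Phi_par[of f i s] dmod_conn_object(4)[OF N, of i "f \<odot>\<^bsub>N\<^esub> s"]
        by (simp add: O.N_simps O.apd_def)
    qed
    then show "f \<odot>\<^bsub>?Fo (?Go N)\<^esub> s = f \<odot>\<^bsub>N\<^esub> s" using sel[OF Go[OF N]] by simp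
  qed
  then show ?thesis by (simp only: diff_op_ring_eq)
qed

end

theorem theorem6p7:
  fixes R :: "'r tring" and A :: "'a tring" and \<eta> :: "'r \<Rightarrow> 'a"
    and d :: nat and \<sigma> :: "nat \<Rightarrow> 'a \<Rightarrow> 'a" and x :: "nat \<Rightarrow> 'a" and q :: "nat \<Rightarrow> 'r"
    and \<Theta> :: "nat \<Rightarrow> 'a \<Rightarrow> (nat, 'a) mpoly set"
  assumes "huber_ring R"
    and "twisted_adic_algebra R \<eta> A d \<sigma>"
    and "x \<in> {..<d} \<rightarrow> carrier A"
    and "q \<in> {..<d} \<rightarrow> carrier R"
    and "q_coordinates_with_taylor R \<eta> A d \<sigma> x q \<Theta>"
    and "classical_coordinates A d \<sigma> x \<Theta>"
    and "symmetric_coordinates R \<eta> A d \<sigma> x \<Theta>"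
    and "\<forall>i<d. \<forall>n\<ge>1. q_number R (q i) n \<in> Units R"
  shows "equivalent_categories
    (integrable_connection_category A d \<sigma> x \<Theta> ::
       (('a, 'm) module \<times> ('a, 'm) conn, 'm \<Rightarrow> 'm) category)
    (left_module_category (diff_op_ring R \<eta> A d \<sigma> x \<Theta>) ::
       (('a \<Rightarrow> 'a, 'm) module, 'm \<Rightarrow> 'm) category)"
proof -
  have R: "cring R" and A: "cring A" and eta: "\<eta> \<in> ring_hom R A"
    and sigma: "\<And>i. i < d \<Longrightarrow> \<sigma> i \<in> ring_hom A A"
    and lin: "\<And>i r a. i < d \<Longrightarrow> r \<in> carrier R \<Longrightarrow> a \<in> carrier A \<Longrightarrow> \<sigma> i (\<eta> r \<otimes>\<^bsub>A\<^esub> a) = \<eta> r \<otimes>\<^bsub>A\<^esub> \<sigma> i a"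
    using assms(2) by (auto simp: twisted_adic_algebra_def huber_hom_def intro: huber_ring_cring adic_hom_ring_hom)
  interpret R: cring R by (rule R)
  interpret A: cring A by (rule A)
  interpret eta: ring_hom_cring R A \<eta> by (rule ring_hom_cringI[OF R A eta])
  interpret TC: twisted_connections A d \<sigma> x "\<lambda>i. \<eta> (q i)" \<Theta>
    by (rule twisted_connectionsI[OF assms(2,3,5,6,7)])
  have "coordinates_with_taylor R \<eta> A d \<sigma> x \<Theta>"
    using assms(5) by (simp add: q_coordinates_with_taylor_def)
  note taylor = coordinates_taylor[OF assms(2,3) this]
  interpret TO: twisted_operators R \<eta> A d \<sigma> x "\<lambda>i. \<eta> (q i)" \<Theta>
  proof unfold_locales
    show "\<sigma> i (\<eta> r) = \<eta> r" if "i < d" "r \<in> carrier R" for i r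
      using lin[OF that A.one_closed] ring_hom_one[OF sigma[OF that(1)]] that by simp
    show "\<exists>r\<in>carrier R. TC.Qn i (Suc n) \<otimes>\<^bsub>A\<^esub> \<eta> r = \<one>\<^bsub>A\<^esub>" if i: "i < d" for i n
    proof
      let ?u = "q_number R (q i) (Suc n)"
      have q: "q i \<in> carrier R" using assms(4) i by auto
      have u: "?u \<in> Units R" using assms(8) i by simp
      then show "inv\<^bsub>R\<^esub> ?u \<in> carrier R" by simp
      \<comment> \<open>The q-number of A is the image of that of R, so its inverse is the image of
        an element of R and thus a constant.\<close>
      have "\<eta> ?u = TC.Qn i (Suc n)"
        unfolding q_number_def TC.Qn_def using q
        by (subst eta.hom_finsum) (auto simp: eta.hom_nat_pow intro!: A.finsum_cong')
      then show "TC.Qn i (Suc n) \<otimes>\<^bsub>A\<^esub> \<eta> (inv\<^bsub>R\<^esub> ?u) = \<one>\<^bsub>A\<^esub>"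
        using u eta.hom_mult[of ?u "inv\<^bsub>R\<^esub> ?u"] by (simp add: R.Units_closed)
    qed
  qed (use eta sigma taylor in auto)
  show ?thesis by (rule TO.equivalence)
qed

end
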